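(* For all $n\in\mathbb{N}_0$ the named non-symmetric shift operators act on the non-symmetric Askey--Wilson polynomials as follows: \begin{align*} \mathcal{G}^q_+E_{-n,k}&=q^{-1/2}\big(q^{n/2}-q^{-n/2}\big)E_{1-n,k+v_1},& \mathcal{G}^q_+E_{n+1,k}&=\big(q^{n/2}-q^{-n/2}\big)E_{n,k+v_1},\\ \mathcal{G}^q_-E_{-n,k}&=\Big(\tfrac{abcd}{q}q^{n/2}-q^{-n/2}\Big)E_{-n-1,k-v_1},& \mathcal{G}^q_-E_{n+1,k}&=q^{-1/2}\Big(\tfrac{abcd}{q}q^{n/2}-q^{-n/2}\Big)E_{n+2,k-v_1},\\ \mathcal{E}^q_{1,+}E_{-n,k}&=-q^{1/2}\big(abq^{n/2}-q^{-n/2}\big)E_{-n,k-v_2},& \mathcal{E}^q_{1,+}E_{n+1,k}&=-\big(abq^{n/2}-q^{-n/2}\big)E_{n+1,k-v_2},\\ \mathcal{E}^q_{1,-}E_{-n,k}&=-q^{-1/2}\Big(\tfrac{cd}{q}q^{n/2}-q^{-n/2}\Big)E_{-n,k+v_2},& \mathcal{E}^q_{1,-}E_{n+1,k}&=-\Big(\tfrac{cd}{q}q^{n/2}-q^{-n/2}\Big)E_{n+1,k+v_2},\\ \mathcal{E}^q_{2,+}E_{-n,k}&=-\Big(\tfrac{ac}{q}q^{n/2}-q^{-n/2}\Big)E_{-n,k-v_3},& \mathcal{E}^q_{2,+}E_{n,k}&=-\Big(\tfrac{ac}{q}q^{n/2}-q^{-n/2}\Big)E_{n,k-v_3},\\ \mathcal{E}^q_{2,-}E_{-n,k}&=-\Big(\tfrac{bd}{q}q^{n/2}-q^{-n/2}\Big)E_{-n,k+v_3},&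 \mathcal{E}^q_{2,-}E_{n,k}&=-\Big(\tfrac{bd}{q}q^{n/2}-q^{-n/2}\Big)E_{n,k+v_3}. \end{align*}
   Context: Let $K=\mathbb{Q}(\sqrt{-ab},b,\sqrt{-cd},d,q^{1/2})$ be the field of rational functions in the five indeterminates $\sqrt{-ab},b,\sqrt{-cd},d,q^{1/2}$; put $a=-(\sqrt{-ab})^2/b$, $c=-(\sqrt{-cd})^2/d$. Let $*$ be the field involution of $K$ inverting the five generators. Let $\mathcal{A}=K[z,z^{-1}]$ and $\mathcal{A}_0=\{f\in\mathcal{A}: f(z)=f(z^{-1})\}$. For $f=\sum_n f_nz^n$ put $f^*=\sum_n f_n^*z^{-n}$. Write $(x;q)_\infty=\prod_{j\ge0}(1-xq^j)$ and $(x_1,\dots,x_r;q)_\infty=\prod_i(x_i;q)_\infty$. Let \[ \Delta=\frac{(z^2,qz^{-2};q)_\infty}{(az,bz,cz,dz,aqz^{-1},bqz^{-1},cz^{-1},dz^{-1};q)_\infty}, \] expanded as a power series in $z$ and $q^{1/2}z^{-1}$ with coefficients in $\mathcal{R}=\mathbb{Q}[a^{\pm1},b^{\pm1},(cq^{-1/2})^{\pm1},(dq^{-1/2})^{\pm1}]$, hence regarded as an element of $\mathcal{R}((q^{1/2}))[[z^{\pm1}]]$. With $\mathrm{ct}$ denoting the coefficient of $z^0$, put $(f,g)=\mathrm{ct}(fg^*\Delta)\in K\otimes_{\mathcal{R}[q^{\pm1/2}]}\mathcal{R}((q^{1/2}))$. Order monomials by $1<z<z^{-1}<z^2<z^{-2}<\cdots$;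 the non-symmetric Askey--Wilson polynomial $E_n=E_{n,k}\in\mathcal{A}$ ($n\in\mathbb{Z}$) is the unique element of the form $z^n+$ (lower-order terms) with $(E_n,z^m)=0$ whenever $z^m<z^n$. Here $k$ is a formal label for $(a,b,c,d)$; for $h\in(\frac12\mathbb{Z})^4$ the subscript $k+h$ (on polynomials, matrices, operators) means that $(a,b,c,d)$ is replaced by $(aq^{h_1},bq^{h_2},cq^{h_3},dq^{h_4})$. $\epsilon_1,\dots,\epsilon_4$ is the standard basis of $\mathbb{Q}^4$; $v_1=\frac12(1,1,1,1)$, $v_2=\frac12(1,1,-1,-1)$, $v_3=\frac12(1,-1,1,-1)$. Let $(Tf)(z)=f(q^{1/2}z)$ and define operators on $\mathcal{A}_0$ \[ G^q_+=\frac{T-T^{-1}}{z-z^{-1}},\qquad G^q_-=\frac{A_1(z)T-A_1(z^{-1})T^{-1}}{z-z^{-1}},\qquad E^q_{ij}=\frac{A_{ij}(z)T-A_{ij}(z^{-1})T^{-1}}{z-z^{-1}}, \] where $A_1(z)=q^{-1/2}z^{-2}\prod_{u\in\{a,b,c,d\}}(1-uq^{-1/2}z)$, $A_{ij}(z)=-z^{-1}(1-u_iq^{-1/2}z)(1-u_jq^{-1/2}z)$ and $(u_1,u_2,u_3,u_4)=(a,b,c,d)$. Let $V_k=\begin{pmatrix}-a^{-1}&-b^{-1}\\1&1\end{pmatrix}$ and let $\mathcal{B}_{\mathrm{S}},\mathcal{B}_{\mathrm{K},k}:\mathcal{A}_0^2\to\mathcal{A}$ be the isomorphisms $\mathcal{B}_{\mathrm{S}}(f_1,f_2)^T=f_1+zf_2$,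 $\mathcal{B}_{\mathrm{K},k}(f_1,f_2)^T=f_1+z^{-1}(1-az)(1-bz)f_2$. For $(\mathcal{S},S,h)$ among $(\mathcal{G}^q_+,G^q_+,v_1)$, $(\mathcal{G}^q_-,G^q_-,-v_1)$, $(\mathcal{E}^q_{1,+},E^q_{12},-v_2)$, $(\mathcal{E}^q_{1,-},E^q_{34},v_2)$, the operator $\mathcal{S}:\mathcal{A}\to\mathcal{A}$ is \[ \mathcal{S}=\mathcal{B}_{\mathrm{S}}\,V_{k+h}\begin{pmatrix}S_{k+\epsilon_1}&0\\0&S_{k+\epsilon_2}\end{pmatrix}V_k^{-1}\,\mathcal{B}_{\mathrm{S}}^{-1}. \] For $(\mathcal{S},S,h)$ among $(\mathcal{E}^q_{2,+},E^q_{13},-v_3)$, $(\mathcal{E}^q_{2,-},E^q_{24},v_3)$, \[ \mathcal{S}=\mathcal{B}_{\mathrm{K},k+h}\begin{pmatrix}S_{k}&0\\0&q^{-1/2}S_{k+\epsilon_1+\epsilon_2}\end{pmatrix}\mathcal{B}_{\mathrm{K},k}^{-1}. \] *)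

theory Defs
  imports
    "HOL-Analysis.Analysis"
    "HOL-Computational_Algebra.Fraction_Field"
    "HOL-Computational_Algebra.Formal_Laurent_Series"
    "HOL-Library.Poly_Mapping"
begin

instance fract :: ("{idom,ring_char_0}") field_char_0
  by standard (simp add: inj_on_def of_nat_fract eq_fract)

section \<open>The field of rational functions in five indeterminates\<close>

text \<open>
  The five polynomial variables are, from the innermost to the outermost one, the indeterminates
  \<open>\<surd>(-ab)\<close>, \<open>b\<close>, \<open>\<surd>(-cd)\<close>, \<open>d\<close>, \<open>q\<^sup>1\<^sup>/\<^sup>2\<close>.
\<close>

type_synonym poly5 = "rat poly poly poly poly poly"
type_synonym K = "poly5 fract"

definition sqrt_mab :: K where "sqrt_mab = Fract [:[:[:[:[:0, 1:]:]:]:]:] 1"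
definition par_b :: K where "par_b = Fract [:[:[:[:0, 1:]:]:]:] 1"
definition sqrt_mcd :: K where "sqrt_mcd = Fract [:[:[:0, 1:]:]:] 1"
definition par_d :: K where "par_d = Fract [:[:0, 1:]:] 1"
definition sqrt_q :: K where "sqrt_q = Fract [:0, 1:] 1"

definition par_a :: K where "par_a = - (sqrt_mab ^ 2) / par_b"
definition par_c :: K where "par_c = - (sqrt_mcd ^ 2) / par_d"
definition par_q :: K where "par_q = sqrt_q ^ 2"

text \<open>\<open>qpow x\<close> is \<open>q\<^sup>x\<close>; only meaningful for half-integers \<open>x\<close>.\<close>

definition qpow :: "rat \<Rightarrow> K" where
  "qpow x = sqrt_q powi \<lfloor>2 * x\<rfloor>"

definition eval_with :: "('a::zero \<Rightarrow> 'l::comm_ring_1) \<Rightarrow> 'l \<Rightarrow> 'a poly \<Rightarrow> 'l" where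
  "eval_with \<phi> x p = poly (map_poly \<phi> p) x"

definition eval5 :: "'l::field_char_0 \<Rightarrow> 'l \<Rightarrow> 'l \<Rightarrow> 'l \<Rightarrow> 'l \<Rightarrow> poly5 \<Rightarrow> 'l" where
  "eval5 x1 x2 x3 x4 x5 =
     eval_with (eval_with (eval_with (eval_with (eval_with of_rat x1) x2) x3) x4) x5"

text \<open>
  Substituting elements of a field of characteristic 0 for the five indeterminates. The value does
  not depend on the fraction chosen. In every use below the substituted elements are algebraically
  independent, so that the substitution is a homomorphism of fields defined on all of \<open>K\<close>.
\<close>

definition ratfun_subst :: "'l::field_char_0 \<Rightarrow> 'l \<Rightarrow> 'l \<Rightarrow> 'l \<Rightarrow> 'l \<Rightarrow> K \<Rightarrow> 'l" where
  "ratfun_subst x1 x2 x3 x4 x5 r =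
     (THE y. \<exists>p d. r = Fract p d \<and> eval5 x1 x2 x3 x4 x5 d \<noteq> 0 \<and>
                   y = eval5 x1 x2 x3 x4 x5 p / eval5 x1 x2 x3 x4 x5 d)"

definition starK :: "K \<Rightarrow> K" where
  "starK = ratfun_subst (inverse sqrt_mab) (inverse par_b) (inverse sqrt_mcd)
                        (inverse par_d) (inverse sqrt_q)"

text \<open>
  The automorphism of \<open>K\<close> which replaces \<open>(a, b, c, d)\<close> by
  \<open>(aq\<^bsup>h1\<^esup>, bq\<^bsup>h2\<^esup>, cq\<^bsup>h3\<^esup>, dq\<^bsup>h4\<^esup>)\<close> and fixes \<open>q\<^sup>1\<^sup>/\<^sup>2\<close>. It multiplies \<open>\<surd>(-ab)\<close> by
  \<open>q\<^bsup>(h1+h2)/2\<^esup>\<close> and \<open>\<surd>(-cd)\<close> by \<open>q\<^bsup>(h3+h4)/2\<^esup>\<close>, hence is meaningful when \<open>h1 + h2\<close> and \<open>h3 + h4\<close>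
  are integers, which is the case for \<open>h = 0\<close> and for \<open>\<plusminus>v1\<close>, \<open>\<plusminus>v2\<close>, \<open>\<plusminus>v3\<close> below.
\<close>

definition shiftK :: "rat^4 \<Rightarrow> K \<Rightarrow> K" where
  "shiftK h = ratfun_subst (sqrt_mab * qpow ((h $ 1 + h $ 2) / 2)) (par_b * qpow (h $ 2))
                           (sqrt_mcd * qpow ((h $ 3 + h $ 4) / 2)) (par_d * qpow (h $ 4)) sqrt_q"

section \<open>Laurent polynomials\<close>

text \<open>\<open>K[z,z\<inverse>]\<close> is the group ring of the integers: \<open>lookup f n\<close> is the coefficient of \<open>z\<^sup>n\<close>.\<close>

type_synonym laurent = "int \<Rightarrow>\<^sub>0 K"

definition cst :: "K \<Rightarrow> laurent" where "cst x = Poly_Mapping.single 0 x"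
definition zpow :: "int \<Rightarrow> laurent" where "zpow n = Poly_Mapping.single n 1"

definition zinv :: "laurent \<Rightarrow> laurent" where \<comment> \<open>\<open>f(z\<inverse>)\<close>\<close>
  "zinv f = Poly_Mapping.map_key uminus f"

definition sym_laurent :: "laurent set" where
  "sym_laurent = {f. zinv f = f}"

definition starL :: "laurent \<Rightarrow> laurent" where
  "starL f = zinv (Poly_Mapping.map starK f)"

section \<open>The weight function and the inner product\<close>

text \<open>
  \<open>F\<close> is the field of rational functions in \<open>\<surd>(-ab)\<close>, \<open>b\<close>, \<open>\<surd>(-c'd')\<close>, \<open>d'\<close> (from the innermost to
  the outermost variable), where \<open>c' = cq\<^sup>-\<^sup>1\<^sup>/\<^sup>2\<close> and \<open>d' = dq\<^sup>-\<^sup>1\<^sup>/\<^sup>2\<close>. It contains the coefficient ring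
  \<open>R = \<rat>[a\<^sup>\<plusminus>\<^sup>1, b\<^sup>\<plusminus>\<^sup>1, c'\<^sup>\<plusminus>\<^sup>1, d'\<^sup>\<plusminus>\<^sup>1]\<close>, and it has degree 4 over the fraction field of \<open>R\<close>, just as \<open>K\<close> has
  degree 4 over \<open>\<rat>(a, b, c, d, q\<^sup>1\<^sup>/\<^sup>2)\<close>. Hence the map
  \<open>K \<otimes> R((q\<^sup>1\<^sup>/\<^sup>2)) \<rightarrow> F((q\<^sup>1\<^sup>/\<^sup>2))\<close> induced by \<open>\<surd>(-cd) = \<surd>(-c'd') q\<^sup>1\<^sup>/\<^sup>2\<close> and \<open>d = d' q\<^sup>1\<^sup>/\<^sup>2\<close>, the tensor
  product being taken over \<open>R[q\<^sup>\<plusminus>\<^sup>1\<^sup>/\<^sup>2]\<close>, is injective. The values of the inner product are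
  represented by their images in the field \<open>F((q\<^sup>1\<^sup>/\<^sup>2))\<close>, whose variable \<open>fls_X\<close> is \<open>q\<^sup>1\<^sup>/\<^sup>2\<close>.
\<close>

type_synonym F = "rat poly poly poly poly fract"

definition F_sqrt_mab :: F where "F_sqrt_mab = Fract [:[:[:[:0, 1:]:]:]:] 1"
definition F_b :: F where "F_b = Fract [:[:[:0, 1:]:]:] 1"
definition F_sqrt_mcd' :: F where "F_sqrt_mcd' = Fract [:[:0, 1:]:] 1"
definition F_d' :: F where "F_d' = Fract [:0, 1:] 1"
definition F_a :: F where "F_a = - (F_sqrt_mab ^ 2) / F_b"
definition F_c' :: F where "F_c' = - (F_sqrt_mcd' ^ 2) / F_d'"

definition embK :: "K \<Rightarrow> F fls" where
  "embK = ratfun_subst (fls_const F_sqrt_mab) (fls_const F_b) (fls_const F_sqrt_mcd' * fls_X)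
                       (fls_const F_d' * fls_X) fls_X"

text \<open>
  Power series in \<open>z\<close> (outer variable) and \<open>w = q\<^sup>1\<^sup>/\<^sup>2z\<inverse>\<close> (inner variable). In these variables
  \<open>q\<^sup>1\<^sup>/\<^sup>2 = zw\<close>, \<open>qz\<inverse> = q\<^sup>1\<^sup>/\<^sup>2w\<close>, \<open>cz = c'q\<^sup>1\<^sup>/\<^sup>2z\<close> and \<open>cz\<inverse> = c'w\<close>. As \<open>q\<close> is divisible by \<open>z\<^sup>2\<close>, the infinite
  products converge in the \<open>z\<close>-adic topology, which is the topology of \<open>F fps fps\<close>.
\<close>

type_synonym zwseries = "F fps fps"

definition ser_cst :: "F \<Rightarrow> zwseries" where "ser_cst r = fps_const (fps_const r)"
definition ser_z :: zwseries where "ser_z = fps_X"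
definition ser_w :: zwseries where "ser_w = fps_const fps_X"
definition ser_sqrt_q :: zwseries where "ser_sqrt_q = ser_z * ser_w"

definition qpoch_inf :: "zwseries \<Rightarrow> zwseries" where \<comment> \<open>\<open>(x;q)\<^sub>\<infinity>\<close>\<close>
  "qpoch_inf x = prodinf (\<lambda>j. 1 - x * (ser_sqrt_q ^ 2) ^ j)"

text \<open>
  The denominator has an invertible constant term with respect to \<open>z\<close>, namely
  \<open>(1 - c'w)(1 - d'w)\<close>, so that \<open>inverse\<close> is the inverse in the power series ring.
\<close>

definition Delta_zw :: zwseries where
  "Delta_zw =
     qpoch_inf (ser_z ^ 2) * qpoch_inf (ser_w ^ 2) *
     inverse (qpoch_inf (ser_cst F_a * ser_z) * qpoch_inf (ser_cst F_b * ser_z) *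
              qpoch_inf (ser_cst F_c' * ser_sqrt_q * ser_z) *
              qpoch_inf (ser_cst F_d' * ser_sqrt_q * ser_z) *
              qpoch_inf (ser_cst F_a * ser_sqrt_q * ser_w) *
              qpoch_inf (ser_cst F_b * ser_sqrt_q * ser_w) *
              qpoch_inf (ser_cst F_c' * ser_w) * qpoch_inf (ser_cst F_d' * ser_w))"

text \<open>
  The coefficient of \<open>z\<^sup>n\<close> in \<open>\<Delta>\<close>, as a series in \<open>q\<^sup>1\<^sup>/\<^sup>2\<close>: since \<open>z\<^sup>iw\<^sup>j = z\<^bsup>i-j\<^esup>(q\<^sup>1\<^sup>/\<^sup>2)\<^sup>j\<close>, it collects the
  terms with \<open>i = n + j\<close>.
\<close>

definition Delta :: "int \<Rightarrow> F fls" where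
  "Delta n = fps_to_fls (Abs_fps (\<lambda>j. if n + int j \<ge> 0
                                      then fps_nth (fps_nth Delta_zw (nat (n + int j))) j else 0))"

definition ct_Delta :: "laurent \<Rightarrow> F fls" where \<comment> \<open>\<open>ct(f\<Delta>)\<close>\<close>
  "ct_Delta f = (\<Sum>n\<in>Poly_Mapping.keys f. embK (Poly_Mapping.lookup f n) * Delta (- n))"

definition inner_AW :: "laurent \<Rightarrow> laurent \<Rightarrow> F fls" where
  "inner_AW f g = ct_Delta (f * starL g)"

section \<open>Non-symmetric Askey--Wilson polynomials\<close>

text \<open>Position of \<open>z\<^sup>n\<close> in the order \<open>1 < z < z\<^sup>-\<^sup>1 < z\<^sup>2 < z\<^sup>-\<^sup>2 < \<dots>\<close>\<close>

definition mono_rank :: "int \<Rightarrow> int" where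
  "mono_rank n = (if n > 0 then 2 * n - 1 else - 2 * n)"

definition nsAW0 :: "int \<Rightarrow> laurent" where \<comment> \<open>\<open>E\<^bsub>n,k\<^esub>\<close>\<close>
  "nsAW0 n = (THE f. Poly_Mapping.lookup f n = 1 \<and>
                     (\<forall>m\<in>Poly_Mapping.keys f. m = n \<or> mono_rank m < mono_rank n) \<and>
                     (\<forall>m. mono_rank m < mono_rank n \<longrightarrow> inner_AW f (zpow m) = 0))"

definition nsAW :: "rat^4 \<Rightarrow> int \<Rightarrow> laurent" where \<comment> \<open>\<open>E\<^bsub>n,k+h\<^esub>\<close>\<close>
  "nsAW h n = Poly_Mapping.map (shiftK h) (nsAW0 n)"

section \<open>Shift operators\<close>

text \<open>A vector \<open>h :: rat^4\<close> stands for the label \<open>k + h\<close>.\<close>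

definition v1 :: "rat^4" where "v1 = (1/2) *s vector [1, 1, 1, 1]"
definition v2 :: "rat^4" where "v2 = (1/2) *s vector [1, 1, -1, -1]"
definition v3 :: "rat^4" where "v3 = (1/2) *s vector [1, -1, 1, -1]"
definition eps :: "4 \<Rightarrow> rat^4" where "eps i = axis i 1"

definition params :: "rat^4 \<Rightarrow> K^4" where
  "params h = (\<chi> i. vector [par_a, par_b, par_c, par_d] $ i * qpow (h $ i))"

definition T_pow :: "int \<Rightarrow> laurent \<Rightarrow> laurent" where \<comment> \<open>\<open>(T\<^sup>ef)(z) = f(q\<^bsup>e/2\<^esup>z)\<close>\<close>
  "T_pow e f = Poly_Mapping.mapp (\<lambda>n x. qpow (of_int (e * n) / 2) * x) f"

text \<open>
  \<open>(A(z)T - A(z\<inverse>)T\<inverse>)f / (z - z\<inverse>)\<close>. For symmetric \<open>f\<close> the numerator is antisymmetric, hence divisible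
  by \<open>z - z\<inverse>\<close> in the integral domain \<open>K[z,z\<inverse>]\<close>.
\<close>

definition skew_op :: "laurent \<Rightarrow> laurent \<Rightarrow> laurent" where
  "skew_op A f = (THE g. (zpow 1 - zpow (-1)) * g = A * T_pow 1 f - zinv A * T_pow (-1) f)"

definition Gq_plus :: "rat^4 \<Rightarrow> laurent \<Rightarrow> laurent" where
  "Gq_plus h = skew_op 1"

definition lin_factor :: "rat^4 \<Rightarrow> 4 \<Rightarrow> laurent" where \<comment> \<open>\<open>1 - u\<^sub>iq\<^sup>-\<^sup>1\<^sup>/\<^sup>2z\<close>\<close>
  "lin_factor h i = 1 - cst (params h $ i * qpow (-1/2)) * zpow 1"

definition Gq_minus :: "rat^4 \<Rightarrow> laurent \<Rightarrow> laurent" where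
  "Gq_minus h = skew_op (cst (qpow (-1/2)) * zpow (-2) * (\<Prod>i\<in>UNIV. lin_factor h i))"

definition Eq_op :: "4 \<Rightarrow> 4 \<Rightarrow> rat^4 \<Rightarrow> laurent \<Rightarrow> laurent" where
  "Eq_op i j h = skew_op (- zpow (-1) * lin_factor h i * lin_factor h j)"

definition sym_pairs :: "(laurent^2) set" where
  "sym_pairs = {f. \<forall>i. f $ i \<in> sym_laurent}"

definition B_S :: "laurent^2 \<Rightarrow> laurent" where
  "B_S f = f $ 1 + zpow 1 * f $ 2"

definition B_K :: "rat^4 \<Rightarrow> laurent^2 \<Rightarrow> laurent" where
  "B_K h f = f $ 1 + zpow (-1) * (1 - cst (params h $ 1) * zpow 1) *
                                 (1 - cst (params h $ 2) * zpow 1) * f $ 2"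

definition V_mat :: "rat^4 \<Rightarrow> K^2^2" where
  "V_mat h = vector [vector [- inverse (params h $ 1), - inverse (params h $ 2)], vector [1, 1]]"

definition mat_act :: "K^2^2 \<Rightarrow> laurent^2 \<Rightarrow> laurent^2" where
  "mat_act M f = (\<chi> i j. cst (M $ i $ j)) *v f"

definition diag_op :: "(laurent \<Rightarrow> laurent) \<Rightarrow> (laurent \<Rightarrow> laurent) \<Rightarrow> laurent^2 \<Rightarrow> laurent^2" where
  "diag_op S1 S2 f = vector [S1 (f $ 1), S2 (f $ 2)]"

definition conj_S :: "(rat^4 \<Rightarrow> laurent \<Rightarrow> laurent) \<Rightarrow> rat^4 \<Rightarrow> laurent \<Rightarrow> laurent" where
  "conj_S S h = B_S \<circ> mat_act (V_mat h) \<circ> diag_op (S (eps 1)) (S (eps 2)) \<circ>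
                mat_act (matrix_inv (V_mat 0)) \<circ> inv_into sym_pairs B_S"

definition conj_K :: "(rat^4 \<Rightarrow> laurent \<Rightarrow> laurent) \<Rightarrow> rat^4 \<Rightarrow> laurent \<Rightarrow> laurent" where
  "conj_K S h = B_K h \<circ> diag_op (S 0) (\<lambda>f. cst (qpow (-1/2)) * S (eps 1 + eps 2) f) \<circ>
                inv_into sym_pairs (B_K 0)"

definition nsG_plus :: "laurent \<Rightarrow> laurent" where "nsG_plus = conj_S Gq_plus v1"
definition nsG_minus :: "laurent \<Rightarrow> laurent" where "nsG_minus = conj_S Gq_minus (- v1)"
definition nsE1_plus :: "laurent \<Rightarrow> laurent" where "nsE1_plus = conj_S (Eq_op 1 2) (- v2)"
definition nsE1_minus :: "laurent \<Rightarrow> laurent" where "nsE1_minus = conj_S (Eq_op 3 4) v2"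
definition nsE2_plus :: "laurent \<Rightarrow> laurent" where "nsE2_plus = conj_K (Eq_op 1 3) (- v3)"
definition nsE2_minus :: "laurent \<Rightarrow> laurent" where "nsE2_minus = conj_K (Eq_op 2 4) v3"

end

theory Submission
  imports Defs
begin

text \<open>
  Write \<open>\<ell>(f) = ct(f\<Delta>)\<close>. Removing the factors \<open>(1-az)(1-bz)\<close> or \<open>(1-cz\<inverse>)(1-dz\<inverse>)\<close> from the denominator of \<open>\<Delta>\<close>
  leaves series with symmetries under \<open>z \<mapsto> z\<inverse>\<close> and \<open>z \<mapsto> qz\<inverse>\<close>. The resulting linear relations determine the
  moments \<open>\<ell>(z\<^sup>n)\<close> up to a common factor, and show that they are rational; so \<open>E\<^bsub>n\<^esub>\<close> exists over \<open>K\<close> and is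
  characterized by its leading term and orthogonality.

  Every Laurent polynomial is \<open>(1-az)F\<^sub>1 + (1-bz)F\<^sub>2\<close> and also \<open>f\<^sub>1 + z\<inverse>(1-az)(1-bz)f\<^sub>2\<close>, with symmetric \<open>F\<^sub>i\<close>, \<open>f\<^sub>i\<close>. In
  these coordinates \<open>\<ell>(fg)\<close> splits into the orthogonality functionals of the symmetric Askey--Wilson polynomials
  with labels \<open>k + \<epsilon>\<^sub>1\<close>, \<open>k + \<epsilon>\<^sub>2\<close> and \<open>k\<close>, \<open>k + \<epsilon>\<^sub>1 + \<epsilon>\<^sub>2\<close>, respectively, and the non-symmetric operators act
  diagonally. Each such functional is, up to a factor, the only one that annihilates the image of the raising
  operator \<open>G\<^sub>-\<close>; hence the commutation relations between the symmetric shift operators show that they have adjoints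
  which are again shift operators. The factors in these adjointness relations turn out to be equal in the two
  coordinates. Therefore the operators preserve supports and orthogonality, and the scalars are read off
  from extreme coefficients.
\<close>

text \<open>The weight \<Delta> is available for the label k only. Shifted labels are reached by
  applying the automorphism \<open>shiftK h\<close> to the moments. Everything after the moments is
  therefore stated for arbitrary parameters and an arbitrary sequence \<open>y\<close> with
  \<open>moment_rel a b c d y\<close>; besides these relations, only non-degeneracy, read off at
  q^(1/2) = 0, is taken from \<Delta>.

  Equal adjointness factors matter because the conditions that define E do not all separate.
  Orthogonality to lower monomials splits into one condition per coordinate, except for a single
  condition that couples the leading parts of both: it concerns E_(n+1) in the coordinates 1-az,
  1-bz, and E_(-n) in the coordinates 1, z^(-1)(1-az)(1-bz). The same factor in both components is
  what preserves this condition; for its sake the values of the functionals at 1 are compared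
  between labels.

  The scalars may vanish, as q^(n/2) - q^(-n/2) does for n = 0, so multiples of E are characterized
  including the multiple 0.\<close>

section \<open>Evaluation of polynomials in five nested variables\<close>

lemma eval_with_0 [simp]: "eval_with \<phi> x 0 = 0"
  by (simp add: eval_with_def)

lemma eval_with_pCons:
  assumes "\<phi> 0 = 0"
  shows "eval_with \<phi> x (pCons c p) = \<phi> c + x * eval_with \<phi> x p"
proof (cases "pCons c p = 0")
  case True then show ?thesis using assms by simp
next
  case False then show ?thesis by (simp add: eval_with_def map_poly_pCons[of \<phi>, OF assms] assms)
qed

definition ring_hom_map :: "('a::comm_ring_1 \<Rightarrow> 'b::comm_ring_1) \<Rightarrow> bool" where
  "ring_hom_map f \<longleftrightarrow> f 0 = 0 \<and> f 1 = 1 \<and> (\<forall>x y. f (x + y) = f x + f y) \<and> (\<forall>x y. f (x * y) = f x * f y)"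

lemma ring_hom_map_eval_with:
  assumes "ring_hom_map \<phi>"
  shows "ring_hom_map (eval_with \<phi> x)"
proof -
  have 0: "\<phi> 0 = 0" and 1: "\<phi> 1 = 1" and a: "\<And>x y. \<phi> (x + y) = \<phi> x + \<phi> y"
    and m: "\<And>x y. \<phi> (x * y) = \<phi> x * \<phi> y"
    using assms by (auto simp: ring_hom_map_def)
  note pC = eval_with_pCons[of \<phi>, OF 0]
  have add: "eval_with \<phi> x (p + r) = eval_with \<phi> x p + eval_with \<phi> x r" for p r
    by (induction p r rule: poly_induct2) (simp_all add: pC a algebra_simps)
  have sm: "eval_with \<phi> x (smult c r) = \<phi> c * eval_with \<phi> x r" for c r
    by (induction r) (simp_all add: pC m algebra_simps)
  have "eval_with \<phi> x (p * r) = eval_with \<phi> x p * eval_with \<phi> x r" for p r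
    by (induction p) (simp_all add: add sm pC 0 algebra_simps)
  then show ?thesis
    using add pC[of x 1 0] by (simp add: ring_hom_map_def 1 one_pCons)
qed

lemma ring_hom_map_minus:
  assumes "ring_hom_map f" shows "f (- x) = - f x"
  using assms unfolding ring_hom_map_def by (metis add.right_inverse add_eq_0_iff)

lemma ring_hom_map_of_rat: "ring_hom_map (of_rat :: rat \<Rightarrow> 'a::field_char_0)"
  by (simp add: ring_hom_map_def of_rat_add of_rat_mult)

lemma ring_hom_map_eq_of_rat:
  fixes f :: "rat \<Rightarrow> 'a::field_char_0"
  assumes "ring_hom_map f"
  shows "f r = of_rat r"
proof -
  have a: "\<And>x y. f (x + y) = f x + f y" and m: "\<And>x y. f (x * y) = f x * f y"
    and 0: "f 0 = 0" and 1: "f 1 = 1"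
    using assms by (auto simp: ring_hom_map_def)
  have n: "f (of_nat k) = of_nat k" for k
    by (induction k) (simp_all add: a 0 1)
  have i: "f (of_int k) = of_int k" for k
    by (cases k) (simp_all add: n ring_hom_map_minus[OF assms] a 1 del: of_nat_Suc)
  obtain p d where r: "r = Rat.Fract p d" "d > 0" by (cases r) auto
  then have e: "r * of_int d = of_int p" by (simp add: Fract_of_int_quotient)
  then have "f r * of_int d = of_int p" by (metis m i)
  moreover have "of_rat r * (of_int d :: 'a) = of_int p"
    using arg_cong[OF e, of "of_rat :: rat \<Rightarrow> 'a"] by (simp add: of_rat_mult)
  ultimately show ?thesis using \<open>d > 0\<close>
    by (metis less_irrefl mult_right_cancel of_int_eq_0_iff)
qed

lemma ring_hom_map_comp_const:
  assumes "ring_hom_map (f :: 'a::comm_ring_1 poly \<Rightarrow> 'b::comm_ring_1)"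
  shows "ring_hom_map (\<lambda>c. f [:c:])"
proof -
  have "[:x + y:] = [:x:] + [:y:]" "[:x * y:] = [:x:] * [:y:]" for x y :: 'a by simp_all
  then show ?thesis using assms unfolding ring_hom_map_def by (metis one_pCons pCons_0_0)
qed

lemma eval_with_unique:
  assumes "ring_hom_map f"
  shows "eval_with (\<lambda>c. f [:c:]) (f [:0, 1:]) p = f p"
proof (induction p)
  case 0 then show ?case using assms by (simp add: ring_hom_map_def)
next
  case (pCons c p)
  have "pCons c p = [:c:] + [:0, 1:] * p" by simp
  then have "f (pCons c p) = f [:c:] + f [:0, 1:] * f p"
    using assms unfolding ring_hom_map_def by metis
  moreover have "f [:0:] = 0" using assms by (simp add: ring_hom_map_def)
  ultimately show ?case
    by (simp add: eval_with_pCons[of "\<lambda>c. f [:c:]"] pCons.IH)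
qed

abbreviation "gen1 \<equiv> [:[:[:[:[:0, 1:]:]:]:]:] :: poly5"
abbreviation "gen2 \<equiv> [:[:[:[:0, 1:]:]:]:] :: poly5"
abbreviation "gen3 \<equiv> [:[:[:0, 1:]:]:] :: poly5"
abbreviation "gen4 \<equiv> [:[:0, 1:]:] :: poly5"
abbreviation "gen5 \<equiv> [:0, 1:] :: poly5"

lemma eval_with_1:
  assumes "\<phi> 0 = 0" "\<phi> 1 = 1"
  shows "eval_with \<phi> x 1 = 1"
  using eval_with_pCons[of \<phi> x 1 0] assms by (simp add: one_pCons)

text \<open>Universal property of the nested polynomial ring: peeling off one layer at a time, each
  restriction to constants is again a ring homomorphism, and on the rationals it is forced to be
  \<open>of_rat\<close>. Maps on \<open>poly5\<close> are identified with evaluations through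
  this.\<close>

lemma eval5_unique:
  assumes "ring_hom_map (f :: poly5 \<Rightarrow> 'a::field_char_0)"
  shows "eval5 (f gen1) (f gen2) (f gen3) (f gen4) (f gen5) p = f p"
proof -
  note h5 = assms
  note h4 = ring_hom_map_comp_const[OF h5]
  note h3 = ring_hom_map_comp_const[OF h4]
  note h2 = ring_hom_map_comp_const[OF h3]
  note h1 = ring_hom_map_comp_const[OF h2]
  note h0 = ring_hom_map_comp_const[OF h1]
  have e0: "of_rat = (\<lambda>r. f [:[:[:[:[:r:]:]:]:]:])"
    using ring_hom_map_eq_of_rat[OF h0] by auto
  show ?thesis
    unfolding eval5_def e0 eval_with_unique[OF h1] eval_with_unique[OF h2]
      eval_with_unique[OF h3] eval_with_unique[OF h4] eval_with_unique[OF h5] ..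
qed

lemma ring_hom_map_eval5: "ring_hom_map (eval5 x1 x2 x3 x4 x5)"
  unfolding eval5_def by (intro ring_hom_map_eval_with ring_hom_map_of_rat)

lemma eval5_gens [simp]:
  "eval5 x1 x2 x3 x4 x5 gen1 = x1" "eval5 x1 x2 x3 x4 x5 gen2 = x2"
  "eval5 x1 x2 x3 x4 x5 gen3 = x3" "eval5 x1 x2 x3 x4 x5 gen4 = x4"
  "eval5 x1 x2 x3 x4 x5 gen5 = x5"
  "eval5 x1 x2 x3 x4 x5 [:[:[:[:[:r:]:]:]:]:] = of_rat r"
  unfolding eval5_def by (simp_all add: eval_with_pCons eval_with_1)

lemma eval5_hom_simps [simp]:
  "eval5 x1 x2 x3 x4 x5 0 = 0" "eval5 x1 x2 x3 x4 x5 1 = 1"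
  "eval5 x1 x2 x3 x4 x5 (p + r) = eval5 x1 x2 x3 x4 x5 p + eval5 x1 x2 x3 x4 x5 r"
  "eval5 x1 x2 x3 x4 x5 (p * r) = eval5 x1 x2 x3 x4 x5 p * eval5 x1 x2 x3 x4 x5 r"
  "eval5 x1 x2 x3 x4 x5 (p ^ k) = eval5 x1 x2 x3 x4 x5 p ^ k"
proof -
  note h = ring_hom_map_eval5[of x1 x2 x3 x4 x5, unfolded ring_hom_map_def]
  show "eval5 x1 x2 x3 x4 x5 0 = 0" and 1: "eval5 x1 x2 x3 x4 x5 1 = 1"
    and "eval5 x1 x2 x3 x4 x5 (p + r) = eval5 x1 x2 x3 x4 x5 p + eval5 x1 x2 x3 x4 x5 r"
    and m: "\<And>p r. eval5 x1 x2 x3 x4 x5 (p * r) = eval5 x1 x2 x3 x4 x5 p * eval5 x1 x2 x3 x4 x5 r"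
    using h by blast+
  show "eval5 x1 x2 x3 x4 x5 (p ^ k) = eval5 x1 x2 x3 x4 x5 p ^ k"
    by (induction k) (simp_all only: power_0 power_Suc 1 m)
qed

lemma eval_with_nonzero_point:
  fixes \<phi> :: "'a::comm_ring_1 \<Rightarrow> rat"
  assumes "ring_hom_map \<phi>" "\<phi> (lead_coeff p) \<noteq> 0"
  shows "\<exists>x. x \<noteq> 0 \<and> eval_with \<phi> x p \<noteq> 0"
proof -
  have 0: "\<phi> 0 = 0" using assms by (simp add: ring_hom_map_def)
  have "coeff (map_poly \<phi> p) (degree p) \<noteq> 0" using assms 0 by (simp add: coeff_map_poly)
  \<comment> \<open>The factor \<open>[:0, 1:]\<close> puts 0 among the roots to be avoided.\<close>
  then have "[:0, 1:] * map_poly \<phi> p \<noteq> 0" by auto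
  then have "finite {x. poly ([:0, 1:] * map_poly \<phi> p) x = 0}" by (rule poly_roots_finite)
  from ex_new_if_finite[OF infinite_UNIV_char_0 this]
  obtain x where "poly ([:0, 1:] * map_poly \<phi> p) x \<noteq> 0" by blast
  then show ?thesis by (auto simp: eval_with_def)
qed

text \<open>The nested leading coefficient is a nonzero rational number. Undoing one leading
  coefficient at a time, from the innermost variable outwards, each variable is fixed where the
  remaining leading coefficient survives. Nonzero coordinates are wanted because negative powers of
  the fifth one will be substituted.\<close>

lemma eval5_nonzero_point:
  assumes "p \<noteq> 0"
  shows "\<exists>r1 r2 r3 r4 r5 :: rat. r1 \<noteq> 0 \<and> r2 \<noteq> 0 \<and> r3 \<noteq> 0 \<and> r4 \<noteq> 0 \<and> r5 \<noteq> 0 \<and> eval5 r1 r2 r3 r4 r5 p \<noteq> 0"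
proof -
  define f0 where "f0 = (of_rat :: rat \<Rightarrow> rat)"
  define f1 where "f1 = eval_with f0"
  define f2 where "f2 r1 = eval_with (f1 r1)" for r1
  define f3 where "f3 r1 r2 = eval_with (f2 r1 r2)" for r1 r2
  define f4 where "f4 r1 r2 r3 = eval_with (f3 r1 r2 r3)" for r1 r2 r3
  have h0: "ring_hom_map f0" unfolding f0_def by (rule ring_hom_map_of_rat)
  have h1: "ring_hom_map (f1 r1)" for r1 unfolding f1_def by (rule ring_hom_map_eval_with[OF h0])
  have h2: "ring_hom_map (f2 r1 r2)" for r1 r2 unfolding f2_def by (rule ring_hom_map_eval_with[OF h1])
  have h3: "ring_hom_map (f3 r1 r2 r3)" for r1 r2 r3 unfolding f3_def by (rule ring_hom_map_eval_with[OF h2])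
  have h4: "ring_hom_map (f4 r1 r2 r3 r4)" for r1 r2 r3 r4 unfolding f4_def by (rule ring_hom_map_eval_with[OF h3])
  have "f0 (lead_coeff (lead_coeff (lead_coeff (lead_coeff (lead_coeff p))))) \<noteq> 0"
    using assms by (simp add: f0_def)
  from eval_with_nonzero_point[OF h0 this, folded f1_def] obtain r1 where r1: "r1 \<noteq> 0"
    "f1 r1 (lead_coeff (lead_coeff (lead_coeff (lead_coeff p)))) \<noteq> 0" by blast
  from eval_with_nonzero_point[OF h1 r1(2), folded f2_def] obtain r2 where r2: "r2 \<noteq> 0"
    "f2 r1 r2 (lead_coeff (lead_coeff (lead_coeff p))) \<noteq> 0" by blast
  from eval_with_nonzero_point[OF h2 r2(2), folded f3_def] obtain r3 where r3: "r3 \<noteq> 0"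
    "f3 r1 r2 r3 (lead_coeff (lead_coeff p)) \<noteq> 0" by blast
  from eval_with_nonzero_point[OF h3 r3(2), folded f4_def] obtain r4 where r4: "r4 \<noteq> 0"
    "f4 r1 r2 r3 r4 (lead_coeff p) \<noteq> 0" by blast
  from eval_with_nonzero_point[OF h4 r4(2)] obtain r5 where r5: "r5 \<noteq> 0"
    "eval5 r1 r2 r3 r4 r5 p \<noteq> 0"
    unfolding eval5_def f4_def f3_def f2_def f1_def f0_def by blast
  show ?thesis using r1(1) r2(1) r3(1) r4(1) r5 by blast
qed

definition rel_closed :: "('a::comm_ring_1 \<Rightarrow> ('c \<Rightarrow> 'b::comm_ring_1) \<Rightarrow> bool) \<Rightarrow> bool" where
  "rel_closed Rel \<longleftrightarrow> Rel 0 (\<lambda>_. 0) \<and>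
     (\<forall>y1 f1 y2 f2. Rel y1 f1 \<longrightarrow> Rel y2 f2 \<longrightarrow>
        Rel (y1 + y2) (\<lambda>r. f1 r + f2 r) \<and> Rel (y1 * y2) (\<lambda>r. f1 r * f2 r))"

text \<open>Both values come from the same Horner scheme, so a relation closed under the ring
  operations passes from the coefficients and the points to the values. It links a computation in a
  field to the pointwise computation at rational points.\<close>

lemma eval_with_rel:
  assumes "rel_closed Rel" "\<And>c. Rel (\<phi> c) (\<lambda>r. \<phi>' r c)" "Rel x x'"
    and "ring_hom_map \<phi>" "\<And>r. ring_hom_map (\<phi>' r)"
  shows "Rel (eval_with \<phi> x p) (\<lambda>r. eval_with (\<phi>' r) (x' r) p)"
proof -
  have 0: "\<phi> 0 = 0" "\<And>r. \<phi>' r 0 = 0" using assms(4,5) by (auto simp: ring_hom_map_def)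
  show ?thesis
  proof (induction p)
    case 0 then show ?case using assms(1) by (simp add: rel_closed_def)
  next
    case (pCons c p)
    show ?case using assms(1-3) pCons.IH unfolding rel_closed_def eval_with_pCons[of \<phi>, OF 0(1)] eval_with_pCons[of "\<phi>' r" for r, OF 0(2)]
      by blast
  qed
qed

text \<open>Algebraic independence of the elements \<open>\<Psi> x\<^sub>i \<cdot> (\<Psi> x\<^sub>5)\<^bsup>e\<^sub>i\<^esup>\<close>: up to a power of \<open>\<Psi> x\<^sub>5\<close>, the value at
  these elements is \<open>\<Psi> P\<close>, where \<open>P\<close> is computed at rational points by the same substitution.\<close>

lemma eval5_monomial_inj:
  fixes \<Psi> :: "poly5 \<Rightarrow> 'a::field_char_0"
  assumes hom: "ring_hom_map \<Psi>" and inj: "\<And>P. \<Psi> P = 0 \<Longrightarrow> P = 0"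
    and z: "eval5 (\<Psi> gen1 * \<Psi> gen5 powi e1) (\<Psi> gen2 * \<Psi> gen5 powi e2) (\<Psi> gen3 * \<Psi> gen5 powi e3)
             (\<Psi> gen4 * \<Psi> gen5 powi e4) (\<Psi> gen5) p = 0"
  shows "p = 0"
proof -
  define u where "u = \<Psi> gen5"
  have "u \<noteq> 0" unfolding u_def using inj[of gen5] by auto
  have \<Psi>: "\<Psi> 0 = 0" "\<Psi> 1 = 1" "\<And>x y. \<Psi> (x + y) = \<Psi> x + \<Psi> y" "\<And>x y. \<Psi> (x * y) = \<Psi> x * \<Psi> y"
    using hom by (auto simp: ring_hom_map_def)
  have \<Psi>pow: "\<Psi> (x ^ k) = \<Psi> x ^ k" for x k by (induction k) (simp_all add: \<Psi>)
  define X :: "rat \<times> rat \<times> rat \<times> rat \<times> rat \<Rightarrow> poly5 \<Rightarrow> rat" where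
    "X = (\<lambda>(r1,r2,r3,r4,r5). eval5 r1 r2 r3 r4 r5)"
  define ok :: "rat \<times> rat \<times> rat \<times> rat \<times> rat \<Rightarrow> bool" where
    "ok = (\<lambda>(r1,r2,r3,r4,r5). r1 \<noteq> 0 \<and> r2 \<noteq> 0 \<and> r3 \<noteq> 0 \<and> r4 \<noteq> 0 \<and> r5 \<noteq> 0)"
  \<comment> \<open>After the negative powers of \<open>u\<close> are cleared by
    \<open>u ^ N\<close>, the element \<open>y\<close> is the image of a polynomial
    \<open>P\<close>, and \<open>f\<close> is the function on rational points described by
    \<open>P / gen5 ^ N\<close>.\<close>
  define Rel where "Rel y f \<longleftrightarrow> (\<exists>N P. u ^ N * y = \<Psi> P \<and> (\<forall>r. ok r \<longrightarrow> X r P = X r gen5 ^ N * f r))"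
    for y and f :: "rat \<times> rat \<times> rat \<times> rat \<times> rat \<Rightarrow> rat"
  have X [simp]: "X r (a + b) = X r a + X r b" "X r (a * b) = X r a * X r b"
    "X r (a ^ k) = X r a ^ k" "X r 0 = 0" "X r 1 = 1" for r a b k
    by (cases r; simp add: X_def)+
  have Xg: "ok r \<Longrightarrow> X r gen5 \<noteq> 0" for r by (cases r) (auto simp: X_def ok_def)
  have R0: "Rel 0 (\<lambda>_. 0)"
    unfolding Rel_def by (rule exI[of _ 0], rule exI[of _ 0]) (simp add: \<Psi>)
  have Rc: "Rel (of_rat c) (\<lambda>_. of_rat c)" for c
  proof -
    have "\<Psi> [:[:[:[:[:c:]:]:]:]:] = of_rat c"
      using eval5_unique[OF hom, of "[:[:[:[:[:c:]:]:]:]:]"] by simp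
    moreover have "X r [:[:[:[:[:c:]:]:]:]:] = of_rat c" for r by (cases r) (simp add: X_def)
    ultimately show ?thesis unfolding Rel_def
      by (intro exI[of _ 0] exI[of _ "[:[:[:[:[:c:]:]:]:]:]"]) simp
  qed
  have Rp: "Rel (y1 + y2) (\<lambda>r. f1 r + f2 r)" if R: "Rel y1 f1" "Rel y2 f2" for y1 f1 y2 f2
  proof -
    from R obtain N1 P1 N2 P2 where
      1: "u ^ N1 * y1 = \<Psi> P1" "\<And>r. ok r \<Longrightarrow> X r P1 = X r gen5 ^ N1 * f1 r" and
      2: "u ^ N2 * y2 = \<Psi> P2" "\<And>r. ok r \<Longrightarrow> X r P2 = X r gen5 ^ N2 * f2 r"
      unfolding Rel_def by blast
    show ?thesis unfolding Rel_def
    proof (intro exI conjI allI impI)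
      show "u ^ (N1 + N2) * (y1 + y2) = \<Psi> (gen5 ^ N2 * P1 + gen5 ^ N1 * P2)"
        using 1(1) 2(1)
        by (simp only: \<Psi> \<Psi>pow u_def[symmetric] 1(1)[symmetric] 2(1)[symmetric]) (simp add: algebra_simps power_add)
      show "X r (gen5 ^ N2 * P1 + gen5 ^ N1 * P2) = X r gen5 ^ (N1 + N2) * (f1 r + f2 r)"
        if "ok r" for r
        using 1(2)[OF that] 2(2)[OF that] by (simp add: algebra_simps power_add)
    qed
  qed
  have Rt: "Rel (y1 * y2) (\<lambda>r. f1 r * f2 r)" if R: "Rel y1 f1" "Rel y2 f2" for y1 f1 y2 f2
  proof -
    from R obtain N1 P1 N2 P2 where
      1: "u ^ N1 * y1 = \<Psi> P1" "\<And>r. ok r \<Longrightarrow> X r P1 = X r gen5 ^ N1 * f1 r" and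
      2: "u ^ N2 * y2 = \<Psi> P2" "\<And>r. ok r \<Longrightarrow> X r P2 = X r gen5 ^ N2 * f2 r"
      unfolding Rel_def by blast
    show ?thesis unfolding Rel_def
    proof (intro exI conjI allI impI)
      show "u ^ (N1 + N2) * (y1 * y2) = \<Psi> (P1 * P2)"
        by (simp only: \<Psi> 1(1)[symmetric] 2(1)[symmetric]) (simp add: algebra_simps power_add)
      show "X r (P1 * P2) = X r gen5 ^ (N1 + N2) * (f1 r * f2 r)" if "ok r" for r
        using 1(2)[OF that] 2(2)[OF that] by (simp add: algebra_simps power_add)
    qed
  qed
  have Rg: "Rel (\<Psi> g * u powi e) (\<lambda>r. X r g * X r gen5 powi e)" for g e
    unfolding Rel_def
  proof (intro exI conjI allI impI)
    have k: "w ^ nat \<bar>e\<bar> * (v * w powi e) = v * w ^ nat (\<bar>e\<bar> + e)" if "w \<noteq> 0" for v w :: "'b::field"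
    proof -
      have "w ^ nat \<bar>e\<bar> * w powi e = w powi (\<bar>e\<bar> + e)"
        using that by (simp add: power_int_add) (simp add: power_int_def)
      also have "\<dots> = w ^ nat (\<bar>e\<bar> + e)" by (simp add: power_int_def)
      finally show ?thesis by (simp add: mult.left_commute)
    qed
    show "u ^ nat \<bar>e\<bar> * (\<Psi> g * u powi e) = \<Psi> (g * gen5 ^ nat (\<bar>e\<bar> + e))"
      by (simp only: k[OF \<open>u \<noteq> 0\<close>] \<Psi> \<Psi>pow u_def[symmetric])
    show "X r (g * gen5 ^ nat (\<bar>e\<bar> + e)) = X r gen5 ^ nat \<bar>e\<bar> * (X r g * X r gen5 powi e)"
      if "ok r" for r
      by (simp only: X k[OF Xg[OF that]])
  qed
  have Rg0: "Rel u (\<lambda>r. X r gen5)" using Rg[of gen5 0] by (simp add: u_def)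
  have Rcl: "rel_closed Rel" using R0 Rp Rt by (simp add: rel_closed_def)
  note h = ring_hom_map_eval_with ring_hom_map_of_rat
  let ?y1 = "\<Psi> gen1 * u powi e1" and ?x1 = "\<lambda>r. X r gen1 * X r gen5 powi e1"
  let ?y2 = "\<Psi> gen2 * u powi e2" and ?x2 = "\<lambda>r. X r gen2 * X r gen5 powi e2"
  let ?y3 = "\<Psi> gen3 * u powi e3" and ?x3 = "\<lambda>r. X r gen3 * X r gen5 powi e3"
  let ?y4 = "\<Psi> gen4 * u powi e4" and ?x4 = "\<lambda>r. X r gen4 * X r gen5 powi e4"
  note E = eval_with_rel[of Rel, OF Rcl]
  have R1: "Rel (eval_with of_rat ?y1 c) (\<lambda>r. eval_with of_rat (?x1 r) c)" for c
    by (rule E[where \<phi>' = "\<lambda>_. of_rat" and x' = ?x1], rule Rc, rule Rg, (intro h)+)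
  have R2: "Rel (eval_with (eval_with of_rat ?y1) ?y2 c) (\<lambda>r. eval_with (eval_with of_rat (?x1 r)) (?x2 r) c)" for c
    by (rule E[where \<phi>' = "\<lambda>r. eval_with of_rat (?x1 r)" and x' = ?x2], rule R1, rule Rg, (intro h)+)
  have R3: "Rel (eval_with (eval_with (eval_with of_rat ?y1) ?y2) ?y3 c)
      (\<lambda>r. eval_with (eval_with (eval_with of_rat (?x1 r)) (?x2 r)) (?x3 r) c)" for c
    by (rule E[where \<phi>' = "\<lambda>r. eval_with (eval_with of_rat (?x1 r)) (?x2 r)" and x' = ?x3], rule R2, rule Rg, (intro h)+)
  have R4: "Rel (eval_with (eval_with (eval_with (eval_with of_rat ?y1) ?y2) ?y3) ?y4 c)
      (\<lambda>r. eval_with (eval_with (eval_with (eval_with of_rat (?x1 r)) (?x2 r)) (?x3 r)) (?x4 r) c)" for c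
    by (rule E[where \<phi>' = "\<lambda>r. eval_with (eval_with (eval_with of_rat (?x1 r)) (?x2 r)) (?x3 r)" and x' = ?x4], rule R3, rule Rg, (intro h)+)
  have R: "Rel (eval5 ?y1 ?y2 ?y3 ?y4 u p) (\<lambda>r. eval5 (?x1 r) (?x2 r) (?x3 r) (?x4 r) (X r gen5) p)"
    unfolding eval5_def
    by (rule E[where \<phi>' = "\<lambda>r. eval_with (eval_with (eval_with (eval_with of_rat (?x1 r)) (?x2 r)) (?x3 r)) (?x4 r)"
          and x' = "\<lambda>r. X r gen5"], rule R4, rule Rg0, (intro h)+)
  show "p = 0"
  proof (rule ccontr)
    assume "p \<noteq> 0"
    from eval5_nonzero_point[OF this] obtain r1 r2 r3 r4 r5 :: rat where r:
      "r1 \<noteq> 0" "r2 \<noteq> 0" "r3 \<noteq> 0" "r4 \<noteq> 0" "r5 \<noteq> 0" and nz: "eval5 r1 r2 r3 r4 r5 p \<noteq> 0" by blast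
    from R obtain N P where P: "u ^ N * eval5 ?y1 ?y2 ?y3 ?y4 u p = \<Psi> P" and
      PX: "\<And>r. ok r \<Longrightarrow> X r P = X r gen5 ^ N * eval5 (?x1 r) (?x2 r) (?x3 r) (?x4 r) (X r gen5) p"
      unfolding Rel_def by (elim exE conjE) blast
    have "\<Psi> P = 0" using P z[folded u_def] by simp
    then have "P = 0" using inj by blast
    \<comment> \<open>Chosen so that t_i r5^(e_i) = r_i. At this point \<open>P\<close> takes the
      value r5^N p(r), which is nonzero although \<open>P = 0\<close>.\<close>
    define t where "t = (r1 * r5 powi (-e1), r2 * r5 powi (-e2), r3 * r5 powi (-e3), r4 * r5 powi (-e4), r5)"
    have "ok t" using r by (simp add: ok_def t_def)
    have c: "v * r5 powi (-e) * r5 powi e = v" for v e using r(5) by (simp add: power_int_minus field_simps)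
    show False using PX[OF \<open>ok t\<close>] \<open>P = 0\<close> nz r(5)
      by (simp add: t_def X_def c)
  qed
qed

section \<open>Substitutions as homomorphisms of fields\<close>

lemma ratfun_subst_Fract:
  assumes inj: "\<And>p. eval5 x1 x2 x3 x4 x5 p = 0 \<Longrightarrow> p = 0" and "d \<noteq> 0"
  shows "ratfun_subst x1 x2 x3 x4 x5 (Fract p d) = eval5 x1 x2 x3 x4 x5 p / eval5 x1 x2 x3 x4 x5 d"
  unfolding ratfun_subst_def
proof (rule the_equality)
  show "\<exists>p' d'. Fract p d = Fract p' d' \<and> eval5 x1 x2 x3 x4 x5 d' \<noteq> 0 \<and>
      eval5 x1 x2 x3 x4 x5 p / eval5 x1 x2 x3 x4 x5 d = eval5 x1 x2 x3 x4 x5 p' / eval5 x1 x2 x3 x4 x5 d'"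
    using assms by blast
next
  fix y assume "\<exists>p' d'. Fract p d = Fract p' d' \<and> eval5 x1 x2 x3 x4 x5 d' \<noteq> 0 \<and>
      y = eval5 x1 x2 x3 x4 x5 p' / eval5 x1 x2 x3 x4 x5 d'"
  then obtain p' d' where *: "Fract p d = Fract p' d'" "eval5 x1 x2 x3 x4 x5 d' \<noteq> 0"
      "y = eval5 x1 x2 x3 x4 x5 p' / eval5 x1 x2 x3 x4 x5 d'" by blast
  then have "d' \<noteq> 0" by auto
  with * assms(2) have "p * d' = p' * d" by (simp add: eq_fract)
  then have "eval5 x1 x2 x3 x4 x5 p * eval5 x1 x2 x3 x4 x5 d' = eval5 x1 x2 x3 x4 x5 p' * eval5 x1 x2 x3 x4 x5 d"
    by (metis eval5_hom_simps(4))
  moreover have nz: "eval5 x1 x2 x3 x4 x5 d \<noteq> 0" using inj[of d] assms(2) by blast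
  ultimately show "y = eval5 x1 x2 x3 x4 x5 p / eval5 x1 x2 x3 x4 x5 d"
    using *(2,3) nz by (simp add: frac_eq_eq)
qed

definition field_hom :: "('a::field \<Rightarrow> 'b::field) \<Rightarrow> bool" where
  "field_hom f \<longleftrightarrow> ring_hom_map f"

lemma field_homD:
  assumes "field_hom f"
  shows "f 0 = 0" "f 1 = 1" "f (x + y) = f x + f y" "f (x * y) = f x * f y" "f (- x) = - f x"
    "f (x - y) = f x - f y" "f (inverse x) = inverse (f x)" "f (x / y) = f x / f y" "f (x ^ n) = f x ^ n"
    "f (x powi k) = f x powi k" "f x = f y \<longleftrightarrow> x = y" "f x = 0 \<longleftrightarrow> x = 0"
proof -
  note h = assms[unfolded field_hom_def]
  have 0: "f 0 = 0" and 1: "f 1 = 1" and a: "\<And>x y. f (x + y) = f x + f y" and m: "\<And>x y. f (x * y) = f x * f y"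
    using h by (auto simp: ring_hom_map_def)
  note u = ring_hom_map_minus[OF h]
  have d: "f (x - y) = f x - f y" for x y using a[of x "-y"] u by simp
  have i: "f (inverse x) = inverse (f x)" for x
  proof (cases "x = 0")
    case False
    then have "f x * f (inverse x) = 1" using m[of x "inverse x"] 1 by simp
    then show ?thesis using inverse_unique by metis
  qed (simp add: 0)
  have z: "f x = 0 \<longleftrightarrow> x = 0" for x
  proof
    assume "f x = 0"
    then have "x \<noteq> 0 \<Longrightarrow> False" using m[of x "inverse x"] 1 by simp
    then show "x = 0" by blast
  qed (simp add: 0)
  have p: "f (x ^ n) = f x ^ n" for x n by (induction n) (simp_all add: 1 m)
  show "f 0 = 0" "f 1 = 1" "f (x + y) = f x + f y" "f (x * y) = f x * f y" "f (- x) = - f x"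
    "f (x - y) = f x - f y" "f (inverse x) = inverse (f x)" "f (x ^ n) = f x ^ n" "f x = 0 \<longleftrightarrow> x = 0"
    by (fact 0 1 a m u d i p z)+
  show "f (x / y) = f x / f y" by (simp add: divide_inverse m i)
  show "f (x powi k) = f x powi k" by (simp add: power_int_def p i)
  show "f x = f y \<longleftrightarrow> x = y" using z[of "x - y"] d[of x y] by auto
qed

lemma ratfun_subst_hom:
  assumes inj: "\<And>p. eval5 x1 x2 x3 x4 x5 p = 0 \<Longrightarrow> p = 0"
  shows "field_hom (ratfun_subst x1 x2 x3 x4 x5)"
    and "ratfun_subst x1 x2 x3 x4 x5 sqrt_mab = x1" "ratfun_subst x1 x2 x3 x4 x5 par_b = x2"
    "ratfun_subst x1 x2 x3 x4 x5 sqrt_mcd = x3" "ratfun_subst x1 x2 x3 x4 x5 par_d = x4"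
    "ratfun_subst x1 x2 x3 x4 x5 sqrt_q = x5"
proof -
  have F: "ratfun_subst x1 x2 x3 x4 x5 (Fract p d) = eval5 x1 x2 x3 x4 x5 p / eval5 x1 x2 x3 x4 x5 d"
    if "d \<noteq> 0" for p d
    using ratfun_subst_Fract that inj by blast
  have nz: "d \<noteq> 0 \<Longrightarrow> eval5 x1 x2 x3 x4 x5 d \<noteq> 0" for d using inj by blast
  have "ratfun_subst x1 x2 x3 x4 x5 (x + y) = ratfun_subst x1 x2 x3 x4 x5 x + ratfun_subst x1 x2 x3 x4 x5 y"
    "ratfun_subst x1 x2 x3 x4 x5 (x * y) = ratfun_subst x1 x2 x3 x4 x5 x * ratfun_subst x1 x2 x3 x4 x5 y" for x y
  proof -
    obtain p d p' d' where xy: "x = Fract p d" "d \<noteq> 0" "y = Fract p' d'" "d' \<noteq> 0"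
      by (cases x; cases y) blast
    then have *: "x + y = Fract (p * d' + p' * d) (d * d')" "x * y = Fract (p * p') (d * d')" "d * d' \<noteq> 0"
      by simp_all
    show "ratfun_subst x1 x2 x3 x4 x5 (x + y) = ratfun_subst x1 x2 x3 x4 x5 x + ratfun_subst x1 x2 x3 x4 x5 y"
      using nz[OF xy(2)] nz[OF xy(4)] unfolding *(1) F[OF *(3)] unfolding xy F[OF xy(2)] F[OF xy(4)]
      by (simp add: add_frac_eq)
    show "ratfun_subst x1 x2 x3 x4 x5 (x * y) = ratfun_subst x1 x2 x3 x4 x5 x * ratfun_subst x1 x2 x3 x4 x5 y"
      unfolding *(2) F[OF *(3)] unfolding xy F[OF xy(2)] F[OF xy(4)] by simp
  qed
  moreover have "ratfun_subst x1 x2 x3 x4 x5 0 = 0" "ratfun_subst x1 x2 x3 x4 x5 1 = 1"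
    using F[of 1 0] F[of 1 1] by (simp_all add: Zero_fract_def One_fract_def)
  ultimately show "field_hom (ratfun_subst x1 x2 x3 x4 x5)"
    by (simp add: field_hom_def ring_hom_map_def)
  show "ratfun_subst x1 x2 x3 x4 x5 sqrt_mab = x1" "ratfun_subst x1 x2 x3 x4 x5 par_b = x2"
    "ratfun_subst x1 x2 x3 x4 x5 sqrt_mcd = x3" "ratfun_subst x1 x2 x3 x4 x5 par_d = x4"
    "ratfun_subst x1 x2 x3 x4 x5 sqrt_q = x5"
    unfolding sqrt_mab_def par_b_def sqrt_mcd_def par_d_def sqrt_q_def F[OF one_neq_zero] by simp_all
qed

lemma field_hom_eval5:
  assumes "field_hom (f :: 'a::field_char_0 \<Rightarrow> 'b::field_char_0)"
  shows "f (eval5 t1 t2 t3 t4 t5 p) = eval5 (f t1) (f t2) (f t3) (f t4) (f t5) p"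
proof -
  have "ring_hom_map (\<lambda>p. f (eval5 t1 t2 t3 t4 t5 p))"
    using field_homD(1-4)[OF assms] by (simp add: ring_hom_map_def)
  from eval5_unique[OF this, of p] show ?thesis by simp
qed

lemma Fract_1_hom: "ring_hom_map (\<lambda>p::poly5. Fract p 1)"
  by (simp add: ring_hom_map_def Zero_fract_def One_fract_def)

lemma K_eq_eval5:
  fixes x :: K
  obtains p d where "eval5 sqrt_mab par_b sqrt_mcd par_d sqrt_q d \<noteq> 0"
    "x = eval5 sqrt_mab par_b sqrt_mcd par_d sqrt_q p / eval5 sqrt_mab par_b sqrt_mcd par_d sqrt_q d"
proof (cases x)
  case (Fract p d)
  have e: "eval5 sqrt_mab par_b sqrt_mcd par_d sqrt_q p' = Fract p' 1" for p'
    unfolding sqrt_mab_def par_b_def sqrt_mcd_def par_d_def sqrt_q_def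
    by (rule eval5_unique[OF Fract_1_hom])
  show ?thesis
    by (rule that[of d p]) (use Fract in \<open>simp_all add: e Zero_fract_def eq_fract\<close>)
qed

lemma gens_nz [simp]:
  "sqrt_mab \<noteq> 0" "par_b \<noteq> 0" "sqrt_mcd \<noteq> 0" "par_d \<noteq> 0" "sqrt_q \<noteq> 0" "par_a \<noteq> 0" "par_c \<noteq> 0" "par_q \<noteq> 0"
proof -
  show *: "sqrt_mab \<noteq> 0" "par_b \<noteq> 0" "sqrt_mcd \<noteq> 0" "par_d \<noteq> 0" "sqrt_q \<noteq> 0"
    unfolding sqrt_mab_def par_b_def sqrt_mcd_def par_d_def sqrt_q_def
    by (simp_all add: Zero_fract_def eq_fract)
  then show "par_a \<noteq> 0" "par_c \<noteq> 0" "par_q \<noteq> 0"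
    by (simp_all add: par_a_def par_c_def par_q_def)
qed

lemma K_monomial_inj:
  assumes "eval5 (sqrt_mab * sqrt_q powi e1) (par_b * sqrt_q powi e2) (sqrt_mcd * sqrt_q powi e3)
    (par_d * sqrt_q powi e4) sqrt_q p = 0"
  shows "p = 0"
proof (rule eval5_monomial_inj[OF Fract_1_hom])
  show "P = 0" if "Fract P 1 = 0" for P :: poly5 using that by (simp add: Zero_fract_def eq_fract)
  show "eval5 (Fract gen1 1 * Fract gen5 1 powi e1) (Fract gen2 1 * Fract gen5 1 powi e2)
     (Fract gen3 1 * Fract gen5 1 powi e3) (Fract gen4 1 * Fract gen5 1 powi e4) (Fract gen5 1) p = 0"
    using assms unfolding sqrt_mab_def par_b_def sqrt_mcd_def par_d_def sqrt_q_def .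
qed

lemma shiftK_hom: "field_hom (shiftK h)"
  and shiftK_gens: "shiftK h sqrt_mab = sqrt_mab * qpow ((h $ 1 + h $ 2) / 2)" "shiftK h par_b = par_b * qpow (h $ 2)"
    "shiftK h sqrt_mcd = sqrt_mcd * qpow ((h $ 3 + h $ 4) / 2)" "shiftK h par_d = par_d * qpow (h $ 4)"
    "shiftK h sqrt_q = sqrt_q"
  unfolding shiftK_def by (rule ratfun_subst_hom, rule K_monomial_inj, simp only: qpow_def)+

text \<open>Substituting the inversely scaled generators gives a preimage, because powers of q^(1/2)
  are fixed. Surjectivity serves \<open>nondeg_smom\<close>, where arbitrary coefficients are pulled
  back.\<close>

lemma surj_shiftK: "surj (shiftK h)"
proof -
  note hom = shiftK_hom[of h]
  define N where "N = (\<lambda>e. qpow e)"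
  have qnz: "qpow e \<noteq> 0" for e by (simp add: qpow_def)
  have qs: "shiftK h (qpow e) = qpow e" for e
    by (simp add: qpow_def field_homD(10)[OF hom] shiftK_gens)
  let ?E = "eval5 (sqrt_mab / qpow ((h $ 1 + h $ 2) / 2)) (par_b / qpow (h $ 2))
     (sqrt_mcd / qpow ((h $ 3 + h $ 4) / 2)) (par_d / qpow (h $ 4)) sqrt_q"
  have E: "shiftK h (?E p) = eval5 sqrt_mab par_b sqrt_mcd par_d sqrt_q p" for p
    unfolding field_hom_eval5[OF hom] field_homD(8)[OF hom] qs shiftK_gens by (simp add: qnz)
  have "\<exists>x. shiftK h x = y" for y
  proof -
    obtain p d where "y = eval5 sqrt_mab par_b sqrt_mcd par_d sqrt_q p / eval5 sqrt_mab par_b sqrt_mcd par_d sqrt_q d"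
      by (rule K_eq_eval5)
    then have "shiftK h (?E p / ?E d) = y" by (simp add: field_homD(8)[OF hom] E)
    then show ?thesis by blast
  qed
  then show ?thesis by (metis surj_def)
qed

text \<open>Orthogonality tests only monomials in the second argument, so the involution enters
  through its value at 1. A fraction that represents 1 has equal numerator and denominator, which
  settles the description directly.\<close>

lemma starK_1 [simp]: "starK 1 = 1"
proof -
  have "\<exists>p d. (1::K) = Fract p d \<and> eval5 (inverse sqrt_mab) (inverse par_b) (inverse sqrt_mcd) (inverse par_d) (inverse sqrt_q) d \<noteq> 0 \<and>
     1 = eval5 (inverse sqrt_mab) (inverse par_b) (inverse sqrt_mcd) (inverse par_d) (inverse sqrt_q) p /
         eval5 (inverse sqrt_mab) (inverse par_b) (inverse sqrt_mcd) (inverse par_d) (inverse sqrt_q) d"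
    by (rule exI[of _ 1], rule exI[of _ 1]) (simp add: One_fract_def[symmetric])
  moreover have "y = 1" if "(1::K) = Fract p d \<and> eval5 x1 x2 x3 x4 x5 d \<noteq> 0 \<and>
     y = eval5 x1 x2 x3 x4 x5 p / eval5 x1 x2 x3 x4 x5 d" for y x1 x2 x3 x4 x5 :: K and p d
  proof -
    have "d \<noteq> 0" using that by auto
    then have "p = d" using that by (simp add: One_fract_def eq_fract)
    then show ?thesis using that by simp
  qed
  ultimately show ?thesis unfolding starK_def ratfun_subst_def
    by (intro the_equality) blast+
qed

subsection \<open>The embedding into Laurent series in \<open>q\<^sup>1\<^sup>/\<^sup>2\<close>\<close>

text \<open>The plain embedding, with d sent to d' itself. \<open>embK\<close> differs from it by
  the exponent 1 of q^(1/2) at the third and fourth generator, so \<open>eval5_monomial_inj\<close>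
  yields the injectivity of \<open>embK\<close>.\<close>

definition poly5_to_fls :: "poly5 \<Rightarrow> F fls" where
  "poly5_to_fls P = fps_to_fls (fps_of_poly (map_poly (\<lambda>p. Fract p 1) P))"

lemma map_poly_Fract_1:
  "map_poly (\<lambda>p. Fract p 1) (P * Q) = map_poly (\<lambda>p. Fract p 1) P * map_poly (\<lambda>p::'a::idom. Fract p 1) Q"
  "map_poly (\<lambda>p. Fract p 1) (P + Q) = map_poly (\<lambda>p. Fract p 1) P + map_poly (\<lambda>p::'a::idom. Fract p 1) Q"
proof -
  have 0: "Fract (0::'a) 1 = 0" by (simp add: Zero_fract_def)
  have a: "Fract (x + y :: 'a) 1 = Fract x 1 + Fract y 1" for x y by simp
  have s: "Fract (sum f A :: 'a) 1 = (\<Sum>i\<in>A. Fract (f i) 1)" for f and A :: "nat set"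
    by (induction A rule: infinite_finite_induct) (simp_all add: 0 a del: add_fract)
  show "map_poly (\<lambda>p. Fract p 1) (P + Q) = map_poly (\<lambda>p. Fract p 1) P + map_poly (\<lambda>p. Fract p 1) Q"
    by (rule poly_eqI) (simp add: coeff_map_poly 0)
  show "map_poly (\<lambda>p. Fract p 1) (P * Q) = map_poly (\<lambda>p. Fract p 1) P * map_poly (\<lambda>p. Fract p 1) Q"
    by (rule poly_eqI) (simp add: coeff_map_poly 0 coeff_mult s)
qed

lemma poly5_to_fls_hom: "ring_hom_map poly5_to_fls"
  unfolding ring_hom_map_def poly5_to_fls_def
  by (simp add: map_poly_Fract_1 fps_of_poly_add fps_of_poly_mult fls_times_fps_to_fls
      map_poly_1 One_fract_def[symmetric] one_pCons[symmetric])

lemma poly5_to_fls_inj: "poly5_to_fls P = 0 \<Longrightarrow> P = 0"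
proof -
  assume "poly5_to_fls P = 0"
  then have "map_poly (\<lambda>p. Fract p 1) P = 0" by (simp add: poly5_to_fls_def)
  then have "Fract (coeff P n) 1 = 0" for n
    by (metis coeff_0 coeff_map_poly Zero_fract_def)
  then show "P = 0" by (intro poly_eqI) (simp add: Zero_fract_def eq_fract)
qed

lemma poly5_to_fls_gens:
  "poly5_to_fls gen1 = fls_const F_sqrt_mab" "poly5_to_fls gen2 = fls_const F_b"
  "poly5_to_fls gen3 = fls_const F_sqrt_mcd'" "poly5_to_fls gen4 = fls_const F_d'"
  "poly5_to_fls gen5 = fls_X"
  by (simp_all add: poly5_to_fls_def F_sqrt_mab_def F_b_def F_sqrt_mcd'_def F_d'_def map_poly_pCons
      Zero_fract_def[symmetric] One_fract_def[symmetric] fps_of_poly_pCons)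

lemma embK_hom: "field_hom embK"
  and embK_gens: "embK sqrt_mab = fls_const F_sqrt_mab" "embK par_b = fls_const F_b"
    "embK sqrt_mcd = fls_const F_sqrt_mcd' * fls_X" "embK par_d = fls_const F_d' * fls_X" "embK sqrt_q = fls_X"
proof -
  have inj: "p = 0" if "eval5 (fls_const F_sqrt_mab) (fls_const F_b) (fls_const F_sqrt_mcd' * fls_X)
      (fls_const F_d' * fls_X) fls_X p = 0" for p
    by (rule eval5_monomial_inj[OF poly5_to_fls_hom poly5_to_fls_inj, where ?e1.0 = 0 and ?e2.0 = 0 and ?e3.0 = 1 and ?e4.0 = 1])
      (use that in \<open>simp_all add: poly5_to_fls_gens\<close>)
  show "field_hom embK"
    "embK sqrt_mab = fls_const F_sqrt_mab" "embK par_b = fls_const F_b"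
    "embK sqrt_mcd = fls_const F_sqrt_mcd' * fls_X" "embK par_d = fls_const F_d' * fls_X" "embK sqrt_q = fls_X"
    unfolding embK_def by (rule ratfun_subst_hom, rule inj, assumption)+
qed

lemma embK_ac: "embK par_a = fls_const F_a" "embK par_c = fls_const F_c' * fls_X" "embK par_q = fls_X ^ 2"
proof -
  have nz: "F_b \<noteq> 0" "F_d' \<noteq> 0" unfolding F_b_def F_d'_def by (simp_all add: Zero_fract_def eq_fract)
  note h = field_homD[OF embK_hom]
  show "embK par_q = fls_X ^ 2" by (simp add: par_q_def h embK_gens)
  show "embK par_a = fls_const F_a"
    using nz by (simp add: par_a_def F_a_def h embK_gens fls_const_divide_const[symmetric] power2_eq_square)
  show "embK par_c = fls_const F_c' * fls_X"
    using nz by (simp add: par_c_def F_c'_def h embK_gens fls_const_divide_const[symmetric] power2_eq_square field_simps)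
qed

section \<open>The weight function\<close>

abbreviation cf2 :: "'a fps fps \<Rightarrow> nat \<Rightarrow> nat \<Rightarrow> 'a" where
  "cf2 X i j \<equiv> fps_nth (fps_nth X i) j"

lemma fps_fps_mult_nth:
  fixes X Y :: "'a::comm_ring_1 fps fps"
  shows "cf2 (X * Y) i j = (\<Sum>k\<le>i. \<Sum>l\<le>j. cf2 X k l * cf2 Y (i - k) (j - l))"
  by (simp add: fps_mult_nth fps_sum_nth atLeast0AtMost)

subsection \<open>Reflections of power series in two variables\<close>

text \<open>As \<open>q\<^sup>1\<^sup>/\<^sup>2 = zw\<close>, the reflection \<open>z \<mapsto> z\<inverse>\<close> at fixed \<open>q\<^sup>1\<^sup>/\<^sup>2\<close> is \<open>z\<^sup>iw\<^sup>j \<mapsto> z\<^bsup>2j-i\<^esup>w\<^sup>j\<close>, defined only for \<open>i \<le> 2j\<close>.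
  Likewise \<open>tau0\<close> is the reflection \<open>z \<mapsto> qz\<inverse>\<close>.\<close>

definition supp1 :: "'a::zero fps fps \<Rightarrow> bool" where
  "supp1 X \<longleftrightarrow> (\<forall>i j. 2 * j < i \<longrightarrow> cf2 X i j = 0)"

definition tau1 :: "'a::zero fps fps \<Rightarrow> 'a fps fps" where
  "tau1 X = Abs_fps (\<lambda>i. Abs_fps (\<lambda>j. if i \<le> 2 * j then cf2 X (2 * j - i) j else 0))"

lemma cf2_tau1 [simp]: "cf2 (tau1 X) i j = (if i \<le> 2 * j then cf2 X (2 * j - i) j else 0)"
  by (simp add: tau1_def)

lemma fps_fps_eqI: "(\<And>i j. cf2 X i j = cf2 Y i j) \<Longrightarrow> X = Y"
  by (simp add: fps_eq_iff)

lemma supp1_mult: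
  fixes X Y :: "'a::comm_ring_1 fps fps"
  assumes "supp1 X" "supp1 Y"
  shows "supp1 (X * Y)"
  unfolding supp1_def
proof (intro allI impI)
  fix i j :: nat assume ij: "2 * j < i"
  have "cf2 X k l * cf2 Y (i - k) (j - l) = 0" if "k \<le> i" "l \<le> j" for k l
    using assms that ij unfolding supp1_def
  proof (cases "2 * l < k")
    case False
    then have "2 * (j - l) < i - k" using that ij by linarith
    then show ?thesis using assms(2) by (simp add: supp1_def)
  qed (use assms(1) in \<open>simp add: supp1_def\<close>)
  then show "cf2 (X * Y) i j = 0" by (simp add: fps_fps_mult_nth)
qed

text \<open>The exponent map (i, j) -> (2j - i, j) is additive, so it respects products as long as
  no term leaves the range i <= 2j, which the supports ensure. On the surviving indices, k -> 2l - k
  matches the two convolution sums.\<close>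

lemma tau1_mult:
  fixes X Y :: "'a::comm_ring_1 fps fps"
  assumes "supp1 X" "supp1 Y"
  shows "tau1 (X * Y) = tau1 X * tau1 Y"
proof (rule fps_fps_eqI)
  fix i j
  have R: "cf2 (tau1 X * tau1 Y) i j = (\<Sum>l\<le>j. \<Sum>k\<le>i. cf2 (tau1 X) k l * cf2 (tau1 Y) (i - k) (j - l))"
    unfolding fps_fps_mult_nth by (rule sum.swap)
  show "cf2 (tau1 (X * Y)) i j = cf2 (tau1 X * tau1 Y) i j"
  proof (cases "i \<le> 2 * j")
    case False
    have "cf2 (tau1 X) k l * cf2 (tau1 Y) (i - k) (j - l) = 0" if "k \<le> i" "l \<le> j" for k l
      using False that by auto
    then show ?thesis using False unfolding R by simp
  next
    case True
    have "cf2 (tau1 (X * Y)) i j = (\<Sum>l\<le>j. \<Sum>k\<le>2 * j - i. cf2 X k l * cf2 Y (2 * j - i - k) (j - l))"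
      using True by (simp add: fps_fps_mult_nth) (rule sum.swap)
    also have "\<dots> = cf2 (tau1 X * tau1 Y) i j" unfolding R
    proof (rule sum.cong[OF refl])
      fix l assume "l \<in> {..j}"
      then have l: "l \<le> j" by simp
      show "(\<Sum>k\<le>2 * j - i. cf2 X k l * cf2 Y (2 * j - i - k) (j - l)) =
            (\<Sum>k\<le>i. cf2 (tau1 X) k l * cf2 (tau1 Y) (i - k) (j - l))"
      proof -
        have "(\<Sum>k\<le>2 * j - i. cf2 X k l * cf2 Y (2 * j - i - k) (j - l)) =
          (\<Sum>k\<in>{k. k \<le> 2 * j - i \<and> k \<le> 2 * l \<and> 2 * l \<le> k + i}. cf2 X k l * cf2 Y (2 * j - i - k) (j - l))"
        proof (intro sum.mono_neutral_right ballI)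
          fix k assume k: "k \<in> {..2 * j - i} - {k. k \<le> 2 * j - i \<and> k \<le> 2 * l \<and> 2 * l \<le> k + i}"
          then consider "2 * l < k" | "2 * (j - l) < 2 * j - i - k" using True l by force
          then show "cf2 X k l * cf2 Y (2 * j - i - k) (j - l) = 0"
            using assms by cases (simp_all add: supp1_def)
        qed auto
        also have "\<dots> = (\<Sum>k\<in>{k. k \<le> i \<and> k \<le> 2 * l \<and> i - k \<le> 2 * (j - l)}. cf2 (tau1 X) k l * cf2 (tau1 Y) (i - k) (j - l))"
        proof (rule sum.reindex_bij_witness[where i = "\<lambda>k. 2 * l - k" and j = "\<lambda>k. 2 * l - k"], goal_cases)
          case (5 k)
          then have k: "k \<le> 2 * j - i" "k \<le> 2 * l" "2 * l \<le> k + i" by auto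
          then have e: "2 * (j - l) - (i - (2 * l - k)) = 2 * j - i - k" "2 * l - (2 * l - k) = k" using True l by linarith+
          have "i - (2 * l - k) \<le> 2 * (j - l)" using k True l by linarith
          then show ?case using e by simp
        qed (use True l in auto)
        also have "\<dots> = (\<Sum>k\<le>i. cf2 (tau1 X) k l * cf2 (tau1 Y) (i - k) (j - l))"
          by (intro sum.mono_neutral_left) auto
        finally show ?thesis .
      qed
    qed
    finally show ?thesis .
  qed
qed


text \<open>Induction on the total degree: if 2j < i, then every splitting of (i, j) has 2l < k or
  2(j-l) < i-k, so in the coefficient of \<open>D * E\<close> at (i, j) all terms but the one with
  \<open>cf2 D 0 0\<close> vanish.\<close>

lemma supp1_inverse:
  fixes D E :: "'a::field fps fps"
  assumes "supp1 D" "cf2 D 0 0 = 1" "D * E = 1"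
  shows "supp1 E"
proof -
  have "2 * j < i \<longrightarrow> cf2 E i j = 0" for i j
  proof (induction "i + j" arbitrary: i j rule: less_induct)
    case less
    show ?case
    proof
      assume ij: "2 * j < i"
      have "0 = cf2 (D * E) i j" using ij assms(3) by (simp add: fps_one_nth)
      also have "\<dots> = (\<Sum>(k, l)\<in>{..i} \<times> {..j}. cf2 D k l * cf2 E (i - k) (j - l))"
        by (simp add: fps_fps_mult_nth sum.cartesian_product)
      also have "\<dots> = cf2 D 0 0 * cf2 E (i - 0) (j - 0) + (\<Sum>(k, l)\<in>{..i} \<times> {..j} - {(0, 0)}. cf2 D k l * cf2 E (i - k) (j - l))"
        by (subst sum.remove[of _ "(0, 0)"]) auto
      also have "(\<Sum>(k, l)\<in>{..i} \<times> {..j} - {(0, 0)}. cf2 D k l * cf2 E (i - k) (j - l)) = 0"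
      proof (intro sum.neutral ballI)
        fix p assume p: "p \<in> {..i} \<times> {..j} - {(0, 0)}"
        obtain k l where [simp]: "p = (k, l)" by (cases p)
        from p have kl: "k \<le> i" "l \<le> j" "(k, l) \<noteq> (0, 0)" by auto
        have "cf2 D k l * cf2 E (i - k) (j - l) = 0"
        proof (cases "2 * l < k")
          case False
          then have "2 * (j - l) < i - k" using kl ij by auto
          moreover have "i - k + (j - l) < i + j" using kl by auto
          ultimately show ?thesis using less by simp
        qed (use assms(1) in \<open>simp add: supp1_def\<close>)
        then show "(case p of (k, l) \<Rightarrow> cf2 D k l * cf2 E (i - k) (j - l)) = 0" by simp
      qed
      finally show "cf2 E i j = 0" using assms(2) by simp
    qed
  qed
  then show ?thesis by (simp add: supp1_def)
qed

lemma tau1_one [simp]: "tau1 (1 :: 'a::comm_ring_1 fps fps) = 1" and supp1_one [simp]: "supp1 (1 :: 'a fps fps)"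
proof -
  show "tau1 (1 :: 'a fps fps) = 1"
    by (rule fps_fps_eqI) (auto simp: fps_one_nth split: if_splits)
qed (auto simp: supp1_def fps_one_nth)

lemma tau1_diff: "tau1 (X - Y) = tau1 X - tau1 (Y :: 'a::comm_ring_1 fps fps)"
  by (rule fps_fps_eqI) simp

lemma supp1_diff: "supp1 X \<Longrightarrow> supp1 Y \<Longrightarrow> supp1 (X - Y :: 'a::comm_ring_1 fps fps)"
  by (simp add: supp1_def)

text \<open>The exchange of z and w = q^(1/2)/z fixes q^(1/2) = zw and conjugates z -> 1/z into z ->
  q/z. Everything about \<open>tau0\<close> is obtained from \<open>tau1\<close> in this
  way.\<close>

definition transp :: "'a::zero fps fps \<Rightarrow> 'a fps fps" where
  "transp X = Abs_fps (\<lambda>i. Abs_fps (\<lambda>j. cf2 X j i))"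

lemma cf2_transp [simp]: "cf2 (transp X) i j = cf2 X j i"
  by (simp add: transp_def)

lemma transp_mult: "transp (X * Y :: 'a::comm_ring_1 fps fps) = transp X * transp Y"
proof (rule fps_fps_eqI)
  show "cf2 (transp (X * Y)) i j = cf2 (transp X * transp Y) i j" for i j
    by (simp add: fps_fps_mult_nth) (rule sum.swap)
qed

lemma transp_one [simp]: "transp (1 :: 'a::comm_ring_1 fps fps) = 1"
  by (rule fps_fps_eqI) (simp add: fps_one_nth)

lemma transp_diff: "transp (X - Y) = transp X - transp (Y :: 'a::comm_ring_1 fps fps)"
  by (rule fps_fps_eqI) simp

definition supp0 :: "'a::zero fps fps \<Rightarrow> bool" where "supp0 X \<longleftrightarrow> supp1 (transp X)"
definition tau0 :: "'a::zero fps fps \<Rightarrow> 'a fps fps" where "tau0 X = transp (tau1 (transp X))"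

lemma cf2_tau0: "cf2 (tau0 X) i j = (if j \<le> 2 * i then cf2 X i (2 * i - j) else 0)"
  by (simp add: tau0_def)

text \<open>Common properties of \<open>tau1\<close> and \<open>tau0\<close>, whose domain is the subring \<open>P\<close>; the last clause makes them
  applicable to infinite products, which are limits in the \<open>z\<close>-adic topology.\<close>

definition is_reflection :: "(zwseries \<Rightarrow> bool) \<Rightarrow> (zwseries \<Rightarrow> zwseries) \<Rightarrow> bool" where
  "is_reflection P \<tau> \<longleftrightarrow> (\<exists>\<rho>. \<forall>X i j. cf2 (\<tau> X) i j = (case \<rho> i j of None \<Rightarrow> 0 | Some (k, l) \<Rightarrow> cf2 X k l)) \<and>
     P 1 \<and> \<tau> 1 = 1 \<and> (\<forall>X Y. P X \<longrightarrow> P Y \<longrightarrow> P (X * Y) \<and> \<tau> (X * Y) = \<tau> X * \<tau> Y \<and> P (X - Y) \<and> \<tau> (X - Y) = \<tau> X - \<tau> Y) \<and>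
     (\<forall>D E. P D \<longrightarrow> cf2 D 0 0 = 1 \<longrightarrow> D * E = 1 \<longrightarrow> P E) \<and>
     (\<forall>X. (\<forall>N. \<exists>Y. P Y \<and> (\<forall>i j. i < N \<longrightarrow> cf2 X i j = cf2 Y i j)) \<longrightarrow> P X)"

lemma is_reflectionI:
  assumes "\<And>X i j. cf2 (\<tau> X) i j = (case \<rho> i j of None \<Rightarrow> 0 | Some (k, l) \<Rightarrow> cf2 X k l)"
    "P 1" "\<tau> 1 = 1"
    "\<And>X Y. P X \<Longrightarrow> P Y \<Longrightarrow> P (X * Y)" "\<And>X Y. P X \<Longrightarrow> P Y \<Longrightarrow> \<tau> (X * Y) = \<tau> X * \<tau> Y"
    "\<And>X Y. P X \<Longrightarrow> P Y \<Longrightarrow> P (X - Y)" "\<And>X Y. P X \<Longrightarrow> P Y \<Longrightarrow> \<tau> (X - Y) = \<tau> X - \<tau> Y"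
    "\<And>D E. P D \<Longrightarrow> cf2 D 0 0 = 1 \<Longrightarrow> D * E = 1 \<Longrightarrow> P E"
    "\<And>X. \<forall>N. \<exists>Y. P Y \<and> (\<forall>i j. i < N \<longrightarrow> cf2 X i j = cf2 Y i j) \<Longrightarrow> P X"
  shows "is_reflection P \<tau>"
  unfolding is_reflection_def
  by (intro conjI allI impI exI[of _ \<rho>], rule assms(1), rule assms(2), rule assms(3), (rule assms(4); assumption),
    (rule assms(5); assumption), (rule assms(6); assumption), (rule assms(7); assumption), (rule assms(8); assumption),
    (rule assms(9), simp))

lemma is_reflection_tau1: "is_reflection supp1 tau1"
proof (rule is_reflectionI[where \<rho> = "\<lambda>i j. if i \<le> 2 * j then Some (2 * j - i, j) else None"])
  show "supp1 X" if "\<forall>N. \<exists>Y. supp1 Y \<and> (\<forall>i j. i < N \<longrightarrow> cf2 X i j = cf2 Y i j)" for X :: zwseries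
    using that unfolding supp1_def by (metis lessI)
qed (simp_all add: tau1_mult supp1_mult tau1_diff supp1_diff supp1_inverse)

lemma is_reflection_tau0: "is_reflection supp0 tau0"
proof (rule is_reflectionI[where \<rho> = "\<lambda>i j. if j \<le> 2 * i then Some (i, 2 * i - j) else None"])
  show "supp0 X" if "\<forall>N. \<exists>Y. supp0 Y \<and> (\<forall>i j. i < N \<longrightarrow> cf2 X i j = cf2 Y i j)" for X :: zwseries
    using that unfolding supp0_def supp1_def cf2_transp by (metis lessI)
  show "supp0 E" if "supp0 D" "cf2 D 0 0 = 1" "D * E = 1" for D E :: zwseries
    using supp1_inverse[of "transp D" "transp E"] that transp_mult[of D E] by (simp add: supp0_def)
  show "cf2 (tau0 X) i j = (case if j \<le> 2 * i then Some (i, 2 * i - j) else None of None \<Rightarrow> 0 | Some (k, l) \<Rightarrow> cf2 X k l)"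
    for X :: zwseries and i j by (simp add: cf2_tau0)
qed (simp_all add: supp0_def tau0_def transp_mult transp_diff tau1_mult supp1_mult tau1_diff supp1_diff)

subsection \<open>Infinite products\<close>

definition qpoch_fin :: "nat \<Rightarrow> zwseries \<Rightarrow> zwseries" where
  "qpoch_fin N x = (\<Prod>k<N. 1 - x * (ser_sqrt_q ^ 2) ^ k)"

text \<open>q^N is divisible by z^(2N), so the factor with index N changes only coefficients from
  z^(2N) on.\<close>

lemma qpoch_fin_nth:
  assumes "i < N" "i < M"
  shows "fps_nth (qpoch_fin N x) i = fps_nth (qpoch_fin M x) i"
proof -
  have step: "fps_nth (qpoch_fin (Suc N) x) i = fps_nth (qpoch_fin N x) i" if "i < N" for N
  proof -
    have "(ser_sqrt_q ^ 2) ^ N = fps_X ^ (2 * N) * (ser_w ^ 2) ^ N"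
      by (simp only: ser_sqrt_q_def ser_z_def power_mult_distrib power_mult)
    then have "qpoch_fin (Suc N) x = qpoch_fin N x - fps_X ^ (2 * N) * (qpoch_fin N x * x * (ser_w ^ 2) ^ N)"
      by (simp only: qpoch_fin_def prod.lessThan_Suc right_diff_distrib mult_1_right mult_1_left ac_simps)
    then show ?thesis using that by (simp add: fps_X_power_mult_nth)
  qed
  have "fps_nth (qpoch_fin (Suc i + m) x) i = fps_nth (qpoch_fin (Suc i) x) i" for m
    by (induction m) (simp_all add: step)
  from this[of "N - Suc i"] this[of "M - Suc i"] assms show ?thesis by simp
qed

lemma qpoch_fin_00:
  assumes "cf2 x 0 0 = 0" shows "cf2 (qpoch_fin N x) 0 0 = 1"
  using assms by (induction N) (simp_all add: qpoch_fin_def)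

lemma qpoch_inf_nth:
  assumes "cf2 x 0 0 = 0" "i < N"
  shows "fps_nth (qpoch_inf x) i = fps_nth (qpoch_fin N x) i"
proof -
  define p where "p = Abs_fps (\<lambda>i. fps_nth (qpoch_fin (Suc i) x) i)"
  have "(\<lambda>n. \<Prod>k\<le>n. 1 - x * (ser_sqrt_q ^ 2) ^ k) \<longlonglongrightarrow> p"
  proof (rule tendsto_fpsI)
    fix i
    show "\<forall>\<^sub>F n in sequentially. fps_nth (\<Prod>k\<le>n. 1 - x * (ser_sqrt_q ^ 2) ^ k) i = fps_nth p i"
      using eventually_ge_at_top[of i]
    proof eventually_elim
      case (elim n)
      have "(\<Prod>k\<le>n. 1 - x * (ser_sqrt_q ^ 2) ^ k) = qpoch_fin (Suc n) x"
        by (simp add: qpoch_fin_def lessThan_Suc_atMost)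
      then show ?case using qpoch_fin_nth[of i "Suc n" "Suc i" x] elim by (simp add: p_def)
    qed
  qed
  \<comment> \<open>Convergence of an infinite product includes that its limit is nonzero; the
    constant term shows it.\<close>
  moreover have "cf2 p 0 0 = 1" using qpoch_fin_00[OF assms(1)] by (simp add: p_def)
  then have "p \<noteq> 0" by auto
  ultimately have "(\<lambda>k. 1 - x * (ser_sqrt_q ^ 2) ^ k) has_prod p"
    by (simp add: has_prod_def raw_has_prod_def)
  then have "qpoch_inf x = p" unfolding qpoch_inf_def by (rule has_prod_unique[symmetric])
  then show ?thesis using qpoch_fin_nth[of i "Suc i" N x] assms(2) by (simp add: p_def)
qed

lemma qpoch_inf_00: "cf2 x 0 0 = 0 \<Longrightarrow> cf2 (qpoch_inf x) 0 0 = 1"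
  using qpoch_inf_nth[of x 0 1] qpoch_fin_00[of x 1] by simp

lemma qpoch_inf_rec:
  assumes "cf2 x 0 0 = 0"
  shows "qpoch_inf x = (1 - x) * qpoch_inf (x * ser_sqrt_q ^ 2)"
proof (rule fps_ext)
  fix n
  have q0: "cf2 (x * ser_sqrt_q ^ 2) 0 0 = 0" using assms by simp
  have "fps_nth (qpoch_inf x) n = fps_nth (qpoch_fin (Suc (Suc n)) x) n"
    using qpoch_inf_nth[OF assms] by simp
  also have "qpoch_fin (Suc (Suc n)) x = (1 - x) * qpoch_fin (Suc n) (x * ser_sqrt_q ^ 2)"
    unfolding qpoch_fin_def by (subst prod.lessThan_Suc_shift) (simp add: algebra_simps)
  also have "fps_nth \<dots> n = fps_nth ((1 - x) * qpoch_inf (x * ser_sqrt_q ^ 2)) n"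
    using qpoch_inf_nth[OF q0, of _ "Suc n"] by (simp add: fps_mult_nth)
  finally show "fps_nth (qpoch_inf x) n = fps_nth ((1 - x) * qpoch_inf (x * ser_sqrt_q ^ 2)) n" .
qed

text \<open>A reflection takes each coefficient of its value from at most one coefficient of its
  argument, so it can be computed on a sufficiently long finite product.\<close>

lemma reflection_qpoch_inf:
  assumes R: "is_reflection P \<tau>" and x: "P x" "\<tau> x = y" "cf2 x 0 0 = 0" "cf2 y 0 0 = 0"
    and q: "P (ser_sqrt_q ^ 2)" "\<tau> (ser_sqrt_q ^ 2) = ser_sqrt_q ^ 2"
  shows "P (qpoch_inf x)" "\<tau> (qpoch_inf x) = qpoch_inf y"
proof -
  from R have 1: "P 1" "\<tau> 1 = 1"
    and h: "\<And>X Y. P X \<Longrightarrow> P Y \<Longrightarrow> P (X * Y)" "\<And>X Y. P X \<Longrightarrow> P Y \<Longrightarrow> \<tau> (X * Y) = \<tau> X * \<tau> Y"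
      "\<And>X Y. P X \<Longrightarrow> P Y \<Longrightarrow> P (X - Y)" "\<And>X Y. P X \<Longrightarrow> P Y \<Longrightarrow> \<tau> (X - Y) = \<tau> X - \<tau> Y"
    and cl: "\<And>X. (\<And>N. \<exists>Y. P Y \<and> (\<forall>i j. i < N \<longrightarrow> cf2 X i j = cf2 Y i j)) \<Longrightarrow> P X"
    unfolding is_reflection_def by blast+
  obtain \<rho> where \<rho>: "\<And>X i j. cf2 (\<tau> X) i j = (case \<rho> i j of None \<Rightarrow> 0 | Some (k, l) \<Rightarrow> cf2 X k l)"
    using R unfolding is_reflection_def by blast
  have pw: "P ((ser_sqrt_q ^ 2) ^ k) \<and> \<tau> ((ser_sqrt_q ^ 2) ^ k) = (ser_sqrt_q ^ 2) ^ k" for k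
    by (induction k) (simp_all add: 1 h q)
  have fin: "P (qpoch_fin N x) \<and> \<tau> (qpoch_fin N x) = qpoch_fin N y" for N
    by (induction N) (simp_all add: qpoch_fin_def 1 h pw x)
  show "P (qpoch_inf x)"
    using fin qpoch_inf_nth[OF x(3)] by (intro cl) metis
  show "\<tau> (qpoch_inf x) = qpoch_inf y"
  proof (rule fps_fps_eqI)
    fix i j
    show "cf2 (\<tau> (qpoch_inf x)) i j = cf2 (qpoch_inf y) i j"
    proof (cases "\<rho> i j")
      case None
      then have "cf2 (\<tau> (qpoch_fin (Suc i) x)) i j = 0" by (simp add: \<rho>)
      then show ?thesis using None fin qpoch_inf_nth[OF x(4), of i "Suc i"] by (simp add: \<rho>)
    next
      case (Some kl)
      obtain k l where kl: "kl = (k, l)" by (cases kl)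
      let ?N = "Suc (max i k)"
      have "cf2 (\<tau> (qpoch_inf x)) i j = cf2 (\<tau> (qpoch_fin ?N x)) i j"
        using Some kl qpoch_inf_nth[OF x(3), of k ?N] by (simp add: \<rho>)
      then show ?thesis using fin qpoch_inf_nth[OF x(4), of i ?N] by simp
    qed
  qed
qed

section \<open>Monomials in z and w, and the symmetric factors of the weight\<close>

definition mono2 :: "F \<Rightarrow> nat \<Rightarrow> nat \<Rightarrow> zwseries" where
  "mono2 c i j = Abs_fps (\<lambda>k. Abs_fps (\<lambda>l. if k = i \<and> l = j then c else 0))"

lemma cf2_mono2 [simp]: "cf2 (mono2 c i j) k l = (if k = i \<and> l = j then c else 0)"
  by (simp add: mono2_def)

lemma mono2_mult: "mono2 c i j * mono2 d k l = mono2 (c * d) (i + k) (j + l)"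
proof (rule fps_fps_eqI)
  fix m n
  have "cf2 (mono2 c i j * mono2 d k l) m n =
    (\<Sum>a\<le>m. \<Sum>b\<le>n. if a = i \<and> b = j then (if m - i = k \<and> n - j = l then c * d else 0) else 0)"
    unfolding fps_fps_mult_nth by (intro sum.cong) auto
  also have "\<dots> = (\<Sum>a\<le>m. if a = i then (if j \<le> n \<and> m - i = k \<and> n - j = l then c * d else 0) else 0)"
    by (intro sum.cong) (auto simp: sum.delta)
  also have "\<dots> = cf2 (mono2 (c * d) (i + k) (j + l)) m n" by (auto simp: sum.delta)
  finally show "cf2 (mono2 c i j * mono2 d k l) m n = cf2 (mono2 (c * d) (i + k) (j + l)) m n" .
qed

lemma ser_mono2: "ser_z = mono2 1 1 0" "ser_w = mono2 1 0 1" "ser_cst r = mono2 r 0 0" "ser_sqrt_q = mono2 1 1 1"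
proof -
  show *: "ser_z = mono2 1 1 0" "ser_w = mono2 1 0 1" "ser_cst r = mono2 r 0 0"
    by (rule fps_fps_eqI; simp add: ser_z_def ser_w_def ser_cst_def fps_X_def)+
  show "ser_sqrt_q = mono2 1 1 1" by (simp add: ser_sqrt_q_def * mono2_mult)
qed

lemma ser_q: "ser_sqrt_q ^ 2 = mono2 1 2 2"
  by (simp add: ser_mono2 power2_eq_square mono2_mult numeral_2_eq_2)

lemma tau1_mono2: "i \<le> 2 * j \<Longrightarrow> supp1 (mono2 c i j) \<and> tau1 (mono2 c i j) = mono2 c (2 * j - i) j"
  by (auto simp: supp1_def intro!: fps_fps_eqI)

lemma tau0_mono2: "j \<le> 2 * i \<Longrightarrow> supp0 (mono2 c i j) \<and> tau0 (mono2 c i j) = mono2 c i (2 * i - j)"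
  by (auto simp: supp0_def supp1_def cf2_tau0 intro!: fps_fps_eqI)

lemma fps_fps_inverse:
  assumes "cf2 D 0 0 = (1::F)"
  shows "D * inverse D = 1"
proof -
  have "fps_nth D 0 * inverse (fps_nth D 0) = 1" using assms by (intro inverse_mult_eq_1') simp
  then have "D * fps_right_inverse D (inverse (fps_nth D 0)) = 1" by (rule fps_right_inverse)
  then show ?thesis by (simp add: fps_inverse_def)
qed

lemma reflection_quotient:
  assumes R: "is_reflection P \<tau>" and N: "P N" "\<tau> N = N" and D: "P D" "\<tau> D = D" "cf2 D 0 0 = 1"
  shows "P (N * inverse D)" "\<tau> (N * inverse D) = N * inverse D"
proof -
  from R have 1: "\<tau> 1 = 1"
    and h: "\<And>X Y. P X \<Longrightarrow> P Y \<Longrightarrow> P (X * Y)" "\<And>X Y. P X \<Longrightarrow> P Y \<Longrightarrow> \<tau> (X * Y) = \<tau> X * \<tau> Y"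
    and i: "\<And>D E. P D \<Longrightarrow> cf2 D 0 0 = 1 \<Longrightarrow> D * E = 1 \<Longrightarrow> P E"
    unfolding is_reflection_def by blast+
  note inv = fps_fps_inverse[OF D(3)]
  have E: "P (inverse D)" using i D inv by blast
  have "D * \<tau> (inverse D) = 1" using h(2)[OF D(1) E] inv 1 D(2) by simp
  then have "D * \<tau> (inverse D) = D * inverse D" using inv by simp
  moreover have "D \<noteq> 0" using D(3) by auto
  ultimately have "\<tau> (inverse D) = inverse D" by simp
  then show "P (N * inverse D)" "\<tau> (N * inverse D) = N * inverse D"
    using h N E by simp_all
qed

text \<open>Since q^(1/2) = zw, the exponents (1,0), (3,2), (1,2) stand for z, qz, q/z. Together
  with c = c' q^(1/2), the exponents (2,1), (0,1), (2,3) at the coefficient c' stand for cz, c/z,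
  cq/z.\<close>

abbreviation "QP c i j \<equiv> qpoch_inf (mono2 c i j)"

lemma Delta_zw_eq:
  "Delta_zw = QP 1 2 0 * QP 1 0 2 *
     inverse (QP F_a 1 0 * QP F_b 1 0 * QP F_c' 2 1 * QP F_d' 2 1 * QP F_a 1 2 * QP F_b 1 2 * QP F_c' 0 1 * QP F_d' 0 1)"
  by (simp add: Delta_zw_def ser_mono2 mono2_mult power2_eq_square numeral_2_eq_2)

lemma QP_00: "i + j > 0 \<Longrightarrow> cf2 (QP c i j) 0 0 = 1"
  by (rule qpoch_inf_00) auto

lemma QP_rec: "i + j > 0 \<Longrightarrow> QP c i j = (1 - mono2 c i j) * QP c (i + 2) (j + 2)"
  using qpoch_inf_rec[of "mono2 c i j"] by (auto simp: ser_q mono2_mult)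

lemma QP_tau1: "i \<le> 2 * j \<Longrightarrow> 0 < j \<Longrightarrow> supp1 (QP c i j) \<and> tau1 (QP c i j) = QP c (2 * j - i) j"
  using reflection_qpoch_inf[OF is_reflection_tau1, of "mono2 c i j"] tau1_mono2[of i j c] tau1_mono2[of 2 2 1]
  by (auto simp: ser_q)

lemma QP_tau0: "j \<le> 2 * i \<Longrightarrow> 0 < i \<Longrightarrow> supp0 (QP c i j) \<and> tau0 (QP c i j) = QP c i (2 * i - j)"
  using reflection_qpoch_inf[OF is_reflection_tau0, of "mono2 c i j"] tau0_mono2[of j i c] tau0_mono2[of 2 2 1]
  by (auto simp: ser_q)

text \<open>(qz^2, q/z^2) over (aqz, bqz, cz, dz, aq/z, bq/z, c/z, d/z), visibly invariant under z
  -> 1/z.\<close>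

definition Sym1 :: zwseries where
  "Sym1 = (QP 1 4 2 * QP 1 0 2) *
     inverse (QP F_a 3 2 * QP F_b 3 2 * QP F_c' 2 1 * QP F_d' 2 1 * QP F_a 1 2 * QP F_b 1 2 * QP F_c' 0 1 * QP F_d' 0 1)"

text \<open>(z^2, q^2/z^2) over (az, bz, cz, dz, aq/z, bq/z, cq/z, dq/z), visibly invariant under z
  -> q/z.\<close>

definition Sym0 :: zwseries where
  "Sym0 = (QP 1 2 0 * QP 1 2 4) *
     inverse (QP F_a 1 0 * QP F_b 1 0 * QP F_c' 2 1 * QP F_d' 2 1 * QP F_a 1 2 * QP F_b 1 2 * QP F_c' 2 3 * QP F_d' 2 3)"

lemma Sym1_sym: "supp1 Sym1" "tau1 Sym1 = Sym1"
proof -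
  note m = supp1_mult tau1_mult
  have "supp1 (QP 1 4 2 * QP 1 0 2)" "tau1 (QP 1 4 2 * QP 1 0 2) = QP 1 4 2 * QP 1 0 2"
    by (simp_all add: m QP_tau1)
  moreover have "supp1 (QP F_a 3 2 * QP F_b 3 2 * QP F_c' 2 1 * QP F_d' 2 1 * QP F_a 1 2 * QP F_b 1 2 * QP F_c' 0 1 * QP F_d' 0 1)"
    "tau1 (QP F_a 3 2 * QP F_b 3 2 * QP F_c' 2 1 * QP F_d' 2 1 * QP F_a 1 2 * QP F_b 1 2 * QP F_c' 0 1 * QP F_d' 0 1)
      = QP F_a 3 2 * QP F_b 3 2 * QP F_c' 2 1 * QP F_d' 2 1 * QP F_a 1 2 * QP F_b 1 2 * QP F_c' 0 1 * QP F_d' 0 1"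
    by (simp_all add: m QP_tau1 mult.commute mult.left_commute)
  moreover have "cf2 (QP F_a 3 2 * QP F_b 3 2 * QP F_c' 2 1 * QP F_d' 2 1 * QP F_a 1 2 * QP F_b 1 2 * QP F_c' 0 1 * QP F_d' 0 1) 0 0 = 1"
    by (simp add: QP_00)
  ultimately show "supp1 Sym1" "tau1 Sym1 = Sym1"
    unfolding Sym1_def by (rule reflection_quotient[OF is_reflection_tau1]; assumption)+
qed

lemma Sym0_sym: "supp0 Sym0" "tau0 Sym0 = Sym0"
proof -
  have m: "supp0 X \<Longrightarrow> supp0 Y \<Longrightarrow> supp0 (X * Y) \<and> tau0 (X * Y) = tau0 X * tau0 Y" for X Y :: zwseries
    by (simp add: supp0_def tau0_def transp_mult tau1_mult supp1_mult)
  have "supp0 (QP 1 2 0 * QP 1 2 4)" "tau0 (QP 1 2 0 * QP 1 2 4) = QP 1 2 0 * QP 1 2 4"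
    by (simp_all add: m QP_tau0)
  moreover have "supp0 (QP F_a 1 0 * QP F_b 1 0 * QP F_c' 2 1 * QP F_d' 2 1 * QP F_a 1 2 * QP F_b 1 2 * QP F_c' 2 3 * QP F_d' 2 3)"
    "tau0 (QP F_a 1 0 * QP F_b 1 0 * QP F_c' 2 1 * QP F_d' 2 1 * QP F_a 1 2 * QP F_b 1 2 * QP F_c' 2 3 * QP F_d' 2 3)
      = QP F_a 1 0 * QP F_b 1 0 * QP F_c' 2 1 * QP F_d' 2 1 * QP F_a 1 2 * QP F_b 1 2 * QP F_c' 2 3 * QP F_d' 2 3"
    by (simp_all add: m QP_tau0 mult.commute mult.left_commute)
  moreover have "cf2 (QP F_a 1 0 * QP F_b 1 0 * QP F_c' 2 1 * QP F_d' 2 1 * QP F_a 1 2 * QP F_b 1 2 * QP F_c' 2 3 * QP F_d' 2 3) 0 0 = 1"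
    by (simp add: QP_00)
  ultimately show "supp0 Sym0" "tau0 Sym0 = Sym0"
    unfolding Sym0_def by (rule reflection_quotient[OF is_reflection_tau0]; assumption)+
qed

lemma quotient_eq:
  assumes "cf2 D 0 0 = 1" "cf2 X 0 0 = 1" "cf2 D' 0 0 = (1::F)" "D = X * D'" "N = Y * N'"
  shows "(N * inverse D) * X = Y * (N' * inverse D')"
proof -
  have "((N * inverse D) * X) * D' = N * (D * inverse D)" by (simp add: assms(4) ac_simps)
  also have "\<dots> = (Y * (N' * inverse D')) * D'"
    using fps_fps_inverse[OF assms(1)] fps_fps_inverse[OF assms(3)] by (simp add: assms(5) ac_simps)
  finally show ?thesis using assms(3) by auto
qed

lemma Delta_Sym1: "Delta_zw * ((1 - mono2 F_a 1 0) * (1 - mono2 F_b 1 0)) = (1 - mono2 1 2 0) * Sym1"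
proof -
  have r: "QP F_a 1 0 = (1 - mono2 F_a 1 0) * QP F_a 3 2" "QP F_b 1 0 = (1 - mono2 F_b 1 0) * QP F_b 3 2"
    "QP 1 2 0 = (1 - mono2 1 2 0) * QP 1 4 2"
    using QP_rec[of 1 0 F_a] QP_rec[of 1 0 F_b] QP_rec[of 2 0 1] by (simp_all add: numeral_eq_Suc)
  show ?thesis unfolding Delta_zw_eq Sym1_def
    by (rule quotient_eq; (simp add: QP_00; fail)?) (simp_all only: r ac_simps)
qed

lemma Delta_Sym0: "Delta_zw * ((1 - mono2 F_c' 0 1) * (1 - mono2 F_d' 0 1)) = (1 - mono2 1 0 2) * Sym0"
proof -
  have r: "QP F_c' 0 1 = (1 - mono2 F_c' 0 1) * QP F_c' 2 3" "QP F_d' 0 1 = (1 - mono2 F_d' 0 1) * QP F_d' 2 3"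
    "QP 1 0 2 = (1 - mono2 1 0 2) * QP 1 2 4"
    using QP_rec[of 0 1 F_c'] QP_rec[of 0 1 F_d'] QP_rec[of 0 2 1] by (simp_all add: numeral_eq_Suc)
  show ?thesis unfolding Delta_zw_eq Sym0_def
    by (rule quotient_eq; (simp add: QP_00; fail)?) (simp_all only: r ac_simps)
qed

subsection \<open>Coefficients of powers of \<open>z\<close>\<close>

definition zcoeff :: "zwseries \<Rightarrow> int \<Rightarrow> F fps" where
  "zcoeff X n = Abs_fps (\<lambda>j. if n + int j \<ge> 0 then cf2 X (nat (n + int j)) j else 0)"

lemma Delta_eq_zcoeff: "Delta n = fps_to_fls (zcoeff Delta_zw n)"
  by (simp add: Delta_def zcoeff_def)

lemma zcoeff_linear: "zcoeff (X - Y) n = zcoeff X n - zcoeff Y n" "zcoeff (X + Y) n = zcoeff X n + zcoeff Y n"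
  by (rule fps_ext, simp add: zcoeff_def)+

lemma cf2_mono2_mult: "cf2 (mono2 c i j * X) k l = (if i \<le> k \<and> j \<le> l then c * cf2 X (k - i) (l - j) else 0)"
proof -
  have "cf2 (mono2 c i j * X) k l = (\<Sum>a\<le>k. \<Sum>b\<le>l. if a = i then (if b = j then c * cf2 X (k - i) (l - j) else 0) else 0)"
    unfolding fps_fps_mult_nth by (intro sum.cong) auto
  also have "\<dots> = (\<Sum>a\<le>k. if a = i then (if j \<le> l then c * cf2 X (k - i) (l - j) else 0) else 0)"
    by (intro sum.cong) (auto simp: sum.delta)
  also have "\<dots> = (if i \<le> k \<and> j \<le> l then c * cf2 X (k - i) (l - j) else 0)" by (simp add: sum.delta)
  finally show ?thesis .
qed

lemma zcoeff_mono2_mult: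
  "zcoeff (mono2 c i j * X) n = fps_const c * (fps_X ^ j * zcoeff X (n - int i + int j))"
proof (rule fps_ext)
  fix l
  have "nat (n - int i + int j + int (l - j)) = nat (n + int l) - i" if "j \<le> l" "int i \<le> n + int l"
    using that by auto
  then show "fps_nth (zcoeff (mono2 c i j * X) n) l = fps_nth (fps_const c * (fps_X ^ j * zcoeff X (n - int i + int j))) l"
    by (auto simp: zcoeff_def fps_X_power_mult_nth cf2_mono2_mult)
qed

lemma zcoeff_Sym1: "zcoeff Sym1 (- n) = zcoeff Sym1 n"
proof -
  have *: "fps_nth (zcoeff Sym1 (- n)) j = fps_nth (zcoeff Sym1 n) j" if "n \<ge> 0" for n j
  proof (cases "n \<le> int j")
    case True
    have "cf2 Sym1 (nat (n + int j)) j = cf2 (tau1 Sym1) (nat (n + int j)) j" by (simp add: Sym1_sym)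
    also have "\<dots> = cf2 Sym1 (2 * j - nat (n + int j)) j" using True that by simp
    also have "2 * j - nat (n + int j) = nat (- n + int j)" using True that by simp
    finally show ?thesis using True that by (simp add: zcoeff_def)
  next
    case False
    then have "cf2 Sym1 (nat (n + int j)) j = 0" using Sym1_sym(1) by (simp add: supp1_def)
    then show ?thesis using False that by (simp add: zcoeff_def)
  qed
  show ?thesis using *[of n] *[of "-n"] by (cases "n \<ge> 0") (auto intro!: fps_ext)
qed

text \<open>The reflection sends z^m to q^m z^(-m), and \<open>fps_X\<close> is q^(1/2).\<close>

lemma zcoeff_Sym0: "zcoeff Sym0 (- int m) = fps_X ^ (2 * m) * zcoeff Sym0 (int m)"
proof (rule fps_ext)
  fix j
  show "fps_nth (zcoeff Sym0 (- int m)) j = fps_nth (fps_X ^ (2 * m) * zcoeff Sym0 (int m)) j"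
  proof (cases "m \<le> j")
    case False then show ?thesis by (simp add: zcoeff_def fps_X_power_mult_nth)
  next
    case True
    then have n: "nat (- int m + int j) = j - m" by simp
    show ?thesis
    proof (cases "2 * m \<le> j")
      case True
      have "cf2 Sym0 (j - m) j = cf2 (tau0 Sym0) (j - m) j" by (simp add: Sym0_sym)
      also have "\<dots> = cf2 Sym0 (j - m) (2 * (j - m) - j)" using True by (simp add: cf2_tau0)
      also have "2 * (j - m) - j = j - 2 * m" by simp
      finally show ?thesis using True n by (simp add: zcoeff_def fps_X_power_mult_nth nat_diff_distrib')
    next
      case False
      then have "cf2 Sym0 (j - m) j = 0" using Sym0_sym(1) \<open>m \<le> j\<close> by (simp add: supp0_def supp1_def)
      then show ?thesis using False n True by (simp add: zcoeff_def fps_X_power_mult_nth)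
    qed
  qed
qed

lemma two_factor: "(X :: 'a::comm_ring_1) * ((1 - u) * (1 - v)) = X - u * X - v * X + (u * v) * X"
  "(1 - u) * X = X - u * X"
  by (simp_all add: algebra_simps)

text \<open>(1-az)(1-bz)\<Delta> is 1-z^2 times a symmetric series with coefficients S_n, so its
  coefficients S_n - S_(n-2) change sign under n -> 2-n. The relation adds those at 1-m and
  1+m.\<close>

lemma Delta_relation_1:
  "zcoeff Delta_zw (1 - m) - fps_const (F_a + F_b) * zcoeff Delta_zw (- m) + fps_const (F_a * F_b) * zcoeff Delta_zw (- 1 - m) +
   (zcoeff Delta_zw (1 + m) - fps_const (F_a + F_b) * zcoeff Delta_zw m + fps_const (F_a * F_b) * zcoeff Delta_zw (m - 1)) = 0"
proof -
  have U: "zcoeff Delta_zw n - fps_const (F_a + F_b) * zcoeff Delta_zw (n - 1) + fps_const (F_a * F_b) * zcoeff Delta_zw (n - 2)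
     = zcoeff Sym1 n - zcoeff Sym1 (n - 2)" for n
    using arg_cong[OF Delta_Sym1, of "\<lambda>X. zcoeff X n"]
    unfolding two_factor(1) two_factor(2)[of "mono2 1 2 0" Sym1] mono2_mult zcoeff_linear zcoeff_mono2_mult
    by (simp add: algebra_simps flip: fps_const_add)
  have "1 - m - 2 = - 1 - m" "1 + m - 2 = m - 1" "1 - m - 1 = - m" "1 + m - 1 = m" by simp_all
  moreover have "zcoeff Sym1 (m - 1) = zcoeff Sym1 (1 - m)" "zcoeff Sym1 (1 + m) = zcoeff Sym1 (- 1 - m)"
    using zcoeff_Sym1[of "1 - m"] zcoeff_Sym1[of "-1 - m"] by (simp_all add: add.commute)
  ultimately show ?thesis using U[of "1 - m"] U[of "1 + m"] by simp
qed

text \<open>Here the factor is 1 - q/z^2, the coefficients are S_n - q S_(n+2), and S_(-n) = q^n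
  S_n. Those at -m-1 and m-1 cancel once the latter is weighted with q^m.\<close>

lemma Delta_relation_0:
  "zcoeff Delta_zw (- int m - 1) - fps_const (F_c' + F_d') * (fps_X * zcoeff Delta_zw (- int m)) + fps_const (F_c' * F_d') * (fps_X ^ 2 * zcoeff Delta_zw (1 - int m)) +
   fps_X ^ (2 * m) * (zcoeff Delta_zw (int m - 1) - fps_const (F_c' + F_d') * (fps_X * zcoeff Delta_zw (int m)) + fps_const (F_c' * F_d') * (fps_X ^ 2 * zcoeff Delta_zw (int m + 1))) = 0"
proof -
  have U: "zcoeff Delta_zw n - fps_const (F_c' + F_d') * (fps_X * zcoeff Delta_zw (n + 1)) + fps_const (F_c' * F_d') * (fps_X ^ 2 * zcoeff Delta_zw (n + 2))
     = zcoeff Sym0 n - fps_X ^ 2 * zcoeff Sym0 (n + 2)" for n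
    using arg_cong[OF Delta_Sym0, of "\<lambda>X. zcoeff X n"]
    unfolding two_factor(1) two_factor(2)[of "mono2 1 0 2" Sym0] mono2_mult zcoeff_linear zcoeff_mono2_mult
    by (simp add: numeral_eq_Suc algebra_simps flip: fps_const_add)
  have A: "zcoeff Sym0 (- int m - 1) = fps_X ^ 2 * (fps_X ^ (2 * m) * zcoeff Sym0 (int m + 1))"
  proof -
    have "- int (m + 1) = - int m - 1" "int (m + 1) = int m + 1" "2 * (m + 1) = 2 + 2 * m" by simp_all
    then show ?thesis using zcoeff_Sym0[of "m + 1"] by (simp only: power_add mult.assoc)
  qed
  \<comment> \<open>For m = 0 the exponent 1 - m is positive, and the symmetry is read in the
    opposite direction.\<close>
  have B: "fps_X ^ 2 * zcoeff Sym0 (1 - int m) = fps_X ^ (2 * m) * zcoeff Sym0 (int m - 1)"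
  proof (cases m)
    case 0 then show ?thesis using zcoeff_Sym0[of 1] by simp
  next
    case (Suc k) then show ?thesis using zcoeff_Sym0[of k] by (simp add: power2_eq_square algebra_simps)
  qed
  have "- int m - 1 + 1 = - int m" "- int m - 1 + 2 = 1 - int m" "int m - 1 + 1 = int m" "int m - 1 + 2 = int m + 1"
    by simp_all
  then show ?thesis using U[of "- int m - 1"] U[of "int m - 1"] A B
    by (simp add: right_diff_distrib mult.left_commute add.commute[of 1 "int m"])
qed

lemma Delta_leading: "n < 0 \<Longrightarrow> fps_nth (zcoeff Delta_zw n) 0 = 0" "fps_nth (zcoeff Delta_zw 0) 0 = 1"
proof -
  show "n < 0 \<Longrightarrow> fps_nth (zcoeff Delta_zw n) 0 = 0" by (simp add: zcoeff_def)
  have "cf2 Delta_zw 0 0 = 1" by (simp add: Delta_zw_eq QP_00)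
  then show "fps_nth (zcoeff Delta_zw 0) 0 = 1" by (simp add: zcoeff_def)
qed

section \<open>Laurent polynomials\<close>

abbreviation lk :: "laurent \<Rightarrow> int \<Rightarrow> K" where "lk \<equiv> Poly_Mapping.lookup"

lemma laurent_induct [case_names monom add]:
  assumes "\<And>c n. P (cst c * zpow n)" "\<And>f g. P f \<Longrightarrow> P g \<Longrightarrow> P (f + g)"
  shows "P f"
proof (induction f rule: Poly_Mapping.update_induct)
  case const then show ?case using assms(1)[of 0 0] by (simp add: cst_def)
next
  case (update f a b)
  have "Poly_Mapping.update a b f = f + Poly_Mapping.single a b"
    using update(1) by (intro poly_mapping_eqI) (auto simp: lookup_update lookup_add lookup_single when_def in_keys_iff)
  moreover have "Poly_Mapping.single a b = cst b * zpow a" by (simp add: cst_def zpow_def mult_single)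
  ultimately show ?case using assms update by metis
qed

lemma cst_hom [simp]: "cst 0 = 0" "cst 1 = 1" "cst (x + y) = cst x + cst y" "cst (x * y) = cst x * cst y"
  "cst (- x) = - cst x" "cst (x - y) = cst x - cst y" "cst (x ^ n) = cst x ^ n"
proof -
  show 0: "cst 0 = 0" "cst 1 = 1" "cst (x + y) = cst x + cst y" and m: "\<And>x y. cst (x * y) = cst x * cst y"
    and u: "\<And>x. cst (- x) = - cst x"
    by (simp_all add: cst_def single_add mult_single Poly_Mapping.single_uminus)
  show "cst (x - y) = cst x - cst y" by (simp add: cst_def Poly_Mapping.single_diff)
  show "cst (x ^ n) = cst x ^ n" by (induction n) (simp_all add: 0 m)
qed

lemma cst_eq_iff [simp]: "cst x = cst y \<longleftrightarrow> x = y"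
  unfolding cst_def by (metis lookup_single_eq)

lemma cst_eq_0 [simp]: "cst x = 0 \<longleftrightarrow> x = 0"
  using cst_eq_iff[of x 0] by simp

lemma cst_inverse: "x \<noteq> 0 \<Longrightarrow> cst x * cst (inverse x) = 1"
  by (simp flip: cst_hom(4))

lemma zpow_0 [simp]: "zpow 0 = 1" and zpow_add: "zpow (m + n) = zpow m * zpow n"
  by (simp_all add: zpow_def mult_single)

lemma lk_zpow: "lk (zpow n) m = (if m = n then 1 else 0)"
  by (auto simp: zpow_def lookup_single when_def)

lemma lk_minus [simp]: "lk (- f) n = - lk f n" "lk (f - g) n = lk f n - lk g n"
  by (simp_all add: lookup_minus)

lemma lk_add [simp]: "lk (f + g) n = lk f n + lk g n"
  by (simp add: lookup_add)

lemma lk_cst_mult [simp]: "lk (cst c * f) n = c * lk f n"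
proof (induction f rule: laurent_induct)
  case (monom d m)
  have "cst c * (cst d * zpow m) = Poly_Mapping.single m (c * d)" "cst d * zpow m = Poly_Mapping.single m d"
    by (simp_all add: cst_def zpow_def mult_single)
  then show ?case by (simp add: lookup_single when_def)
qed (simp add: distrib_left)

lemma lk_zpow_mult [simp]: "lk (zpow m * f) n = lk f (n - m)"
proof (induction f rule: laurent_induct)
  case (monom d k)
  have "zpow m * (cst d * zpow k) = Poly_Mapping.single (m + k) d" "cst d * zpow k = Poly_Mapping.single k d"
    by (simp_all add: cst_def zpow_def mult_single)
  then show ?case by (auto simp: lookup_single when_def)
qed (simp add: distrib_left)

lemma lk_cst: "lk (cst c) n = (if n = 0 then c else 0)"
  by (auto simp: cst_def lookup_single when_def)

lemma lk_one: "lk 1 n = (if n = 0 then 1 else 0)"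
  using lk_cst[of 1] by simp

lemma lk_zinv [simp]: "lk (zinv f) n = lk f (- n)"
proof -
  interpret inj_f: "Groups.uminus" "uminus :: int \<Rightarrow> int" .
  show ?thesis by (simp add: zinv_def map_key.rep_eq)
qed

lemma lk_T_pow [simp]: "lk (T_pow e f) n = sqrt_q powi (e * n) * lk f n"
  by (simp add: T_pow_def lookup_mapp when_def in_keys_iff qpow_def flip: of_int_mult)

lemma zinv_add [simp]: "zinv (f + g) = zinv f + zinv g" "zinv (f - g) = zinv f - zinv g" "zinv (- f) = - zinv f"
  by (rule poly_mapping_eqI, simp)+

lemma T_pow_add [simp]: "T_pow e (f + g) = T_pow e f + T_pow e g" "T_pow e (f - g) = T_pow e f - T_pow e g"
  "T_pow e (- f) = - T_pow e f"
  by (rule poly_mapping_eqI, simp add: algebra_simps)+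

lemma zinv_monom: "zinv (cst c * zpow n) = cst c * zpow (- n)"
  by (rule poly_mapping_eqI) (auto simp: lk_zpow)

lemma T_pow_monom: "T_pow e (cst c * zpow n) = cst (sqrt_q powi (e * n)) * (cst c * zpow n)"
  by (rule poly_mapping_eqI) (auto simp: lk_zpow)

lemma monom_mult: "(cst c * zpow m) * (cst d * zpow n) = cst (c * d) * zpow (m + n)"
  by (simp add: zpow_add ac_simps)

lemma zinv_mult [simp]: "zinv (f * g) = zinv f * zinv g"
proof (induction f rule: laurent_induct)
  case (monom c m)
  show ?case
  proof (induction g rule: laurent_induct)
    case (monom d n)
    show ?case by (simp only: monom_mult zinv_monom) (simp add: zpow_add ac_simps)
  qed (simp add: distrib_left)
qed (simp add: distrib_right)

lemma T_pow_mult [simp]: "T_pow e (f * g) = T_pow e f * T_pow e g"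
proof (induction f rule: laurent_induct)
  case (monom c m)
  show ?case
  proof (induction g rule: laurent_induct)
    case (monom d n)
    show ?case by (simp only: monom_mult T_pow_monom) (simp add: zpow_add power_int_add algebra_simps)
  qed (simp add: distrib_left)
qed (simp add: distrib_right)

lemma zinv_cst [simp]: "zinv (cst c) = cst c" and T_pow_cst [simp]: "T_pow e (cst c) = cst c"
  and zinv_zpow [simp]: "zinv (zpow n) = zpow (- n)" and T_pow_zpow: "T_pow e (zpow n) = cst (sqrt_q powi (e * n)) * zpow n"
  by (rule poly_mapping_eqI, auto simp: lk_cst lk_zpow)+

lemma zinv_0 [simp]: "zinv 0 = 0" "zinv 1 = 1" and T_pow_0 [simp]: "T_pow e 0 = 0" "T_pow e 1 = 1"
  using zinv_cst[of 0] zinv_cst[of 1] T_pow_cst[of e 0] T_pow_cst[of e 1] by simp_all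

lemma zinv_zinv [simp]: "zinv (zinv f) = f"
  by (rule poly_mapping_eqI) simp

lemma T_pow_zinv: "zinv (T_pow e f) = T_pow (- e) (zinv f)"
  by (rule poly_mapping_eqI) simp

lemma T_pow_T_pow: "T_pow d (T_pow e f) = T_pow (d + e) f"
  by (rule poly_mapping_eqI) (simp add: distrib_right power_int_add)

lemma T_pow_zero [simp]: "T_pow 0 f = f"
  by (rule poly_mapping_eqI) simp

lemma keys_lk: "n \<in> Poly_Mapping.keys f \<longleftrightarrow> lk f n \<noteq> 0"
  by (simp add: in_keys_iff)

section \<open>Moment functionals\<close>

definition ell :: "(int \<Rightarrow> K) \<Rightarrow> laurent \<Rightarrow> K" where
  "ell y f = (\<Sum>n\<in>Poly_Mapping.keys f. lk f n * y n)"

lemma ell_eq_sum: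
  assumes "finite S" "\<And>n. lk f n \<noteq> 0 \<Longrightarrow> n \<in> S"
  shows "ell y f = (\<Sum>n\<in>S. lk f n * y n)"
  unfolding ell_def by (rule sum.mono_neutral_left) (use assms in \<open>auto simp: in_keys_iff\<close>)

lemma ell_add [simp]: "ell y (f + g) = ell y f + ell y g"
proof -
  let ?S = "Poly_Mapping.keys f \<union> Poly_Mapping.keys g"
  have "ell y f = (\<Sum>n\<in>?S. lk f n * y n)" "ell y g = (\<Sum>n\<in>?S. lk g n * y n)" "ell y (f + g) = (\<Sum>n\<in>?S. lk (f + g) n * y n)"
    by (rule ell_eq_sum; auto simp: in_keys_iff)+
  then show ?thesis by (simp add: sum.distrib distrib_right)
qed

lemma ell_cst_mult [simp]: "ell y (cst c * f) = c * ell y f"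
proof -
  have "ell y (cst c * f) = (\<Sum>n\<in>Poly_Mapping.keys f. lk (cst c * f) n * y n)"
    by (rule ell_eq_sum) (auto simp: in_keys_iff)
  then show ?thesis by (simp add: ell_def sum_distrib_left mult.assoc)
qed

lemma ell_uminus [simp]: "ell y (- f) = - ell y f"
  using ell_cst_mult[of y "-1" f] by simp

lemma ell_diff [simp]: "ell y (f - g) = ell y f - ell y g"
  using ell_add[of y f "- g"] by simp

lemma ell_zpow [simp]: "ell y (zpow n) = y n"
  by (subst ell_eq_sum[of "{n}"]) (auto simp: lk_zpow split: if_splits)

lemma ell_0 [simp]: "ell y 0 = 0" and ell_1 [simp]: "ell y 1 = y 0"
  using ell_cst_mult[of y 0 0] ell_zpow[of y 0] by simp_all

section \<open>Orthogonality in the order of monomials\<close>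

definition below :: "nat \<Rightarrow> laurent \<Rightarrow> bool" where
  "below r f \<longleftrightarrow> (\<forall>n. lk f n \<noteq> 0 \<longrightarrow> mono_rank n < int r)"

text \<open>The involution inverts z, so pairing with z^m means multiplying by z^(-m).\<close>

definition orth_below :: "(int \<Rightarrow> K) \<Rightarrow> nat \<Rightarrow> laurent \<Rightarrow> bool" where
  "orth_below y r f \<longleftrightarrow> (\<forall>m. mono_rank m < int r \<longrightarrow> ell y (f * zpow (- m)) = 0)"

text \<open>\<open>y n\<close> stands for \<open>ct(z\<^sup>n\<Delta>)\<close> up to a common factor. The two families of relations come from the symmetries of
  \<open>\<Delta>\<close> under \<open>z \<mapsto> z\<inverse>\<close> and \<open>z \<mapsto> qz\<inverse>\<close>, after the factors \<open>(1-az)(1-bz)\<close> and \<open>(1-cz\<inverse>)(1-dz\<inverse>)\<close> are removed.\<close>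

definition moment_rel :: "K \<Rightarrow> K \<Rightarrow> K \<Rightarrow> K \<Rightarrow> (int \<Rightarrow> K) \<Rightarrow> bool" where
  "moment_rel a b c d y \<longleftrightarrow> y 0 \<noteq> 0 \<and>
    (\<forall>m. y (m - 1) - (a + b) * y m + a * b * y (m + 1) + (y (- m - 1) - (a + b) * y (- m) + a * b * y (1 - m)) = 0) \<and>
    (\<forall>m::nat. y (int m + 1) - (c + d) * y (int m) + c * d * y (int m - 1) +
        (sqrt_q ^ 2) ^ m * (y (1 - int m) - (c + d) * y (- int m) + c * d * y (- int m - 1)) = 0)"

text \<open>Equivalently, all leading principal minors of the Gram matrix in the order of monomials
  are nonzero.\<close>

definition nondeg :: "(int \<Rightarrow> K) \<Rightarrow> bool" where
  "nondeg y \<longleftrightarrow> (\<forall>r f. below r f \<longrightarrow> orth_below y r f \<longrightarrow> f = 0)"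

lemma mono_rank_inj: "mono_rank m = mono_rank n \<longleftrightarrow> m = n"
  unfolding mono_rank_def by (auto split: if_splits; presburger)

lemma mono_rank_nonneg: "0 \<le> mono_rank n"
  by (simp add: mono_rank_def)

lemma mono_rank_surj: "\<exists>n. mono_rank n = int r"
proof (cases "even r")
  case True then show ?thesis by (intro exI[of _ "- (int r div 2)"]) (auto simp: mono_rank_def elim!: evenE)
next
  case False then show ?thesis by (intro exI[of _ "(int r + 1) div 2"]) (auto simp: mono_rank_def elim!: oddE)
qed

lemma finite_below: "finite {n. mono_rank n < int r}"
proof (rule finite_subset)
  show "{n. mono_rank n < int r} \<subseteq> {- int r..int r}" by (auto simp: mono_rank_def split: if_splits)
qed simp

lemma orth_below_diff: "orth_below y r f \<Longrightarrow> orth_below y r g \<Longrightarrow> orth_below y r (f - g)"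
  by (simp add: orth_below_def left_diff_distrib)

lemma orth_below_cst: "orth_below y r f \<Longrightarrow> orth_below y r (cst c * f)"
  by (simp add: orth_below_def mult.assoc)

lemma below_diff: "below r f \<Longrightarrow> below r g \<Longrightarrow> below r (f - g)"
  and below_add: "below r f \<Longrightarrow> below r g \<Longrightarrow> below r (f + g)"
  and below_cst: "below r f \<Longrightarrow> below r (cst c * f)"
  unfolding below_def by (auto, metis diff_zero minus_diff_eq add.right_neutral neg_0_equal_iff_equal, metis add.right_neutral)

text \<open>Gram-Schmidt for a pairing that need not be symmetric: orthogonality is demanded on one
  side only, and correcting by a multiple of \<open>E\<close> keeps the conditions already reached
  because \<open>E\<close> itself satisfies them.\<close>

lemma orthogonal_projection:
  assumes "nondeg y"
  shows "\<exists>h. below r h \<and> orth_below y r (g - h)"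
proof (induction r arbitrary: g)
  case 0
  show ?case by (rule exI[of _ 0]) (simp add: below_def orth_below_def mono_rank_nonneg leD)
next
  case (Suc r)
  obtain n where n: "mono_rank n = int r" using mono_rank_surj by blast
  have lt: "mono_rank m < int (Suc r) \<longleftrightarrow> m = n \<or> mono_rank m < int r" for m
    using n mono_rank_inj[of m n] by auto
  obtain h0 where h0: "below r h0" "orth_below y r (zpow n - h0)" using Suc by blast
  define E where "E = zpow n - h0"
  have bE: "below (Suc r) E" using h0(1) n unfolding E_def below_def by (auto simp: lk_zpow split: if_splits)
  have "lk h0 n = 0" using h0(1) n by (auto simp: below_def)
  then have "lk E n = 1" by (simp add: E_def lk_zpow)
  then have "E \<noteq> 0" by auto
  define \<nu> where "\<nu> = ell y (E * zpow (- n))"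
  \<comment> \<open>Otherwise \<open>E\<close> would be nonzero, supported on the first r+1
    monomials and orthogonal to all of them.\<close>
  have "\<nu> \<noteq> 0"
  proof
    assume "\<nu> = 0"
    then have "orth_below y (Suc r) E" using h0(2) unfolding orth_below_def lt E_def[symmetric] \<nu>_def by auto
    then show False using assms bE \<open>E \<noteq> 0\<close> unfolding nondeg_def by blast
  qed
  obtain h1 where h1: "below r h1" "orth_below y r (g - h1)" using Suc by blast
  define c where "c = ell y ((g - h1) * zpow (- n)) / \<nu>"
  show ?case
  proof (intro exI conjI)
    have "below (Suc r) h1" using h1(1) by (auto simp: below_def)
    then show "below (Suc r) (h1 + cst c * E)" by (intro below_add below_cst bE)
    have o: "orth_below y r (g - (h1 + cst c * E))"
      using orth_below_diff[OF h1(2) orth_below_cst[OF h0(2), of c]] by (simp add: E_def algebra_simps)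
    have "ell y ((g - (h1 + cst c * E)) * zpow (- n)) = ell y ((g - h1) * zpow (- n)) - ell y (cst c * (E * zpow (- n)))"
      by (simp add: algebra_simps)
    also have "\<dots> = 0" using \<open>\<nu> \<noteq> 0\<close> by (simp add: c_def \<nu>_def)
    finally show "orth_below y (Suc r) (g - (h1 + cst c * E))"
      using o unfolding orth_below_def lt by blast
  qed
qed

definition is_AW :: "(int \<Rightarrow> K) \<Rightarrow> int \<Rightarrow> laurent \<Rightarrow> bool" where
  "is_AW y n f \<longleftrightarrow> lk f n = 1 \<and> below (nat (mono_rank n) + 1) f \<and> orth_below y (nat (mono_rank n)) f"

lemma is_AW_unique:
  assumes "nondeg y" "is_AW y n f" "is_AW y n g"
  shows "f = g"
proof -
  let ?r = "nat (mono_rank n)"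
  have r: "int ?r = mono_rank n" using mono_rank_nonneg by simp
  have fg: "below (?r + 1) (f - g)" "lk (f - g) n = 0" using assms(2,3) by (simp_all add: is_AW_def below_diff)
  have "below ?r (f - g)"
    unfolding below_def r
  proof (intro allI impI)
    fix m assume m: "lk (f - g) m \<noteq> 0"
    then have "m \<noteq> n" using fg(2) by blast
    moreover have "mono_rank m < int (?r + 1)" using fg(1) m unfolding below_def by blast
    ultimately have "mono_rank m < int (?r + 1)" "m \<noteq> n" by blast+
    then show "mono_rank m < mono_rank n" using mono_rank_inj[of m n] r by linarith
  qed
  moreover have "orth_below y ?r (f - g)" using assms(2,3) orth_below_diff by (auto simp: is_AW_def)
  ultimately show ?thesis using assms(1) unfolding nondeg_def by fastforce
qed

lemma is_AW_exists:
  assumes "nondeg y"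
  shows "\<exists>f. is_AW y n f"
proof -
  let ?r = "nat (mono_rank n)"
  have r: "int ?r = mono_rank n" using mono_rank_nonneg by simp
  obtain h where h: "below ?r h" "orth_below y ?r (zpow n - h)" using orthogonal_projection[OF assms] by blast
  have "lk h n = 0" using h(1) r by (auto simp: below_def)
  then have "is_AW y n (zpow n - h)"
    using h r unfolding is_AW_def below_def by (auto simp: lk_zpow split: if_splits)
  then show ?thesis by blast
qed

lemma eq_cst_AW:
  assumes "nondeg y" "is_AW y n E" "lk f n = c" "below (nat (mono_rank n) + 1) f" "orth_below y (nat (mono_rank n)) f"
  shows "f = cst c * E"
proof (cases "c = 0")
  case False
  have "is_AW y n (cst (inverse c) * f)"
    using assms(3-5) False by (simp add: is_AW_def below_cst orth_below_cst)
  from is_AW_unique[OF assms(1,2) this] have "cst c * E = (cst c * cst (inverse c)) * f" by (simp only: mult.assoc)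
  then show ?thesis using False by (simp add: cst_inverse)
next
  case True
  \<comment> \<open>For c = 0 both \<open>E\<close> and \<open>E + f\<close> qualify, so uniqueness
    gives \<open>f = 0\<close>.\<close>
  have "is_AW y n (E + f)" "is_AW y n E" using assms True unfolding is_AW_def orth_below_def
    by (auto simp: below_add distrib_right)
  from is_AW_unique[OF assms(1) this] show ?thesis using True by simp
qed

section \<open>Generic parameters\<close>

lemma sqrt_q_powi_eq_1: "sqrt_q powi k = 1 \<longleftrightarrow> k = 0"
proof
  assume "sqrt_q powi k = 1"
  then have "embK (sqrt_q powi k) = 1" by (simp add: field_homD(2)[OF embK_hom])
  then have "fls_X powi k = (1 :: F fls)" by (simp add: field_homD(10)[OF embK_hom] embK_gens)
  then have "fls_X_intpow k = (1 :: F fls)" by (simp add: fls_X_power_int)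
  then have "fls_subdegree (fls_X_intpow k :: F fls) = 0" by simp
  then show "k = 0" by simp
qed simp

text \<open>Non-resonance, demanded for all powers of q^(1/2) so that it persists under the shifts.
  The products occur in denominators and leading coefficients; the last clause keeps 1-az and 1-bz
  independent.\<close>

definition gen_par :: "K \<Rightarrow> K \<Rightarrow> K \<Rightarrow> K \<Rightarrow> bool" where
  "gen_par a b c d \<longleftrightarrow> a \<noteq> 0 \<and> b \<noteq> 0 \<and> c \<noteq> 0 \<and> d \<noteq> 0 \<and>
    (\<forall>e::int. a * b * sqrt_q powi e \<noteq> 1 \<and> a * c * sqrt_q powi e \<noteq> 1 \<and> a * d * sqrt_q powi e \<noteq> 1 \<and>
       b * c * sqrt_q powi e \<noteq> 1 \<and> b * d * sqrt_q powi e \<noteq> 1 \<and> c * d * sqrt_q powi e \<noteq> 1 \<and>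
       a * b * c * d * sqrt_q powi e \<noteq> 1 \<and> a * sqrt_q powi e \<noteq> b)"

lemma gen_par_shift:
  assumes "gen_par a b c d"
  shows "gen_par (a * sqrt_q powi e1) (b * sqrt_q powi e2) (c * sqrt_q powi e3) (d * sqrt_q powi e4)"
proof -
  note g = assms[unfolded gen_par_def]
  have p: "sqrt_q powi i * sqrt_q powi j = sqrt_q powi (i + j)" for i j by (simp add: power_int_add)
  have 2: "(u * sqrt_q powi i) * (v * sqrt_q powi j) * sqrt_q powi e = u * v * sqrt_q powi (i + j + e)" for u v i j e
    by (simp add: power_int_add ac_simps)
  have 4: "(a * sqrt_q powi e1) * (b * sqrt_q powi e2) * (c * sqrt_q powi e3) * (d * sqrt_q powi e4) * sqrt_q powi e =
     a * b * c * d * sqrt_q powi (e1 + e2 + e3 + e4 + e)" for e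
    by (simp add: power_int_add ac_simps)
  have "a * sqrt_q powi e1 * sqrt_q powi e \<noteq> b * sqrt_q powi e2" for e
  proof
    assume "a * sqrt_q powi e1 * sqrt_q powi e = b * sqrt_q powi e2"
    then have "(a * sqrt_q powi e1 * sqrt_q powi e) * sqrt_q powi (- e2) = (b * sqrt_q powi e2) * sqrt_q powi (- e2)"
      by simp
    then have "a * sqrt_q powi (e1 + e - e2) = b" by (simp add: mult.assoc p)
    then show False using g by blast
  qed
  then show ?thesis using g unfolding gen_par_def 2 4 by simp
qed

text \<open>The square roots are scaled by half of a sum of two entries of h. The parity conditions
  make this exponent a half-integer, where the floor in \<open>qpow\<close> is exact.\<close>

lemma shiftK_params:
  fixes h :: "rat^4"
  assumes h: "h $ 1 = of_int e1 / 2" "h $ 2 = of_int e2 / 2" "h $ 3 = of_int e3 / 2" "h $ 4 = of_int e4 / 2"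
    and "e1 + e2 = 2 * f" "e3 + e4 = 2 * g"
  shows "shiftK h par_a = par_a * sqrt_q powi e1" "shiftK h par_b = par_b * sqrt_q powi e2"
    "shiftK h par_c = par_c * sqrt_q powi e3" "shiftK h par_d = par_d * sqrt_q powi e4"
proof -
  note H = field_homD[OF shiftK_hom[of h]]
  have "(h $ 1 + h $ 2) / 2 = of_int (e1 + e2) / 4" "(h $ 3 + h $ 4) / 2 = of_int (e3 + e4) / 4"
    by (simp_all add: h)
  then have fg: "(h $ 1 + h $ 2) / 2 = of_int f / 2" "(h $ 3 + h $ 4) / 2 = of_int g / 2"
    unfolding assms(5,6) by simp_all
  have q: "qpow (of_int e / 2) = sqrt_q powi e" for e by (simp add: qpow_def)
  have e: "e1 = 2 * f - e2" "e3 = 2 * g - e4" using assms(5,6) by simp_all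
  have sq: "(x * sqrt_q powi f) ^ 2 = x ^ 2 * sqrt_q powi (2 * f)" for x f
  proof -
    have "sqrt_q powi (2 * f) = sqrt_q powi f * sqrt_q powi f" unfolding mult_2 by (rule power_int_add) simp
    then show ?thesis by (simp add: power2_eq_square)
  qed
  show b: "shiftK h par_b = par_b * sqrt_q powi e2" and d: "shiftK h par_d = par_d * sqrt_q powi e4"
    unfolding shiftK_gens(2,4) h(2) h(4) q by (rule refl)+
  show "shiftK h par_a = par_a * sqrt_q powi e1"
    unfolding par_a_def H b shiftK_gens(1) fg q sq e by (simp add: power_int_diff)
  show "shiftK h par_c = par_c * sqrt_q powi e3"
    unfolding par_c_def H d shiftK_gens(3) fg q sq e by (simp add: power_int_diff)
qed

text \<open>The automorphisms \<open>shiftK h\<close> fix q^(1/2). A monomial in the parameters that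
  some of them multiplies by a nontrivial power of q^(1/2) can therefore not itself be a power of
  q^(1/2). Three shifts detect all the monomials in question.\<close>

lemma gen_par: "gen_par par_a par_b par_c par_d"
proof -
  define h1 :: "rat^4" where "h1 = (\<chi> i. if i = 1 \<or> i = 2 then 1 else 0)"
  define h2 :: "rat^4" where "h2 = (\<chi> i. if i = 3 \<or> i = 4 then 1 else 0)"
  define h3 :: "rat^4" where "h3 = (\<chi> i. if i = 1 then 1 else if i = 2 then -1 else 0)"
  have 1: "shiftK h1 par_a = par_a * sqrt_q powi 2" "shiftK h1 par_b = par_b * sqrt_q powi 2"
    "shiftK h1 par_c = par_c * sqrt_q powi 0" "shiftK h1 par_d = par_d * sqrt_q powi 0"
    by (rule shiftK_params[of h1 2 2 0 0 2 0]; simp add: h1_def)+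
  have 2: "shiftK h2 par_a = par_a * sqrt_q powi 0" "shiftK h2 par_b = par_b * sqrt_q powi 0"
    "shiftK h2 par_c = par_c * sqrt_q powi 2" "shiftK h2 par_d = par_d * sqrt_q powi 2"
    by (rule shiftK_params[of h2 0 0 2 2 0 2]; simp add: h2_def)+
  have 3: "shiftK h3 par_a = par_a * sqrt_q powi 2" "shiftK h3 par_b = par_b * sqrt_q powi (-2)"
    by (rule shiftK_params[of h3 2 "-2" 0 0 0 0]; simp add: h3_def)+
  have s: "shiftK h (sqrt_q powi e) = sqrt_q powi e" for h e
    by (simp add: field_homD(10)[OF shiftK_hom] shiftK_gens)
  have m: "shiftK h (x * y) = shiftK h x * shiftK h y" "shiftK h 1 = 1" for h x y
    by (simp_all add: field_homD[OF shiftK_hom])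
  have key: "u * sqrt_q powi e \<noteq> 1" if u: "shiftK h u = u * sqrt_q powi k" "k \<noteq> 0" for u h k e
  proof
    assume *: "u * sqrt_q powi e = 1"
    then have "shiftK h (u * sqrt_q powi e) = 1" by (simp add: m)
    then have "(u * sqrt_q powi e) * sqrt_q powi k = 1" by (simp add: m s u(1) ac_simps)
    then have "sqrt_q powi k = 1" using * by simp
    then show False using u(2) sqrt_q_powi_eq_1 by blast
  qed
  have pp: "sqrt_q powi 2 * sqrt_q powi 2 = sqrt_q powi 4" by (simp add: power_int_add[symmetric])
  have "par_a * sqrt_q powi e \<noteq> par_b" for e
  proof -
    have "par_a / par_b * sqrt_q powi e \<noteq> 1"
    proof (rule key[of h3 _ 4])
      have "shiftK h3 (par_a / par_b) = (par_a * sqrt_q powi 2) / (par_b * sqrt_q powi (-2))"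
        by (simp only: field_homD(8)[OF shiftK_hom] 3)
      then show "shiftK h3 (par_a / par_b) = par_a / par_b * sqrt_q powi 4"
        using pp by (simp add: power_int_minus field_simps)
    qed simp
    then show ?thesis by (simp add: field_simps)
  qed
  moreover have "par_a * par_b * sqrt_q powi e \<noteq> 1" "par_a * par_b * par_c * par_d * sqrt_q powi e \<noteq> 1" for e
    by (rule key[of h1 _ 4]; simp add: m 1 ac_simps pp[symmetric])+
  moreover have "par_c * par_d * sqrt_q powi e \<noteq> 1" for e
    by (rule key[of h2 _ 4]; simp add: m 2 ac_simps pp[symmetric])
  moreover have "par_a * par_c * sqrt_q powi e \<noteq> 1" "par_a * par_d * sqrt_q powi e \<noteq> 1"
    "par_b * par_c * sqrt_q powi e \<noteq> 1" "par_b * par_d * sqrt_q powi e \<noteq> 1" for e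
    by (rule key[of h1 _ 2]; simp add: m 1 ac_simps)+
  ultimately show ?thesis unfolding gen_par_def by simp
qed

section \<open>The moments of the weight function\<close>

lemma Delta_relations:
  shows "Delta (1 - m) - (embK par_a + embK par_b) * Delta (- m) + embK par_a * embK par_b * Delta (- m - 1) +
   (Delta (m + 1) - (embK par_a + embK par_b) * Delta m + embK par_a * embK par_b * Delta (m - 1)) = 0"
   and "Delta (- int k - 1) - (embK par_c + embK par_d) * Delta (- int k) + embK par_c * embK par_d * Delta (1 - int k) +
   (embK sqrt_q ^ 2) ^ k * (Delta (int k - 1) - (embK par_c + embK par_d) * Delta (int k) + embK par_c * embK par_d * Delta (int k + 1)) = 0"
proof -
  have "fps_to_fls (zcoeff Delta_zw (1 - m) - fps_const (F_a + F_b) * zcoeff Delta_zw (- m) + fps_const (F_a * F_b) * zcoeff Delta_zw (- 1 - m) +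
   (zcoeff Delta_zw (1 + m) - fps_const (F_a + F_b) * zcoeff Delta_zw m + fps_const (F_a * F_b) * zcoeff Delta_zw (m - 1))) = 0"
    unfolding Delta_relation_1 by simp
  then show "Delta (1 - m) - (embK par_a + embK par_b) * Delta (- m) + embK par_a * embK par_b * Delta (- m - 1) +
   (Delta (m + 1) - (embK par_a + embK par_b) * Delta m + embK par_a * embK par_b * Delta (m - 1)) = 0"
    unfolding Delta_eq_zcoeff embK_ac embK_gens(2)
    by (simp add: fls_times_fps_to_fls add.commute[of 1 m] minus_diff_commute flip: fls_plus_const fls_const_mult_const)
  have "fps_to_fls (zcoeff Delta_zw (- int k - 1) - fps_const (F_c' + F_d') * (fps_X * zcoeff Delta_zw (- int k)) + fps_const (F_c' * F_d') * (fps_X ^ 2 * zcoeff Delta_zw (1 - int k)) +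
   fps_X ^ (2 * k) * (zcoeff Delta_zw (int k - 1) - fps_const (F_c' + F_d') * (fps_X * zcoeff Delta_zw (int k)) + fps_const (F_c' * F_d') * (fps_X ^ 2 * zcoeff Delta_zw (int k + 1)))) = 0"
    unfolding Delta_relation_0 by simp
  then show "Delta (- int k - 1) - (embK par_c + embK par_d) * Delta (- int k) + embK par_c * embK par_d * Delta (1 - int k) +
   (embK sqrt_q ^ 2) ^ k * (Delta (int k - 1) - (embK par_c + embK par_d) * Delta (int k) + embK par_c * embK par_d * Delta (int k + 1)) = 0"
    unfolding Delta_eq_zcoeff embK_ac embK_gens(4,5)
    by (simp add: fls_times_fps_to_fls fps_to_fls_power power_mult power2_eq_square algebra_simps flip: fls_plus_const fls_const_mult_const)
qed

lemma Delta_0_nz: "Delta 0 \<noteq> 0"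
proof -
  have "zcoeff Delta_zw 0 \<noteq> 0" using Delta_leading(2) by auto
  then show ?thesis by (simp add: Delta_eq_zcoeff)
qed

lemma solve_2x2:
  fixes z w :: "'a::field"
  assumes "u * z + w = p" "z + v * w = r" "u * v \<noteq> 1"
  shows "z = (r - v * p) / (1 - u * v)" "w = p - u * ((r - v * p) / (1 - u * v))"
proof -
  have "z * (1 - u * v) = r - v * p" unfolding assms(1,2)[symmetric] by (simp add: algebra_simps)
  then show *: "z = (r - v * p) / (1 - u * v)" using assms(3) by (simp add: field_simps)
  show "w = p - u * ((r - v * p) / (1 - u * v))" using assms(1) unfolding *[symmetric] by (simp add: algebra_simps)
qed

text \<open>The two relations with index m are linear equations for the coefficients at m+1 and
  -m-1, with earlier ones on the right-hand side. Their determinant is 1 - abcd q^m up to sign,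
  nonzero by genericity.\<close>

lemma Delta_moments:
  "\<exists>x x'. Delta (int k) = Delta 0 * embK x \<and> Delta (- int k) = Delta 0 * embK x'"
proof (induction k rule: less_induct)
  case (less k)
  note H = field_homD[OF embK_hom]
  define D where "D x \<longleftrightarrow> (\<exists>y. x = Delta 0 * embK y)" for x
  have Dp: "D (x + y)" "D (x - y)" if "D x" "D y" for x y
    using that unfolding D_def by (metis H(3) distrib_left, metis H(6) right_diff_distrib)
  have Dm: "D (embK u * x)" if "D x" for u x
    using that unfolding D_def by (metis H(4) mult.left_commute)
  have low: "D (Delta n)" if "nat \<bar>n\<bar> < k" for n
  proof (cases "n \<ge> 0")
    case True then show ?thesis using less[of "nat \<bar>n\<bar>"] that unfolding D_def by auto
  next
    case False
    then have "- int (nat \<bar>n\<bar>) = n" by simp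
    then show ?thesis using less[of "nat \<bar>n\<bar>"] that unfolding D_def by metis
  qed
  show ?case
  proof (cases k)
    case 0
    have "Delta 0 = Delta 0 * embK 1" by (simp add: H)
    then show ?thesis using 0 by auto
  next
    case (Suc m)
    define u where "u = embK (par_a * par_b)"
    define v where "v = embK ((sqrt_q ^ 2) ^ m * (par_c * par_d))"
    have ex: "\<exists>P Q. D P \<and> D Q \<and> u * Delta (- int k) + Delta (int k) = P \<and> Delta (- int k) + v * Delta (int k) = Q"
    proof (cases "m = 0")
      case False
      define P where "P = embK (par_a + par_b) * (Delta (- int m) + Delta (int m)) - Delta (1 - int m) - embK (par_a * par_b) * Delta (int m - 1)"
      define Q where "Q = embK (par_c + par_d) * Delta (- int m) - embK (par_c * par_d) * Delta (1 - int m)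
        - embK ((sqrt_q ^ 2) ^ m) * (Delta (int m - 1) - embK (par_c + par_d) * Delta (int m))"
      have "D P \<and> D Q"
        unfolding P_def Q_def using Suc False by (intro conjI Dp Dm low) auto
      moreover have ik: "- int k = - int m - 1" "int k = int m + 1" using Suc by simp_all
      note dk = arg_cong[OF ik(1), of Delta] arg_cong[OF ik(2), of Delta]
      have "u * Delta (- int k) + Delta (int k) = P" unfolding dk u_def P_def
        using Delta_relations(1)[of "int m"] by (simp add: H algebra_simps)
      moreover have "Delta (- int k) + v * Delta (int k) = Q" unfolding dk v_def Q_def
        using Delta_relations(2)[of m] by (simp add: H algebra_simps)
      ultimately show ?thesis by blast
    next
      case True
      \<comment> \<open>At m = 0 each relation contains every term twice.\<close>
      have two: "x + x = 0 \<Longrightarrow> x = 0" for x :: "F fls" by (metis mult_2 mult_eq_0_iff zero_neq_numeral)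
      have "D (Delta 0)" using low[of 0] Suc by simp
      then have "D (embK (par_a + par_b) * Delta 0)" "D (embK (par_c + par_d) * Delta 0)" by (intro Dm; simp)+
      moreover have "u * Delta (- int k) + Delta (int k) = embK (par_a + par_b) * Delta 0"
        using two[OF Delta_relations(1)[of 0, unfolded minus_zero diff_0 diff_0_right add_0_left diff_zero]] Suc True by (simp add: u_def H algebra_simps)
      moreover have "Delta (- int k) + v * Delta (int k) = embK (par_c + par_d) * Delta 0"
        using two[OF Delta_relations(2)[of 0, unfolded of_nat_0 minus_zero diff_0 diff_0_right add_0_left diff_zero power_0 mult_1_left]] Suc True by (simp add: v_def H algebra_simps)
      ultimately show ?thesis by blast
    qed
    then obtain P Q where PQ: "D P" "D Q" "u * Delta (- int k) + Delta (int k) = P" "Delta (- int k) + v * Delta (int k) = Q"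
      by blast
    have uv: "u * v = embK (par_a * par_b * par_c * par_d * sqrt_q powi (2 * int m))"
    proof -
      have "(sqrt_q ^ 2) ^ m = sqrt_q powi (2 * int m)"
        by (simp add: power_int_def nat_mult_distrib flip: power_mult)
      then show ?thesis unfolding u_def v_def H(4)[symmetric] by (simp add: ac_simps)
    qed
    moreover have "par_a * par_b * par_c * par_d * sqrt_q powi (2 * int m) \<noteq> 1"
      using gen_par unfolding gen_par_def by blast
    ultimately have "u * v \<noteq> 1" using H(11)[of _ 1] H(2) by simp
    note sol = solve_2x2[OF PQ(3,4) this]
    have i: "1 / (1 - u * v) = embK (1 / (1 - par_a * par_b * par_c * par_d * sqrt_q powi (2 * int m)))"
      unfolding uv H ..
    have "Delta (- int k) = embK (1 / (1 - par_a * par_b * par_c * par_d * sqrt_q powi (2 * int m))) * (Q - v * P)"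
      unfolding i[symmetric] using sol(1) by simp
    moreover have "D (Q - v * P)" unfolding v_def using PQ by (intro Dp Dm)
    ultimately have 1: "D (Delta (- int k))" using Dm by simp
    have "Delta (int k) = P - u * Delta (- int k)" using PQ(3) by (simp add: algebra_simps)
    moreover have "D (P - u * Delta (- int k))" unfolding u_def using PQ 1 by (intro Dp Dm)
    ultimately have "D (Delta (int k))" by simp
    then show ?thesis using 1 unfolding D_def by blast
  qed
qed


lemma embK_moments:
  obtains y where "y 0 = 1" "\<And>n. Delta (- n) = Delta 0 * embK (y n)"
proof -
  have ex: "\<exists>x. Delta (- n) = Delta 0 * embK x" for n
  proof (cases "n \<ge> 0")
    case True then show ?thesis using Delta_moments[of "nat n"] by auto
  next
    case False then show ?thesis using Delta_moments[of "nat (- n)"] by auto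
  qed
  define y where "y n = (SOME x. Delta (- n) = Delta 0 * embK x)" for n
  have y: "Delta (- n) = Delta 0 * embK (y n)" for n
    unfolding y_def by (rule someI_ex[OF ex])
  from y[of 0] have "embK (y 0) = embK 1" using Delta_0_nz by (simp add: field_homD(2)[OF embK_hom])
  then have "y 0 = 1" by (simp only: field_homD(11)[OF embK_hom])
  then show thesis using y that by blast
qed

text \<open>The normalized moments ct(z^n \<Delta>) / ct(\<Delta>). The constant term pairs z^n with
  the coefficient of z^(-n), hence the sign; the normalization brings them into
  \<open>K\<close>.\<close>

definition mom :: "int \<Rightarrow> K" where
  "mom = (SOME y. y 0 = 1 \<and> (\<forall>n. Delta (- n) = Delta 0 * embK (y n)))"

lemma mom: "mom 0 = 1" "Delta n = Delta 0 * embK (mom (- n))"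
proof -
  have "\<exists>y. y 0 = 1 \<and> (\<forall>n. Delta (- n) = Delta 0 * embK (y n))" using embK_moments by metis
  from someI_ex[OF this, folded mom_def] show "mom 0 = 1" "Delta n = Delta 0 * embK (mom (- n))"
    by auto (metis minus_minus)
qed

lemma moment_rel_mom: "moment_rel par_a par_b par_c par_d mom"
proof -
  note H = field_homD[OF embK_hom]
  have E: "embK x = 0 \<Longrightarrow> x = 0" for x by (simp add: H)
  have M: "x = 0" if "Delta 0 * embK x = 0" for x using that Delta_0_nz E by simp
  have e: "- (1 - m) = m - 1" "- (m + 1) = - m - 1" "- (m - 1) = 1 - m" "- (- m - 1) = m + 1" "1 - - m = m + 1" for m :: int by simp_all
  have "mom (m - 1) - (par_a + par_b) * mom m + par_a * par_b * mom (m + 1) +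
      (mom (- m - 1) - (par_a + par_b) * mom (- m) + par_a * par_b * mom (1 - m)) = 0" for m
  proof (rule M)
    have "Delta 0 * embK (mom (m - 1) - (par_a + par_b) * mom m + par_a * par_b * mom (m + 1) +
      (mom (- m - 1) - (par_a + par_b) * mom (- m) + par_a * par_b * mom (1 - m))) =
      Delta 0 * embK (mom (m - 1)) - (embK par_a + embK par_b) * (Delta 0 * embK (mom m)) + embK par_a * embK par_b * (Delta 0 * embK (mom (m + 1))) +
      (Delta 0 * embK (mom (- m - 1)) - (embK par_a + embK par_b) * (Delta 0 * embK (mom (- m))) + embK par_a * embK par_b * (Delta 0 * embK (mom (1 - m))))"
      unfolding H by (simp only: algebra_simps)
    also have "\<dots> = 0"
      using Delta_relations(1)[of m] unfolding mom(2)[of "1 - m"] mom(2)[of "- m"] mom(2)[of "- m - 1"] mom(2)[of "m + 1"] mom(2)[of "m - 1"] mom(2)[of m] e minus_minus .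
    finally show "Delta 0 * embK (mom (m - 1) - (par_a + par_b) * mom m + par_a * par_b * mom (m + 1) +
      (mom (- m - 1) - (par_a + par_b) * mom (- m) + par_a * par_b * mom (1 - m))) = 0" .
  qed
  moreover have "mom (int k + 1) - (par_c + par_d) * mom (int k) + par_c * par_d * mom (int k - 1) +
        (sqrt_q ^ 2) ^ k * (mom (1 - int k) - (par_c + par_d) * mom (- int k) + par_c * par_d * mom (- int k - 1)) = 0" for k
  proof (rule M)
    have "Delta 0 * embK (mom (int k + 1) - (par_c + par_d) * mom (int k) + par_c * par_d * mom (int k - 1) +
        (sqrt_q ^ 2) ^ k * (mom (1 - int k) - (par_c + par_d) * mom (- int k) + par_c * par_d * mom (- int k - 1))) =
      Delta 0 * embK (mom (int k + 1)) - (embK par_c + embK par_d) * (Delta 0 * embK (mom (int k))) + embK par_c * embK par_d * (Delta 0 * embK (mom (int k - 1))) +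
      (embK sqrt_q ^ 2) ^ k * (Delta 0 * embK (mom (1 - int k)) - (embK par_c + embK par_d) * (Delta 0 * embK (mom (- int k))) + embK par_c * embK par_d * (Delta 0 * embK (mom (- int k - 1))))"
      unfolding H by (simp only: algebra_simps)
    also have "\<dots> = 0"
      using Delta_relations(2)[of k] unfolding mom(2)[of "1 - int k"] mom(2)[of "- int k"] mom(2)[of "- int k - 1"] mom(2)[of "int k + 1"] mom(2)[of "int k - 1"] mom(2)[of "int k"] e minus_minus .
    finally show "Delta 0 * embK (mom (int k + 1) - (par_c + par_d) * mom (int k) + par_c * par_d * mom (int k - 1) +
        (sqrt_q ^ 2) ^ k * (mom (1 - int k) - (par_c + par_d) * mom (- int k) + par_c * par_d * mom (- int k - 1))) = 0" .
  qed
  ultimately show ?thesis by (simp add: moment_rel_def mom(1))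
qed

text \<open>At \<open>q\<^sup>1\<^sup>/\<^sup>2 = 0\<close> the Toeplitz matrices of \<open>\<Delta>\<close> become unitriangular.\<close>

lemma Toeplitz_nondegenerate_fps:
  fixes f :: "int \<Rightarrow> F fps"
  assumes "finite S" "\<And>k. k \<in> S \<Longrightarrow> (\<Sum>m\<in>S. f m * zcoeff Delta_zw (k - m)) = 0" "m \<in> S"
  shows "f m = 0"
proof -
  \<comment> \<open>Once the coefficients of lower order in q^(1/2) vanish, order e sees only the
    values of \<Delta> at q^(1/2) = 0.\<close>
  have "\<forall>m\<in>S. fps_nth (f m) e = 0" for e
  proof (induction e rule: less_induct)
    case (less e)
    have eq: "(\<Sum>m\<in>S. fps_nth (f m) e * fps_nth (zcoeff Delta_zw (k - m)) 0) = 0" if "k \<in> S" for k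
    proof -
      have "0 = fps_nth (\<Sum>m\<in>S. f m * zcoeff Delta_zw (k - m)) e" using assms(2)[OF that] by simp
      also have "\<dots> = (\<Sum>m\<in>S. fps_nth (f m * zcoeff Delta_zw (k - m)) e)" by (rule fps_sum_nth)
      also have "\<dots> = (\<Sum>m\<in>S. fps_nth (f m) e * fps_nth (zcoeff Delta_zw (k - m)) 0)"
      proof (rule sum.cong[OF refl])
        fix m assume "m \<in> S"
        have "(\<Sum>i = 0..e. fps_nth (f m) i * fps_nth (zcoeff Delta_zw (k - m)) (e - i)) =
          (\<Sum>i\<in>{e}. fps_nth (f m) i * fps_nth (zcoeff Delta_zw (k - m)) (e - i))"
          by (rule sum.mono_neutral_right) (use less \<open>m \<in> S\<close> in auto)
        then show "fps_nth (f m * zcoeff Delta_zw (k - m)) e = fps_nth (f m) e * fps_nth (zcoeff Delta_zw (k - m)) 0"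
          by (simp add: fps_mult_nth)
      qed
      finally show ?thesis by simp
    qed
    \<comment> \<open>These values vanish at negative index and are 1 at index 0: forward
      substitution starting from \<open>Min S\<close>.\<close>
    have "fps_nth (f m) e = 0" if "m \<in> S" for m
      using that
    proof (induction "nat (m - Min S)" arbitrary: m rule: less_induct)
      case (less m)
      have "0 = (\<Sum>l\<in>S. fps_nth (f l) e * fps_nth (zcoeff Delta_zw (m - l)) 0)" using eq less(2) by simp
      also have "\<dots> = (\<Sum>l\<in>{m}. fps_nth (f l) e * fps_nth (zcoeff Delta_zw (m - l)) 0)"
      proof (rule sum.mono_neutral_right)
        show "\<forall>l\<in>S - {m}. fps_nth (f l) e * fps_nth (zcoeff Delta_zw (m - l)) 0 = 0"
        proof
          fix l assume l: "l \<in> S - {m}"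
          show "fps_nth (f l) e * fps_nth (zcoeff Delta_zw (m - l)) 0 = 0"
          proof (cases "l < m")
            case True
            have "Min S \<le> l" using l assms(1) by simp
            then show ?thesis using less(1)[of l] l True by simp
          next
            case False
            then show ?thesis using l Delta_leading(1)[of "m - l"] by auto
          qed
        qed
      qed (use assms(1) less(2) in auto)
      finally show ?case by (simp add: Delta_leading)
    qed
    then show ?case by blast
  qed
  then show ?thesis using assms(3) by (intro fps_ext) simp
qed

lemma nondeg_mom: "nondeg mom"
  unfolding nondeg_def
proof (intro allI impI)
  fix r f assume f: "below r f" "orth_below mom r f"
  note H = field_homD[OF embK_hom]
  let ?S = "{n. mono_rank n < int r}"
  have sup: "lk f n \<noteq> 0 \<Longrightarrow> n \<in> ?S" for n using f(1) by (simp add: below_def)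
  \<comment> \<open>A common power of q^(1/2) clears the poles of the finitely many coefficients, so
    that the statement about power series applies.\<close>
  obtain N g where g: "\<And>n. n \<in> ?S \<Longrightarrow> fls_X ^ N * embK (lk f n) = fps_to_fls (g n)"
  proof -
    have "\<exists>N h. \<forall>n. n \<in> S \<longrightarrow> fls_X ^ N * embK (lk f n) = fps_to_fls (h n)" if "finite S" for S
      using that
    proof (induction S)
      case empty then show ?case by simp
    next
      case (insert s S)
      obtain N h where Nh: "\<And>n. n \<in> S \<Longrightarrow> fls_X ^ N * embK (lk f n) = fps_to_fls (h n)" using insert by blast
      define k where "k = nat (- fls_subdegree (embK (lk f s)))"
      have "fls_subdegree (fls_X ^ k * embK (lk f s)) \<ge> 0 \<or> embK (lk f s) = 0"
        by (cases "embK (lk f s) = 0") (simp_all add: k_def)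
      then have "\<exists>p. fls_X ^ k * embK (lk f s) = fps_to_fls p"
        by (metis fls_as_fps fls_regpart_to_fls_trivial mult_zero_right fps_zero_to_fls)
      then obtain p where p: "fls_X ^ k * embK (lk f s) = fps_to_fls p" by blast
      have Xp: "(fls_X :: F fls) ^ m = fps_to_fls (fps_X ^ m)" for m by (simp add: fps_to_fls_power)
      show ?case
      proof (intro exI allI impI)
        fix n assume "n \<in> insert s S"
        show "fls_X ^ (N + k) * embK (lk f n) = fps_to_fls (if n = s then fps_X ^ N * p else fps_X ^ k * h n)"
        proof (cases "n = s")
          case True
          have "fls_X ^ (N + k) * embK (lk f s) = fls_X ^ N * (fls_X ^ k * embK (lk f s))" by (simp only: power_add mult.assoc)
          also have "\<dots> = fps_to_fls (fps_X ^ N * p)" unfolding p unfolding Xp fls_times_fps_to_fls ..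
          finally show ?thesis using True by simp
        next
          case False
          then have "fls_X ^ k * (fls_X ^ N * embK (lk f n)) = fls_X ^ k * fps_to_fls (h n)" using Nh \<open>n \<in> insert s S\<close> by simp
          then show ?thesis using False by (simp add: power_add ac_simps fls_times_fps_to_fls Xp)
        qed
      qed
    qed
    from this[OF finite_below[of r]] show ?thesis using that by blast
  qed
  have "(\<Sum>m\<in>?S. g m * zcoeff Delta_zw (k - m)) = 0" if k: "k \<in> ?S" for k
  proof -
    have "ell mom (f * zpow (- k)) = (\<Sum>n\<in>?S. lk f n * mom (n - k))"
    proof -
      have "ell mom (f * zpow (- k)) = (\<Sum>n\<in>(\<lambda>n. n - k) ` ?S. lk (f * zpow (- k)) n * mom n)"
      proof (rule ell_eq_sum)
        show "n \<in> (\<lambda>n. n - k) ` ?S" if "lk (f * zpow (- k)) n \<noteq> 0" for n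
          using that sup[of "n + k"] by (auto simp: mult.commute[of f] image_iff intro!: exI[of _ "n + k"])
      qed (use finite_below in simp)
      also have "\<dots> = (\<Sum>n\<in>?S. lk f n * mom (n - k))"
        by (subst sum.reindex) (auto simp: inj_on_def mult.commute[of f])
      finally show ?thesis .
    qed
    then have "(\<Sum>n\<in>?S. lk f n * mom (n - k)) = 0" using f(2) k by (simp add: orth_below_def)
    then have "embK (\<Sum>n\<in>?S. lk f n * mom (n - k)) = 0" by (simp add: H)
    moreover have "embK (sum h A) = (\<Sum>n\<in>A. embK (h n))" for h and A :: "int set"
      by (induction A rule: infinite_finite_induct) (simp_all add: H)
    ultimately have z: "(\<Sum>n\<in>?S. embK (lk f n) * embK (mom (n - k))) = 0" by (simp add: H)
    have "fps_to_fls (\<Sum>m\<in>?S. g m * zcoeff Delta_zw (k - m)) = (\<Sum>m\<in>?S. fps_to_fls (g m) * Delta (k - m))"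
    proof -
      have "fps_to_fls (sum h A) = (\<Sum>n\<in>A. fps_to_fls (h n))" for h :: "int \<Rightarrow> F fps" and A
        by (induction A rule: infinite_finite_induct) simp_all
      then show ?thesis by (simp add: fls_times_fps_to_fls Delta_eq_zcoeff)
    qed
    also have "\<dots> = (\<Sum>m\<in>?S. fls_X ^ N * Delta 0 * (embK (lk f m) * embK (mom (m - k))))"
      using g by (intro sum.cong) (auto simp: mom(2)[of "k - m" for m] ac_simps)
    also have "\<dots> = fls_X ^ N * Delta 0 * (\<Sum>m\<in>?S. embK (lk f m) * embK (mom (m - k)))"
      by (simp add: sum_distrib_left)
    also have "\<dots> = 0" using z by simp
    finally show ?thesis by simp
  qed
  from Toeplitz_nondegenerate_fps[OF finite_below this] have "g m = 0" if "m \<in> ?S" for m using that by blast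
  then have "embK (lk f m) = 0" if "m \<in> ?S" for m using g[OF that] that by simp
  then have "lk f m = 0" for m using sup[of m] H(12) by metis
  then show "f = 0" by (intro poly_mapping_eqI) simp
qed

section \<open>Characterization of the Askey--Wilson polynomials\<close>

lemma starL_zpow: "starL (zpow m) = zpow (- m)"
proof -
  have "Poly_Mapping.map starK (zpow m) = zpow m"
    by (rule poly_mapping_eqI) (auto simp: zpow_def map.rep_eq lookup_single when_def)
  then show ?thesis by (simp add: starL_def)
qed

lemma inner_AW_zpow: "inner_AW f (zpow m) = Delta 0 * embK (ell mom (f * zpow (- m)))"
proof -
  note H = field_homD[OF embK_hom]
  have S: "embK (sum h A) = (\<Sum>n\<in>A. embK (h n))" for h and A :: "int set"
    by (induction A rule: infinite_finite_induct) (simp_all add: H)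
  have D: "Delta (- n) = Delta 0 * embK (mom n)" for n using mom(2)[of "- n"] by simp
  show ?thesis
    by (simp add: inner_AW_def starL_zpow ct_Delta_def ell_def S H(4) sum_distrib_left D ac_simps)
qed

lemma is_AW_nsAW0: "is_AW mom n (nsAW0 n)"
proof -
  have r: "int (nat (mono_rank n)) = mono_rank n" using mono_rank_nonneg by simp
  have iff: "(lk f n = 1 \<and> (\<forall>m\<in>Poly_Mapping.keys f. m = n \<or> mono_rank m < mono_rank n) \<and>
         (\<forall>m. mono_rank m < mono_rank n \<longrightarrow> inner_AW f (zpow m) = 0)) \<longleftrightarrow> is_AW mom n f" for f
  proof -
    have "(m = n \<or> mono_rank m < mono_rank n) \<longleftrightarrow> mono_rank m < mono_rank n + 1" for m
      using mono_rank_inj[of m n] by auto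
    moreover have r1: "int (nat (mono_rank n) + 1) = mono_rank n + 1" using r by simp
    moreover have "inner_AW f (zpow m) = 0 \<longleftrightarrow> ell mom (f * zpow (- m)) = 0" for m
      using Delta_0_nz by (simp add: inner_AW_zpow field_homD(12)[OF embK_hom])
    ultimately show ?thesis
      unfolding is_AW_def below_def orth_below_def r keys_lk Ball_def r1 by simp
  qed
  show ?thesis unfolding nsAW0_def iff
    by (rule theI') (use is_AW_exists[OF nondeg_mom] is_AW_unique[OF nondeg_mom] in blast)
qed

section \<open>Transfer to shifted labels\<close>

abbreviation "smom h n \<equiv> shiftK h (mom n)"

lemma lk_map_shiftK [simp]: "lk (Poly_Mapping.map (shiftK h) f) n = shiftK h (lk f n)"
  by (simp add: map.rep_eq when_def field_homD(1)[OF shiftK_hom])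

lemma ell_map_shiftK: "ell (smom h) (Poly_Mapping.map (shiftK h) f) = shiftK h (ell mom f)"
proof -
  note H = field_homD[OF shiftK_hom[of h]]
  have S: "shiftK h (sum g A) = (\<Sum>n\<in>A. shiftK h (g n))" for g and A :: "int set"
    by (induction A rule: infinite_finite_induct) (simp_all add: H)
  have "ell (smom h) (Poly_Mapping.map (shiftK h) f) = (\<Sum>n\<in>Poly_Mapping.keys f. lk (Poly_Mapping.map (shiftK h) f) n * smom h n)"
    by (rule ell_eq_sum) (auto simp: in_keys_iff H)
  then show ?thesis by (simp add: ell_def S H)
qed

lemma map_shiftK_zpow: "Poly_Mapping.map (shiftK h) f * zpow m = Poly_Mapping.map (shiftK h) (f * zpow m)"
  by (rule poly_mapping_eqI) (simp add: mult.commute[of _ "zpow m"])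

lemma below_orth_map:
  "below r (Poly_Mapping.map (shiftK h) f) \<longleftrightarrow> below r f"
  "orth_below (smom h) r (Poly_Mapping.map (shiftK h) f) \<longleftrightarrow> orth_below mom r f"
  by (simp_all add: below_def orth_below_def map_shiftK_zpow ell_map_shiftK field_homD(12)[OF shiftK_hom])

lemma is_AW_nsAW: "is_AW (smom h) n (nsAW h n)"
  using is_AW_nsAW0[of n] unfolding nsAW_def is_AW_def below_orth_map by (simp add: field_homD(2)[OF shiftK_hom])

lemma nondeg_smom: "nondeg (smom h)"
  unfolding nondeg_def
proof (intro allI impI)
  fix r f assume f: "below r f" "orth_below (smom h) r f"
  obtain g where g: "f = Poly_Mapping.map (shiftK h) g"
  proof
    have "shiftK h (inv (shiftK h) x) = x" for x using surj_shiftK by (rule surj_f_inv_f)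
    moreover have "inv (shiftK h) 0 = 0"
      using calculation[of 0] field_homD(12)[OF shiftK_hom] by blast
    ultimately show "f = Poly_Mapping.map (shiftK h) (Poly_Mapping.map (inv (shiftK h)) f)"
      using field_homD(1)[OF shiftK_hom] by (intro poly_mapping_eqI) (auto simp: map.rep_eq when_def, metis)
  qed
  then have "g = 0" using f nondeg_mom unfolding nondeg_def g below_orth_map by blast
  then show "f = 0" using g by (intro poly_mapping_eqI) (simp add: field_homD(1)[OF shiftK_hom])
qed

lemma moment_rel_smom:
  "moment_rel (shiftK h par_a) (shiftK h par_b) (shiftK h par_c) (shiftK h par_d) (smom h)"
proof -
  note H = field_homD[OF shiftK_hom[of h]]
  have s: "sqrt_q = shiftK h sqrt_q" by (simp add: shiftK_gens)
  show ?thesis using moment_rel_mom unfolding moment_rel_def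
    apply (subst s)
    unfolding H(3,4,6,9)[symmetric]
    by (simp only: H(12) simp_thms)
qed

section \<open>Symmetric Laurent polynomials and divided differences\<close>

abbreviation "zZ \<equiv> zpow 1"
abbreviation "zW \<equiv> zpow (-1)"
abbreviation "cs \<equiv> cst sqrt_q"
abbreviation "ci \<equiv> cst (inverse sqrt_q)"

lemma ZW: "zZ * zW = 1" and SI: "cs * ci = 1"
  by (simp_all add: cst_inverse flip: zpow_add)

lemma T_ZW: "T_pow 1 zZ = cs * zZ" "T_pow 1 zW = ci * zW" "T_pow (-1) zZ = ci * zZ" "T_pow (-1) zW = cs * zW"
  by (simp_all add: T_pow_zpow)

abbreviation sym :: "laurent \<Rightarrow> bool" where "sym f \<equiv> zinv f = f"

abbreviation "zR \<equiv> zZ - zW"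

lemma zR_nz: "zR \<noteq> 0"
proof
  assume "zR = 0"
  then have "lk zR 1 = 0" by simp
  then show False by (simp add: lk_zpow)
qed

lemma lk_zR_mult: "lk (zR * g) j = lk g (j - 1) - lk g (j + 1)"
  by (simp add: left_diff_distrib)

text \<open>The quotient of z^n - z^(-n) comes by induction in steps of two. An antisymmetric
  \<open>X\<close> is half of \<open>X - zinv X\<close>, which reduces to these.\<close>

lemma antisym_divisible:
  assumes "zinv X = - X"
  obtains g where "zR * g = X" "sym g"
proof -
  have nat: "\<exists>g. zR * g = zpow (int n) - zpow (- int n)" for n
  proof (induction n rule: nat_less_induct)
    case (1 n)
    show ?case
    proof (cases "n < 2")
      case True
      then consider "n = 0" | "n = 1" by linarith
      then show ?thesis
      proof cases
        case 1 then show ?thesis by (intro exI[of _ 0]) simp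
      next
        case 2 then show ?thesis by (intro exI[of _ 1]) simp
      qed
    next
      case False
      then obtain g where g: "zR * g = zpow (int (n - 2)) - zpow (- int (n - 2))"
        using 1[rule_format, of "n - 2"] by auto
      have e: "zpow (int n) = zpow (int (n - 2)) * (zZ * zZ)" "zpow (- int n) = zpow (- int (n - 2)) * (zW * zW)"
        "zpow (int (n - 1)) = zpow (int (n - 2)) * zZ" "zpow (- int (n - 1)) = zpow (- int (n - 2)) * zW"
        using False by (simp_all flip: zpow_add)
      have "zR * (g + zpow (int (n - 1)) + zpow (- int (n - 1))) = zpow (int n) - zpow (- int n)"
        using g ZW unfolding e by algebra
      then show ?thesis by blast
    qed
  qed
  have mon: "\<exists>g. zR * g = zpow n - zpow (- n)" for n
  proof (cases "n \<ge> 0")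
    case True then show ?thesis using nat[of "nat n"] by simp
  next
    case False
    then obtain g where "zR * g = zpow (- n) - zpow n" using nat[of "nat (- n)"] by auto
    then have "zR * (- g) = zpow n - zpow (- n)" by (metis minus_diff_eq mult_minus_right)
    then show ?thesis by blast
  qed
  have "\<exists>g. zR * g = f - zinv f" for f
  proof (induction f rule: laurent_induct)
    case (monom c n)
    obtain g where "zR * g = zpow n - zpow (- n)" using mon by blast
    then have "zR * (cst c * g) = cst c * zpow n - zinv (cst c * zpow n)"
      unfolding mult.left_commute[of zR] zinv_monom by (simp only: right_diff_distrib)
    then show ?case by blast
  next
    case (add f h)
    then obtain g g' where "zR * g = f - zinv f" "zR * g' = h - zinv h" by blast
    then have "zR * (g + g') = (f + h) - zinv (f + h)" by (simp add: distrib_left)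
    then show ?case by blast
  qed
  then obtain g where g: "zR * g = X - zinv X" by blast
  have h: "zR * (cst (1/2) * g) = X"
  proof -
    have "zR * (cst (1/2) * g) = cst (1/2) * (zR * g)" by (rule mult.left_commute)
    also have "\<dots> = (cst (1/2) + cst (1/2)) * X" unfolding g assms by (simp add: distrib_right distrib_left)
    also have "cst (1/2) + cst (1/2) = 1" by (simp flip: cst_hom(3))
    finally show ?thesis by simp
  qed
  have "zR * zinv (cst (1/2) * g) = zR * (cst (1/2) * g)"
  proof -
    have "zinv zR = - zR" by simp
    then have "zR * zinv (cst (1/2) * g) = - zinv (zR * (cst (1/2) * g))" by (simp only: zinv_mult mult_minus_left minus_minus)
    then show ?thesis unfolding h assms by simp
  qed
  then have "sym (cst (1/2) * g)" using zR_nz by simp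
  then show thesis using that h by blast
qed

lemma zR_cancel: "zR * f = zR * g \<Longrightarrow> f = g"
  using zR_nz by simp

lemma skew_op:
  assumes "sym f"
  shows "zR * skew_op A f = A * T_pow 1 f - zinv A * T_pow (-1) f" "sym (skew_op A f)"
proof -
  let ?X = "A * T_pow 1 f - zinv A * T_pow (-1) f"
  have "zinv ?X = - ?X" using assms by (simp add: T_pow_zinv)
  then obtain g where g: "zR * g = ?X" "sym g" by (rule antisym_divisible)
  have "skew_op A f = g" unfolding skew_op_def
  proof (rule the_equality)
    show "zR * g = ?X" by (rule g(1))
    show "h = g" if "zR * h = ?X" for h by (rule zR_cancel) (simp only: that g(1))
  qed
  then show "zR * skew_op A f = ?X" "sym (skew_op A f)" using g by simp_all
qed

lemma skew_op_eqI:
  assumes "sym f" "zR * g = A * T_pow 1 f - zinv A * T_pow (-1) f"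
  shows "skew_op A f = g"
  by (rule zR_cancel) (simp only: assms(2) skew_op(1)[OF assms(1)])

lemma skew_op_linear:
  assumes "sym f" "sym g"
  shows "skew_op A (f + g) = skew_op A f + skew_op A g" "skew_op A (cst c * f) = cst c * skew_op A f"
    "skew_op (cst c * A) f = cst c * skew_op A f"
proof -
  note s = skew_op(1)[OF assms(1), of A] skew_op(1)[OF assms(2), of A]
  have "zR * (skew_op A f + skew_op A g) = A * T_pow 1 (f + g) - zinv A * T_pow (-1) (f + g)"
    unfolding distrib_left s by (simp add: algebra_simps)
  then show "skew_op A (f + g) = skew_op A f + skew_op A g"
    using assms by (intro skew_op_eqI) simp_all
  have "zR * (cst c * skew_op A f) = A * T_pow 1 (cst c * f) - zinv A * T_pow (-1) (cst c * f)"
    unfolding mult.left_commute[of zR] s by (simp add: right_diff_distrib mult.left_commute)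
  then show "skew_op A (cst c * f) = cst c * skew_op A f"
    using assms by (intro skew_op_eqI) simp_all
  have "zR * (cst c * skew_op A f) = (cst c * A) * T_pow 1 f - zinv (cst c * A) * T_pow (-1) f"
    unfolding mult.left_commute[of zR] s by (simp add: right_diff_distrib mult.assoc)
  then show "skew_op (cst c * A) f = cst c * skew_op A f"
    using assms by (intro skew_op_eqI)
qed

subsection \<open>Degrees\<close>

text \<open>The bound is an integer because lowering operators and second coordinates lead to degree
  -1; a negative bound forces f = 0.\<close>

definition symdeg :: "int \<Rightarrow> laurent \<Rightarrow> bool" where
  "symdeg n f \<longleftrightarrow> sym f \<and> (\<forall>m. n < \<bar>m\<bar> \<longrightarrow> lk f m = 0)"

lemma symdegI: "sym f \<Longrightarrow> (\<And>m. m > n \<Longrightarrow> lk f m = 0) \<Longrightarrow> symdeg n f"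
  unfolding symdeg_def by (metis abs_if lk_zinv)

lemma symdeg_sym: "symdeg n f \<Longrightarrow> sym f"
  by (simp add: symdeg_def)

lemma symdeg_lin: "symdeg n f \<Longrightarrow> symdeg n g \<Longrightarrow> symdeg n (f + g)" "symdeg n f \<Longrightarrow> symdeg n g \<Longrightarrow> symdeg n (f - g)"
  "symdeg n f \<Longrightarrow> symdeg n (cst c * f)"
  by (simp_all add: symdeg_def)

lemma symdeg_exists: "sym f \<Longrightarrow> \<exists>n::nat. symdeg (int n) f"
proof -
  assume f: "sym f"
  let ?N = "Max (insert 0 (abs ` Poly_Mapping.keys f))"
  have "lk f m = 0" if "?N < \<bar>m\<bar>" for m
  proof (rule ccontr)
    assume "lk f m \<noteq> 0"
    then have "\<bar>m\<bar> \<le> ?N" by (intro Max_ge) (auto simp: in_keys_iff)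
    then show False using that by simp
  qed
  moreover have "0 \<le> ?N" by (intro Max_ge) auto
  ultimately have "symdeg (int (nat ?N)) f" using f unfolding symdeg_def by auto
  then show ?thesis by blast
qed

lemma symdeg_0: "symdeg 0 f \<Longrightarrow> f = cst (lk f 0)"
  by (rule poly_mapping_eqI) (simp add: lk_cst symdeg_def)

lemma symdeg_lower:
  assumes "symdeg n f" "lk f n = 0" shows "symdeg (n - 1) f"
proof (rule symdegI)
  show "sym f" using assms(1) by (rule symdeg_sym)
  show "lk f m = 0" if "m > n - 1" for m
  proof (cases "m = n")
    case False
    then show ?thesis using assms(1) that by (simp add: symdeg_def)
  qed (use assms(2) in simp)
qed

lemma symdeg_neg: "symdeg n f \<Longrightarrow> n < 0 \<Longrightarrow> f = 0"
  by (rule poly_mapping_eqI) (simp add: symdeg_def)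

definition msym :: "nat \<Rightarrow> laurent" where
  "msym n = (if n = 0 then 1 else zpow (int n) + zpow (- int n))"

lemma msym: "symdeg (int n) (msym n)" "lk (msym n) (int n) = 1" "sym (msym n)"
  by (auto simp: symdeg_def msym_def lk_zpow lk_one)

lemma laurent_eq_sum:
  assumes "finite S" "\<And>n. lk B n \<noteq> 0 \<Longrightarrow> n \<in> S"
  shows "B = (\<Sum>i\<in>S. cst (lk B i) * zpow i)"
proof (rule poly_mapping_eqI)
  fix k
  have "lk (\<Sum>i\<in>S. cst (lk B i) * zpow i) k = (\<Sum>i\<in>S. if k = i then lk B i else 0)"
    by (simp add: lookup_sum lk_zpow if_distrib cong: if_cong)
  also have "\<dots> = lk B k" using assms by (auto simp: sum.delta')
  finally show "lk B k = lk (\<Sum>i\<in>S. cst (lk B i) * zpow i) k" by simp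
qed

lemma lk_mult_top:
  assumes B: "\<And>j. e < j \<Longrightarrow> lk B j = 0" and F: "\<And>j. n < j \<Longrightarrow> lk F j = 0"
  shows "e + n < j \<Longrightarrow> lk (B * F) j = 0" "lk (B * F) (e + n) = lk B e * lk F n"
proof -
  let ?S = "insert e (Poly_Mapping.keys B)"
  have eq: "lk (B * F) j = (\<Sum>i\<in>?S. lk B i * lk F (j - i))" for j
  proof -
    have "B * F = (\<Sum>i\<in>?S. cst (lk B i) * (zpow i * F))"
      by (subst laurent_eq_sum[of ?S B]) (auto simp: in_keys_iff sum_distrib_right mult.assoc)
    then show ?thesis by (simp add: lookup_sum)
  qed
  show "lk (B * F) j = 0" if "e + n < j"
    unfolding eq
  proof (rule sum.neutral, rule ballI)
    fix i show "lk B i * lk F (j - i) = 0" using B[of i] F[of "j - i"] that by (cases "e < i") auto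
  qed
  have "lk (B * F) (e + n) = (\<Sum>i\<in>{e}. lk B i * lk F (e + n - i))"
    unfolding eq
  proof (rule sum.mono_neutral_right)
    show "\<forall>i\<in>?S - {e}. lk B i * lk F (e + n - i) = 0"
    proof
      fix i assume "i \<in> ?S - {e}"
      then show "lk B i * lk F (e + n - i) = 0" using B[of i] F[of "e + n - i"] by (cases "e < i") auto
    qed
  qed auto
  then show "lk (B * F) (e + n) = lk B e * lk F n" by simp
qed

lemma skew_op_deg:
  assumes f: "symdeg n f" and B: "\<And>j. e < \<bar>j\<bar> \<Longrightarrow> lk B j = 0"
  shows "symdeg (n + e - 1) (skew_op B f)"
    "lk (skew_op B f) (n + e - 1) = (lk B e * sqrt_q powi n - lk B (- e) * sqrt_q powi (- n)) * lk f n"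
proof -
  define g where "g = skew_op B f"
  define X where "X = B * T_pow 1 f - zinv B * T_pow (-1) f"
  have X: "zR * g = X" and sg: "sym g" using skew_op[OF symdeg_sym[OF f], of B] by (simp_all add: g_def X_def)
  have f0: "n < j \<Longrightarrow> lk f j = 0" for j using f by (auto simp: symdeg_def)
  have B1: "e < j \<Longrightarrow> lk B j = 0" "e < j \<Longrightarrow> lk (zinv B) j = 0" for j using B by auto
  have T0: "n < j \<Longrightarrow> lk (T_pow d f) j = 0" for j d using f0 by simp
  have X0: "lk X j = 0" if "e + n < j" for j
    unfolding X_def using lk_mult_top(1)[OF B1(1) T0 that] lk_mult_top(1)[OF B1(2) T0 that] by simp
  have Xt: "lk X (e + n) = (lk B e * sqrt_q powi n - lk B (- e) * sqrt_q powi (- n)) * lk f n"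
    unfolding X_def using lk_mult_top(2)[OF B1(1) T0] lk_mult_top(2)[OF B1(2) T0] by (simp add: algebra_simps)
  have step: "lk g (j - 1) - lk g (j + 1) = lk X j" for j using lk_zR_mult[of g j] X by simp
  obtain N :: nat where N: "\<And>j. int N < \<bar>j\<bar> \<Longrightarrow> lk g j = 0" using symdeg_exists[OF sg] by (auto simp: symdeg_def)
  \<comment> \<open>Coefficients of \<open>g\<close> two apart differ by a coefficient of
    \<open>X\<close>, which vanishes beyond e + n. They are thus equal up to where the support of
    \<open>g\<close> has ended.\<close>
  have top: "lk g j = 0" if "e + n \<le> j" for j
  proof -
    have "lk g (j + 2 * int k) = lk g j" for k
    proof (induction k)
      case (Suc k)
      have "lk g (j + 2 * int k) - lk g (j + 2 * int k + 2) = 0"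
        using step[of "j + 2 * int k + 1"] X0[of "j + 2 * int k + 1"] that by (simp add: add.assoc)
      then show ?case using Suc by (simp add: algebra_simps)
    qed simp
    from this[of "nat (\<bar>j\<bar> + int N + 1)"] show ?thesis using N[of "j + 2 * (\<bar>j\<bar> + int N + 1)"] by (simp add: abs_if split: if_splits)
  qed
  show "symdeg (n + e - 1) (skew_op B f)"
    using top sg unfolding g_def[symmetric] by (intro symdegI) auto
  show "lk (skew_op B f) (n + e - 1) = (lk B e * sqrt_q powi n - lk B (- e) * sqrt_q powi (- n)) * lk f n"
    using step[of "e + n"] top[of "e + n + 1"] Xt unfolding g_def[symmetric] by (simp add: algebra_simps)
qed

text \<open>Multiplication by \<open>zR\<close> and its shifts under T and T^(-1) clears all
  denominators, so identities between compositions become identities between the coefficients of T^2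
  f, f and T^(-2) f.\<close>

lemma skew_op_comp:
  assumes "sym f"
  shows "zR * ((cs * zZ - ci * zW) * ((ci * zZ - cs * zW) * skew_op A (skew_op B f))) =
     A * (ci * zZ - cs * zW) * (T_pow 1 B * T_pow 2 f - T_pow 1 (zinv B) * f)
     - zinv A * (cs * zZ - ci * zW) * (T_pow (-1) B * f - T_pow (-1) (zinv B) * T_pow (-2) f)"
proof -
  define X where "X = skew_op B f"
  have X: "zR * X = B * T_pow 1 f - zinv B * T_pow (-1) f" "sym X" using skew_op[OF assms] by (simp_all add: X_def)
  have 1: "(cs * zZ - ci * zW) * T_pow 1 X = T_pow 1 B * T_pow 2 f - T_pow 1 (zinv B) * f"
    using arg_cong[OF X(1), of "T_pow 1"] by (simp add: T_ZW T_pow_T_pow)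
  have 2: "(ci * zZ - cs * zW) * T_pow (-1) X = T_pow (-1) B * f - T_pow (-1) (zinv B) * T_pow (-2) f"
    using arg_cong[OF X(1), of "T_pow (-1)"] by (simp add: T_ZW T_pow_T_pow)
  have 3: "zR * skew_op A X = A * T_pow 1 X - zinv A * T_pow (-1) X" using skew_op(1)[OF X(2)] .
  show ?thesis unfolding X_def[symmetric] 1[symmetric] 2[symmetric]
    using 3 by algebra
qed

section \<open>Symmetric shift operators\<close>

definition LF :: "K \<Rightarrow> laurent" where "LF u = 1 - cst u * zZ"
definition LG :: "K \<Rightarrow> laurent" where "LG u = 1 - cst u * zW"

abbreviation "si \<equiv> inverse sqrt_q"

lemma LF_maps [simp]:
  "zinv (LF u) = LG u" "zinv (LG u) = LF u"
  "T_pow 1 (LF u) = LF (u * sqrt_q)" "T_pow (-1) (LF u) = LF (u * si)"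
  "T_pow 1 (LG u) = LG (u * si)" "T_pow (-1) (LG u) = LG (u * sqrt_q)"
  by (simp_all add: LF_def LG_def T_ZW ac_simps)

lemma ss_cancel [simp]: "u * sqrt_q * si = u" "u * si * sqrt_q = u"
  by simp_all

definition Gp :: "laurent \<Rightarrow> laurent" where "Gp f = skew_op 1 f"
text \<open>The arguments of \<open>Gm\<close>, and likewise of \<open>Ep\<close>, are the
  parameters already multiplied by q^(-1/2), that is, those of the target label. The prefactor
  q^(-1/2) of G_- is left out.\<close>

definition Gm :: "K \<Rightarrow> K \<Rightarrow> K \<Rightarrow> K \<Rightarrow> laurent \<Rightarrow> laurent" where
  "Gm a b c d = skew_op (zW * zW * (LF a * LF b * LF c * LF d))"
definition Ep :: "K \<Rightarrow> K \<Rightarrow> laurent \<Rightarrow> laurent" where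
  "Ep a c = skew_op (- (zW * (LF a * LF c)))"

lemma sym_ops [simp]: "sym f \<Longrightarrow> sym (Gp f)" "sym f \<Longrightarrow> sym (Gm a b c d f)" "sym f \<Longrightarrow> sym (Ep a c f)"
  by (simp_all add: Gp_def Gm_def Ep_def skew_op)

section \<open>Commutation relations and product rules\<close>

lemma ring_identity_0:
  fixes Z W s i b d :: "'a::idom"
  assumes "Z * W = 1" "s * i = 1"
  shows "s * s * Z * ((1 - b * i * W) * (1 - d * i * W)) - W * ((1 - b * s * Z) * (1 - d * s * Z)) = s * (s * Z - i * W) * (1 - b * d)"
    "s * s * W * ((1 - b * i * Z) * (1 - d * i * Z)) - Z * ((1 - b * s * W) * (1 - d * s * W)) = - (s * (i * Z - s * W) * (1 - b * d))"
  using assms by algebra+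

text \<open>On both sides the coefficients of \<open>X\<close> and of \<open>Y\<close> agree at
  once. Those of \<open>f\<close> differ by a combination in which \<open>k1\<close> and
  \<open>k2\<close> produce the same multiple of \<open>R1 * R2\<close> with opposite signs.\<close>

lemma ring_identity_1:
  fixes Z W s i P P' Q Q' X Y f B1 B2 B3 B4 R1 R2 e :: "'a::idom"
  assumes ZW: "Z * W = 1" and si: "s * i = 1"
    and k1: "s * s * Z * B2 - W * B1 = s * R1 * e" and k2: "s * s * W * B3 - Z * B4 = - (s * R2 * e)"
  shows "(- (W * P)) * R2 * ((i * W * (i * W) * (Q * B1)) * X - (s * Z * (s * Z) * (P' * B2)) * f)
      - (- (Z * P')) * R1 * ((s * W * (s * W) * (P * B3)) * f - (i * Z * (i * Z) * (Q' * B4)) * Y)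
    = i * ((W * W * (P * B1)) * R2 * ((- (i * W * Q)) * X - (- (s * Z * P')) * f)
      - (Z * Z * (P' * B4)) * R1 * ((- (s * W * P)) * f - (- (i * Z * Q')) * Y))"
    (is "?L = ?R")
proof -
  have "?L - ?R = P * P' * f * (R2 * ((Z * W) * (s * s * Z * B2) - (s * i) * (Z * W) * (W * B1))
     + R1 * ((Z * W) * (s * s * W * B3) - (s * i) * (Z * W) * (Z * B4)))"
    by (simp add: algebra_simps)
  also have "\<dots> = P * P' * f * (R2 * (s * R1 * e) + R1 * (- (s * R2 * e)))"
    unfolding ZW si k1[symmetric] k2[symmetric] by simp
  also have "\<dots> = 0" by (simp add: algebra_simps)
  finally show ?thesis by simp
qed

lemma R12_nz: "cs * zZ - ci * zW \<noteq> 0" "ci * zZ - cs * zW \<noteq> 0"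
proof -
  have "lk (cs * zZ - ci * zW) 1 = sqrt_q" "lk (ci * zZ - cs * zW) 1 = si" by (simp_all add: lk_zpow)
  then show "cs * zZ - ci * zW \<noteq> 0" "ci * zZ - cs * zW \<noteq> 0"
    by (metis gens_nz(5) lookup_zero, metis gens_nz(5) lookup_zero inverse_nonzero_iff_nonzero)
qed

lemma zR12_cancel:
  assumes "zR * ((cs * zZ - ci * zW) * ((ci * zZ - cs * zW) * f)) = zR * ((cs * zZ - ci * zW) * ((ci * zZ - cs * zW) * g))"
  shows "f = g"
  using assms zR_nz R12_nz by simp

lemma LF_scaled: "LF (b * sqrt_q) = 1 - cst b * cs * zZ" "LF (b * si) = 1 - cst b * ci * zZ"
  "LG (b * sqrt_q) = 1 - cst b * cs * zW" "LG (b * si) = 1 - cst b * ci * zW"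
  by (simp_all add: LF_def LG_def)

lemma LF_identity:
  "cs * cs * zZ * (LG (b * si) * LG (d * si)) - zW * (LF (b * sqrt_q) * LF (d * sqrt_q)) = cs * (cs * zZ - ci * zW) * (1 - cst b * cst d)"
  "cs * cs * zW * (LF (b * si) * LF (d * si)) - zZ * (LG (b * sqrt_q) * LG (d * sqrt_q)) = - (cs * (ci * zZ - cs * zW) * (1 - cst b * cst d))"
  unfolding LF_scaled by (rule ring_identity_0[OF ZW SI])+

text \<open>\<open>Ep\<close> carries the image of the raising operator for one label into the image
  for the shifted label. A functional that kills the latter thus becomes, composed with
  \<open>Ep\<close>, one that kills the former.\<close>

lemma Ep_Gm:
  assumes "sym g"
  shows "Ep (a * si) (c * si) (Gm a b c d g) = ci * Gm (a * si) (b * sqrt_q) (c * si) (d * sqrt_q) (Ep a c g)"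
proof (rule zR12_cancel)
  have "zR * ((cs * zZ - ci * zW) * ((ci * zZ - cs * zW) * (ci * Gm (a * si) (b * sqrt_q) (c * si) (d * sqrt_q) (Ep a c g))))
    = ci * (zR * ((cs * zZ - ci * zW) * ((ci * zZ - cs * zW) * (Gm (a * si) (b * sqrt_q) (c * si) (d * sqrt_q) (Ep a c g)))))"
    by (simp only: ac_simps)
  also have "\<dots> = zR * ((cs * zZ - ci * zW) * ((ci * zZ - cs * zW) * Ep (a * si) (c * si) (Gm a b c d g)))"
    unfolding Ep_def Gm_def skew_op_comp[OF assms]
    using ring_identity_1[OF ZW SI LF_identity(1)[of b d] LF_identity(2)[of b d], where P = "LF (a * si) * LF (c * si)" and Q = "LF (a * sqrt_q) * LF (c * sqrt_q)" and X = "T_pow 2 g"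
        and P' = "LG (a * si) * LG (c * si)" and f = g and Q' = "LG (a * sqrt_q) * LG (c * sqrt_q)" and Y = "T_pow (-2) g"]
    by (simp add: T_ZW ac_simps)
  finally show "zR * ((cs * zZ - ci * zW) * ((ci * zZ - cs * zW) * Ep (a * si) (c * si) (Gm a b c d g))) =
     zR * ((cs * zZ - ci * zW) * ((ci * zZ - cs * zW) * (ci * Gm (a * si) (b * sqrt_q) (c * si) (d * sqrt_q) (Ep a c g))))" ..
qed

text \<open>The terms with \<open>G2\<close> and \<open>G2'\<close> cancel between \<open>E\<close>
  and \<open>i * G\<close>; by \<open>k1\<close> and \<open>k2\<close> the remaining ones combine to
  a multiple of \<open>F * g\<close>.\<close>

lemma ring_identity_2:
  fixes Z W s i P P' Tf T'f g G2 G2' R1 R2 TX TX' TY TY' E G F B1 B2 B3 B4 e :: "'a::idom"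
  assumes ZW: "Z * W = 1" and si: "s * i = 1"
    and k1: "s * s * Z * B2 - W * B1 = s * R1 * e" and k2: "s * s * W * B3 - Z * B4 = - (s * R2 * e)"
    and X: "R1 * TX = (- (i * W * B1)) * G2 - (- (s * Z * B2)) * g" "R2 * TX' = (- (s * W * B3)) * g - (- (i * Z * B4)) * G2'"
    and Y: "R1 * TY = G2 - g" "R2 * TY' = g - G2'"
    and E: "(Z - W) * E = (- (W * P)) * (Tf * TX) - (- (Z * P')) * (T'f * TX')"
    and G: "(Z - W) * G = (W * W * (P * B1)) * (Tf * TY) - (Z * Z * (P' * B4)) * (T'f * TY')"
    and F: "(Z - W) * F = (- (W * P)) * Tf - (- (Z * P')) * T'f"
  shows "(Z - W) * (R1 * (R2 * (E - i * G))) = (Z - W) * (R1 * (R2 * (e * (F * g))))"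
proof -
  have "(Z - W) * (R1 * (R2 * (E - i * G))) = R1 * (R2 * ((Z - W) * E - i * ((Z - W) * G)))"
    by (simp add: algebra_simps)
  also have "\<dots> = (- (W * P)) * Tf * R2 * (R1 * TX) - (- (Z * P')) * T'f * R1 * (R2 * TX')
     - i * ((W * W * (P * B1)) * Tf * R2 * (R1 * TY) - (Z * Z * (P' * B4)) * T'f * R1 * (R2 * TY'))"
    unfolding E G by (simp add: algebra_simps)
  also have "\<dots> = P' * T'f * R1 * (i * (Z * Z * B4) - s * (Z * W) * B3) * g - P * Tf * R2 * (s * (Z * W) * B2 - i * (W * W * B1)) * g"
    unfolding X Y by (simp add: algebra_simps)
  also have "\<dots> = P' * T'f * R1 * (i * (Z * Z * B4) - (s * i) * s * (Z * W) * B3) * g - P * Tf * R2 * ((s * i) * s * (Z * W) * B2 - i * (W * W * B1)) * g"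
    unfolding si by simp
  also have "\<dots> = - (P' * T'f * R1 * (i * Z * (s * s * W * B3 - Z * B4)) * g) - P * Tf * R2 * (i * W * (s * s * Z * B2 - W * B1)) * g"
    by (simp add: algebra_simps)
  also have "\<dots> = (s * i) * (e * (R1 * R2 * ((- (W * P)) * Tf - (- (Z * P')) * T'f)) * g)"
    unfolding k1 k2 by (simp add: algebra_simps)
  also have "\<dots> = (Z - W) * (R1 * (R2 * (e * (F * g))))"
    unfolding si F[symmetric] by (simp add: algebra_simps)
  finally show ?thesis .
qed

text \<open>A product rule modulo the image of the raising operator. Under a functional that kills
  this image, it moves the operator from one factor of a product to the other.\<close>

lemma Ep_product:
  assumes f: "sym f" and g: "sym g"
  shows "Ep (a * si) (c * si) (f * Ep b d g) - ci * Gm (a * si) (b * sqrt_q) (c * si) (d * sqrt_q) (f * Gp g)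
    = cst (1 - b * d) * (Ep (a * si) (c * si) f * g)"
proof -
  define X where "X = Ep b d g"
  define Y where "Y = Gp g"
  have sX: "sym X" "sym Y" using g by (simp_all add: X_def Y_def)
  have X: "zR * X = - (zW * (LF b * LF d)) * T_pow 1 g - - (zZ * (LG b * LG d)) * T_pow (-1) g"
    unfolding X_def Ep_def using skew_op(1)[OF g] by simp
  have Y: "zR * Y = T_pow 1 g - T_pow (-1) g"
    unfolding Y_def Gp_def using skew_op(1)[OF g, of 1] by simp
  let ?R1 = "cs * zZ - ci * zW" and ?R2 = "ci * zZ - cs * zW"
  have e1: "?R1 * T_pow 1 X = (- (ci * zW * (LF (b * sqrt_q) * LF (d * sqrt_q)))) * T_pow 2 g - (- (cs * zZ * (LG (b * si) * LG (d * si)))) * g"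
    using arg_cong[OF X, of "T_pow 1"] by (simp add: T_ZW T_pow_T_pow)
  have e2: "?R2 * T_pow (-1) X = (- (cs * zW * (LF (b * si) * LF (d * si)))) * g - (- (ci * zZ * (LG (b * sqrt_q) * LG (d * sqrt_q)))) * T_pow (-2) g"
    using arg_cong[OF X, of "T_pow (-1)"] by (simp add: T_ZW T_pow_T_pow)
  have e3: "?R1 * T_pow 1 Y = T_pow 2 g - g" "?R2 * T_pow (-1) Y = g - T_pow (-2) g"
    using arg_cong[OF Y, of "T_pow 1"] arg_cong[OF Y, of "T_pow (-1)"] by (simp_all add: T_ZW T_pow_T_pow)
  let ?P = "LF (a * si) * LF (c * si)" and ?P' = "LG (a * si) * LG (c * si)"
  have sym2: "sym (f * X)" "sym (f * Y)" using f sX by simp_all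
  have e4: "zR * Ep (a * si) (c * si) (f * X) = (- (zW * ?P)) * (T_pow 1 f * T_pow 1 X) - (- (zZ * ?P')) * (T_pow (-1) f * T_pow (-1) X)"
    unfolding Ep_def using skew_op(1)[OF sym2(1)] by simp
  have e5: "zR * Gm (a * si) (b * sqrt_q) (c * si) (d * sqrt_q) (f * Y) =
     (zW * zW * (?P * (LF (b * sqrt_q) * LF (d * sqrt_q)))) * (T_pow 1 f * T_pow 1 Y) - (zZ * zZ * (?P' * (LG (b * sqrt_q) * LG (d * sqrt_q)))) * (T_pow (-1) f * T_pow (-1) Y)"
    unfolding Gm_def skew_op(1)[OF sym2(2)] by (simp add: ac_simps)
  have e6: "zR * Ep (a * si) (c * si) f = (- (zW * ?P)) * T_pow 1 f - (- (zZ * ?P')) * T_pow (-1) f"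
    unfolding Ep_def using skew_op(1)[OF f] by simp
  have "cst (1 - b * d) = 1 - cst b * cst d" by simp
  then show ?thesis
    using ring_identity_2[OF ZW SI LF_identity e1 e2 e3 e4 e5 e6] zR12_cancel
    unfolding X_def[symmetric] Y_def[symmetric] by presburger
qed

text \<open>\<open>h\<close> replaces f by the average of T f and T^(-1) f. Since f - (T^2 f + f)/2
  = -(T^2 f - f)/2 is a multiple of T (Gp f), the difference is expressed by
  \<open>Gp f\<close>.\<close>

lemma Gm_product:
  assumes f: "sym f" and g: "sym g"
  defines "h \<equiv> cst (1/2) * ((T_pow 1 f + T_pow (-1) f) * g)"
  shows "f * Gm a b c d g - Gm a b c d h =
    cst (-1/2) * skew_op (zW * zW * (LF a * LF b * LF c * LF d) * (cs * zZ - ci * zW)) (Gp f * g)"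
proof (rule zR_cancel)
  define Y where "Y = Gp f"
  define A where "A = zW * zW * (LF a * LF b * LF c * LF d)"
  have Y: "zR * Y = T_pow 1 f - T_pow (-1) f" "sym Y"
    unfolding Y_def Gp_def using skew_op[OF f, of 1] by simp_all
  have e3: "(cs * zZ - ci * zW) * T_pow 1 Y = T_pow 2 f - f" "(ci * zZ - cs * zW) * T_pow (-1) Y = f - T_pow (-2) f"
    using arg_cong[OF Y(1), of "T_pow 1"] arg_cong[OF Y(1), of "T_pow (-1)"] by (simp_all add: T_ZW T_pow_T_pow)
  have sh: "sym h" using f g by (simp add: h_def T_pow_zinv add.commute)
  have e1: "zR * Gm a b c d g = A * T_pow 1 g - zinv A * T_pow (-1) g"
    unfolding Gm_def A_def by (rule skew_op(1)[OF g])
  have e2: "zR * Gm a b c d h = A * T_pow 1 h - zinv A * T_pow (-1) h"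
    unfolding Gm_def A_def by (rule skew_op(1)[OF sh])
  have sYg: "sym (Y * g)" using Y g by simp
  have e4: "zR * skew_op (A * (cs * zZ - ci * zW)) (Y * g) =
     A * ((cs * zZ - ci * zW) * T_pow 1 Y) * T_pow 1 g + zinv A * ((ci * zZ - cs * zW) * T_pow (-1) Y) * T_pow (-1) g"
    unfolding skew_op(1)[OF sYg] by (simp add: algebra_simps)
  have half: "cst (1/2) + cst (1/2) = 1" "cst (-1/2) = - cst (1/2)" by (simp_all flip: cst_hom(3) cst_hom(5))
  have Th: "T_pow 1 h = cst (1/2) * ((T_pow 2 f + f) * T_pow 1 g)" "T_pow (-1) h = cst (1/2) * ((f + T_pow (-2) f) * T_pow (-1) g)"
    by (simp_all add: h_def T_pow_T_pow)
  show "zR * (f * Gm a b c d g - Gm a b c d h) =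
    zR * (cst (-1/2) * skew_op (zW * zW * (LF a * LF b * LF c * LF d) * (cs * zZ - ci * zW)) (Gp f * g))"
    unfolding A_def[symmetric] Y_def[symmetric] half(2)
    using e1 e2 e4 half(1) unfolding Th e3 by algebra
qed

text \<open>Adding instead of subtracting the two terms of the numerator of \<open>Gm\<close> gives
  a symmetric polynomial, and the contributions of g itself cancel on either side. Thus a functional
  that kills the image of \<open>Gm a b c d\<close>, composed with this operator, kills the image
  for the label shifted upwards.\<close>

lemma Hop_Gm:
  assumes g: "sym g"
  shows "skew_op (zW * zW * (LF a * LF b * LF c * LF d) * (cs * zZ - ci * zW)) (Gm (a * sqrt_q) (b * sqrt_q) (c * sqrt_q) (d * sqrt_q) g)
    = Gm a b c d ((zW * zW * (LF (a * sqrt_q) * LF (b * sqrt_q) * LF (c * sqrt_q) * LF (d * sqrt_q))) * T_pow 1 g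
       + (zZ * zZ * (LG (a * sqrt_q) * LG (b * sqrt_q) * LG (c * sqrt_q) * LG (d * sqrt_q))) * T_pow (-1) g)"
proof -
  define M where "M = LF a * LF b * LF c * LF d"
  define M' where "M' = LG a * LG b * LG c * LG d"
  define N where "N = LF (a * sqrt_q) * LF (b * sqrt_q) * LF (c * sqrt_q) * LF (d * sqrt_q)"
  define N' where "N' = LG (a * sqrt_q) * LG (b * sqrt_q) * LG (c * sqrt_q) * LG (d * sqrt_q)"
  have z: "zinv M = M'" "zinv N = N'" "zinv N' = N" "T_pow (-1) N = M" "T_pow 1 N' = M'"
    by (simp_all add: M_def M'_def N_def N'_def)
  define Y where "Y = Gm (a * sqrt_q) (b * sqrt_q) (c * sqrt_q) (d * sqrt_q) g"
  have Y: "zR * Y = zW * zW * N * T_pow 1 g - zZ * zZ * N' * T_pow (-1) g" "sym Y"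
    unfolding Y_def Gm_def using skew_op[OF g, of "zW * zW * N"] by (simp_all add: z N_def[symmetric])
  have e: "(cs * zZ - ci * zW) * T_pow 1 Y = (ci * zW) * (ci * zW) * T_pow 1 N * T_pow 2 g - (cs * zZ) * (cs * zZ) * M' * g"
    "(ci * zZ - cs * zW) * T_pow (-1) Y = (cs * zW) * (cs * zW) * M * g - (ci * zZ) * (ci * zZ) * T_pow (-1) N' * T_pow (-2) g"
    using arg_cong[OF Y(1), of "T_pow 1"] arg_cong[OF Y(1), of "T_pow (-1)"] by (simp_all add: T_ZW T_pow_T_pow z)
  define h where "h = zW * zW * N * T_pow 1 g + zZ * zZ * N' * T_pow (-1) g"
  have h: "sym h" "T_pow 1 h = (ci * zW) * (ci * zW) * T_pow 1 N * T_pow 2 g + (cs * zZ) * (cs * zZ) * M' * g"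
     "T_pow (-1) h = (cs * zW) * (cs * zW) * M * g + (ci * zZ) * (ci * zZ) * T_pow (-1) N' * T_pow (-2) g"
    using g by (simp_all add: h_def z T_pow_zinv T_ZW T_pow_T_pow add.commute)
  have "zR * Gm a b c d h = zW * zW * M * T_pow 1 h - zZ * zZ * M' * T_pow (-1) h"
    unfolding Gm_def using skew_op(1)[OF h(1), of "zW * zW * M"] by (simp add: z M_def[symmetric])
  also have "\<dots> = zW * zW * M * ((cs * zZ - ci * zW) * T_pow 1 Y) + zZ * zZ * M' * ((ci * zZ - cs * zW) * T_pow (-1) Y)"
  proof -
    have "zW * zW * M * (cs * zZ * (cs * zZ) * M' * g) = zZ * zZ * M' * (cs * zW * (cs * zW) * M * g)" by (simp only: ac_simps)
    then show ?thesis unfolding h(2,3) e by (simp add: distrib_left right_diff_distrib)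
  qed
  also have "\<dots> = zW * zW * M * (cs * zZ - ci * zW) * T_pow 1 Y - zinv (zW * zW * M * (cs * zZ - ci * zW)) * T_pow (-1) Y"
    by (simp add: z algebra_simps)
  finally have "skew_op (zW * zW * M * (cs * zZ - ci * zW)) Y = Gm a b c d h"
    by (rule skew_op_eqI[OF Y(2)])
  then show ?thesis by (simp add: M_def N_def N'_def Y_def h_def)
qed

subsection \<open>Degrees of the shift operators\<close>

text \<open>The leading coefficients in this and the next degree lemmas are the source of the
  scalars in the final formulas.\<close>

lemma Gp_deg:
  assumes "symdeg n f"
  shows "symdeg (n - 1) (Gp f)" "lk (Gp f) (n - 1) = (sqrt_q powi n - sqrt_q powi (- n)) * lk f n"
  using skew_op_deg[OF assms, of 0 1] by (simp_all add: Gp_def lk_one)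

lemma Ep_deg:
  assumes "symdeg n f"
  shows "symdeg n (Ep a c f)" "lk (Ep a c f) n = - (a * c * sqrt_q powi n - sqrt_q powi (- n)) * lk f n"
proof -
  have B: "- (zW * (LF a * LF c)) = cst (a + c) - zW - cst (a * c) * zZ"
    using ZW unfolding LF_def cst_hom by algebra
  have lkB: "lk (- (zW * (LF a * LF c))) j = (if j = 0 then a + c else 0) - (if j = -1 then 1 else 0) - (if j = 1 then a * c else 0)" for j
    unfolding B by (simp add: lk_cst lk_zpow del: cst_hom)
  define C where "C = - (zW * (LF a * LF c))"
  have zero1: "lk C j = 0" if "1 < \<bar>j\<bar>" for j using that unfolding C_def lkB by auto
  have "symdeg (n + 1 - 1) (skew_op C f)" "lk (skew_op C f) (n + 1 - 1) = (lk C 1 * sqrt_q powi n - lk C (- 1) * sqrt_q powi (- n)) * lk f n"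
    using skew_op_deg[OF assms zero1] by blast+
  then show "symdeg n (Ep a c f)" "lk (Ep a c f) n = - (a * c * sqrt_q powi n - sqrt_q powi (- n)) * lk f n"
    unfolding Ep_def C_def[symmetric] by (simp_all add: lkB[folded C_def] algebra_simps)
qed

lemma Gm_expand:
  "zW * zW * (LF a * LF b * LF c * LF d) = zpow (-2) - cst (a + b + c + d) * zW
     + cst (a * b + a * c + a * d + b * c + b * d + c * d) - cst (a * b * c + a * b * d + a * c * d + b * c * d) * zZ + cst (a * b * c * d) * zpow 2"
proof -
  have e: "zpow 2 = zZ * zZ" "zpow (-2) = zW * zW" by (simp_all flip: zpow_add)
  show ?thesis unfolding e LF_def cst_hom using ZW by algebra
qed

lemma Gm_deg:
  assumes "symdeg n f"
  shows "symdeg (n + 1) (Gm a b c d f)" "lk (Gm a b c d f) (n + 1) = (a * b * c * d * sqrt_q powi n - sqrt_q powi (- n)) * lk f n"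
proof -
  have lkB: "lk (zW * zW * (LF a * LF b * LF c * LF d)) j = (if j = -2 then 1 else 0) - (if j = -1 then a + b + c + d else 0)
      + (if j = 0 then a * b + a * c + a * d + b * c + b * d + c * d else 0)
      - (if j = 1 then a * b * c + a * b * d + a * c * d + b * c * d else 0) + (if j = 2 then a * b * c * d else 0)" for j
    unfolding Gm_expand by (simp add: lk_cst lk_zpow del: cst_hom)
  define C where "C = zW * zW * (LF a * LF b * LF c * LF d)"
  have zero2: "lk C j = 0" if "2 < \<bar>j\<bar>" for j using that unfolding C_def lkB by auto
  have "symdeg (n + 2 - 1) (skew_op C f)" "lk (skew_op C f) (n + 2 - 1) = (lk C 2 * sqrt_q powi n - lk C (- 2) * sqrt_q powi (- n)) * lk f n"
    using skew_op_deg[OF assms zero2] by blast+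
  moreover have "n + 2 - 1 = n + 1" by simp
  ultimately show "symdeg (n + 1) (Gm a b c d f)" "lk (Gm a b c d f) (n + 1) = (a * b * c * d * sqrt_q powi n - sqrt_q powi (- n)) * lk f n"
    unfolding Gm_def C_def[symmetric] by (simp_all add: lkB[folded C_def])
qed

lemma ops_of_one:
  "Ep a c 1 = cst (1 - a * c)" "Gp (zZ + zW) = cst (sqrt_q - si)"
  "Gm a b c d 1 = cst (a * b * c * d - 1) * (zZ + zW) + cst ((a + b + c + d) - (a * b * c + a * b * d + a * c * d + b * c * d))"
proof -
  have s1: "sym 1" "sym (zZ + zW)" by (simp_all add: add.commute)
  show "Ep a c 1 = cst (1 - a * c)"
    unfolding Ep_def by (rule skew_op_eqI[OF s1(1)], unfold zinv_mult zinv_add LF_maps, unfold LF_def LG_def cst_hom T_pow_0 zinv_zpow minus_minus)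
      (use ZW in algebra)
  show "Gp (zZ + zW) = cst (sqrt_q - si)"
    unfolding Gp_def by (rule skew_op_eqI[OF s1(2)]) (simp add: T_ZW algebra_simps)
  show "Gm a b c d 1 = cst (a * b * c * d - 1) * (zZ + zW) + cst ((a + b + c + d) - (a * b * c + a * b * d + a * c * d + b * c * d))"
    unfolding Gm_def by (rule skew_op_eqI[OF s1(1)], unfold zinv_mult zinv_add LF_maps, unfold LF_def LG_def cst_hom T_pow_0 zinv_zpow minus_minus)
      (use ZW in algebra)
qed

section \<open>Functionals on symmetric Laurent polynomials\<close>

text \<open>Linearity is confined to symmetric arguments because the divided differences are
  meaningful only there.\<close>

definition linf :: "(laurent \<Rightarrow> K) \<Rightarrow> bool" where
  "linf \<phi> \<longleftrightarrow> (\<forall>f g. sym f \<longrightarrow> sym g \<longrightarrow> \<phi> (f + g) = \<phi> f + \<phi> g) \<and> (\<forall>c f. sym f \<longrightarrow> \<phi> (cst c * f) = c * \<phi> f)"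

lemma linfD:
  assumes "linf \<phi>" "sym f" "sym g"
  shows "\<phi> (f + g) = \<phi> f + \<phi> g" "\<phi> (cst c * f) = c * \<phi> f" "\<phi> (f - g) = \<phi> f - \<phi> g" "\<phi> (cst c) = c * \<phi> 1"
    "\<phi> (- f) = - \<phi> f"
proof -
  show a: "\<phi> (f + g) = \<phi> f + \<phi> g" and m: "\<phi> (cst c * f) = c * \<phi> f"
    using assms by (auto simp: linf_def)
  have "\<phi> (f + cst (-1) * g) = \<phi> f + (-1) * \<phi> g" using assms unfolding linf_def by (metis zinv_cst zinv_mult)
  then show "\<phi> (f - g) = \<phi> f - \<phi> g" by simp
  have "\<phi> (cst (-1) * f) = (-1) * \<phi> f" using assms unfolding linf_def by blast
  then show "\<phi> (- f) = - \<phi> f" by simp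
  have "\<phi> (cst c * 1) = c * \<phi> 1" using assms(1) zinv_0(2) unfolding linf_def by blast
  then show "\<phi> (cst c) = c * \<phi> 1" by simp
qed

text \<open>The raising operator of the symmetric Askey--Wilson polynomials is annihilated by their
  orthogonality functional, and this determines the functional up to a factor.\<close>

definition star :: "K \<Rightarrow> K \<Rightarrow> K \<Rightarrow> K \<Rightarrow> (laurent \<Rightarrow> K) \<Rightarrow> bool" where
  "star a b c d \<phi> \<longleftrightarrow> linf \<phi> \<and> (\<forall>g. sym g \<longrightarrow> \<phi> (Gm a b c d g) = 0)"

lemma linf_ell: "linf (\<lambda>f. ell y (P * f))"
  unfolding linf_def by (simp add: distrib_left mult.left_commute[of P])

lemma sqrt_q_powi_factor:
  assumes "x * sqrt_q powi (2 * n) \<noteq> 1"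
  shows "x * sqrt_q powi n - sqrt_q powi (- n) \<noteq> 0"
proof
  assume *: "x * sqrt_q powi n - sqrt_q powi (- n) = 0"
  have "x * sqrt_q powi (2 * n) = (x * sqrt_q powi n) * sqrt_q powi n"
    unfolding mult_2 by (subst power_int_add) simp_all
  also have "\<dots> = sqrt_q powi (- n) * sqrt_q powi n" using * by simp
  also have "\<dots> = 1" by (simp add: power_int_minus)
  finally show False using assms by simp
qed

definition gen_prod :: "K \<Rightarrow> K \<Rightarrow> K \<Rightarrow> K \<Rightarrow> bool" where
  "gen_prod a b c d \<longleftrightarrow> (\<forall>e::int. a * b * c * d * sqrt_q powi e \<noteq> 1)"

lemma gen_prod_shift:
  assumes "gen_prod a b c d"
  shows "gen_prod (a * sqrt_q powi e1) (b * sqrt_q powi e2) (c * sqrt_q powi e3) (d * sqrt_q powi e4)"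
proof -
  have eq: "(a * sqrt_q powi e1) * (b * sqrt_q powi e2) * (c * sqrt_q powi e3) * (d * sqrt_q powi e4) * sqrt_q powi e =
     a * b * c * d * sqrt_q powi (e1 + e2 + e3 + e4 + e)" for e
    by (simp add: power_int_add ac_simps)
  show ?thesis unfolding gen_prod_def eq using assms unfolding gen_prod_def by blast
qed

text \<open>By genericity \<open>Gm\<close> raises the degree of \<open>msym n\<close> by exactly
  one, so its image and the constants together exhaust the symmetric polynomials.\<close>

lemma star_zero:
  assumes "star a b c d \<nu>" "gen_prod a b c d" "\<nu> 1 = 0" "sym f"
  shows "\<nu> f = 0"
proof -
  have lin: "linf \<nu>" and G: "\<And>g. sym g \<Longrightarrow> \<nu> (Gm a b c d g) = 0" using assms(1) by (auto simp: star_def)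
  have "\<nu> f = 0" if "symdeg (int n) f" for n f
    using that
  proof (induction n arbitrary: f)
    case 0
    then have "f = cst (lk f 0)" by (intro symdeg_0) simp
    then show ?case using linfD(4)[OF lin, of 0 0 "lk f 0"] assms(3) by simp
  next
    case (Suc n)
    define \<kappa> where "\<kappa> = a * b * c * d * sqrt_q powi (int n) - sqrt_q powi (- int n)"
    have "\<kappa> \<noteq> 0" unfolding \<kappa>_def
      by (rule sqrt_q_powi_factor) (use assms(2) in \<open>unfold gen_prod_def, blast\<close>)
    define g where "g = cst (lk f (int n + 1) / \<kappa>) * Gm a b c d (msym n)"
    have d: "symdeg (int n + 1) (Gm a b c d (msym n))" "lk (Gm a b c d (msym n)) (int n + 1) = \<kappa>"
      using Gm_deg[OF msym(1)] by (simp_all add: \<kappa>_def msym(2))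
    have sg: "symdeg (int n + 1) g" unfolding g_def by (rule symdeg_lin(3)[OF d(1)])
    have "symdeg (int n + 1) (f - g)" using Suc.prems sg by (intro symdeg_lin) (simp_all add: add.commute)
    moreover have "lk (f - g) (int n + 1) = 0" using \<open>\<kappa> \<noteq> 0\<close> d(2) by (simp add: g_def)
    ultimately have "symdeg (int n + 1 - 1) (f - g)" by (rule symdeg_lower)
    then have "\<nu> (f - g) = 0" using Suc.IH by simp
    moreover have "\<nu> g = 0" unfolding g_def using linfD(2)[OF lin symdeg_sym[OF d(1)] symdeg_sym[OF d(1)]] G[OF msym(3)] by simp
    ultimately show ?case using linfD(3)[OF lin symdeg_sym[OF Suc.prems] symdeg_sym[OF sg]] by simp
  qed
  then show ?thesis using symdeg_exists[OF assms(4)] by blast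
qed

text \<open>The combination with coefficients \<phi>(1) and -\<mu>(1) vanishes at 1, so it is zero;
  nothing is divided.\<close>

lemma star_unique:
  assumes "star a b c d \<phi>" "star a b c d \<mu>" "gen_prod a b c d" "sym f"
  shows "\<phi> 1 * \<mu> f = \<mu> 1 * \<phi> f"
proof -
  have "linf \<phi>" "linf \<mu>" using assms by (auto simp: star_def)
  then have "star a b c d (\<lambda>f. \<phi> 1 * \<mu> f - \<mu> 1 * \<phi> f)"
    using assms(1,2) unfolding star_def linf_def by (simp add: algebra_simps)
  from star_zero[OF this assms(3) _ assms(4)] show ?thesis by (simp add: mult.commute)
qed

lemma star_first_moment:
  assumes "star a b c d \<phi>"
  shows "(1 - a * b * c * d) * \<phi> (zZ + zW) = ((a + b + c + d) - (a * b * c + a * b * d + a * c * d + b * c * d)) * \<phi> 1"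
proof -
  have lin: "linf \<phi>" using assms by (simp add: star_def)
  have s: "sym (zZ + zW)" by (simp add: add.commute)
  have "0 = \<phi> (Gm a b c d 1)" using assms by (simp add: star_def)
  also have "\<dots> = (a * b * c * d - 1) * \<phi> (zZ + zW) + ((a + b + c + d) - (a * b * c + a * b * d + a * c * d + b * c * d)) * \<phi> 1"
    unfolding ops_of_one using linfD(1)[OF lin, of "cst (a * b * c * d - 1) * (zZ + zW)" "cst ((a + b + c + d) - (a * b * c + a * b * d + a * c * d + b * c * d))"]
      linfD(2)[OF lin s s, of "a * b * c * d - 1"] linfD(4)[OF lin s s] s zinv_cst by (simp del: cst_hom)
  finally show ?thesis by (simp add: algebra_simps)
qed

lemma Gm_perm: "Gm a b c d = Gm b a c d" "Gm a b c d = Gm c b a d" "Gm a b c d = Gm a d c b"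
  "Gm a b c d = Gm a c b d"
  by (simp_all add: Gm_def ac_simps)

lemma star_perm: "star a b c d \<phi> \<longleftrightarrow> star b a c d \<phi>" "star a b c d \<phi> \<longleftrightarrow> star a c b d \<phi>" "star a b c d \<phi> \<longleftrightarrow> star c d a b \<phi>"
  "star a b c d \<phi> \<longleftrightarrow> star b a d c \<phi>"
  by (simp_all add: star_def Gm_def ac_simps)

subsection \<open>Adjointness of the symmetric shift operators\<close>

text \<open>The pullback of \<phi>' along \<open>Ep\<close> kills the raising operator of the label
  of \<phi>, so it is a multiple of \<phi>, determined by the value at 1. The product rule then
  turns this pullback into an adjoint.\<close>

lemma adjoint_Ep:
  assumes l: "star a b c d \<phi>" and l': "star (a * si) (b * sqrt_q) (c * si) (d * sqrt_q) \<phi>'" and g: "gen_prod a b c d"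
    and f: "sym f" and h: "sym h"
  shows "(1 - b * d) * \<phi> 1 * \<phi>' (Ep (a * si) (c * si) f * h) = (1 - (a * si) * (c * si)) * \<phi>' 1 * \<phi> (f * Ep b d h)"
proof -
  have lin: "linf \<phi>" "linf \<phi>'" using l l' by (auto simp: star_def)
  define \<mu> where "\<mu> f = \<phi>' (Ep (a * si) (c * si) f)" for f
  have "star a b c d \<mu>"
  proof -
    have "linf \<mu>" unfolding linf_def \<mu>_def
      using lin(2) by (simp add: Ep_def skew_op_linear[where g = 0] skew_op_linear(1) linfD skew_op)
    moreover have "\<mu> (Gm a b c d g) = 0" if "sym g" for g
      unfolding \<mu>_def Ep_Gm[OF that] using l' that by (simp add: linfD[OF lin(2), of _ 0] star_def)
    ultimately show ?thesis by (simp add: star_def)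
  qed
  from star_unique[OF l this g] have u: "\<phi> 1 * \<mu> x = \<mu> 1 * \<phi> x" if "sym x" for x using that .
  have m1: "\<mu> 1 = (1 - (a * si) * (c * si)) * \<phi>' 1"
    unfolding \<mu>_def ops_of_one by (rule linfD(4)[OF lin(2), of 0 0]) simp_all
  have "(1 - b * d) * \<phi>' (Ep (a * si) (c * si) f * h) = \<phi>' (cst (1 - b * d) * (Ep (a * si) (c * si) f * h))"
    using linfD(2)[OF lin(2), of "Ep (a * si) (c * si) f * h" 0] f h by (simp del: cst_hom)
  also have "\<dots> = \<phi>' (Ep (a * si) (c * si) (f * Ep b d h) - ci * Gm (a * si) (b * sqrt_q) (c * si) (d * sqrt_q) (f * Gp h))"
    unfolding Ep_product[OF f h] ..
  also have "\<dots> = \<mu> (f * Ep b d h)"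
    using linfD(3)[OF lin(2), of "Ep (a * si) (c * si) (f * Ep b d h)" "ci * Gm (a * si) (b * sqrt_q) (c * si) (d * sqrt_q) (f * Gp h)"]
      linfD(2)[OF lin(2), of "Gm (a * si) (b * sqrt_q) (c * si) (d * sqrt_q) (f * Gp h)" 0 si] l' f h
    by (simp add: \<mu>_def star_def)
  finally have "(1 - b * d) * \<phi> 1 * \<phi>' (Ep (a * si) (c * si) f * h) = \<phi> 1 * \<mu> (f * Ep b d h)" by simp
  also have "\<dots> = \<mu> 1 * \<phi> (f * Ep b d h)" using f h by (intro u) simp
  finally show ?thesis unfolding m1 .
qed

text \<open>The same scheme with the operator of \<open>Hop_Gm\<close>. The unknown multiple is
  expressed by testing f = z + 1/z and h = 1, where \<open>Gp f\<close> is the constant q^(1/2) -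
  q^(-1/2).\<close>

lemma adjoint_G:
  assumes l: "star a b c d \<phi>" and l': "star (a * sqrt_q) (b * sqrt_q) (c * sqrt_q) (d * sqrt_q) \<phi>'" and g: "gen_prod a b c d"
    and f: "sym f" and h: "sym h"
  shows "(sqrt_q - si) * \<phi>' 1 * \<phi> (f * Gm a b c d h) = \<phi> ((zZ + zW) * Gm a b c d 1) * \<phi>' (Gp f * h)"
proof -
  have lin: "linf \<phi>" "linf \<phi>'" using l l' by (auto simp: star_def)
  define H where "H = skew_op (zW * zW * (LF a * LF b * LF c * LF d) * (cs * zZ - ci * zW))"
  define \<mu> where "\<mu> f = \<phi> (H f)" for f
  have "star (a * sqrt_q) (b * sqrt_q) (c * sqrt_q) (d * sqrt_q) \<mu>"
  proof -
    have "linf \<mu>" unfolding linf_def \<mu>_def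
      using lin(1) by (simp add: H_def skew_op_linear[where g = 0] skew_op_linear(1) linfD skew_op)
    moreover have "\<mu> (Gm (a * sqrt_q) (b * sqrt_q) (c * sqrt_q) (d * sqrt_q) x) = 0" if "sym x" for x
      unfolding \<mu>_def H_def Hop_Gm[OF that]
      using l that by (simp add: star_def T_pow_zinv add.commute)
    ultimately show ?thesis by (simp add: star_def)
  qed
  moreover have "gen_prod (a * sqrt_q) (b * sqrt_q) (c * sqrt_q) (d * sqrt_q)"
    using gen_prod_shift[OF g, of 1 1 1 1] by simp
  ultimately have u: "\<phi>' 1 * \<mu> x = \<mu> 1 * \<phi>' x" if "sym x" for x using star_unique[OF l'] that by blast
  have key: "\<phi> (f * Gm a b c d h) = - 1/2 * \<mu> (Gp f * h)" if f: "sym f" and h: "sym h" for f h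
  proof -
    define x where "x = cst (1/2) * ((T_pow 1 f + T_pow (-1) f) * h)"
    have x: "sym x" using f h by (simp add: x_def T_pow_zinv add.commute)
    have "\<phi> (f * Gm a b c d h) = \<phi> (f * Gm a b c d h) - \<phi> (Gm a b c d x)" using l x by (simp add: star_def)
    also have "\<dots> = \<phi> (f * Gm a b c d h - Gm a b c d x)"
      using linfD(3)[OF lin(1), of "f * Gm a b c d h" "Gm a b c d x"] f h x by simp
    also have "\<dots> = \<phi> (cst (-1/2) * H (Gp f * h))"
      unfolding x_def Gm_product[OF f h] H_def ..
    also have "\<dots> = (-1/2) * \<phi> (H (Gp f * h))"
      using f h by (intro linfD(2)[OF lin(1), of _ 0]) (simp_all add: H_def skew_op)
    finally show ?thesis by (simp add: \<mu>_def)
  qed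
  have s1: "sym (zZ + zW)" "sym 1" by (simp_all add: add.commute)
  have "\<mu> (cst (sqrt_q - si)) = (sqrt_q - si) * \<mu> 1"
    using \<open>star (a * sqrt_q) (b * sqrt_q) (c * sqrt_q) (d * sqrt_q) \<mu>\<close> linfD(4)[of \<mu> 0 0] by (simp add: star_def del: cst_hom)
  then have k1: "\<phi> ((zZ + zW) * Gm a b c d 1) = - 1/2 * ((sqrt_q - si) * \<mu> 1)"
    unfolding key[OF s1] ops_of_one(2) by (simp del: cst_hom)
  have "\<phi>' 1 * \<phi> (f * Gm a b c d h) = - 1/2 * (\<phi>' 1 * \<mu> (Gp f * h))" unfolding key[OF f h] by simp
  also have "\<dots> = - 1/2 * (\<mu> 1 * \<phi>' (Gp f * h))" using u[of "Gp f * h"] f h by simp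
  finally have e: "\<phi>' 1 * \<phi> (f * Gm a b c d h) = - 1/2 * (\<mu> 1 * \<phi>' (Gp f * h))" .
  have "(sqrt_q - si) * \<phi>' 1 * \<phi> (f * Gm a b c d h) = (sqrt_q - si) * (\<phi>' 1 * \<phi> (f * Gm a b c d h))" by (simp only: mult.assoc)
  also have "\<dots> = \<phi> ((zZ + zW) * Gm a b c d 1) * \<phi>' (Gp f * h)" unfolding e k1 by simp
  finally show ?thesis .
qed

section \<open>The functionals attached to a moment sequence\<close>

text \<open>The second basis element of \<open>B_K\<close>; removing this factor from the weight
  exposes the symmetry z -> 1/z. Its counterpart \<open>eta\<close> belongs to the symmetry z ->
  q/z.\<close>

definition kap :: "K \<Rightarrow> K \<Rightarrow> laurent" where "kap a b = zW * (LF a * LF b)"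
definition eta :: "K \<Rightarrow> K \<Rightarrow> laurent" where "eta c d = zZ * (LG c * LG d)"

lemma kap_expand: "kap a b = zW - cst (a + b) + cst (a * b) * zZ" "eta c d = zZ - cst (c + d) + cst (c * d) * zW"
  unfolding kap_def eta_def LF_def LG_def cst_hom using ZW by algebra+

lemma moment_kap:
  assumes "moment_rel a b c d y" "sym g"
  shows "ell y (kap a b * g) = 0"
proof -
  have "ell y (kap a b * (f + zinv f)) = 0" for f
  proof (induction f rule: laurent_induct)
    case (monom u n)
    have e: "kap a b * (cst u * zpow n + zinv (cst u * zpow n)) = cst u * ((zpow (n - 1) - cst (a + b) * zpow n + cst (a * b) * zpow (n + 1))
        + (zpow (- n - 1) - cst (a + b) * zpow (- n) + cst (a * b) * zpow (1 - n)))"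
    proof -
      have z: "zpow (n - 1) = zW * zpow n" "zpow (n + 1) = zZ * zpow n" "zpow (- n - 1) = zW * zpow (- n)" "zpow (1 - n) = zZ * zpow (- n)"
        by (simp_all only: zpow_add[symmetric]) (rule arg_cong[where f = zpow], simp)+
      show ?thesis unfolding z zinv_monom kap_expand by (simp add: algebra_simps)
    qed
    show ?case unfolding e using assms(1) by (simp add: moment_rel_def del: cst_hom)
  next
    case (add f g)
    then show ?case by (simp add: distrib_left)
  qed
  from this[of g] have "ell y (kap a b * g) + ell y (kap a b * g) = 0" unfolding assms(2) distrib_left ell_add .
  then show ?thesis by (metis mult_2 mult_eq_0_iff zero_neq_numeral)
qed

lemma moment_eta:
  assumes "moment_rel a b c d y" "T_pow (-2) (zinv t) = t"
  shows "ell y (eta c d * t) = 0"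
proof -
  have base: "ell y (eta c d * (zpow (int n) + cst ((sqrt_q ^ 2) ^ n) * zpow (- int n))) = 0" for n
  proof -
    have e: "eta c d * (zpow (int n) + cst ((sqrt_q ^ 2) ^ n) * zpow (- int n)) =
       (zpow (int n + 1) - cst (c + d) * zpow (int n) + cst (c * d) * zpow (int n - 1))
        + cst ((sqrt_q ^ 2) ^ n) * (zpow (1 - int n) - cst (c + d) * zpow (- int n) + cst (c * d) * zpow (- int n - 1))"
    proof -
      have z: "zpow (int n - 1) = zW * zpow (int n)" "zpow (int n + 1) = zZ * zpow (int n)" "zpow (- int n - 1) = zW * zpow (- int n)" "zpow (1 - int n) = zZ * zpow (- int n)"
        by (simp_all only: zpow_add[symmetric]) (rule arg_cong[where f = zpow], simp)+
      show ?thesis unfolding z kap_expand by (simp add: algebra_simps)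
    qed
    show ?thesis unfolding e using assms(1) by (simp add: moment_rel_def del: cst_hom)
  qed
  have "ell y (eta c d * (f + T_pow (-2) (zinv f))) = 0" for f
  proof (induction f rule: laurent_induct)
    case (monom u n)
    have T: "T_pow (-2) (zinv (cst u * zpow n)) = cst u * (cst (sqrt_q powi (2 * n)) * zpow (- n))"
      unfolding zinv_monom T_pow_monom by (simp add: ac_simps)
    have p: "sqrt_q powi (2 * int m) = (sqrt_q ^ 2) ^ m" for m
      by (simp add: power_int_def nat_mult_distrib flip: power_mult)
    show ?case
    proof (cases "n \<ge> 0")
      case True
      then obtain m where n: "n = int m" using zero_le_imp_eq_int by blast
      have "eta c d * (cst u * zpow n + T_pow (-2) (zinv (cst u * zpow n))) = cst u * (eta c d * (zpow (int m) + cst ((sqrt_q ^ 2) ^ m) * zpow (- int m)))"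
        unfolding T unfolding n p by (simp add: algebra_simps del: cst_hom)
      then show ?thesis by (simp only: ell_cst_mult base mult_zero_right)
    next
      case False
      then have "n = - int (nat (- n))" by simp
      then obtain m where n: "n = - int m" by blast
      have q: "cst ((sqrt_q ^ 2) ^ m) * cst (sqrt_q powi (2 * n)) = 1"
      proof -
        have "2 * n = - (2 * int m)" unfolding n by simp
        then have "sqrt_q powi (2 * n) = inverse ((sqrt_q ^ 2) ^ m)" by (simp only: power_int_minus p)
        then show ?thesis by (simp only:) (rule cst_inverse, simp)
      qed
      \<comment> \<open>Multiplication by q^m turns the symmetrization of z^(-m) under z -> q/z into
        the one of z^m, which \<open>base\<close> covers.\<close>
      have "cst ((sqrt_q ^ 2) ^ m) * (eta c d * (cst u * zpow n + T_pow (-2) (zinv (cst u * zpow n)))) =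
         cst u * (eta c d * ((cst ((sqrt_q ^ 2) ^ m) * cst (sqrt_q powi (2 * n))) * zpow (- n) + cst ((sqrt_q ^ 2) ^ m) * zpow n))"
        unfolding T by (simp add: algebra_simps del: cst_hom)
      also have "\<dots> = cst u * (eta c d * (zpow (int m) + cst ((sqrt_q ^ 2) ^ m) * zpow (- int m)))"
        unfolding q by (simp add: n del: cst_hom)
      finally have e2: "cst ((sqrt_q ^ 2) ^ m) * (eta c d * (cst u * zpow n + T_pow (-2) (zinv (cst u * zpow n)))) =
        cst u * (eta c d * (zpow (int m) + cst ((sqrt_q ^ 2) ^ m) * zpow (- int m)))" .
      have "(sqrt_q ^ 2) ^ m * ell y (eta c d * (cst u * zpow n + T_pow (-2) (zinv (cst u * zpow n)))) = u * 0"
        using arg_cong[OF e2, of "ell y"] unfolding ell_cst_mult base .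
      then show ?thesis by simp
    qed
  next
    case (add f g)
    then show ?case by (simp add: distrib_left)
  qed
  from this[of t] have "ell y (eta c d * t) + ell y (eta c d * t) = 0" unfolding assms(2) distrib_left ell_add .
  then show ?thesis by (metis mult_2 mult_eq_0_iff zero_neq_numeral)
qed

section \<open>Symmetric coordinates and functionals that kill the raising operator\<close>

text \<open>The antisymmetric part of f determines f2 by division by z - 1/z. The choices of
  \<open>v\<close> below are z, z^(-1)(1-bz) and \<open>kap a b\<close>.\<close>

lemma sym_decomposition:
  assumes "v - zinv v = cst e * zR" "e \<noteq> 0"
  obtains f1 f2 where "sym f1" "sym f2" "f = f1 + v * f2"
proof -
  have "zinv (f - zinv f) = - (f - zinv f)" by simp
  then obtain g where g: "zR * g = f - zinv f" "sym g" by (rule antisym_divisible)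
  define f2 where "f2 = cst (inverse e) * g"
  have f2: "sym f2" using g(2) by (simp add: f2_def)
  have "(v - zinv v) * f2 = (cst e * cst (inverse e)) * (zR * g)" unfolding assms(1) f2_def by (simp only: ac_simps)
  then have d: "(v - zinv v) * f2 = f - zinv f" using assms(2) g by (simp add: cst_inverse)
  have "zinv (f - v * f2) = f - v * f2"
    using d f2 by (simp add: algebra_simps)
  then show thesis using that f2 by (metis diff_add_cancel)
qed

lemma kap_antisym: "kap a b - zinv (kap a b) = cst (a * b - 1) * zR"
  unfolding kap_expand by (simp add: algebra_simps)

lemma T2_LF: "T_pow (-2) (LF u) = LF (u * si * si)" "T_pow (-2) (LG u) = LG (u * sqrt_q * sqrt_q)"
proof -
  have "T_pow (-2) f = T_pow (-1) (T_pow (-1) f)" for f by (simp add: T_pow_T_pow)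
  then show "T_pow (-2) (LF u) = LF (u * si * si)" "T_pow (-2) (LG u) = LG (u * sqrt_q * sqrt_q)" by simp_all
qed

text \<open>The numerator of \<open>Gm h\<close> is \<open>kap a b\<close> times the reflection of
  \<open>eta c d * t\<close>, antisymmetrized, where t = T^(-1) h is invariant under z -> q/z. In
  the coordinates 1 and \<open>kap a b\<close> it reduces to the first coordinate y1 of
  \<open>eta c d * t\<close>, and \<open>ell y\<close> kills both \<open>eta c d * t\<close> and the
  part with \<open>kap a b\<close>.\<close>

lemma star_lam0:
  assumes y: "moment_rel a b c d y" and g: "gen_par a b c d"
  shows "star a b c d (ell y)"
proof -
  have ab: "a * b - 1 \<noteq> 0" using g unfolding gen_par_def by (metis eq_iff_diff_eq_0 mult.right_neutral power_int_0_right)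
  have "ell y (Gm a b c d h) = 0" if h: "sym h" for h
  proof -
    define t where "t = T_pow (-1) h"
    have t: "T_pow (-2) (zinv t) = t" "zinv t = T_pow 1 h" using h by (simp_all add: t_def T_pow_zinv T_pow_T_pow)
    obtain y1 y2 where yy: "sym y1" "sym y2" "eta c d * t = y1 + kap a b * y2"
      using sym_decomposition[OF kap_antisym ab] .
    have "zR * Gm a b c d h = kap a b * zinv (eta c d * t) - zinv (kap a b) * (eta c d * t)"
      unfolding Gm_def skew_op(1)[OF h] by (simp add: kap_def eta_def t t_def[symmetric] ac_simps)
    also have "\<dots> = (kap a b - zinv (kap a b)) * y1" unfolding yy(3) using yy(1,2) by (simp add: algebra_simps)
    also have "\<dots> = zR * (cst (a * b - 1) * y1)" unfolding kap_antisym by (simp only: ac_simps)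
    finally have "Gm a b c d h = cst (a * b - 1) * y1" by (rule zR_cancel)
    moreover have "ell y y1 = 0"
      using moment_eta[OF y t(1)] moment_kap[OF y yy(2)] unfolding yy(3) by simp
    ultimately show ?thesis by (simp del: cst_hom)
  qed
  then show ?thesis using linf_ell[of y 1] by (simp add: star_def)
qed

text \<open>(1-az)(1-aq/z) is invariant under z -> q/z and may be inserted into
  \<open>moment_eta\<close>. In the coordinates 1 and z^(-1)(1-bz), multiplication by 1-az turns the
  second part into \<open>kap a b\<close> times a symmetric polynomial.\<close>

lemma star_lamA:
  assumes y: "moment_rel a b c d y"
  shows "star (a * sqrt_q * sqrt_q) b c d (\<lambda>f. ell y (LF a * f))"
proof -
  let ?a = "a * sqrt_q * sqrt_q"
  have "ell y (LF a * Gm ?a b c d h) = 0" if h: "sym h" for h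
  proof -
    define t where "t = T_pow (-1) h"
    have t: "T_pow (-2) (zinv t) = t" "zinv t = T_pow 1 h" using h by (simp_all add: t_def T_pow_zinv T_pow_T_pow)
    have v: "zW * LF b - zinv (zW * LF b) = cst (-1) * zR"
    proof -
      have "zW * LF b = zW - cst b" unfolding LF_def using ZW by algebra
      then show ?thesis by simp
    qed
    obtain y1 y2 where yy: "sym y1" "sym y2" "eta c d * (LG ?a * t) = y1 + (zW * LF b) * y2"
      using sym_decomposition[OF v] by (metis neg_equal_0_iff_equal zero_neq_one)
    have "zR * Gm ?a b c d h = zinv (zZ * LG b * (eta c d * (LG ?a * t))) - zZ * LG b * (eta c d * (LG ?a * t))"
      unfolding Gm_def skew_op(1)[OF h] by (simp add: eta_def t t_def[symmetric] ac_simps)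
    also have "\<dots> = (zW * LF b - zinv (zW * LF b)) * y1 + (zW * zZ - zZ * zW) * (LF b * LG b * y2)"
      unfolding yy(3) using yy(1,2) by (simp add: algebra_simps)
    also have "\<dots> = zR * (- y1)" unfolding v by (simp add: algebra_simps)
    finally have G: "Gm ?a b c d h = - y1" by (rule zR_cancel)
    have "T_pow (-2) (zinv (LF a * (LG ?a * t))) = LF a * (LG ?a * t)"
      using t(1) by (simp add: T2_LF)
    from moment_eta[OF y this] have "ell y (LF a * (y1 + (zW * LF b) * y2)) = 0"
      unfolding yy(3)[symmetric] by (simp only: ac_simps)
    moreover have "LF a * (y1 + (zW * LF b) * y2) = LF a * y1 + kap a b * y2"
      by (simp add: kap_def algebra_simps)
    ultimately show ?thesis using moment_kap[OF y yy(2)] unfolding G by simp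
  qed
  then show ?thesis using linf_ell by (simp add: star_def)
qed

lemma moment_rel_swap: "moment_rel a b c d y \<Longrightarrow> moment_rel b a c d y"
  by (simp add: moment_rel_def add.commute mult.commute)

lemma star_lamB:
  assumes y: "moment_rel a b c d y"
  shows "star a (b * sqrt_q * sqrt_q) c d (\<lambda>f. ell y (LF b * f))"
  using star_lamA[OF moment_rel_swap[OF y]] star_perm(1) by blast

text \<open>Now the coordinates are 1 and z. \<open>kap a b * X\<close> is \<open>eta c d\<close>
  times a polynomial invariant under z -> q/z, and modulo \<open>kap a b\<close> times symmetric
  polynomials it leaves (1-az)(1-bz) y2, where \<open>Gm\<close> gives -y2.\<close>

lemma star_rho:
  assumes y: "moment_rel a b c d y"
  shows "star (a * sqrt_q * sqrt_q) (b * sqrt_q * sqrt_q) c d (\<lambda>f. ell y (LF a * LF b * f))"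
proof -
  let ?a = "a * sqrt_q * sqrt_q" and ?b = "b * sqrt_q * sqrt_q"
  have "ell y (LF a * LF b * Gm ?a ?b c d h) = 0" if h: "sym h" for h
  proof -
    define t where "t = T_pow (-1) h"
    have t: "T_pow (-2) (zinv t) = t" "zinv t = T_pow 1 h" using h by (simp_all add: t_def T_pow_zinv T_pow_T_pow)
    define X where "X = zZ * LG ?a * LG ?b * (eta c d * t)"
    have v: "zZ - zinv zZ = cst 1 * zR" by simp
    obtain y1 y2 where yy: "sym y1" "sym y2" "X = y1 + zZ * y2"
      using sym_decomposition[OF v] by (metis zero_neq_one)
    have "zR * Gm ?a ?b c d h = zinv X - X"
      unfolding Gm_def skew_op(1)[OF h] by (simp add: X_def eta_def t t_def[symmetric] ac_simps)
    also have "\<dots> = zR * (- y2)" unfolding yy(3) using yy(1,2) by (simp add: algebra_simps)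
    finally have G: "Gm ?a ?b c d h = - y2" by (rule zR_cancel)
    have "T_pow (-2) (zinv (LF a * LG ?a * (LF b * LG ?b) * t)) = LF a * LG ?a * (LF b * LG ?b) * t"
      using t(1) by (simp add: T2_LF)
    from moment_eta[OF y this] have "ell y (eta c d * (LF a * LG ?a * (LF b * LG ?b) * t)) = 0" .
    moreover have "eta c d * (LF a * LG ?a * (LF b * LG ?b) * t) = kap a b * X"
    proof -
      have "kap a b * X = (zZ * zW) * (eta c d * (LF a * LG ?a * (LF b * LG ?b) * t))"
        unfolding kap_def X_def by (simp only: ac_simps)
      then show ?thesis by (simp add: ZW)
    qed
    moreover have "kap a b * X = kap a b * y1 + LF a * LF b * y2"
    proof -
      have "kap a b * X = kap a b * y1 + (zZ * zW) * (LF a * LF b * y2)"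
        unfolding yy(3) kap_def by (simp only: ac_simps distrib_left)
      then show ?thesis by (simp add: ZW)
    qed
    ultimately show ?thesis using moment_kap[OF y yy(1)] unfolding G by simp
  qed
  then show ?thesis using linf_ell[of y "LF a * LF b"] by (simp add: star_def)
qed

section \<open>Supports and orthogonality\<close>

definition supp :: "int \<Rightarrow> int \<Rightarrow> laurent \<Rightarrow> bool" where
  "supp lo hi f \<longleftrightarrow> (\<forall>m. lk f m \<noteq> 0 \<longrightarrow> lo \<le> m \<and> m \<le> hi)"

lemma suppD: "supp lo hi f \<Longrightarrow> m < lo \<or> hi < m \<Longrightarrow> lk f m = 0"
  unfolding supp_def by (metis not_le)

text \<open>The monomials before z^(-n) are those with exponents 1-n, ..., n; those before z^(n+1)
  have exponents -n, ..., n.\<close>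

lemma rank_even: "mono_rank m < int (2 * n) \<longleftrightarrow> 1 - int n \<le> m \<and> m \<le> int n"
  and rank_odd: "mono_rank m < int (2 * n + 1) \<longleftrightarrow> - int n \<le> m \<and> m \<le> int n"
  by (auto simp: mono_rank_def)

lemma below_even: "below (2 * n) f \<longleftrightarrow> supp (1 - int n) (int n) f"
  and below_odd: "below (2 * n + 1) f \<longleftrightarrow> supp (- int n) (int n) f"
  unfolding below_def supp_def rank_even rank_odd by simp_all

lemma ell_supp_zero:
  assumes "\<And>m. lo \<le> m \<Longrightarrow> m \<le> hi \<Longrightarrow> ell y (f * zpow (- m)) = 0" "supp (- hi) (- lo) w"
  shows "ell y (f * w) = 0"
proof -
  have w: "w = (\<Sum>i\<in>{- hi..- lo}. cst (lk w i) * zpow i)"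
    by (rule laurent_eq_sum) (use assms(2) in \<open>auto simp: supp_def\<close>)
  have s: "ell y (sum h A) = (\<Sum>i\<in>A. ell y (h i))" for h and A :: "int set"
    by (induction A rule: infinite_finite_induct) simp_all
  have "ell y (f * w) = (\<Sum>i\<in>{- hi..- lo}. lk w i * ell y (f * zpow i))"
    by (subst w) (simp add: sum_distrib_left s mult.left_commute[of f])
  also have "\<dots> = 0"
    by (rule sum.neutral) (use assms(1)[of "- i" for i] in auto)
  finally show ?thesis .
qed

lemma zR_quotient_deg:
  assumes "zR * g = X" "sym g" "\<And>m. N < m \<Longrightarrow> lk X m = 0"
  shows "symdeg (N - 1) g"
proof -
  obtain M :: nat where M: "\<And>j. int M < \<bar>j\<bar> \<Longrightarrow> lk g j = 0" using symdeg_exists[OF assms(2)] by (auto simp: symdeg_def)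
  have step: "lk g (j - 1) - lk g (j + 1) = lk X j" for j using lk_zR_mult[of g j] assms(1) by simp
  have "lk g j = 0" if "N \<le> j" for j
  proof -
    have "lk g (j + 2 * int k) = lk g j" for k
    proof (induction k)
      case (Suc k)
      have "lk g (j + 2 * int k) - lk g (j + 2 * int k + 2) = 0"
        using step[of "j + 2 * int k + 1"] assms(3)[of "j + 2 * int k + 1"] that by (simp add: add.assoc)
      then show ?case using Suc by (simp add: algebra_simps)
    qed simp
    from this[of "nat (\<bar>j\<bar> + int M + 1)"] show ?thesis using M[of "j + 2 * (\<bar>j\<bar> + int M + 1)"] by (simp add: abs_if split: if_splits)
  qed
  then show ?thesis using assms(2) by (intro symdegI) auto
qed

lemma S_decomposition:
  obtains g1 g2 where "sym g1" "sym g2" "f = g1 + zZ * g2"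
proof -
  have "zZ - zinv zZ = cst 1 * zR" by simp
  from sym_decomposition[OF this, of f] show thesis using that by auto
qed

text \<open>e = 0 serves E_(-n) and e = 1 serves E_(n+1). The bound n may be -1, which arises in
  \<open>SS_orth\<close>; this is why negative n are treated separately.\<close>

lemma S_decomposition_deg:
  assumes "sym g1" "sym g2" "f = g1 + zZ * g2" and s: "supp (- n) (n + e) f" and e: "e = 0 \<or> e = 1"
  shows "symdeg n g1" "symdeg (n + e - 1) g2" "lk f (- n) = lk g1 n" "lk f (n + 1) = lk g2 n"
proof -
  have "zR * g2 = f - zinv f" using assms(1-3) by (simp add: algebra_simps)
  moreover have "lk (f - zinv f) m = 0" if "n + e < m" for m using suppD[OF s, of m] suppD[OF s, of "- m"] that e by auto
  ultimately show g2: "symdeg (n + e - 1) g2" using assms(2) zR_quotient_deg by blast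
  have l: "lk f m = lk g1 m + lk g2 (m - 1)" for m using assms(3) by simp
  have g20: "lk g2 m = 0" if "n < \<bar>m\<bar>" for m using g2 e that by (auto simp: symdeg_def)
  show g1: "symdeg n g1"
  proof (rule symdegI[OF assms(1)])
    fix m assume m: "n < m"
    have "lk g1 m = lk g1 (- m)" using assms(1) by (metis lk_zinv)
    moreover have "lk f (- m) = 0" using suppD[OF s] m by auto
    moreover have "lk g2 (- m - 1) = 0"
    proof (cases "n < 0")
      case True
      then show ?thesis using g2 e m by (cases "m \<ge> 0") (auto simp: symdeg_def abs_if split: if_splits)
    qed (use g20 m in auto)
    ultimately show "lk g1 m = 0" using l[of "- m"] by simp
  qed
  have "lk g1 (- n) = lk g1 n" by (metis assms(1) lk_zinv)
  show "lk f (- n) = lk g1 n"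
  proof (cases "n < 0")
    case True
    then have "g1 = 0" using symdeg_neg[OF g1] by simp
    moreover have "g2 = 0 \<or> n + e - 1 = 0 \<and> False" using True e symdeg_neg[OF g2] by auto
    ultimately show ?thesis using assms(3) by simp
  next
    case False
    then have "lk g2 (- n - 1) = 0" using g20 by auto
    then show ?thesis using l[of "- n"] \<open>lk g1 (- n) = lk g1 n\<close> by simp
  qed
  show "lk f (n + 1) = lk g2 n"
  proof (cases "n < 0")
    case True
    have "g1 = 0" using symdeg_neg[OF g1 True] .
    then show ?thesis using l[of "n + 1"] by simp
  next
    case False
    then have "lk g1 (n + 1) = 0" using g1 by (simp add: symdeg_def)
    then show ?thesis using l[of "n + 1"] by simp
  qed
qed

lemma symdeg_uminus: "symdeg n f \<Longrightarrow> symdeg n (- f)"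
  by (simp add: symdeg_def)

lemma symdeg_supp: "symdeg n f \<Longrightarrow> supp (- n) n f"
  unfolding supp_def
proof (intro allI impI)
  fix m assume "symdeg n f" "lk f m \<noteq> 0"
  then have "\<not> n < \<bar>m\<bar>" by (auto simp: symdeg_def)
  then show "- n \<le> m \<and> m \<le> n" by auto
qed

lemma supp_S: "symdeg n g1 \<Longrightarrow> symdeg (n + e - 1) g2 \<Longrightarrow> e = 0 \<or> e = 1 \<Longrightarrow> supp (- n) (n + e) (g1 + zZ * g2)"
  unfolding supp_def
proof (intro allI impI)
  fix m assume g: "symdeg n g1" "symdeg (n + e - 1) g2" "e = 0 \<or> e = 1" and "lk (g1 + zZ * g2) m \<noteq> 0"
  then have "lk g1 m \<noteq> 0 \<or> lk g2 (m - 1) \<noteq> 0" by auto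
  then have "\<not> n < \<bar>m\<bar> \<or> \<not> n + e - 1 < \<bar>m - 1\<bar>" using g by (auto simp: symdeg_def)
  then show "- n \<le> m \<and> m \<le> n + e" using g(3) by auto
qed

lemma symdeg_mono: "symdeg n f \<Longrightarrow> n \<le> m \<Longrightarrow> symdeg m f"
  by (simp add: symdeg_def)

lemma symdeg_remainder:
  assumes "symdeg (int n) w"
  obtains w0 where "symdeg (int n - 1) w0" "w = cst (lk w (int n)) * msym n + w0"
proof -
  have "symdeg (int n) (w - cst (lk w (int n)) * msym n)" "lk (w - cst (lk w (int n)) * msym n) (int n) = 0"
    using assms msym(1,2) by (simp_all add: symdeg_lin)
  then have "symdeg (int n - 1) (w - cst (lk w (int n)) * msym n)" by (rule symdeg_lower)
  then show thesis using that by (metis add.commute diff_add_cancel)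
qed

section \<open>Operators of Steinberg type\<close>

text \<open>On symmetric \<open>f\<close> these are the orthogonality functionals with the labels \<open>k + \<epsilon>\<^sub>1\<close> (for \<open>u = a\<close>) and \<open>k + \<epsilon>\<^sub>2\<close> (for \<open>u = b\<close>);
  \<open>rhov\<close> below belongs to \<open>k + \<epsilon>\<^sub>1 + \<epsilon>\<^sub>2\<close>.\<close>

abbreviation "lamv y u f \<equiv> ell y (LF u * f)"

lemma lamv_expand: "lamv y u (F * (cst k * m + v)) = k * lamv y u (F * m) + lamv y u (F * v)"
proof -
  have "LF u * (F * (cst k * m + v)) = cst k * (LF u * (F * m)) + LF u * (F * v)" by (simp only: algebra_simps)
  then show ?thesis by (simp only: ell_add ell_cst_mult)
qed

text \<open>z^(-1)(1-az) and z^(-1)(1-bz) differ by the constant b - a. Hence all products, the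
  mixed ones included, are \<open>kap a b\<close> times symmetric polynomials up to the two diagonal
  terms. The factor z^(-1) on the right is harmless, as test monomials can be written z^(-1)
  z^(1-m).\<close>

lemma S_pairing:
  assumes y: "moment_rel a b c d y" and s: "sym F1" "sym F2" "sym w1" "sym w2"
  shows "ell y ((LF a * F1 + LF b * F2) * (zW * (LF a * w1 + LF b * w2))) = (b - a) * (lamv y a (F1 * w1) - lamv y b (F2 * w2))"
proof -
  have W: "zW * LF a = zW * LF b + cst (b - a)" "zW * LF b = zW * LF a - cst (b - a)"
    unfolding LF_def cst_hom using ZW by algebra+
  have "(LF a * F1 + LF b * F2) * (zW * (LF a * w1 + LF b * w2)) =
    (zW * LF a) * LF a * (F1 * w1) + kap a b * (F1 * w2 + F2 * w1) + (zW * LF b) * LF b * (F2 * w2)"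
    by (simp add: kap_def algebra_simps)
  also have "\<dots> = kap a b * (F1 * w1 + (F1 * w2 + F2 * w1) + F2 * w2) + cst (b - a) * (LF a * (F1 * w1)) - cst (b - a) * (LF b * (F2 * w2))"
  proof -
    have t1: "zW * LF a * LF a * x = kap a b * x + cst (b - a) * (LF a * x)" for x
      by (subst W(1)) (simp add: kap_def algebra_simps)
    have t2: "zW * LF b * LF b * x = kap a b * x - cst (b - a) * (LF b * x)" for x
      by (subst W(2)) (simp add: kap_def algebra_simps)
    show ?thesis unfolding t1 t2 by (simp only: algebra_simps)
  qed
  finally have e: "(LF a * F1 + LF b * F2) * (zW * (LF a * w1 + LF b * w2)) =
    kap a b * (F1 * w1 + (F1 * w2 + F2 * w1) + F2 * w2) + cst (b - a) * (LF a * (F1 * w1)) - cst (b - a) * (LF b * (F2 * w2))" .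
  have "ell y (kap a b * (F1 * w1 + (F1 * w2 + F2 * w1) + F2 * w2)) = 0"
    by (rule moment_kap[OF y]) (use s in simp)
  then show ?thesis unfolding e by (simp add: right_diff_distrib del: cst_hom)
qed

lemma S_coordinates:
  assumes "a \<noteq> b"
  shows "g1 + zZ * g2 = LF a * (cst (1 / (b - a)) * (cst b * g1 + g2)) + LF b * (cst (1 / (b - a)) * (- (cst a * g1 + g2)))"
proof -
  have "LF a * (cst (1 / (b - a)) * (cst b * g1 + g2)) + LF b * (cst (1 / (b - a)) * (- (cst a * g1 + g2))) =
    cst (1 / (b - a)) * (LF a * (cst b * g1 + g2) - LF b * (cst a * g1 + g2))" by (simp add: algebra_simps)
  also have "LF a * (cst b * g1 + g2) - LF b * (cst a * g1 + g2) = cst (b - a) * (g1 + zZ * g2)"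
    unfolding LF_def by (simp add: algebra_simps)
  also have "cst (1 / (b - a)) * (cst (b - a) * (g1 + zZ * g2)) = (cst (b - a) * cst (inverse (b - a))) * (g1 + zZ * g2)"
    by (simp only: inverse_eq_divide ac_simps)
  also have "\<dots> = g1 + zZ * g2" using assms by (simp add: cst_inverse del: cst_hom)
  finally show ?thesis by simp
qed

lemma LF_split: "LF a * F1 + LF b * F2 = (F1 + F2) + zZ * (- (cst a * F1 + cst b * F2))"
  unfolding LF_def by (simp add: algebra_simps)

lemma lk_W_LF: "lk (zW * (LF a * w)) m = lk w (m + 1) - a * lk w m"
proof -
  have "zW * (LF a * w) = zW * w - cst a * w" unfolding LF_def using ZW by algebra
  then show ?thesis by simp
qed

lemma supp_LF_W: "symdeg n w \<Longrightarrow> supp (- n - 1) n (zW * (LF a * w))"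
  unfolding supp_def lk_W_LF symdeg_def
proof (intro allI impI)
  fix m assume w: "zinv w = w \<and> (\<forall>m. n < \<bar>m\<bar> \<longrightarrow> lk w m = 0)" and m: "lk w (m + 1) - a * lk w m \<noteq> 0"
  then have "lk w (m + 1) \<noteq> 0 \<or> lk w m \<noteq> 0" by auto
  then have "\<not> n < \<bar>m + 1\<bar> \<or> \<not> n < \<bar>m\<bar>" using w by blast
  then show "- n - 1 \<le> m \<and> m \<le> n" by auto
qed

text \<open>\<open>A1\<close>, \<open>A2\<close> are the adjoints of \<open>S1\<close>, \<open>S2\<close>; the common factor \<open>e\<close> makes the extra orthogonality
  condition of \<open>E\<^bsub>n+1\<^esub>\<close> carry over.\<close>

locale S_shift =
  fixes a b c d a' b' c' d' :: K and y y' :: "int \<Rightarrow> K" and S1 S2 A1 A2 :: "laurent \<Rightarrow> laurent"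
    and e \<omega> :: K and \<delta> :: int and \<sigma> \<tau> :: "int \<Rightarrow> K"
  assumes y: "moment_rel a b c d y" and y': "moment_rel a' b' c' d' y'"
    and ab: "a \<noteq> b" "a = \<omega> * a'" "b = \<omega> * b'" "\<omega> \<noteq> 0"
    and S_deg: "\<And>n f. symdeg n f \<Longrightarrow> symdeg (n + \<delta>) (S1 f) \<and> lk (S1 f) (n + \<delta>) = \<sigma> n * lk f n"
      "\<And>n f. symdeg n f \<Longrightarrow> symdeg (n + \<delta>) (S2 f) \<and> lk (S2 f) (n + \<delta>) = \<sigma> n * lk f n"
    and A_deg: "\<And>n f. symdeg n f \<Longrightarrow> symdeg (n - \<delta>) (A1 f) \<and> lk (A1 f) (n - \<delta>) = \<tau> n * lk f n"
      "\<And>n f. symdeg n f \<Longrightarrow> symdeg (n - \<delta>) (A2 f) \<and> lk (A2 f) (n - \<delta>) = \<tau> n * lk f n"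
    and adj: "\<And>f g. sym f \<Longrightarrow> sym g \<Longrightarrow> lamv y' a' (S1 f * g) = e * lamv y a (f * A1 g)"
      "\<And>f g. sym f \<Longrightarrow> sym g \<Longrightarrow> lamv y' b' (S2 f * g) = e * lamv y b (f * A2 g)"
begin

text \<open>The factor \<omega> = a/a' = b/b' comes from the entries -1/a and -1/b of
  \<open>V_mat\<close>, taken at two labels.\<close>

definition SS :: "laurent \<Rightarrow> laurent \<Rightarrow> laurent" where
  "SS F1 F2 = cst \<omega> * (LF a' * S1 F1 + LF b' * S2 F2)"

lemma ab': "a' \<noteq> b'" using ab by auto

text \<open>For w of degree n-1 the test functions z^(-1)(1-az)w and z^(-1)(1-bz)w have exponents in
  -n, ..., n-1, the range of -m, and each isolates one coordinate.\<close>

lemma orth_coordinates: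
  assumes s: "sym F1" "sym F2" and o: "\<And>m. 1 - int n \<le> m \<Longrightarrow> m \<le> int n \<Longrightarrow> ell y ((LF a * F1 + LF b * F2) * zpow (- m)) = 0"
    and w: "symdeg (int n - 1) w"
  shows "lamv y a (F1 * w) = 0" "lamv y b (F2 * w) = 0"
proof -
  have sw: "sym w" using w by (rule symdeg_sym)
  have sup: "supp (- int n) (- (1 - int n)) (zW * (LF u * w))" for u
    using supp_LF_W[OF w, of u] by (simp add: supp_def)
  have "ell y ((LF a * F1 + LF b * F2) * (zW * (LF a * w + LF b * 0))) = 0"
    using ell_supp_zero[OF o sup[of a]] by simp
  then show "lamv y a (F1 * w) = 0"
    unfolding S_pairing[OF y s sw zinv_0(1)] using ab(1) by simp
  have "ell y ((LF a * F1 + LF b * F2) * (zW * (LF a * 0 + LF b * w))) = 0"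
    using ell_supp_zero[OF o sup[of b]] by simp
  then show "lamv y b (F2 * w) = 0"
    unfolding S_pairing[OF y s zinv_0(1) sw] using ab(1) by simp
qed

text \<open>The one additional condition on E_(n+1). Testing with \<open>msym n\<close> itself means
  coordinates \<open>msym n\<close> and \<open>- msym n\<close> up to a constant, so the condition
  couples both functionals.\<close>

lemma orth_coordinates_extra:
  assumes s: "sym F1" "sym F2" and o: "\<And>m. - int n \<le> m \<Longrightarrow> m \<le> int n \<Longrightarrow> ell y ((LF a * F1 + LF b * F2) * zpow (- m)) = 0"
  shows "lamv y a (F1 * msym n) + lamv y b (F2 * msym n) = 0"
proof -
  have e: "zW * (LF a * msym n + LF b * (- msym n)) = cst (b - a) * msym n"
  proof -
    have "LF a * msym n + LF b * (- msym n) = zZ * (cst (b - a) * msym n)" unfolding LF_def by (simp add: algebra_simps)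
    then have "zW * (LF a * msym n + LF b * (- msym n)) = (zZ * zW) * (cst (b - a) * msym n)" by (simp only: ac_simps)
    then show ?thesis by (simp add: ZW)
  qed
  have "supp (- int n) (- (- int n)) (zW * (LF a * msym n + LF b * (- msym n)))"
    unfolding e minus_minus by (rule symdeg_supp[OF symdeg_lin(3)[OF msym(1)]])
  from ell_supp_zero[OF o this] have "(b - a) * (lamv y a (F1 * msym n) - lamv y b (F2 * (- msym n))) = 0"
    using S_pairing[OF y s, of "msym n" "- msym n"] msym(3) by simp
  then show ?thesis using ab(1) by simp
qed

lemma SS_orth:
  assumes s: "sym F1" "sym F2" and n': "int n' = int n + \<delta>"
    and o: "\<And>w. symdeg (int n - 1) w \<Longrightarrow> lamv y a (F1 * w) = 0 \<and> lamv y b (F2 * w) = 0"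
    and sS: "sym (S1 F1)" "sym (S2 F2)" and ee: "\<epsilon> = 0 \<or> \<epsilon> = 1 \<and> lamv y a (F1 * msym n) + lamv y b (F2 * msym n) = 0"
    and m: "1 - int n' - \<epsilon> \<le> m" "m \<le> int n'"
  shows "ell y' (SS F1 F2 * zpow (- m)) = 0"
proof -
  obtain h1 h2 where h: "sym h1" "sym h2" "zpow (1 - m) = h1 + zZ * h2" by (rule S_decomposition)
  define w1 where "w1 = cst (1 / (b' - a')) * (cst b' * h1 + h2)"
  define w2 where "w2 = cst (1 / (b' - a')) * (- (cst a' * h1 + h2))"
  have w: "zpow (1 - m) = LF a' * w1 + LF b' * w2" unfolding h(3) w1_def w2_def by (rule S_coordinates[OF ab'])
  have sw: "sym w1" "sym w2" using h by (simp_all add: w1_def w2_def)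
  have zm: "zpow (- m) = zW * (LF a' * w1 + LF b' * w2)"
    unfolding w[symmetric] by (simp flip: zpow_add)
  have z: "lamv y' a' (S1 F1 * v) = 0 \<and> lamv y' b' (S2 F2 * v) = 0" if "symdeg (int n' - 1) v" for v
    using adj[OF s(1), of v] adj[OF s(2), of v] symdeg_sym[OF that] o[of "A1 v"] o[of "A2 v"] A_deg(1)[OF that] A_deg(2)[OF that] n'
    by (simp add: algebra_simps)
  have key: "lamv y' a' (S1 F1 * w1) - lamv y' b' (S2 F2 * w2) = 0"
  proof (cases "\<epsilon> = 0")
    case True
    have "supp (- (int n' - 1)) ((int n' - 1) + 1) (zpow (1 - m))" using m True by (auto simp: supp_def lk_zpow)
    from S_decomposition_deg(1,2)[OF h this] have "symdeg (int n' - 1) w1" "symdeg (int n' - 1) w2"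
      unfolding w1_def w2_def by (intro symdeg_lin symdeg_uminus; simp)+
    then show ?thesis using z by simp
  next
    case False
    then have x: "lamv y a (F1 * msym n) + lamv y b (F2 * msym n) = 0" and e1: "\<epsilon> = 1" using ee by auto
    have "supp (- int n') (int n' + 1) (zpow (1 - m))" using m e1 by (auto simp: supp_def lk_zpow)
    note D = S_decomposition_deg[OF h this]
    have d: "symdeg (int n') h1" "symdeg (int n') h2" using D(1,2) by simp_all
    \<comment> \<open>z^(1-m) has no term z^(-n'), since m <= n'. Therefore the leading coefficients
      of \<open>w1\<close> and \<open>w2\<close> are opposite, which matches the coupled
      condition.\<close>
    have "lk h1 (int n') = 0" using D(3) m e1 by (simp add: lk_zpow)
    define u where "u = lk h2 (int n') / (b' - a')"
    have dw: "symdeg (int n') w1" "symdeg (int n') w2"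
      unfolding w1_def w2_def using d by (intro symdeg_lin symdeg_uminus; simp)+
    have u: "lk w1 (int n') = u" "lk w2 (int n') = - u"
      using \<open>lk h1 (int n') = 0\<close> by (simp_all add: w1_def w2_def u_def)
    obtain v1 where v1: "symdeg (int n' - 1) v1" "w1 = cst u * msym n' + v1" using symdeg_remainder[OF dw(1)] u by metis
    obtain v2 where v2: "symdeg (int n' - 1) v2" "w2 = cst (- u) * msym n' + v2" using symdeg_remainder[OF dw(2)] u by metis
    have "lamv y' a' (S1 F1 * w1) = u * lamv y' a' (S1 F1 * msym n')"
      "lamv y' b' (S2 F2 * w2) = - u * lamv y' b' (S2 F2 * msym n')"
      unfolding v1(2) v2(2) lamv_expand using z[OF v1(1)] z[OF v2(1)] by simp_all
    moreover have "lamv y' a' (S1 F1 * msym n') + lamv y' b' (S2 F2 * msym n') = 0"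
    proof -
      have n: "int n' - \<delta> = int n" using n' by simp
      have dA: "symdeg (int n) (A1 (msym n'))" "symdeg (int n) (A2 (msym n'))"
        "lk (A1 (msym n')) (int n) = \<tau> (int n')" "lk (A2 (msym n')) (int n) = \<tau> (int n')"
        using A_deg(1)[OF msym(1)[of n']] A_deg(2)[OF msym(1)[of n']] by (simp_all add: n msym(2))
      obtain r1 where r1: "symdeg (int n - 1) r1" "A1 (msym n') = cst (\<tau> (int n')) * msym n + r1" using symdeg_remainder[OF dA(1)] dA(3) by metis
      obtain r2 where r2: "symdeg (int n - 1) r2" "A2 (msym n') = cst (\<tau> (int n')) * msym n + r2" using symdeg_remainder[OF dA(2)] dA(4) by metis
      have "lamv y a (F1 * A1 (msym n')) = \<tau> (int n') * lamv y a (F1 * msym n)"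
        "lamv y b (F2 * A2 (msym n')) = \<tau> (int n') * lamv y b (F2 * msym n)"
        unfolding r1(2) r2(2) lamv_expand using o[OF r1(1)] o[OF r2(1)] by simp_all
      then have "lamv y' a' (S1 F1 * msym n') + lamv y' b' (S2 F2 * msym n') = e * \<tau> (int n') * (lamv y a (F1 * msym n) + lamv y b (F2 * msym n))"
        using adj[OF s(1) msym(3)] adj[OF s(2) msym(3)] by (simp add: algebra_simps)
      then show ?thesis using x by simp
    qed
    ultimately show ?thesis by (simp add: distrib_left[symmetric])
  qed
  have "ell y' (SS F1 F2 * zpow (- m)) = \<omega> * ell y' ((LF a' * S1 F1 + LF b' * S2 F2) * (zW * (LF a' * w1 + LF b' * w2)))"
    unfolding SS_def zm by (simp only: mult.assoc ell_cst_mult)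
  also have "\<dots> = 0" unfolding S_pairing[OF y' sS sw] key by simp
  finally show ?thesis .
qed

lemma SS_split:
  "SS F1 F2 = cst \<omega> * (S1 F1 + S2 F2) + zZ * (- (cst a * S1 F1 + cst b * S2 F2))"
  unfolding SS_def LF_split ab(2,3) by (simp add: algebra_simps)

theorem SS_general:
  assumes s: "sym F1" "sym F2" and sup: "supp (- int n) (int n + \<epsilon>) (LF a * F1 + LF b * F2)" and \<epsilon>: "\<epsilon> = 0 \<or> \<epsilon> = 1"
    and o: "\<And>m. 1 - int n - \<epsilon> \<le> m \<Longrightarrow> m \<le> int n \<Longrightarrow> ell y ((LF a * F1 + LF b * F2) * zpow (- m)) = 0"
    and n': "int n' = int n + \<delta>"
  shows "supp (- int n') (int n' + \<epsilon>) (SS F1 F2)"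
    "1 - int n' - \<epsilon> \<le> m \<Longrightarrow> m \<le> int n' \<Longrightarrow> ell y' (SS F1 F2 * zpow (- m)) = 0"
    "lk (SS F1 F2) (- int n') = \<omega> * \<sigma> (int n) * lk (LF a * F1 + LF b * F2) (- int n)"
    "lk (SS F1 F2) (int n' + 1) = \<sigma> (int n) * lk (LF a * F1 + LF b * F2) (int n + 1)"
proof -
  let ?g1 = "F1 + F2" and ?g2 = "- (cst a * F1 + cst b * F2)"
  have sg: "sym ?g1" "sym ?g2" using s by simp_all
  note D = S_decomposition_deg[OF sg LF_split sup \<epsilon>]
  have d: "symdeg (int n) ?g1" using D(1) .
  have d2: "symdeg (int n) ?g2" using D(2) by (rule symdeg_mono) (use \<epsilon> in auto)
  have F: "F1 = cst (1 / (b - a)) * (cst b * ?g1 + ?g2)" "F2 = cst (1 / (b - a)) * (- (cst a * ?g1 + ?g2))"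
  proof -
    have "cst b * ?g1 + ?g2 = cst (b - a) * F1" "- (cst a * ?g1 + ?g2) = cst (b - a) * F2" by (simp_all add: algebra_simps)
    moreover have "cst (1 / (b - a)) * (cst (b - a) * x) = x" for x
    proof -
      have "cst (1 / (b - a)) * cst (b - a) = cst 1" unfolding cst_hom(4)[symmetric] using ab(1) by simp
      then show ?thesis by (simp only: mult.assoc[symmetric] cst_hom(2) mult_1_left)
    qed
    ultimately show "F1 = cst (1 / (b - a)) * (cst b * ?g1 + ?g2)" "F2 = cst (1 / (b - a)) * (- (cst a * ?g1 + ?g2))" by simp_all
  qed
  have dF: "symdeg (int n) F1" "symdeg (int n) F2"
  proof -
    have "symdeg (int n) (cst (1 / (b - a)) * (cst b * ?g1 + ?g2))" "symdeg (int n) (cst (1 / (b - a)) * (- (cst a * ?g1 + ?g2)))"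
      by (intro symdeg_lin(3) symdeg_uminus symdeg_lin(1) d d2)+
    then show "symdeg (int n) F1" "symdeg (int n) F2" using F by metis+
  qed
  have dS: "symdeg (int n') (S1 F1)" "symdeg (int n') (S2 F2)"
    and lS: "lk (S1 F1) (int n') = \<sigma> (int n) * lk F1 (int n)" "lk (S2 F2) (int n') = \<sigma> (int n) * lk F2 (int n)"
    using S_deg(1)[OF dF(1)] S_deg(2)[OF dF(2)] n' by simp_all
  let ?G1 = "cst \<omega> * (S1 F1 + S2 F2)" and ?G2 = "- (cst a * S1 F1 + cst b * S2 F2)"
  have dG: "symdeg (int n') ?G1" "symdeg (int n') ?G2"
    by (intro symdeg_lin(1,3) symdeg_uminus dS)+
  have lG: "lk ?G1 (int n') = \<omega> * \<sigma> (int n) * lk ?g1 (int n)" "lk ?G2 (int n') = \<sigma> (int n) * lk ?g2 (int n)"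
    by (simp_all add: lS distrib_left right_diff_distrib mult.left_commute)
  \<comment> \<open>For \<epsilon> = 0 the second coordinate lacks its top term. The operators scale
    both leading coefficients by the same \<sigma>, so this is inherited.\<close>
  have dG2: "symdeg (int n' + \<epsilon> - 1) ?G2"
  proof (cases "\<epsilon> = 0")
    case True
    then have "lk ?g2 (int n) = 0" using D(2) unfolding symdeg_def by simp
    then have "lk ?G2 (int n') = 0" unfolding lG(2) by simp
    from symdeg_lower[OF dG(2) this] show ?thesis using True by simp
  qed (use dG(2) \<epsilon> in auto)
  show sup': "supp (- int n') (int n' + \<epsilon>) (SS F1 F2)"
    unfolding SS_split by (rule supp_S[OF dG(1) dG2 \<epsilon>])
  note D' = S_decomposition_deg(3,4)[OF symdeg_sym[OF dG(1)] symdeg_sym[OF dG(2)] SS_split sup' \<epsilon>]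
  show "lk (SS F1 F2) (- int n') = \<omega> * \<sigma> (int n) * lk (LF a * F1 + LF b * F2) (- int n)"
    "lk (SS F1 F2) (int n' + 1) = \<sigma> (int n) * lk (LF a * F1 + LF b * F2) (int n + 1)"
    unfolding D' D(3,4) lG by simp_all
  assume m: "1 - int n' - \<epsilon> \<le> m" "m \<le> int n'"
  have ex: "\<epsilon> = 0 \<or> \<epsilon> = 1 \<and> lamv y a (F1 * msym n) + lamv y b (F2 * msym n) = 0"
    using \<epsilon> orth_coordinates_extra[OF s] o by auto
  have oc: "lamv y a (F1 * w) = 0 \<and> lamv y b (F2 * w) = 0" if "symdeg (int n - 1) w" for w
    using orth_coordinates[OF s _ that] o \<epsilon> by auto
  show "ell y' (SS F1 F2 * zpow (- m)) = 0"
    by (rule SS_orth[OF s n' oc symdeg_sym[OF dS(1)] symdeg_sym[OF dS(2)] ex m])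
qed

end

section \<open>Operators of Koornwinder type\<close>

text \<open>Write k for \<open>kap a b\<close> and k' for its reflection. \<open>ell y\<close> kills
  k(k+k')u, and k-k' = (ab-1)(z-1/z), so k^2 u amounts to (ab-1)/2 times k(z-1/z)u. As k(z+1/z)u is
  killed too, the latter amounts to 2kzu = 2(1-az)(1-bz)u.\<close>

lemma K_pairing:
  assumes y: "moment_rel a b c d y" and s: "sym F1" "sym F2" "sym w1" "sym w2"
  shows "ell y ((F1 + kap a b * F2) * (w1 + kap a b * w2)) = ell y (F1 * w1) - (1 - a * b) * ell y (LF a * LF b * (F2 * w2))"
proof -
  have k2: "kap a b = zinv (kap a b) + cst (a * b - 1) * zR" using kap_antisym[of a b] by (simp add: algebra_simps)
  have sk: "sym (kap a b + zinv (kap a b))" by (simp add: add.commute)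
  have zz: "sym (zZ + zW)" by (simp add: add.commute)
  have kz: "kap a b * zZ = LF a * LF b"
  proof -
    have "kap a b * zZ = (zZ * zW) * (LF a * LF b)" unfolding kap_def by (simp only: ac_simps)
    then show ?thesis by (simp add: ZW)
  qed
  let ?u = "F2 * w2"
  have su: "sym ?u" using s by simp
  have A: "ell y (kap a b * kap a b * ?u) = - ell y (kap a b * zinv (kap a b) * ?u)"
  proof -
    have "ell y (kap a b * ((kap a b + zinv (kap a b)) * ?u)) = 0" by (rule moment_kap[OF y]) (use sk su in \<open>simp only: zinv_mult\<close>)
    then show ?thesis by (simp add: algebra_simps eq_neg_iff_add_eq_0)
  qed
  have B: "ell y (kap a b * kap a b * ?u) = ell y (kap a b * zinv (kap a b) * ?u) + (a * b - 1) * ell y (kap a b * zR * ?u)"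
  proof -
    have "kap a b * kap a b * ?u = kap a b * zinv (kap a b) * ?u + cst (a * b - 1) * (kap a b * zR * ?u)"
      by (subst (2) k2) (simp only: algebra_simps)
    then show ?thesis by (simp only: ell_add ell_cst_mult)
  qed
  have C: "ell y (kap a b * zR * ?u) = 2 * ell y (LF a * LF b * ?u)"
  proof -
    have "ell y (kap a b * ((zZ + zW) * ?u)) = 0" by (rule moment_kap[OF y]) (use zz su in \<open>simp only: zinv_mult\<close>)
    moreover have "kap a b * zR * ?u + kap a b * ((zZ + zW) * ?u) = (kap a b * zZ) * ?u + (kap a b * zZ) * ?u"
      by (simp add: algebra_simps)
    ultimately have "ell y (kap a b * zR * ?u) + 0 = ell y ((kap a b * zZ) * ?u) + ell y ((kap a b * zZ) * ?u)"
      by (metis ell_add)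
    then show ?thesis by (simp add: kz)
  qed
  have "2 * ell y (kap a b * kap a b * ?u) = 2 * ((a * b - 1) * ell y (LF a * LF b * ?u))"
    using A B C by (simp add: algebra_simps)
  then have kk: "ell y (kap a b * kap a b * ?u) = (a * b - 1) * ell y (LF a * LF b * ?u)" by simp
  have "(F1 + kap a b * F2) * (w1 + kap a b * w2) = F1 * w1 + kap a b * (F1 * w2 + F2 * w1) + kap a b * kap a b * ?u"
    by (simp add: algebra_simps)
  moreover have "ell y (kap a b * (F1 * w2 + F2 * w1)) = 0" by (rule moment_kap[OF y]) (use s in simp)
  ultimately show ?thesis by (simp only: ell_add kk; simp add: left_diff_distrib)
qed


lemma K_decomposition:
  assumes "a * b \<noteq> 1"
  obtains f1 f2 where "sym f1" "sym f2" "f = f1 + kap a b * f2"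
  using sym_decomposition[OF kap_antisym, of a b f] assms by auto

lemma lk_kap: "lk (kap a b * f) m = lk f (m + 1) - (a + b) * lk f m + a * b * lk f (m - 1)"
proof -
  have "kap a b * f = zW * f - cst (a + b) * f + cst (a * b) * (zZ * f)"
    unfolding kap_expand by (simp add: algebra_simps)
  then show ?thesis by (simp del: cst_hom)
qed

lemma K_decomposition_deg:
  assumes ab: "a * b \<noteq> 1" and s: "sym f1" "sym f2" "f = f1 + kap a b * f2" and sup: "supp (- n) n f"
  shows "symdeg n f1" "symdeg (n - 1) f2"
    "n \<ge> 0 \<Longrightarrow> lk f n = lk f1 n + a * b * lk f2 (n - 1)" "n \<ge> 0 \<Longrightarrow> lk f (- n) = lk f1 n + lk f2 (n - 1)"
proof -
  have "f - zinv f = (kap a b - zinv (kap a b)) * f2" using s by (simp add: algebra_simps)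
  also have "\<dots> = zR * (cst (a * b - 1) * f2)" unfolding kap_antisym by (simp only: ac_simps)
  finally have e: "zR * (cst (a * b - 1) * f2) = f - zinv f" ..
  have "lk (f - zinv f) m = 0" if "n < m" for m
    using suppD[OF sup, of m] suppD[OF sup, of "- m"] that by auto
  then have "symdeg (n - 1) (cst (a * b - 1) * f2)"
    using zR_quotient_deg[OF e, of n] s(2) by (simp del: cst_hom)
  then show f2: "symdeg (n - 1) f2"
    using s(2) ab unfolding symdeg_def by (simp del: cst_hom)
  have l: "lk f m = lk f1 m + (lk f2 (m + 1) - (a + b) * lk f2 m + a * b * lk f2 (m - 1))" for m
    using s(3) by (simp add: lk_kap)
  have z: "lk f2 m = 0" if "n - 1 < \<bar>m\<bar>" for m using f2 that by (simp add: symdeg_def)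
  show "symdeg n f1"
  proof (rule symdegI[OF s(1)])
    fix m assume m: "n < m"
    have f0: "lk f m = 0" "lk f (- m) = 0" using suppD[OF sup, of m] suppD[OF sup, of "- m"] m by auto
    show "lk f1 m = 0"
    proof (cases "n \<ge> 0")
      case True
      then show ?thesis using l[of m] z[of "m + 1"] z[of m] z[of "m - 1"] f0 m by simp
    next
      case False
      then have "f2 = 0" using symdeg_neg[OF f2] by simp
      then show ?thesis using l[of m] f0 by simp
    qed
  qed
  assume n: "n \<ge> 0"
  show "lk f n = lk f1 n + a * b * lk f2 (n - 1)" using l[of n] z[of "n + 1"] z[of n] n by simp
  have "lk f2 (- n + 1) = lk f2 (n - 1)" "lk f1 (- n) = lk f1 n" using s(1,2) by (metis lk_zinv minus_diff_eq uminus_add_conv_diff diff_minus_eq_add add.commute)+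
  then show "lk f (- n) = lk f1 n + lk f2 (n - 1)" using l[of "- n"] z[of "- n"] z[of "- n - 1"] n by simp
qed

lemma supp_K: "symdeg n f1 \<Longrightarrow> symdeg (n - 1) f2 \<Longrightarrow> supp (- n) n (f1 + kap a b * f2)"
  unfolding supp_def
proof (intro allI impI)
  fix m assume g: "symdeg n f1" "symdeg (n - 1) f2" and "lk (f1 + kap a b * f2) m \<noteq> 0"
  then have "lk f1 m \<noteq> 0 \<or> lk f2 (m + 1) \<noteq> 0 \<or> lk f2 m \<noteq> 0 \<or> lk f2 (m - 1) \<noteq> 0" by (auto simp: lk_kap)
  then have "\<not> n < \<bar>m\<bar> \<or> \<not> n - 1 < \<bar>m + 1\<bar> \<or> \<not> n - 1 < \<bar>m\<bar> \<or> \<not> n - 1 < \<bar>m - 1\<bar>"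
    using g by (auto simp: symdeg_def)
  then show "- n \<le> m \<and> m \<le> n" by auto
qed

abbreviation "rhov y a b f \<equiv> ell y (LF a * LF b * f)"

lemma rhov_expand: "rhov y a b (F * (cst k * m + v)) = k * rhov y a b (F * m) + rhov y a b (F * v)"
proof -
  have "LF a * LF b * (F * (cst k * m + v)) = cst k * (LF a * LF b * (F * m)) + LF a * LF b * (F * v)" by (simp only: algebra_simps)
  then show ?thesis by (simp only: ell_add ell_cst_mult)
qed

lemma ell_expand: "ell y (F * (cst k * m + v)) = k * ell y (F * m) + ell y (F * v)"
proof -
  have "F * (cst k * m + v) = cst k * (F * m) + F * v" by (simp only: algebra_simps)
  then show ?thesis by (simp only: ell_add ell_cst_mult)
qed

text \<open>The second coordinate has degree n-1 when the polynomial has degree n;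
  \<open>S_deg\<close> and \<open>A_deg\<close> still ask for the scalars of index n. The factor
  q^(-1/2) in the second diagonal entry of the operators achieves this.\<close>

locale K_shift =
  fixes a b c d a' b' c' d' :: K and y y' :: "int \<Rightarrow> K" and S1 S2 A1 A2 :: "laurent \<Rightarrow> laurent"
    and e :: K and \<sigma> \<tau> :: "int \<Rightarrow> K"
  assumes y: "moment_rel a b c d y" and y': "moment_rel a' b' c' d' y'"
    and ab: "a' * b' = a * b" "a * b \<noteq> 1"
    and S_deg: "\<And>n f. symdeg n f \<Longrightarrow> symdeg n (S1 f) \<and> lk (S1 f) n = \<sigma> n * lk f n"
      "\<And>n f. symdeg (n - 1) f \<Longrightarrow> symdeg (n - 1) (S2 f) \<and> lk (S2 f) (n - 1) = \<sigma> n * lk f (n - 1)"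
    and A_deg: "\<And>n f. symdeg n f \<Longrightarrow> symdeg n (A1 f) \<and> lk (A1 f) n = \<tau> n * lk f n"
      "\<And>n f. symdeg (n - 1) f \<Longrightarrow> symdeg (n - 1) (A2 f) \<and> lk (A2 f) (n - 1) = \<tau> n * lk f (n - 1)"
    and adj: "\<And>f g. sym f \<Longrightarrow> sym g \<Longrightarrow> ell y' (S1 f * g) = e * ell y (f * A1 g)"
      "\<And>f g. sym f \<Longrightarrow> sym g \<Longrightarrow> rhov y' a' b' (S2 f * g) = e * rhov y a b (f * A2 g)"
begin

definition KK :: "laurent \<Rightarrow> laurent \<Rightarrow> laurent" where
  "KK F1 F2 = S1 F1 + kap a' b' * S2 F2"

text \<open>\<epsilon> = 1 collects the conditions on E_(-n). \<epsilon> = 0 is used for E_n, where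
  the missing term z^(-n) is handled by the formula for the extreme coefficients.\<close>

theorem KK_general:
  assumes s: "sym F1" "sym F2" and sup: "supp (- int n) (int n) (F1 + kap a b * F2)" and \<epsilon>: "\<epsilon> = 0 \<or> \<epsilon> = 1"
    and o: "\<And>m. 1 - int n \<le> m \<Longrightarrow> m \<le> int n - 1 + \<epsilon> \<Longrightarrow> ell y ((F1 + kap a b * F2) * zpow (- m)) = 0"
  shows "supp (- int n) (int n) (KK F1 F2)"
    "1 - int n \<le> m \<Longrightarrow> m \<le> int n - 1 + \<epsilon> \<Longrightarrow> ell y' (KK F1 F2 * zpow (- m)) = 0"
    "lk (KK F1 F2) (- int n) = \<sigma> (int n) * lk (F1 + kap a b * F2) (- int n)"
    "lk (KK F1 F2) (int n) = \<sigma> (int n) * lk (F1 + kap a b * F2) (int n)"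
proof -
  note D = K_decomposition_deg[OF ab(2) s refl sup]
  have dF: "symdeg (int n) F1" "symdeg (int n - 1) F2" using D(1,2) .
  have dS: "symdeg (int n) (S1 F1)" "symdeg (int n - 1) (S2 F2)"
    and lS: "lk (S1 F1) (int n) = \<sigma> (int n) * lk F1 (int n)" "lk (S2 F2) (int n - 1) = \<sigma> (int n) * lk F2 (int n - 1)"
    using S_deg(1)[OF dF(1)] S_deg(2)[OF dF(2)] by simp_all
  note sS = symdeg_sym[OF dS(1)] symdeg_sym[OF dS(2)]
  have ab': "a' * b' \<noteq> 1" using ab by simp
  show sup': "supp (- int n) (int n) (KK F1 F2)"
    unfolding KK_def by (rule supp_K[OF dS])
  note D' = K_decomposition_deg[OF ab' sS KK_def sup']
  show "lk (KK F1 F2) (- int n) = \<sigma> (int n) * lk (F1 + kap a b * F2) (- int n)"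
    "lk (KK F1 F2) (int n) = \<sigma> (int n) * lk (F1 + kap a b * F2) (int n)"
    using D'(3,4) D(3,4) by (simp_all add: lS ab(1) algebra_simps)
  have o1: "ell y (F1 * w) = 0" if w: "symdeg (int n - 1) w" for w
  proof -
    have "supp (- (int n - 1 + \<epsilon>)) (- (1 - int n)) w" using symdeg_supp[OF w] \<epsilon> by (auto simp: supp_def)
    from ell_supp_zero[OF o this] K_pairing[OF y s symdeg_sym[OF w] zinv_0(1)] show ?thesis by simp
  qed
  have o2: "rhov y a b (F2 * w) = 0" if w: "symdeg (int n - 2) w" for w
  proof -
    have "supp (- (int n - 1)) (int n - 1) (0 + kap a b * w)"
      by (rule supp_K) (use w in \<open>simp_all add: symdeg_def\<close>)
    then have "supp (- (int n - 1 + \<epsilon>)) (- (1 - int n)) (0 + kap a b * w)" using \<epsilon> by (auto simp: supp_def)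
    from ell_supp_zero[OF o this] K_pairing[OF y s zinv_0(1) symdeg_sym[OF w]] show ?thesis using ab(2) by simp
  qed
  have z1: "ell y' (S1 F1 * v) = 0" if "symdeg (int n - 1) v" for v
    using adj(1)[OF s(1) symdeg_sym[OF that]] A_deg(1)[OF that] o1 by simp
  have z2: "rhov y' a' b' (S2 F2 * v) = 0" if "symdeg (int n - 2) v" for v
    using adj(2)[OF s(2) symdeg_sym[OF that]] A_deg(2)[of "int n - 1" v] that o2 by simp
  assume m: "1 - int n \<le> m" "m \<le> int n - 1 + \<epsilon>"
  obtain w1 w2 where w: "sym w1" "sym w2" "zpow (- m) = w1 + kap a' b' * w2" using K_decomposition[OF ab'] .
  have pair: "ell y' (KK F1 F2 * zpow (- m)) = ell y' (S1 F1 * w1) - (1 - a' * b') * rhov y' a' b' (S2 F2 * w2)"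
    unfolding KK_def w(3) by (rule K_pairing[OF y' sS w(1,2)])
  show "ell y' (KK F1 F2 * zpow (- m)) = 0"
  proof (cases "\<bar>m\<bar> \<le> int n - 1")
    case True
    then have "supp (- (int n - 1)) (int n - 1) (zpow (- m))" by (auto simp: supp_def lk_zpow)
    from K_decomposition_deg(1,2)[OF ab' w this] show ?thesis unfolding pair using z1 z2 by simp
  next
    case False
    then have m': "m = int n" "\<epsilon> = 1" "n > 0" using m \<epsilon> by auto
    have "supp (- int n) (int n) (zpow (- m))" using m' by (auto simp: supp_def lk_zpow)
    note E = K_decomposition_deg[OF ab' w this]
    define u where "u = lk w2 (int n - 1)"
    \<comment> \<open>z^(-n) has no term z^n, which ties the leading coefficients of its two
      coordinates.\<close>
    have "lk w1 (int n) = - (a * b * u)"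
      using E(3) m' ab(1) by (simp add: u_def lk_zpow eq_neg_iff_add_eq_0)
    then obtain v1 where v1: "symdeg (int n - 1) v1" "w1 = cst (- (a * b * u)) * msym n + v1"
      using symdeg_remainder[OF E(1)] by metis
    have n1: "int (n - 1) = int n - 1" using m' by simp
    have n2: "int n - 1 - 1 = int n - 2" by simp
    note rem = symdeg_remainder[of "n - 1", unfolded n1 n2]
    note mm = msym(1,2)[of "n - 1", unfolded n1]
    obtain v2 where v2: "symdeg (int n - 2) v2" "w2 = cst u * msym (n - 1) + v2"
      using rem[OF E(2)] unfolding u_def by blast
    have dA: "symdeg (int n) (A1 (msym n))" "symdeg (int n - 1) (A2 (msym (n - 1)))"
      "lk (A1 (msym n)) (int n) = \<tau> (int n)" "lk (A2 (msym (n - 1))) (int n - 1) = \<tau> (int n)"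
      using A_deg(1)[OF msym(1)[of n]] A_deg(2)[OF mm(1)] unfolding mm(2) msym(2) by simp_all
    obtain r1 where r1: "symdeg (int n - 1) r1" "A1 (msym n) = cst (\<tau> (int n)) * msym n + r1"
      using symdeg_remainder[OF dA(1)] dA(3) by metis
    obtain r2 where r2: "symdeg (int n - 2) r2" "A2 (msym (n - 1)) = cst (\<tau> (int n)) * msym (n - 1) + r2"
      using rem[OF dA(2)] unfolding dA(4) by blast
    have "symdeg (int n) (cst (- (a * b)) * msym n)" by (rule symdeg_lin(3)[OF msym(1)])
    \<comment> \<open>The coupled condition: -ab \<open>msym n\<close> + \<open>kap a b\<close>
      \<open>msym (n - 1)\<close> is built so that its terms z^n cancel, so it is an admissible test
      function for E_(-n).\<close>
    have x: "a * b * ell y (F1 * msym n) + (1 - a * b) * rhov y a b (F2 * msym (n - 1)) = 0"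
    proof -
      let ?w1 = "cst (- (a * b)) * msym n"
      have dw: "symdeg (int n) ?w1" "symdeg (int n - 1) (msym (n - 1))"
        by (rule symdeg_lin(3)[OF msym(1)], rule mm(1))
      have sw: "supp (- int n) (int n) (?w1 + kap a b * msym (n - 1))" by (rule supp_K[OF dw])
      have "lk (?w1 + kap a b * msym (n - 1)) (int n) = lk ?w1 (int n) + a * b * lk (msym (n - 1)) (int n - 1)"
        by (rule K_decomposition_deg(3)[OF ab(2) symdeg_sym[OF dw(1)] symdeg_sym[OF dw(2)] refl sw]) simp
      also have "\<dots> = 0" unfolding lk_cst_mult mm(2) msym(2) by simp
      finally have "supp (- int n) (int n - 1) (?w1 + kap a b * msym (n - 1))"
        using sw unfolding supp_def by (metis zle_diff1_eq order_le_imp_less_or_eq)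
      then have "supp (- (int n - 1 + \<epsilon>)) (- (1 - int n)) (?w1 + kap a b * msym (n - 1))" using m' by simp
      from ell_supp_zero[OF o this] K_pairing[OF y s symdeg_sym[OF dw(1)] symdeg_sym[OF dw(2)]]
        ell_expand[of y F1 "- (a * b)" "msym n" 0]
      show ?thesis by (simp add: algebra_simps eq_neg_iff_add_eq_0 del: cst_hom)
    qed
    have "ell y' (S1 F1 * w1) = - (a * b * u) * (e * (\<tau> (int n) * ell y (F1 * msym n)))"
      unfolding v1(2) ell_expand z1[OF v1(1)] adj(1)[OF s(1) msym(3)] r1(2) o1[OF r1(1)] by simp
    moreover have "rhov y' a' b' (S2 F2 * w2) = u * (e * (\<tau> (int n) * rhov y a b (F2 * msym (n - 1))))"
      unfolding v2(2) rhov_expand z2[OF v2(1)] adj(2)[OF s(2) msym(3)] r2(2) o2[OF r2(1)] by simp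
    ultimately have "ell y' (KK F1 F2 * zpow (- m)) =
      - (u * e * \<tau> (int n)) * (a * b * ell y (F1 * msym n) + (1 - a * b) * rhov y a b (F2 * msym (n - 1)))"
      unfolding pair ab(1) by (simp add: algebra_simps)
    then show ?thesis unfolding x by simp
  qed
qed

end

section \<open>Normalization constants\<close>

lemma first_moment:
  assumes y: "moment_rel a b c d y"
  shows "(1 - a * b * c * d) * y 1 = (c + d - c * d * (a + b)) * y 0"
proof -
  have 1: "y (-1) - (a + b) * y 0 + a * b * y 1 = 0"
    using moment_kap[OF y zinv_0(2)] ell_cst_mult[of y "a + b" 1] ell_cst_mult[of y "a * b" zZ] by (simp add: kap_expand del: cst_hom)
  have 2: "y 1 - (c + d) * y 0 + c * d * y (-1) = 0"
    using moment_eta[OF y, of 1] ell_cst_mult[of y "c + d" 1] ell_cst_mult[of y "c * d" zW] by (simp add: kap_expand del: cst_hom)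
  show ?thesis using 1 2 by algebra
qed

text \<open>The value of the functionals at k + \<epsilon>1 and k + \<epsilon>2 on 1 is y_0 - u y_1.
  Comparing these values at two labels decides whether the adjointness factors agree.\<close>

lemma lamv_one:
  assumes y: "moment_rel a b c d y"
  shows "(1 - a * b * c * d) * lamv y a 1 = (1 - a * c) * (1 - a * d) * y 0"
    "(1 - a * b * c * d) * lamv y b 1 = (1 - b * c) * (1 - b * d) * y 0"
proof -
  have l: "lamv y u 1 = y 0 - u * y 1" for u
    by (simp add: LF_def left_diff_distrib)
  show "(1 - a * b * c * d) * lamv y a 1 = (1 - a * c) * (1 - a * d) * y 0"
    "(1 - a * b * c * d) * lamv y b 1 = (1 - b * c) * (1 - b * d) * y 0"
    unfolding l using first_moment[OF y] by algebra+
qed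

lemma sym_m1: "sym (zZ + zW)"
  by (simp add: add.commute)

text \<open>Write bz = b(z+1/z) - b/z; then b z^(-1)(1-az) is b \<open>kap a b\<close> + b^2 (1-az),
  where the first summand is killed. This ties the functional at k + \<epsilon>1 + \<epsilon>2 to
  the one at k + \<epsilon>1.\<close>

lemma lamv_rhov:
  assumes y: "moment_rel a b c d y" and f: "sym f"
  shows "rhov y a b f = (1 + b * b) * lamv y a f - b * lamv y a ((zZ + zW) * f)"
proof -
  have "LF a * LF b * f = LF a * f - cst b * (LF a * ((zZ + zW) * f)) + cst b * (zW * (LF a * f))"
    by (simp add: LF_def algebra_simps)
  moreover have "cst b * (zW * (LF a * f)) = cst b * (kap a b * f) + cst b * (cst b * (LF a * f))"
  proof -
    have "kap a b * f = zW * (LF a * f) - (zW * zZ) * (cst b * (LF a * f))" by (simp add: kap_def LF_def algebra_simps)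
    then have "zW * (LF a * f) = kap a b * f + cst b * (LF a * f)" using ZW by (simp add: mult.commute[of zW zZ])
    then show ?thesis by (simp only: distrib_left)
  qed
  ultimately have E: "LF a * LF b * f = LF a * f - cst b * (LF a * ((zZ + zW) * f)) + (cst b * (kap a b * f) + cst b * (cst b * (LF a * f)))"
    by simp
  have "rhov y a b f = lamv y a f - b * lamv y a ((zZ + zW) * f) + (b * 0 + b * (b * lamv y a f))"
    using arg_cong[OF E, of "ell y"] unfolding ell_add ell_diff ell_cst_mult moment_kap[OF y f] .
  then show ?thesis by (simp add: algebra_simps del: ell_add)
qed

lemma rhov_one:
  assumes y: "moment_rel a b c d y"
  shows "(1 - a * b * c * d * sqrt_q * sqrt_q) * rhov y a b 1 =
    (1 - a * b * sqrt_q * sqrt_q) * (1 - b * c) * (1 - b * d) * lamv y a 1"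
proof -
  have r: "rhov y a b 1 = (1 + b * b) * lamv y a 1 - b * lamv y a (zZ + zW)"
    using lamv_rhov[OF y zinv_0(2)] by simp
  have m: "(1 - a * sqrt_q * sqrt_q * b * c * d) * lamv y a (zZ + zW) =
     ((a * sqrt_q * sqrt_q + b + c + d) - (a * sqrt_q * sqrt_q * b * c + a * sqrt_q * sqrt_q * b * d + a * sqrt_q * sqrt_q * c * d + b * c * d)) * lamv y a 1"
    by (rule star_first_moment[OF star_lamA[OF y]])
  show ?thesis unfolding r using m by algebra
qed

text \<open>Evaluates the constant in \<open>adjoint_G\<close>. The functional at k + \<epsilon>1
  kills \<open>G\<close>, so \<open>lamv_rhov\<close> turns the wanted value into
  \<open>rhov y a b G\<close> up to the factor -b; that one follows from the explicit
  \<open>G\<close> and the first moment at k + \<epsilon>1 + \<epsilon>2.\<close>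

lemma lamv_m1_Gm:
  assumes y: "moment_rel a b c d y" and b: "b \<noteq> 0"
  shows "(1 - a * b * c * d * sqrt_q * sqrt_q * sqrt_q * sqrt_q) * lamv y a ((zZ + zW) * Gm (a * sqrt_q * sqrt_q) b c d 1) =
    - ((1 - sqrt_q * sqrt_q) * (1 - c * d) * (1 - a * c * sqrt_q * sqrt_q) * (1 - a * d * sqrt_q * sqrt_q)) * rhov y a b 1"
proof -
  let ?a = "a * sqrt_q * sqrt_q" and ?b = "b * sqrt_q * sqrt_q"
  define G where "G = Gm ?a b c d 1"
  have sG: "sym G" by (simp add: G_def)
  have "lamv y a G = 0" using star_lamA[OF y] by (simp add: star_def G_def)
  then have r: "rhov y a b G = - b * lamv y a ((zZ + zW) * G)" using lamv_rhov[OF y sG] by simp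
  have e: "rhov y a b G = (?a * b * c * d - 1) * rhov y a b (zZ + zW) + ((?a + b + c + d) - (?a * b * c + ?a * b * d + ?a * c * d + b * c * d)) * rhov y a b 1"
  proof -
    have lin: "linf (rhov y a b)" by (rule linf_ell)
    show ?thesis unfolding G_def ops_of_one
      using linfD(1)[OF lin, of "cst (?a * b * c * d - 1) * (zZ + zW)" "cst ((?a + b + c + d) - (?a * b * c + ?a * b * d + ?a * c * d + b * c * d))"]
        linfD(2)[OF lin sym_m1 sym_m1, of "?a * b * c * d - 1"] linfD(4)[OF lin sym_m1 sym_m1] sym_m1 zinv_cst by (simp del: cst_hom)
  qed
  have m: "(1 - ?a * ?b * c * d) * rhov y a b (zZ + zW) =
     ((?a + ?b + c + d) - (?a * ?b * c + ?a * ?b * d + ?a * c * d + ?b * c * d)) * rhov y a b 1"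
    by (rule star_first_moment[OF star_rho[OF y]])
  have "b * ((1 - a * b * c * d * sqrt_q * sqrt_q * sqrt_q * sqrt_q) * lamv y a ((zZ + zW) * G)) =
    b * (- ((1 - sqrt_q * sqrt_q) * (1 - c * d) * (1 - a * c * sqrt_q * sqrt_q) * (1 - a * d * sqrt_q * sqrt_q)) * rhov y a b 1)"
    using r e m by algebra
  then show ?thesis using b unfolding G_def mult_cancel_left by blast
qed

lemma gen_parD:
  assumes "gen_par a b c d"
  shows "a \<noteq> 0" "b \<noteq> 0" "c \<noteq> 0" "d \<noteq> 0" "a \<noteq> b" "a * b \<noteq> 1" "a * c \<noteq> 1" "a * d \<noteq> 1" "b * c \<noteq> 1" "b * d \<noteq> 1" "c * d \<noteq> 1" "a * b * c * d \<noteq> 1"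
  using assms unfolding gen_par_def by (auto, (metis mult_1_right power_int_0_right)+)

lemma gen_par_shift':
  assumes "gen_par a b c d"
  shows "gen_par (a * sqrt_q) (b * sqrt_q) (c * sqrt_q) (d * sqrt_q)" "gen_par (a * si) (b * si) (c * si) (d * si)"
    "gen_par (a * si) (b * si) (c * sqrt_q) (d * sqrt_q)" "gen_par (a * sqrt_q) (b * sqrt_q) (c * si) (d * si)"
    "gen_par (a * si) (b * sqrt_q) (c * si) (d * sqrt_q)" "gen_par (a * sqrt_q) (b * si) (c * sqrt_q) (d * si)"
    "gen_par (a * sqrt_q * sqrt_q) b c d" "gen_par a (b * sqrt_q * sqrt_q) c d" "gen_par (a * sqrt_q * sqrt_q) (b * sqrt_q * sqrt_q) c d"
proof -
  have p: "sqrt_q powi 2 = sqrt_q * sqrt_q" by (simp add: power2_eq_square)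
  note g = gen_par_shift[OF assms]
  show "gen_par (a * sqrt_q) (b * sqrt_q) (c * sqrt_q) (d * sqrt_q)" "gen_par (a * si) (b * si) (c * si) (d * si)"
    "gen_par (a * si) (b * si) (c * sqrt_q) (d * sqrt_q)" "gen_par (a * sqrt_q) (b * sqrt_q) (c * si) (d * si)"
    "gen_par (a * si) (b * sqrt_q) (c * si) (d * sqrt_q)" "gen_par (a * sqrt_q) (b * si) (c * sqrt_q) (d * si)"
    using g[of 1 1 1 1] g[of "-1" "-1" "-1" "-1"] g[of "-1" "-1" 1 1] g[of 1 1 "-1" "-1"] g[of "-1" 1 "-1" 1] g[of 1 "-1" 1 "-1"] by simp_all
  show "gen_par (a * sqrt_q * sqrt_q) b c d" "gen_par a (b * sqrt_q * sqrt_q) c d" "gen_par (a * sqrt_q * sqrt_q) (b * sqrt_q * sqrt_q) c d"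
    using g[of 2 0 0 0] g[of 0 2 0 0] g[of 2 2 0 0] by (simp_all add: p mult.assoc power2_eq_square)
qed

lemma gen_prodI: "gen_par a b c d \<Longrightarrow> gen_prod a b c d"
  by (simp add: gen_par_def gen_prod_def)

lemma lamv_one_nz:
  assumes y: "moment_rel a b c d y" and g: "gen_par a b c d"
  shows "y 0 \<noteq> 0" "lamv y a 1 \<noteq> 0" "lamv y b 1 \<noteq> 0" "rhov y a b 1 \<noteq> 0"
proof -
  note D = gen_parD[OF g]
  show y0: "y 0 \<noteq> 0" using y by (simp add: moment_rel_def)
  show la: "lamv y a 1 \<noteq> 0"
  proof
    assume "lamv y a 1 = 0"
    then have "(1 - a * c) * (1 - a * d) * y 0 = 0" using lamv_one(1)[OF y] by simp
    then show False using D y0 by simp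
  qed
  show "lamv y b 1 \<noteq> 0"
  proof
    assume "lamv y b 1 = 0"
    then have "(1 - b * c) * (1 - b * d) * y 0 = 0" using lamv_one(2)[OF y] by simp
    then show False using D y0 by simp
  qed
  show "rhov y a b 1 \<noteq> 0"
  proof
    assume "rhov y a b 1 = 0"
    then have "(1 - a * b * sqrt_q * sqrt_q) * (1 - b * c) * (1 - b * d) * lamv y a 1 = 0" using rhov_one[OF y] by simp
    moreover have "a * b * sqrt_q * sqrt_q \<noteq> 1" using gen_parD(6)[OF gen_par_shift'(7)[OF g]] by (simp add: ac_simps)
    ultimately show False using D la by simp
  qed
qed


section \<open>The shift operators as instances\<close>

lemma Ep_deg0:
  assumes "symdeg n f"
  shows "symdeg (n + 0) (Ep u v f) \<and> lk (Ep u v f) (n + 0) = - (u * v * sqrt_q powi n - sqrt_q powi (- n)) * lk f n"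
    "symdeg (n - 0) (Ep u v f) \<and> lk (Ep u v f) (n - 0) = - (u * v * sqrt_q powi n - sqrt_q powi (- n)) * lk f n"
  using Ep_deg[OF assms] by simp_all

lemma frac_const:
  fixes p q :: "'a::field"
  assumes "p * x = q * z" "p \<noteq> 0" shows "x = (q / p) * z"
  using assms by (simp add: field_simps)

lemma star_perm_all:
  assumes "star a b c d \<phi>"
  shows "star a c b d \<phi>" "star c a d b \<phi>" "star c b d a \<phi>" "star b a d c \<phi>" "star c d a b \<phi>"
  using assms by (simp_all add: star_def Gm_def ac_simps)

lemma gen_prod_perm_all:
  assumes "gen_prod a b c d"
  shows "gen_prod a c b d" "gen_prod c a d b" "gen_prod c b d a" "gen_prod b a d c" "gen_prod c d a b"
  using assms by (simp_all add: gen_prod_def ac_simps)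

text \<open>The adjoint of E_12 is E_34, by \<open>adjoint_Ep\<close> with the parameters in the
  order a, c, b, d. The factors agree because ac, ad, bc, bd and abcd are unchanged by the shift, so
  that by \<open>lamv_one\<close> both values at 1 change by y'_0 / y_0.\<close>

lemma S_shift_E12:
  assumes y: "moment_rel a b c d y" and g: "gen_par a b c d"
    and y': "moment_rel (a * si) (b * si) (c * sqrt_q) (d * sqrt_q) y'"
  shows "S_shift a b c d (a * si) (b * si) (c * sqrt_q) (d * sqrt_q) y y' (Ep (a * sqrt_q) (b * si)) (Ep (a * si) (b * sqrt_q)) (Ep c d) (Ep c d)
    ((1 - a * b) / (1 - c * d) * (y' 0 / y 0)) sqrt_q 0
    (\<lambda>n. - (a * b * sqrt_q powi n - sqrt_q powi (- n))) (\<lambda>n. - (c * d * sqrt_q powi n - sqrt_q powi (- n)))"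
proof -
  note D = gen_parD[OF g]
  have g': "gen_par (a * si) (b * si) (c * sqrt_q) (d * sqrt_q)" by (rule gen_par_shift'(3)[OF g])
  note nz = lamv_one_nz[OF y g] and nz' = lamv_one_nz[OF y' g']
  have r: "lamv y' (a * si) 1 = y' 0 / y 0 * lamv y a 1" "lamv y' (b * si) 1 = y' 0 / y 0 * lamv y b 1"
  proof -
    have "(1 - a * b * c * d) * lamv y' (a * si) 1 = (1 - a * c) * (1 - a * d) * y' 0"
      "(1 - a * b * c * d) * lamv y' (b * si) 1 = (1 - b * c) * (1 - b * d) * y' 0"
      using lamv_one[OF y'] by (simp_all add: field_simps)
    then have "(1 - a * b * c * d) * (y 0 * lamv y' (a * si) 1) = (1 - a * b * c * d) * (y' 0 * lamv y a 1)"
      "(1 - a * b * c * d) * (y 0 * lamv y' (b * si) 1) = (1 - a * b * c * d) * (y' 0 * lamv y b 1)"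
      using lamv_one[OF y] by algebra+
    then have "y 0 * lamv y' (a * si) 1 = y' 0 * lamv y a 1" "y 0 * lamv y' (b * si) 1 = y' 0 * lamv y b 1"
      using D(12) by simp_all
    then show "lamv y' (a * si) 1 = y' 0 / y 0 * lamv y a 1" "lamv y' (b * si) 1 = y' 0 / y 0 * lamv y b 1"
      using nz(1) by (simp_all add: nonzero_eq_divide_eq mult.commute)
  qed
  have s1: "star (a * sqrt_q * sqrt_q) c b d (lamv y a)" "star (a * sqrt_q * sqrt_q * si) (c * sqrt_q) (b * si) (d * sqrt_q) (lamv y' (a * si))"
    using star_perm_all(1)[OF star_lamA[OF y]] star_perm_all(1)[OF star_lamA[OF y']] by simp_all
  have s2: "star a c (b * sqrt_q * sqrt_q) d (lamv y b)" "star (a * si) (c * sqrt_q) (b * sqrt_q * sqrt_q * si) (d * sqrt_q) (lamv y' (b * si))"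
    using star_perm_all(1)[OF star_lamB[OF y]] star_perm_all(1)[OF star_lamB[OF y']] by simp_all
  have g1: "gen_prod (a * sqrt_q * sqrt_q) c b d" "gen_prod a c (b * sqrt_q * sqrt_q) d"
    using gen_prod_perm_all(1)[OF gen_prodI[OF gen_par_shift'(7)[OF g]]] gen_prod_perm_all(1)[OF gen_prodI[OF gen_par_shift'(8)[OF g]]] by simp_all
  have cd: "1 - c * d \<noteq> 0" using D(11) by simp
  have A1: "lamv y' (a * si) (Ep (a * sqrt_q) (b * si) f * h) = ((1 - a * b) / (1 - c * d) * (y' 0 / y 0)) * lamv y a (f * Ep c d h)"
    if "sym f" "sym h" for f h
  proof -
    have "(1 - c * d) * lamv y a 1 * lamv y' (a * si) (Ep (a * sqrt_q) (b * si) f * h) = (1 - a * b) * lamv y' (a * si) 1 * lamv y a (f * Ep c d h)"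
      using adjoint_Ep[OF s1 g1(1) that] by simp
    then have "lamv y' (a * si) (Ep (a * sqrt_q) (b * si) f * h) = ((1 - a * b) * lamv y' (a * si) 1 / ((1 - c * d) * lamv y a 1)) * lamv y a (f * Ep c d h)"
      by (rule frac_const) (use cd nz in simp)
    then show ?thesis unfolding r using nz by simp
  qed
  have A2: "lamv y' (b * si) (Ep (a * si) (b * sqrt_q) f * h) = ((1 - a * b) / (1 - c * d) * (y' 0 / y 0)) * lamv y b (f * Ep c d h)"
    if "sym f" "sym h" for f h
  proof -
    have "(1 - c * d) * lamv y b 1 * lamv y' (b * si) (Ep (a * si) (b * sqrt_q) f * h) = (1 - a * b) * lamv y' (b * si) 1 * lamv y b (f * Ep c d h)"
      using adjoint_Ep[OF s2 g1(2) that] by simp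
    then have "lamv y' (b * si) (Ep (a * si) (b * sqrt_q) f * h) = ((1 - a * b) * lamv y' (b * si) 1 / ((1 - c * d) * lamv y b 1)) * lamv y b (f * Ep c d h)"
      by (rule frac_const) (use cd nz in simp)
    then show ?thesis unfolding r using nz by simp
  qed
  have ab: "(a * sqrt_q) * (b * si) = a * b" "(a * si) * (b * sqrt_q) = a * b" by simp_all
  show ?thesis
    by unfold_locales (use y y' D A1 A2 Ep_deg0[of _ _ "a * sqrt_q" "b * si"] Ep_deg0[of _ _ "a * si" "b * sqrt_q"] Ep_deg0[of _ _ c d] in \<open>simp_all add: ab\<close>)
qed


text \<open>The same argument with the order c, a, d, b and the opposite shift.\<close>

lemma S_shift_E34:
  assumes y: "moment_rel a b c d y" and g: "gen_par a b c d"
    and y': "moment_rel (a * sqrt_q) (b * sqrt_q) (c * si) (d * si) y'"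
  shows "S_shift a b c d (a * sqrt_q) (b * sqrt_q) (c * si) (d * si) y y' (Ep (c * si) (d * si)) (Ep (c * si) (d * si))
    (Ep (a * sqrt_q * sqrt_q) b) (Ep a (b * sqrt_q * sqrt_q))
    ((1 - c * si * (d * si)) / (1 - a * b * sqrt_q * sqrt_q) * (y' 0 / y 0)) si 0
    (\<lambda>n. - (c * si * (d * si) * sqrt_q powi n - sqrt_q powi (- n))) (\<lambda>n. - (a * b * sqrt_q * sqrt_q * sqrt_q powi n - sqrt_q powi (- n)))"
proof -
  note D = gen_parD[OF g]
  have g': "gen_par (a * sqrt_q) (b * sqrt_q) (c * si) (d * si)" by (rule gen_par_shift'(4)[OF g])
  note nz = lamv_one_nz[OF y g] and nz' = lamv_one_nz[OF y' g']
  have r: "lamv y' (a * sqrt_q) 1 = y' 0 / y 0 * lamv y a 1" "lamv y' (b * sqrt_q) 1 = y' 0 / y 0 * lamv y b 1"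
  proof -
    have "(1 - a * b * c * d) * lamv y' (a * sqrt_q) 1 = (1 - a * c) * (1 - a * d) * y' 0"
      "(1 - a * b * c * d) * lamv y' (b * sqrt_q) 1 = (1 - b * c) * (1 - b * d) * y' 0"
      using lamv_one[OF y'] by (simp_all add: field_simps)
    then have "(1 - a * b * c * d) * (y 0 * lamv y' (a * sqrt_q) 1) = (1 - a * b * c * d) * (y' 0 * lamv y a 1)"
      "(1 - a * b * c * d) * (y 0 * lamv y' (b * sqrt_q) 1) = (1 - a * b * c * d) * (y' 0 * lamv y b 1)"
      using lamv_one[OF y] by algebra+
    then have "y 0 * lamv y' (a * sqrt_q) 1 = y' 0 * lamv y a 1" "y 0 * lamv y' (b * sqrt_q) 1 = y' 0 * lamv y b 1"
      using D(12) by simp_all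
    then show "lamv y' (a * sqrt_q) 1 = y' 0 / y 0 * lamv y a 1" "lamv y' (b * sqrt_q) 1 = y' 0 / y 0 * lamv y b 1"
      using nz(1) by (simp_all add: nonzero_eq_divide_eq mult.commute)
  qed
  have s1: "star c (a * sqrt_q * sqrt_q) d b (lamv y a)" "star (c * si) (a * sqrt_q * sqrt_q * sqrt_q) (d * si) (b * sqrt_q) (lamv y' (a * sqrt_q))"
    using star_perm_all(2)[OF star_lamA[OF y]] star_perm_all(2)[OF star_lamA[OF y']] by simp_all
  have s2: "star c a d (b * sqrt_q * sqrt_q) (lamv y b)" "star (c * si) (a * sqrt_q) (d * si) (b * sqrt_q * sqrt_q * sqrt_q) (lamv y' (b * sqrt_q))"
    using star_perm_all(2)[OF star_lamB[OF y]] star_perm_all(2)[OF star_lamB[OF y']] by simp_all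
  have g1: "gen_prod c (a * sqrt_q * sqrt_q) d b" "gen_prod c a d (b * sqrt_q * sqrt_q)"
    using gen_prod_perm_all(2)[OF gen_prodI[OF gen_par_shift'(7)[OF g]]] gen_prod_perm_all(2)[OF gen_prodI[OF gen_par_shift'(8)[OF g]]] by simp_all
  have ab2: "1 - a * b * sqrt_q * sqrt_q \<noteq> 0" using gen_parD(6)[OF gen_par_shift'(7)[OF g]] by (simp add: ac_simps)
  let ?e = "((1 - c * si * (d * si)) / (1 - a * b * sqrt_q * sqrt_q) * (y' 0 / y 0))"
  have p: "a * sqrt_q * sqrt_q * b = a * b * sqrt_q * sqrt_q" "a * (b * sqrt_q * sqrt_q) = a * b * sqrt_q * sqrt_q" by simp_all
  have A1: "lamv y' (a * sqrt_q) (Ep (c * si) (d * si) f * h) = ?e * lamv y a (f * Ep (a * sqrt_q * sqrt_q) b h)"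
    if "sym f" "sym h" for f h
  proof -
    have "(1 - a * b * sqrt_q * sqrt_q) * lamv y a 1 * lamv y' (a * sqrt_q) (Ep (c * si) (d * si) f * h) = (1 - c * si * (d * si)) * lamv y' (a * sqrt_q) 1 * lamv y a (f * Ep (a * sqrt_q * sqrt_q) b h)"
      using adjoint_Ep[OF s1 g1(1) that] unfolding p .
    then have "lamv y' (a * sqrt_q) (Ep (c * si) (d * si) f * h) = ((1 - c * si * (d * si)) * lamv y' (a * sqrt_q) 1 / ((1 - a * b * sqrt_q * sqrt_q) * lamv y a 1)) * lamv y a (f * Ep (a * sqrt_q * sqrt_q) b h)"
      by (rule frac_const) (use ab2 nz in simp)
    then show ?thesis unfolding r using nz by simp
  qed
  have A2: "lamv y' (b * sqrt_q) (Ep (c * si) (d * si) f * h) = ?e * lamv y b (f * Ep a (b * sqrt_q * sqrt_q) h)"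
    if "sym f" "sym h" for f h
  proof -
    have "(1 - a * b * sqrt_q * sqrt_q) * lamv y b 1 * lamv y' (b * sqrt_q) (Ep (c * si) (d * si) f * h) = (1 - c * si * (d * si)) * lamv y' (b * sqrt_q) 1 * lamv y b (f * Ep a (b * sqrt_q * sqrt_q) h)"
      using adjoint_Ep[OF s2 g1(2) that] unfolding p .
    then have "lamv y' (b * sqrt_q) (Ep (c * si) (d * si) f * h) = ((1 - c * si * (d * si)) * lamv y' (b * sqrt_q) 1 / ((1 - a * b * sqrt_q * sqrt_q) * lamv y b 1)) * lamv y b (f * Ep a (b * sqrt_q * sqrt_q) h)"
      by (rule frac_const) (use ab2 nz in simp)
    then show ?thesis unfolding r using nz by simp
  qed
  show ?thesis
  proof (unfold_locales)
    show "symdeg (n - 0) (Ep (a * sqrt_q * sqrt_q) b f) \<and> lk (Ep (a * sqrt_q * sqrt_q) b f) (n - 0) = - (a * b * sqrt_q * sqrt_q * sqrt_q powi n - sqrt_q powi (- n)) * lk f n"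
      if "symdeg n f" for n f using Ep_deg0(2)[OF that, of "a * sqrt_q * sqrt_q" b] unfolding p .
    show "symdeg (n - 0) (Ep a (b * sqrt_q * sqrt_q) f) \<and> lk (Ep a (b * sqrt_q * sqrt_q) f) (n - 0) = - (a * b * sqrt_q * sqrt_q * sqrt_q powi n - sqrt_q powi (- n)) * lk f n"
      if "symdeg n f" for n f using Ep_deg0(2)[OF that, of a "b * sqrt_q * sqrt_q"] unfolding p .
  qed (use y y' D A1 A2 Ep_deg0 in simp_all)
qed

text \<open>When the constant from \<open>lamv_m1_Gm\<close> is divided by the value at 1 at the
  shifted label, the factors (1-acq)(1-adq) cancel. What is left involves
  \<open>rhov y a b 1\<close>, symmetric in a and b, so one \<open>e\<close> serves both
  coordinates.\<close>

lemma adjoint_G_lamv: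
  assumes y: "moment_rel a b c d y" and g: "gen_par a b c d"
    and y': "moment_rel (a * sqrt_q) (b * sqrt_q) (c * sqrt_q) (d * sqrt_q) y'"
    and fh: "sym f" "sym h"
  defines "e \<equiv> - ((1 - sqrt_q * sqrt_q) * (1 - c * d) * rhov y a b 1) / ((sqrt_q - si) * y' 0)"
  shows "lamv y a (f * Gm (a * sqrt_q * sqrt_q) b c d h) = e * lamv y' (a * sqrt_q) (Gp f * h)"
    "lamv y b (f * Gm a (b * sqrt_q * sqrt_q) c d h) = e * lamv y' (b * sqrt_q) (Gp f * h)" "e \<noteq> 0"
proof -
  note D = gen_parD[OF g]
  have g': "gen_par (a * sqrt_q) (b * sqrt_q) (c * sqrt_q) (d * sqrt_q)" by (rule gen_par_shift'(1)[OF g])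
  note nz = lamv_one_nz[OF y g] and nz' = lamv_one_nz[OF y' g']
  have q1: "sqrt_q * sqrt_q \<noteq> 1"
    using sqrt_q_powi_eq_1[of 2] by (simp add: power2_eq_square)
  have ss: "sqrt_q - si \<noteq> 0"
  proof
    assume "sqrt_q - si = 0"
    then have "sqrt_q * sqrt_q = sqrt_q * si" by simp
    then show False using q1 by simp
  qed
  define P where "P = 1 - a * b * c * d * sqrt_q * sqrt_q * sqrt_q * sqrt_q"
  have P: "P \<noteq> 0" using gen_parD(12)[OF g'] by (simp add: P_def ac_simps)
  define k where "k = - ((1 - sqrt_q * sqrt_q) * (1 - c * d) * rhov y a b 1)"
  have k0: "k \<noteq> 0" using q1 D(11) nz(4) by (simp add: k_def)
  have ek: "e = k / ((sqrt_q - si) * y' 0)" by (simp add: e_def k_def)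
  show "e \<noteq> 0" using ek k0 ss nz'(1) by simp
  have swap: "rhov y b a 1 = rhov y a b 1" by (simp add: mult.commute)
  have GA: "P * lamv y a ((zZ + zW) * Gm (a * sqrt_q * sqrt_q) b c d 1) * y' 0 = P * lamv y' (a * sqrt_q) 1 * k"
  proof -
    have "P * lamv y a ((zZ + zW) * Gm (a * sqrt_q * sqrt_q) b c d 1) = - ((1 - sqrt_q * sqrt_q) * (1 - c * d) * (1 - a * c * sqrt_q * sqrt_q) * (1 - a * d * sqrt_q * sqrt_q)) * rhov y a b 1"
      unfolding P_def by (rule lamv_m1_Gm[OF y D(2)])
    moreover have "P * lamv y' (a * sqrt_q) 1 = (1 - a * c * sqrt_q * sqrt_q) * (1 - a * d * sqrt_q * sqrt_q) * y' 0"
      using lamv_one(1)[OF y'] by (simp add: P_def ac_simps)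
    ultimately show ?thesis unfolding k_def by algebra
  qed
  have GB: "P * lamv y b ((zZ + zW) * Gm a (b * sqrt_q * sqrt_q) c d 1) * y' 0 = P * lamv y' (b * sqrt_q) 1 * k"
  proof -
    have p: "Gm (b * sqrt_q * sqrt_q) a c d = Gm a (b * sqrt_q * sqrt_q) c d" by (rule Gm_perm)
    have "P * lamv y b ((zZ + zW) * Gm a (b * sqrt_q * sqrt_q) c d 1) = - ((1 - sqrt_q * sqrt_q) * (1 - c * d) * (1 - b * c * sqrt_q * sqrt_q) * (1 - b * d * sqrt_q * sqrt_q)) * rhov y a b 1"
      using lamv_m1_Gm[OF moment_rel_swap[OF y] D(1)] unfolding p swap by (simp add: P_def mult.commute[of b a])
    moreover have "P * lamv y' (b * sqrt_q) 1 = (1 - b * c * sqrt_q * sqrt_q) * (1 - b * d * sqrt_q * sqrt_q) * y' 0"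
      using lamv_one(2)[OF y'] by (simp add: P_def ac_simps)
    ultimately show ?thesis unfolding k_def by algebra
  qed
  have sA: "star (a * sqrt_q * sqrt_q) b c d (lamv y a)" "star (a * sqrt_q * sqrt_q * sqrt_q) (b * sqrt_q) (c * sqrt_q) (d * sqrt_q) (lamv y' (a * sqrt_q))"
    using star_lamA[OF y] star_lamA[OF y'] by simp_all
  have sB: "star a (b * sqrt_q * sqrt_q) c d (lamv y b)" "star (a * sqrt_q) (b * sqrt_q * sqrt_q * sqrt_q) (c * sqrt_q) (d * sqrt_q) (lamv y' (b * sqrt_q))"
    using star_lamB[OF y] star_lamB[OF y'] by simp_all
  have fin: "x = e * z" if "(sqrt_q - si) * l' * x = w * z" "P * w * y' 0 = P * l' * k" "l' \<noteq> 0" for x z w l' :: K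
  proof -
    have "w * y' 0 = l' * k" using that(2) P by (simp add: mult.assoc)
    then have "((sqrt_q - si) * y' 0) * (l' * x) = k * (l' * z)" using that(1) by algebra
    then have "l' * x = e * (l' * z)" unfolding ek by (rule frac_const) (use ss nz'(1) in simp)
    then show ?thesis using that(3) by simp
  qed
  show "lamv y a (f * Gm (a * sqrt_q * sqrt_q) b c d h) = e * lamv y' (a * sqrt_q) (Gp f * h)"
    by (rule fin[OF adjoint_G[OF sA gen_prodI[OF gen_par_shift'(7)[OF g]] fh] GA nz'(2)])
  show "lamv y b (f * Gm a (b * sqrt_q * sqrt_q) c d h) = e * lamv y' (b * sqrt_q) (Gp f * h)"
    by (rule fin[OF adjoint_G[OF sB gen_prodI[OF gen_par_shift'(8)[OF g]] fh] GB nz'(3)])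
qed

text \<open>\<open>adjoint_G_lamv\<close> read from right to left, hence the factor
  \<open>1 / e\<close>.\<close>

lemma S_shift_Gp:
  assumes y: "moment_rel a b c d y" and g: "gen_par a b c d"
    and y': "moment_rel (a * sqrt_q) (b * sqrt_q) (c * sqrt_q) (d * sqrt_q) y'"
  obtains e where "S_shift a b c d (a * sqrt_q) (b * sqrt_q) (c * sqrt_q) (d * sqrt_q) y y' Gp Gp
    (Gm (a * sqrt_q * sqrt_q) b c d) (Gm a (b * sqrt_q * sqrt_q) c d) e si (-1)
    (\<lambda>n. sqrt_q powi n - sqrt_q powi (- n)) (\<lambda>n. a * b * c * d * sqrt_q * sqrt_q * sqrt_q powi n - sqrt_q powi (- n))"
proof -
  note D = gen_parD[OF g]
  define e where "e = - ((1 - sqrt_q * sqrt_q) * (1 - c * d) * rhov y a b 1) / ((sqrt_q - si) * y' 0)"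
  note A = adjoint_G_lamv[OF y g y', folded e_def]
  have e0: "e \<noteq> 0" using A(3)[of 1 1] by simp
  have p: "a * sqrt_q * sqrt_q * b * c * d = a * b * c * d * sqrt_q * sqrt_q" "a * (b * sqrt_q * sqrt_q) * c * d = a * b * c * d * sqrt_q * sqrt_q"
    by simp_all
  have "S_shift a b c d (a * sqrt_q) (b * sqrt_q) (c * sqrt_q) (d * sqrt_q) y y' Gp Gp
    (Gm (a * sqrt_q * sqrt_q) b c d) (Gm a (b * sqrt_q * sqrt_q) c d) (1 / e) si (-1)
    (\<lambda>n. sqrt_q powi n - sqrt_q powi (- n)) (\<lambda>n. a * b * c * d * sqrt_q * sqrt_q * sqrt_q powi n - sqrt_q powi (- n))"
  proof (unfold_locales)
    show "symdeg (n + - 1) (Gp f) \<and> lk (Gp f) (n + - 1) = (sqrt_q powi n - sqrt_q powi (- n)) * lk f n"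
      if "symdeg n f" for n f using Gp_deg[OF that] by simp
    show "symdeg (n - - 1) (Gm (a * sqrt_q * sqrt_q) b c d f) \<and> lk (Gm (a * sqrt_q * sqrt_q) b c d f) (n - - 1)
       = (a * b * c * d * sqrt_q * sqrt_q * sqrt_q powi n - sqrt_q powi (- n)) * lk f n" if "symdeg n f" for n f
      using Gm_deg[OF that, of "a * sqrt_q * sqrt_q" b c d] unfolding p by simp
    show "symdeg (n - - 1) (Gm a (b * sqrt_q * sqrt_q) c d f) \<and> lk (Gm a (b * sqrt_q * sqrt_q) c d f) (n - - 1)
       = (a * b * c * d * sqrt_q * sqrt_q * sqrt_q powi n - sqrt_q powi (- n)) * lk f n" if "symdeg n f" for n f
      using Gm_deg[OF that, of a "b * sqrt_q * sqrt_q" c d] unfolding p by simp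
    show "lamv y' (a * sqrt_q) (Gp f * h) = 1 / e * lamv y a (f * Gm (a * sqrt_q * sqrt_q) b c d h)"
      "lamv y' (b * sqrt_q) (Gp f * h) = 1 / e * lamv y b (f * Gm a (b * sqrt_q * sqrt_q) c d h)" if "sym f" "sym h" for f h
      unfolding A(1)[OF that] A(2)[OF that] using e0 by simp_all
  qed (use y y' D Gp_deg in simp_all)
  then show thesis by (rule that)
qed

text \<open>\<open>adjoint_G_lamv\<close> with the target label as the lower one, from which the
  given label arises by the upward shift.\<close>

lemma S_shift_Gm:
  assumes y: "moment_rel a b c d y" and g: "gen_par a b c d"
    and y': "moment_rel (a * si) (b * si) (c * si) (d * si) y'"
  obtains e where "S_shift a b c d (a * si) (b * si) (c * si) (d * si) y y'
    (\<lambda>f. ci * Gm (a * sqrt_q) (b * si) (c * si) (d * si) f) (\<lambda>f. ci * Gm (a * si) (b * sqrt_q) (c * si) (d * si) f) Gp Gp e sqrt_q 1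
    (\<lambda>n. si * (a * b * c * d * si * si * sqrt_q powi n - sqrt_q powi (- n))) (\<lambda>n. sqrt_q powi n - sqrt_q powi (- n))"
proof -
  note D = gen_parD[OF g]
  have g': "gen_par (a * si) (b * si) (c * si) (d * si)" by (rule gen_par_shift'(2)[OF g])
  have y2: "moment_rel (a * si * sqrt_q) (b * si * sqrt_q) (c * si * sqrt_q) (d * si * sqrt_q) y" using y by simp
  define e where "e = - ((1 - sqrt_q * sqrt_q) * (1 - c * si * (d * si)) * rhov y' (a * si) (b * si) 1) / ((sqrt_q - si) * y 0)"
  note A = adjoint_G_lamv[OF y' g' y2, folded e_def, unfolded ss_cancel]
  have p: "a * sqrt_q * (b * si) * (c * si) * (d * si) = a * b * c * d * si * si" "a * si * (b * sqrt_q) * (c * si) * (d * si) = a * b * c * d * si * si"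
    by simp_all
  have m: "LF u * (ci * x * h) = cst si * (LF u * (h * x))" for u x h by (simp only: ac_simps)
  have "S_shift a b c d (a * si) (b * si) (c * si) (d * si) y y'
    (\<lambda>f. ci * Gm (a * sqrt_q) (b * si) (c * si) (d * si) f) (\<lambda>f. ci * Gm (a * si) (b * sqrt_q) (c * si) (d * si) f) Gp Gp (si * e) sqrt_q 1
    (\<lambda>n. si * (a * b * c * d * si * si * sqrt_q powi n - sqrt_q powi (- n))) (\<lambda>n. sqrt_q powi n - sqrt_q powi (- n))"
  proof (unfold_locales)
    show "symdeg (n - 1) (Gp f) \<and> lk (Gp f) (n - 1) = (sqrt_q powi n - sqrt_q powi (- n)) * lk f n"
      if "symdeg n f" for n f using Gp_deg[OF that] by simp
    show "symdeg (n + 1) (ci * Gm (a * sqrt_q) (b * si) (c * si) (d * si) f) \<and> lk (ci * Gm (a * sqrt_q) (b * si) (c * si) (d * si) f) (n + 1)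
       = si * (a * b * c * d * si * si * sqrt_q powi n - sqrt_q powi (- n)) * lk f n" if "symdeg n f" for n f
      using Gm_deg[OF that, of "a * sqrt_q" "b * si" "c * si" "d * si"] unfolding p by (simp add: symdeg_lin(3))
    show "symdeg (n + 1) (ci * Gm (a * si) (b * sqrt_q) (c * si) (d * si) f) \<and> lk (ci * Gm (a * si) (b * sqrt_q) (c * si) (d * si) f) (n + 1)
       = si * (a * b * c * d * si * si * sqrt_q powi n - sqrt_q powi (- n)) * lk f n" if "symdeg n f" for n f
      using Gm_deg[OF that, of "a * si" "b * sqrt_q" "c * si" "d * si"] unfolding p by (simp add: symdeg_lin(3))
    show "lamv y' (a * si) (ci * Gm (a * sqrt_q) (b * si) (c * si) (d * si) f * h) = si * e * lamv y a (f * Gp h)"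
      "lamv y' (b * si) (ci * Gm (a * si) (b * sqrt_q) (c * si) (d * si) f * h) = si * e * lamv y b (f * Gp h)" if "sym f" "sym h" for f h
      unfolding m ell_cst_mult A(1)[OF that(2,1)] A(2)[OF that(2,1)] by (simp_all add: mult.commute)
  qed (use y y' D Gp_deg in simp_all)
  then show thesis by (rule that)
qed

text \<open>The first coordinate gives the factor (1-X)/(1-bd) y'_0/y_0, the second one (1-ac)/(1-Y)
  times the quotient of the values of \<open>rhov\<close> at 1, with X = ac/q and Y = bdq. They are
  equal by \<open>R\<close>, which combines \<open>rhov_one\<close> and \<open>lamv_one\<close> at
  both labels.\<close>

lemma K_shift_E13:
  assumes y: "moment_rel a b c d y" and g: "gen_par a b c d"
    and y': "moment_rel (a * si) (b * sqrt_q) (c * si) (d * sqrt_q) y'"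
  shows "K_shift a b c d (a * si) (b * sqrt_q) (c * si) (d * sqrt_q) y y' (Ep (a * si) (c * si)) (\<lambda>f. ci * Ep (a * sqrt_q) (c * si) f)
    (Ep b d) (\<lambda>f. ci * Ep (b * sqrt_q * sqrt_q) d f) ((1 - a * si * (c * si)) / (1 - b * d) * (y' 0 / y 0))
    (\<lambda>n. - (a * c * si * si * sqrt_q powi n - sqrt_q powi (- n))) (\<lambda>n. - (b * d * sqrt_q powi n - sqrt_q powi (- n)))"
proof -
  note D = gen_parD[OF g]
  have g': "gen_par (a * si) (b * sqrt_q) (c * si) (d * sqrt_q)" by (rule gen_par_shift'(5)[OF g])
  note nz = lamv_one_nz[OF y g] and nz' = lamv_one_nz[OF y' g']
  define X where "X = a * c * si * si"
  define Y where "Y = b * d * sqrt_q * sqrt_q"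
  have X: "a * si * (c * si) = X" "a * c * si * si = X" by (simp_all add: X_def)
  have Y: "b * sqrt_q * sqrt_q * d = Y" "b * sqrt_q * (d * sqrt_q) = Y" "Y \<noteq> 1" "b * d \<noteq> 1"
    using gen_parD(10)[OF gen_par_shift'(8)[OF g]] D by (simp_all add: Y_def ac_simps)
  let ?e4 = "a * b * c * d"
  have e4: "1 - ?e4 \<noteq> 0" "1 - ?e4 * sqrt_q * sqrt_q \<noteq> 0"
    using D(12) gen_parD(12)[OF gen_par_shift'(7)[OF g]] by (simp_all add: ac_simps)
  have pe: "a * si * (b * sqrt_q) = a * b" "a * b * (c * si) * (d * sqrt_q) = a * b * c * d" "b * sqrt_q * (c * si) = b * c" "a * si * (d * sqrt_q) = a * d"
    by simp_all
  have R: "(1 - a * c) * (1 - b * d) * (y 0 * rhov y' (a * si) (b * sqrt_q) 1) = (1 - X) * (1 - Y) * (y' 0 * rhov y a b 1)"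
  proof -
    have 1: "(1 - ?e4 * sqrt_q * sqrt_q) * rhov y a b 1 = (1 - a * b * sqrt_q * sqrt_q) * (1 - b * c) * (1 - b * d) * lamv y a 1"
      by (rule rhov_one[OF y])
    have 2: "(1 - ?e4) * lamv y a 1 = (1 - a * c) * (1 - a * d) * y 0" by (rule lamv_one(1)[OF y])
    have 3: "(1 - ?e4 * sqrt_q * sqrt_q) * rhov y' (a * si) (b * sqrt_q) 1 = (1 - a * b * sqrt_q * sqrt_q) * (1 - b * c) * (1 - Y) * lamv y' (a * si) 1"
      using rhov_one[OF y'] unfolding pe Y(2) .
    have 4: "(1 - ?e4) * lamv y' (a * si) 1 = (1 - X) * (1 - a * d) * y' 0"
      using lamv_one(1)[OF y'] unfolding pe X(1) .
    have "(1 - ?e4) * (1 - ?e4 * sqrt_q * sqrt_q) * ((1 - a * c) * (1 - b * d) * (y 0 * rhov y' (a * si) (b * sqrt_q) 1)) =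
      ((1 - a * c) * (1 - b * d) * y 0) * ((1 - a * b * sqrt_q * sqrt_q) * (1 - b * c) * (1 - Y)) * ((1 - ?e4) * lamv y' (a * si) 1)"
      using 3 by algebra
    also have "\<dots> = ((1 - X) * (1 - Y) * y' 0) * ((1 - a * b * sqrt_q * sqrt_q) * (1 - b * c) * (1 - b * d)) * ((1 - a * c) * (1 - a * d) * y 0)"
      unfolding 4 by algebra
    also have "\<dots> = (1 - ?e4) * (1 - ?e4 * sqrt_q * sqrt_q) * ((1 - X) * (1 - Y) * (y' 0 * rhov y a b 1))"
      unfolding 2[symmetric] using 1 by algebra
    finally show ?thesis using e4 by simp
  qed
  let ?e = "(1 - X) / (1 - b * d) * (y' 0 / y 0)"
  have A1: "ell y' (Ep (a * si) (c * si) f * h) = ?e * ell y (f * Ep b d h)" if "sym f" "sym h" for f h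
  proof -
    have "(1 - b * d) * y 0 * ell y' (Ep (a * si) (c * si) f * h) = (1 - X) * y' 0 * ell y (f * Ep b d h)"
      using adjoint_Ep[OF star_lam0[OF y g] star_lam0[OF y' g'] gen_prodI[OF g] that] by (simp add: X_def)
    then have "ell y' (Ep (a * si) (c * si) f * h) = ((1 - X) * y' 0 / ((1 - b * d) * y 0)) * ell y (f * Ep b d h)"
      by (rule frac_const) (use Y nz in simp)
    then show ?thesis by simp
  qed
  have sr: "star (a * sqrt_q * sqrt_q) (b * sqrt_q * sqrt_q) c d (rhov y a b)"
    "star (a * sqrt_q * sqrt_q * si) (b * sqrt_q * sqrt_q * sqrt_q) (c * si) (d * sqrt_q) (rhov y' (a * si) (b * sqrt_q))"
    using star_rho[OF y] star_rho[OF y'] by simp_all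
  have ac: "a * sqrt_q * sqrt_q * si * (c * si) = a * c" by simp
  have m: "F * (ci * x * h) = cst si * (F * (x * h))" "F * (x * (ci * h)) = cst si * (F * (x * h))" for F x h by (simp_all only: ac_simps)
  have A2: "rhov y' (a * si) (b * sqrt_q) (ci * Ep (a * sqrt_q) (c * si) f * h) = ?e * rhov y a b (f * (ci * Ep (b * sqrt_q * sqrt_q) d h))"
    if "sym f" "sym h" for f h
  proof -
    have "(1 - Y) * rhov y a b 1 * rhov y' (a * si) (b * sqrt_q) (Ep (a * sqrt_q) (c * si) f * h) =
      (1 - a * c) * rhov y' (a * si) (b * sqrt_q) 1 * rhov y a b (f * Ep (b * sqrt_q * sqrt_q) d h)"
      using adjoint_Ep[OF sr gen_prodI[OF gen_par_shift'(9)[OF g]] that] unfolding Y(1) ac unfolding ss_cancel .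
    moreover have "(1 - b * d) * y 0 * ((1 - a * c) * rhov y' (a * si) (b * sqrt_q) 1) = (1 - X) * y' 0 * ((1 - Y) * rhov y a b 1)"
      using R by algebra
    ultimately have "((1 - Y) * rhov y a b 1) * ((1 - b * d) * y 0 * rhov y' (a * si) (b * sqrt_q) (Ep (a * sqrt_q) (c * si) f * h)) =
      ((1 - Y) * rhov y a b 1) * ((1 - X) * y' 0 * rhov y a b (f * Ep (b * sqrt_q * sqrt_q) d h))"
      by algebra
    moreover have "(1 - Y) * rhov y a b 1 \<noteq> 0" using Y nz(4) by simp
    ultimately have "(1 - b * d) * y 0 * rhov y' (a * si) (b * sqrt_q) (Ep (a * sqrt_q) (c * si) f * h) =
      (1 - X) * y' 0 * rhov y a b (f * Ep (b * sqrt_q * sqrt_q) d h)"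
      unfolding mult_cancel_left by blast
    then have "rhov y' (a * si) (b * sqrt_q) (Ep (a * sqrt_q) (c * si) f * h) = ((1 - X) * y' 0 / ((1 - b * d) * y 0)) * rhov y a b (f * Ep (b * sqrt_q * sqrt_q) d h)"
      by (rule frac_const) (use Y nz in simp)
    then show ?thesis unfolding m ell_cst_mult by simp
  qed
  \<comment> \<open>In degree n-1 with a parameter product enlarged by q, the factor q^(-1/2)
    restores the leading coefficient of degree n.\<close>
  have pw: "si * sqrt_q powi (1 - n) = sqrt_q powi (- n)" "si * (z * sqrt_q * sqrt_q * sqrt_q powi (n - 1)) = z * sqrt_q powi n" for n and z :: K
    by (simp_all add: power_int_diff power_int_minus field_simps)
  have low: "symdeg (n - 1) (ci * Ep u v f) \<and> lk (ci * Ep u v f) (n - 1) = - (z * sqrt_q powi n - sqrt_q powi (- n)) * lk f (n - 1)"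
    if f: "symdeg (n - 1) f" and uv: "u * v = z * sqrt_q * sqrt_q" for u v z n f
  proof -
    have "lk (ci * Ep u v f) (n - 1) = - (si * (u * v * sqrt_q powi (n - 1)) - si * sqrt_q powi (1 - n)) * lk f (n - 1)"
      unfolding lk_cst_mult Ep_deg(2)[OF f] by (simp add: right_diff_distrib algebra_simps del: ss_cancel)
    then show ?thesis unfolding uv pw using symdeg_lin(3)[OF Ep_deg(1)[OF f]] by blast
  qed
  show ?thesis unfolding X
  proof (unfold_locales)
    show "symdeg (n - 1) (ci * Ep (a * sqrt_q) (c * si) f) \<and> lk (ci * Ep (a * sqrt_q) (c * si) f) (n - 1) = - (X * sqrt_q powi n - sqrt_q powi (- n)) * lk f (n - 1)"
      if "symdeg (n - 1) f" for n f by (rule low[OF that]) (simp add: X_def)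
    show "symdeg (n - 1) (ci * Ep (b * sqrt_q * sqrt_q) d f) \<and> lk (ci * Ep (b * sqrt_q * sqrt_q) d f) (n - 1) = - (b * d * sqrt_q powi n - sqrt_q powi (- n)) * lk f (n - 1)"
      if "symdeg (n - 1) f" for n f by (rule low[OF that]) simp
    show "symdeg n (Ep (a * si) (c * si) f) \<and> lk (Ep (a * si) (c * si) f) n = - (X * sqrt_q powi n - sqrt_q powi (- n)) * lk f n" if "symdeg n f" for n f
      using Ep_deg[OF that, of "a * si" "c * si"] unfolding X by blast
  qed (use y y' D A1 A2 Ep_deg in simp_all)
qed

section \<open>The shift operators in coordinates\<close>

lemma vector_4 [simp]:
  "(vector [w, x, y, z] :: ('a::zero)^4) $ 1 = w" "(vector [w, x, y, z] :: ('a::zero)^4) $ 2 = x"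
  "(vector [w, x, y, z] :: ('a::zero)^4) $ 3 = y" "(vector [w, x, y, z] :: ('a::zero)^4) $ 4 = z"
  by (simp_all add: vector_def)

lemma v_nth [simp]:
  "v1 $ 1 = 1 / 2" "v1 $ 2 = 1 / 2" "v1 $ 3 = 1 / 2" "v1 $ 4 = 1 / 2"
  "v2 $ 1 = 1 / 2" "v2 $ 2 = 1 / 2" "v2 $ 3 = - 1 / 2" "v2 $ 4 = - 1 / 2"
  "v3 $ 1 = 1 / 2" "v3 $ 2 = - 1 / 2" "v3 $ 3 = 1 / 2" "v3 $ 4 = - 1 / 2"
  by (simp_all add: v1_def v2_def v3_def)

lemma eps_nth [simp]:
  "eps 1 $ 1 = 1" "eps 1 $ 2 = 0" "eps 1 $ 3 = 0" "eps 1 $ 4 = 0"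
  "eps 2 $ 1 = 0" "eps 2 $ 2 = 1" "eps 2 $ 3 = 0" "eps 2 $ 4 = 0"
  by (simp_all add: eps_def axis_def)

lemma qpow_simps [simp]:
  "qpow 0 = 1" "qpow 1 = sqrt_q * sqrt_q" "qpow (1 / 2) = sqrt_q" "qpow (- 1 / 2) = si"
  "qpow (- (1 / 2)) = si"
  "qpow (of_nat n / 2) = sqrt_q powi (int n)" "qpow (- of_nat n / 2) = sqrt_q powi (- int n)"
proof -
  have "\<lfloor>- (of_nat n :: rat)\<rfloor> = - int n" by (metis floor_of_int of_int_minus of_int_of_nat_eq)
  then show "qpow (- of_nat n / 2) = sqrt_q powi (- int n)" by (simp add: qpow_def)
  have "\<lfloor>- 1 :: rat\<rfloor> = - 1" by linarith
  then show "qpow (- 1 / 2) = si" "qpow (- (1 / 2)) = si" by (simp_all add: qpow_def power_int_minus)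
qed (simp_all add: qpow_def power2_eq_square)

lemma params_nth [simp]:
  "params h $ 1 = par_a * qpow (h $ 1)" "params h $ 2 = par_b * qpow (h $ 2)"
  "params h $ 3 = par_c * qpow (h $ 3)" "params h $ 4 = par_d * qpow (h $ 4)"
  by (simp_all add: params_def)

lemma lin_factor_LF: "lin_factor h i = LF (params h $ i * si)"
  by (simp add: lin_factor_def LF_def)

lemma Eq_op_Ep:
  "Eq_op i j h = Ep (params h $ i * si) (params h $ j * si)"
  by (simp add: Eq_op_def Ep_def lin_factor_LF mult.assoc)

lemma Gq_plus_Gp: "Gq_plus h = Gp"
  by (simp add: fun_eq_iff Gq_plus_def Gp_def)

lemma Gq_minus_Gm:
  assumes "sym f"
  shows "Gq_minus h f = ci * Gm (params h $ 1 * si) (params h $ 2 * si) (params h $ 3 * si) (params h $ 4 * si) f"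
proof -
  have "zpow (-2) = zW * zW" by (simp flip: zpow_add)
  moreover have "(\<Prod>i\<in>UNIV. lin_factor h i) = lin_factor h 1 * (lin_factor h 2 * (lin_factor h 3 * lin_factor h 4))"
    unfolding UNIV_4 by simp
  ultimately have X: "cst si * zpow (-2) * (\<Prod>i\<in>UNIV. lin_factor h i) = ci * (zW * zW * (lin_factor h 1 * lin_factor h 2 * lin_factor h 3 * lin_factor h 4))"
    by (simp only: mult.assoc)
  show ?thesis
    unfolding Gq_minus_def Gm_def qpow_simps X skew_op_linear(3)[OF assms assms] lin_factor_LF ..
qed

lemma mat_act_nth:
  fixes M :: "K^2^2" and f :: "laurent^2"
  shows "mat_act M f $ i = cst (M $ i $ 1) * f $ 1 + cst (M $ i $ 2) * f $ 2"
  by (simp add: mat_act_def matrix_vector_mult_def sum_2)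

lemma mat_act_inv:
  assumes "invertible M"
  shows "mat_act (matrix_inv M) (mat_act M f) = f"
proof -
  have "matrix_inv M ** M = mat 1" 
    using someI_ex[OF assms[unfolded invertible_def]] unfolding matrix_inv_def by blast
  then have i: "(matrix_inv M ** M) $ i $ j = mat 1 $ i $ j" for i j by simp
  have "mat_act (matrix_inv M) (mat_act M f) $ i =
    cst ((matrix_inv M ** M) $ i $ 1) * f $ 1 + cst ((matrix_inv M ** M) $ i $ 2) * f $ 2" for i
    by (simp add: mat_act_nth matrix_matrix_mult_def sum_2 algebra_simps)
  then show ?thesis unfolding i by (simp add: vec_eq_iff forall_2 mat_def)
qed

lemma V_mat_invertible:
  fixes h :: "rat^4"
  assumes "par_a * qpow (h $ 1) \<noteq> par_b * qpow (h $ 2)"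
  shows "invertible (V_mat h)"
proof -
  have "inverse (par_a * qpow (h $ 1)) \<noteq> inverse (par_b * qpow (h $ 2))"
    using assms by (metis inverse_inverse_eq)
  then show ?thesis unfolding invertible_det_nz by (simp add: det_2 V_mat_def)
qed

lemma inj_B_S: "inj_on B_S sym_pairs"
proof (rule inj_onI)
  fix f g assume s: "f \<in> sym_pairs" "g \<in> sym_pairs" and e: "B_S f = B_S g"
  have s: "sym (f $ i)" "sym (g $ i)" for i using s by (simp_all add: sym_pairs_def sym_laurent_def)
  have e': "f $ 1 + zZ * f $ 2 = g $ 1 + zZ * g $ 2" using e by (simp add: B_S_def)
  have "zinv (f $ 1 + zZ * f $ 2) = zinv (g $ 1 + zZ * g $ 2)" using e' by simp
  then have "f $ 1 + zW * f $ 2 = g $ 1 + zW * g $ 2" using s by simp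
  then have "zR * (f $ 2 - g $ 2) = 0" using e' by algebra
  then have "f $ 2 = g $ 2" using zR_nz by simp
  then show "f = g" using e' by (simp add: vec_eq_iff forall_2)
qed

lemma inj_B_K:
  fixes h :: "rat^4"
  assumes "par_a * qpow (h $ 1) * (par_b * qpow (h $ 2)) \<noteq> 1"
  shows "inj_on (B_K h) sym_pairs"
proof (rule inj_onI)
  fix f g assume s: "f \<in> sym_pairs" "g \<in> sym_pairs" and e: "B_K h f = B_K h g"
  let ?k = "kap (par_a * qpow (h $ 1)) (par_b * qpow (h $ 2))"
  have s: "sym (f $ i)" "sym (g $ i)" for i using s by (simp_all add: sym_pairs_def sym_laurent_def)
  have e': "f $ 1 + ?k * f $ 2 = g $ 1 + ?k * g $ 2" using e by (simp add: B_K_def kap_def LF_def mult.assoc)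
  have "zinv (f $ 1 + ?k * f $ 2) = zinv (g $ 1 + ?k * g $ 2)" using e' by simp
  then have "f $ 1 + zinv ?k * f $ 2 = g $ 1 + zinv ?k * g $ 2" using s by simp
  then have "(?k - zinv ?k) * (f $ 2 - g $ 2) = 0" using e' by algebra
  then have "f $ 2 = g $ 2" unfolding kap_antisym using zR_nz assms by (simp del: cst_hom)
  then show "f = g" using e' by (simp add: vec_eq_iff forall_2)
qed

text \<open>\<open>B_S\<close> sends the columns of \<open>V_mat 0\<close> to -(1-az)/a and
  -(1-bz)/b, so the diagonal entries act on -a F1 and -b F2; returning with the new parameters
  leaves the factor \<omega>.\<close>

lemma conj_S_coordinates:
  fixes h :: "rat^4"
  assumes S: "\<And>h. S h = skew_op (A h)" and s: "sym F1" "sym F2"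
    and w: "par_a = \<omega> * (par_a * qpow (h $ 1))" "par_b = \<omega> * (par_b * qpow (h $ 2))"
  shows "conj_S S h (LF par_a * F1 + LF par_b * F2) =
    cst \<omega> * (LF (par_a * qpow (h $ 1)) * S (eps 1) F1 + LF (par_b * qpow (h $ 2)) * S (eps 2) F2)"
proof -
  define g p :: "laurent^2" where "g = vector [F1 + F2, - (cst par_a * F1 + cst par_b * F2)]"
    and "p = vector [cst (- par_a) * F1, cst (- par_b) * F2]"
  note D = gen_parD[OF gen_par]
  define a' b' where "a' = par_a * qpow (h $ 1)" and "b' = par_b * qpow (h $ 2)"
  have w: "par_a = \<omega> * a'" "par_b = \<omega> * b'" using w by (simp_all add: a'_def b'_def)
  have nz: "a' \<noteq> 0" "b' \<noteq> 0" using w D by auto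
  have "g \<in> sym_pairs" using s by (simp add: sym_pairs_def sym_laurent_def forall_2 g_def)
  moreover have "B_S g = LF par_a * F1 + LF par_b * F2" by (simp add: B_S_def g_def LF_split)
  ultimately have 1: "inv_into sym_pairs B_S (LF par_a * F1 + LF par_b * F2) = g"
    using inv_into_f_f[OF inj_B_S] by metis
  have c: "cst (inverse u) * (cst u * F) = F" if "u \<noteq> 0" for u F
    unfolding mult.assoc[symmetric] using that by (simp add: cst_inverse mult.commute)
  have "mat_act (V_mat 0) p = g"
    by (simp add: c[OF D(1)] c[OF D(2)] vec_eq_iff forall_2 mat_act_nth V_mat_def p_def g_def)
  then have 2: "mat_act (matrix_inv (V_mat 0)) g = p"
    using mat_act_inv[OF V_mat_invertible, of 0 p] D by simp
  have 3: "diag_op (S (eps 1)) (S (eps 2)) p = vector [cst (- par_a) * S (eps 1) F1, cst (- par_b) * S (eps 2) F2]"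
    unfolding diag_op_def p_def S using skew_op_linear(2)[OF s(1) s(1)] skew_op_linear(2)[OF s(2) s(2)] by (simp del: cst_hom)
  have c': "cst (inverse u) * (cst \<omega> * cst u * F) = cst \<omega> * F" if "u \<noteq> 0" for u F
    using c[OF that, of "cst \<omega> * F"] by (simp only: ac_simps)
  have "mat_act (V_mat h) (vector [cst (- par_a) * X, cst (- par_b) * Y]) =
    vector [cst \<omega> * (X + Y), cst (- par_a) * X + cst (- par_b) * Y]" for X Y
    by (simp add: vec_eq_iff forall_2 mat_act_nth V_mat_def distrib_left flip: a'_def b'_def) (simp add: w c'[OF nz(1)] c'[OF nz(2)])
  moreover have "B_S (vector [cst \<omega> * (X + Y), cst (- par_a) * X + cst (- par_b) * Y]) = cst \<omega> * (LF a' * X + LF b' * Y)" for X Y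
    by (simp add: B_S_def LF_def w algebra_simps)
  ultimately show ?thesis unfolding conj_S_def comp_def 1 2 3 a'_def b'_def by simp
qed

lemma conj_K_coordinates:
  fixes h :: "rat^4"
  assumes s: "sym F1" "sym F2"
  shows "conj_K S h (F1 + kap par_a par_b * F2) =
    S 0 F1 + kap (par_a * qpow (h $ 1)) (par_b * qpow (h $ 2)) * (ci * S (eps 1 + eps 2) F2)"
proof -
  define g :: "laurent^2" where "g = vector [F1, F2]"
  have B: "B_K h f = f $ 1 + kap (par_a * qpow (h $ 1)) (par_b * qpow (h $ 2)) * f $ 2" for h f
    by (simp add: B_K_def kap_def LF_def mult.assoc)
  have "g \<in> sym_pairs" using s by (simp add: sym_pairs_def sym_laurent_def forall_2 g_def)
  moreover have "B_K 0 g = F1 + kap par_a par_b * F2" by (simp add: B g_def)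
  moreover have "inj_on (B_K 0) sym_pairs" by (rule inj_B_K) (use gen_parD[OF gen_par] in simp)
  ultimately have "inv_into sym_pairs (B_K 0) (F1 + kap par_a par_b * F2) = g"
    using inv_into_f_f by metis
  then show ?thesis by (simp add: conj_K_def B diag_op_def g_def)
qed

section \<open>From supports and orthogonality to multiples of E\<close>

lemma is_AW_supp:
  "is_AW y (- int n) f \<longleftrightarrow> lk f (- int n) = 1 \<and> supp (- int n) (int n) f \<and> (\<forall>m. 1 - int n \<le> m \<longrightarrow> m \<le> int n \<longrightarrow> ell y (f * zpow (- m)) = 0)"
  "is_AW y (int n + 1) f \<longleftrightarrow> lk f (int n + 1) = 1 \<and> supp (- int n) (int n + 1) f \<and> (\<forall>m. - int n \<le> m \<longrightarrow> m \<le> int n \<longrightarrow> ell y (f * zpow (- m)) = 0)"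
proof -
  have r: "nat (mono_rank (- int n)) = 2 * n" "nat (mono_rank (int n + 1)) = 2 * n + 1" "2 * n + 1 + 1 = 2 * (n + 1)"
    by (simp_all add: mono_rank_def)
  show "is_AW y (- int n) f \<longleftrightarrow> lk f (- int n) = 1 \<and> supp (- int n) (int n) f \<and> (\<forall>m. 1 - int n \<le> m \<longrightarrow> m \<le> int n \<longrightarrow> ell y (f * zpow (- m)) = 0)"
    unfolding is_AW_def r orth_below_def rank_even below_odd by blast
  have "supp (1 - int (n + 1)) (int (n + 1)) f \<longleftrightarrow> supp (- int n) (int n + 1) f" by (simp add: algebra_simps)
  then show "is_AW y (int n + 1) f \<longleftrightarrow> lk f (int n + 1) = 1 \<and> supp (- int n) (int n + 1) f \<and> (\<forall>m. - int n \<le> m \<longrightarrow> m \<le> int n \<longrightarrow> ell y (f * zpow (- m)) = 0)"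
    unfolding is_AW_def r orth_below_def rank_odd below_even by blast
qed

lemma eq_cst_AW_supp:
  assumes "nondeg y"
  shows "is_AW y (- int n) E \<Longrightarrow> supp (- int n) (int n) f \<Longrightarrow> lk f (- int n) = c \<Longrightarrow>
      (\<And>m. 1 - int n \<le> m \<Longrightarrow> m \<le> int n \<Longrightarrow> ell y (f * zpow (- m)) = 0) \<Longrightarrow> f = cst c * E"
    "is_AW y (int n + 1) E \<Longrightarrow> supp (- int n) (int n + 1) f \<Longrightarrow> lk f (int n + 1) = c \<Longrightarrow>
      (\<And>m. - int n \<le> m \<Longrightarrow> m \<le> int n \<Longrightarrow> ell y (f * zpow (- m)) = 0) \<Longrightarrow> f = cst c * E"
proof -
  have r: "nat (mono_rank (- int n)) = 2 * n" "nat (mono_rank (int n + 1)) = 2 * n + 1" "2 * n + 1 + 1 = 2 * (n + 1)"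
    by (simp_all add: mono_rank_def)
  show "f = cst c * E" if "is_AW y (- int n) E" "supp (- int n) (int n) f" "lk f (- int n) = c"
    "\<And>m. 1 - int n \<le> m \<Longrightarrow> m \<le> int n \<Longrightarrow> ell y (f * zpow (- m)) = 0"
    by (rule eq_cst_AW[OF assms that(1,3)]) (unfold r orth_below_def rank_even below_odd, use that in auto)+
  have s: "supp (1 - int (n + 1)) (int (n + 1)) f \<longleftrightarrow> supp (- int n) (int n + 1) f" by (simp add: algebra_simps)
  show "f = cst c * E" if "is_AW y (int n + 1) E" "supp (- int n) (int n + 1) f" "lk f (int n + 1) = c"
    "\<And>m. - int n \<le> m \<Longrightarrow> m \<le> int n \<Longrightarrow> ell y (f * zpow (- m)) = 0"
    by (rule eq_cst_AW[OF assms that(1,3)]) (unfold r orth_below_def rank_odd below_even s, use that in auto)+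
qed

lemma S_coordinates_exist:
  assumes "a \<noteq> b"
  obtains F1 F2 where "sym F1" "sym F2" "f = LF a * F1 + LF b * F2"
proof -
  obtain g1 g2 where g: "sym g1" "sym g2" "f = g1 + zZ * g2" by (rule S_decomposition)
  show thesis
    by (rule that[OF _ _ g(3)[unfolded S_coordinates[OF assms, of g1 g2]]]) (use g in \<open>simp_all del: cst_hom\<close>)
qed

lemma (in S_shift) SS_AW:
  assumes s: "sym F1" "sym F2" and nd: "nondeg y'" and n': "int n' = int n + \<delta>"
  shows "is_AW y (- int n) (LF a * F1 + LF b * F2) \<Longrightarrow> is_AW y' (- int n') E \<Longrightarrow> SS F1 F2 = cst (\<omega> * \<sigma> (int n)) * E"
    "is_AW y (int n + 1) (LF a * F1 + LF b * F2) \<Longrightarrow> is_AW y' (int n' + 1) E \<Longrightarrow> SS F1 F2 = cst (\<sigma> (int n)) * E"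
proof -
  note G = SS_general[OF s _ _ _ n', of 0, simplified] and G1 = SS_general[OF s _ _ _ n', of 1, simplified]
  show "SS F1 F2 = cst (\<omega> * \<sigma> (int n)) * E" if "is_AW y (- int n) (LF a * F1 + LF b * F2)" "is_AW y' (- int n') E"
    using that(1) unfolding is_AW_supp
    by (intro eq_cst_AW_supp(1)[OF nd that(2)]) (auto intro!: G simp: G(3))
  show "SS F1 F2 = cst (\<sigma> (int n)) * E" if "is_AW y (int n + 1) (LF a * F1 + LF b * F2)" "is_AW y' (int n' + 1) E"
    using that(1) unfolding is_AW_supp
    by (intro eq_cst_AW_supp(2)[OF nd that(2)]) (auto intro!: G1 simp: G1(4))
qed

lemma (in K_shift) KK_AW:
  assumes s: "sym F1" "sym F2" and nd: "nondeg y'"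
  shows "is_AW y (- int n) (F1 + kap a b * F2) \<Longrightarrow> is_AW y' (- int n) E \<Longrightarrow> KK F1 F2 = cst (\<sigma> (int n)) * E"
    "is_AW y (int n) (F1 + kap a b * F2) \<Longrightarrow> is_AW y' (int n) E \<Longrightarrow> KK F1 F2 = cst (\<sigma> (int n)) * E"
proof -
  note G1 = KK_general[OF s _ _, of n 1, simplified]
  show 1: "KK F1 F2 = cst (\<sigma> (int n)) * E" if "is_AW y (- int n) (F1 + kap a b * F2)" "is_AW y' (- int n) E"
    using that(1) unfolding is_AW_supp
    by (intro eq_cst_AW_supp(1)[OF nd that(2)]) (auto intro!: G1 simp: G1(3))
  show "KK F1 F2 = cst (\<sigma> (int n)) * E" if "is_AW y (int n) (F1 + kap a b * F2)" "is_AW y' (int n) E"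
  proof (cases n)
    case 0
    then show ?thesis using 1 that by simp
  next
    case (Suc k)
    then have n: "int n = int k + 1" by simp
    have A: "is_AW y (int k + 1) (F1 + kap a b * F2)" "is_AW y' (int k + 1) E" using that n by simp_all
    note A1 = A(1)[unfolded is_AW_supp]
    have sup: "supp (- int n) (int n) (F1 + kap a b * F2)" using A1 unfolding supp_def n by force
    have o: "ell y ((F1 + kap a b * F2) * zpow (- m)) = 0" if "1 - int n \<le> m" "m \<le> int n - 1 + 0" for m
      using A1 that n by simp
    note G = KK_general[OF s sup disjI1[OF refl] o]
    \<comment> \<open>E_n has no term z^(-n). Extreme coefficients are only scaled, so neither has
      its image, whose support thus shrinks as required.\<close>
    have "lk (F1 + kap a b * F2) (- int n) = 0" using A1 n by (intro suppD) auto
    then have z: "lk (KK F1 F2) (- int n) = 0" using G(3) by simp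
    have "supp (- int k) (int k + 1) (KK F1 F2)" unfolding supp_def
    proof (intro allI impI)
      fix m assume m: "lk (KK F1 F2) m \<noteq> 0"
      then have "m \<noteq> - int n" using z by auto
      moreover have "- int n \<le> m \<and> m \<le> int n" using G(1) m unfolding supp_def by blast
      ultimately show "- int k \<le> m \<and> m \<le> int k + 1" using n by auto
    qed
    moreover have "lk (KK F1 F2) (int k + 1) = \<sigma> (int n)" using G(4) A1 n by simp
    ultimately show ?thesis
      by (rule eq_cst_AW_supp(2)[OF nd A(2)]) (use G(2) n in simp)
  qed
qed


lemma conj_S_AW:
  fixes h :: "rat^4"
  assumes L: "S_shift par_a par_b par_c par_d a' b' c' d' (smom 0) (smom h) S1 S2 A1 A2 e \<omega> \<delta> \<sigma> \<tau>"
    and h: "a' = par_a * qpow (h $ 1)" "b' = par_b * qpow (h $ 2)"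
    and S: "\<And>h. S h = skew_op (A h)"
    and S12: "\<And>f. sym f \<Longrightarrow> S (eps 1) f = S1 f" "\<And>f. sym f \<Longrightarrow> S (eps 2) f = S2 f"
    and n': "int n' = int n + \<delta>"
  shows "conj_S S h (nsAW 0 (- int n)) = cst (\<omega> * \<sigma> (int n)) * nsAW h (- int n')"
    "conj_S S h (nsAW 0 (int n + 1)) = cst (\<sigma> (int n)) * nsAW h (int n' + 1)"
proof -
  interpret S_shift par_a par_b par_c par_d a' b' c' d' "smom 0" "smom h" S1 S2 A1 A2 e \<omega> \<delta> \<sigma> \<tau>
    by (rule L)
  have C: "conj_S S h (LF par_a * F1 + LF par_b * F2) = SS F1 F2" if "sym F1" "sym F2" for F1 F2
    unfolding conj_S_coordinates[OF S that ab(2,3)[unfolded h]] SS_def by (simp add: S12 that h)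
  show "conj_S S h (nsAW 0 (- int n)) = cst (\<omega> * \<sigma> (int n)) * nsAW h (- int n')"
  proof -
    obtain F1 F2 where F: "sym F1" "sym F2" "nsAW 0 (- int n) = LF par_a * F1 + LF par_b * F2"
      using S_coordinates_exist[OF ab(1)] .
    show ?thesis unfolding F(3) C[OF F(1,2)]
      by (rule SS_AW(1)[OF F(1,2) nondeg_smom n' _ is_AW_nsAW]) (simp only: F(3)[symmetric] is_AW_nsAW)
  qed
  show "conj_S S h (nsAW 0 (int n + 1)) = cst (\<sigma> (int n)) * nsAW h (int n' + 1)"
  proof -
    obtain F1 F2 where F: "sym F1" "sym F2" "nsAW 0 (int n + 1) = LF par_a * F1 + LF par_b * F2"
      using S_coordinates_exist[OF ab(1)] .
    show ?thesis unfolding F(3) C[OF F(1,2)]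
      by (rule SS_AW(2)[OF F(1,2) nondeg_smom n' _ is_AW_nsAW]) (simp only: F(3)[symmetric] is_AW_nsAW)
  qed
qed

text \<open>For n = 0 the target degree n - 1 is negative and \<open>SS_AW\<close> does not apply.
  The symmetric coordinates of E_0 and E_1 are constants, which \<open>Gp\<close> kills.\<close>

lemma conj_S_Gp_constants:
  fixes h :: "rat^4"
  assumes s: "symdeg 0 g1" "symdeg 0 g2" and w: "par_a = \<omega> * (par_a * qpow (h $ 1))" "par_b = \<omega> * (par_b * qpow (h $ 2))"
  shows "conj_S Gq_plus h (g1 + zZ * g2) = 0"
proof -
  have ab: "par_a \<noteq> par_b" using gen_parD(5)[OF gen_par] .
  have sy: "sym g1" "sym g2" using s by (simp_all add: symdeg_sym)
  have G0: "Gp f = 0" if f: "symdeg 0 f" for f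
  proof (rule poly_mapping_eqI)
    show "lk (Gp f) m = lk 0 m" for m using Gp_deg(1)[OF f] by (simp add: symdeg_def)
  qed
  show ?thesis
    unfolding S_coordinates[OF ab] by (subst conj_S_coordinates[where \<omega> = \<omega> and A = "\<lambda>_. 1"]; (rule w)?)
      (simp_all add: Gq_plus_def Gq_plus_Gp[unfolded Gq_plus_def] sy G0 symdeg_lin symdeg_uminus s del: cst_hom)
qed

text \<open>The second alternative covers E_(2,-), which is E_(2,+) after exchanging a with b and c
  with d; as \<open>kap\<close> is symmetric in its arguments, the coordinates stay the
  same.\<close>

lemma conj_K_AW:
  fixes h :: "rat^4"
  assumes L: "K_shift par_a par_b c d a' b' c' d' (smom 0) (smom h) S1 S2 A1 A2 e \<sigma> \<tau> \<or>
      K_shift par_b par_a c d b' a' c' d' (smom 0) (smom h) S1 S2 A1 A2 e \<sigma> \<tau>"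
    and ab: "a' = par_a * qpow (h $ 1)" "b' = par_b * qpow (h $ 2)"
    and S12: "S 0 = S1" "\<And>f. ci * S (eps 1 + eps 2) f = S2 f"
  shows "conj_K S h (nsAW 0 (- int n)) = cst (\<sigma> (int n)) * nsAW h (- int n)"
    "conj_K S h (nsAW 0 (int n)) = cst (\<sigma> (int n)) * nsAW h (int n)"
proof -
  have k: "kap par_b par_a = kap par_a par_b" "kap b' a' = kap a' b'" by (simp_all add: kap_def mult.commute)
  have C: "conj_K S h (F1 + kap par_a par_b * F2) = S1 F1 + kap a' b' * S2 F2" if "sym F1" "sym F2" for F1 F2
    unfolding conj_K_coordinates[OF that] ab S12 ..
  have R: "is_AW (smom 0) m (F1 + kap par_a par_b * F2) \<Longrightarrow> is_AW (smom h) m E \<Longrightarrow> S1 F1 + kap a' b' * S2 F2 = cst (\<sigma> (int n)) * E"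
    if "sym F1" "sym F2" "m = int n \<or> m = - int n" for F1 F2 m E
    using L that K_shift.KK_AW[OF _ that(1,2) nondeg_smom, unfolded K_shift.KK_def]
      K_shift.KK_AW[where a = par_b and b = par_a and a' = b' and b' = a', unfolded k, OF _ that(1,2) nondeg_smom]
    by (auto simp: K_shift.KK_def k)
  have "conj_K S h (nsAW 0 m) = cst (\<sigma> (int n)) * nsAW h m" if m: "m = int n \<or> m = - int n" for m
  proof -
    have "par_a * par_b \<noteq> 1" using gen_parD[OF gen_par] by blast
    then obtain F1 F2 where F: "sym F1" "sym F2" "nsAW 0 m = F1 + kap par_a par_b * F2" by (rule K_decomposition)
    show ?thesis unfolding F(3) C[OF F(1,2)]
      by (rule R[OF F(1,2) m _ is_AW_nsAW]) (simp only: F(3)[symmetric] is_AW_nsAW)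
  qed
  then show "conj_K S h (nsAW 0 (- int n)) = cst (\<sigma> (int n)) * nsAW h (- int n)"
    "conj_K S h (nsAW 0 (int n)) = cst (\<sigma> (int n)) * nsAW h (int n)" by blast+
qed

section \<open>The six operators\<close>

lemma moment_rel_smom':
  fixes h :: "rat^4"
  assumes "h $ 1 = of_int e1 / 2" "h $ 2 = of_int e2 / 2" "h $ 3 = of_int e3 / 2" "h $ 4 = of_int e4 / 2"
    "e1 + e2 = 2 * f" "e3 + e4 = 2 * g"
  shows "moment_rel (par_a * sqrt_q powi e1) (par_b * sqrt_q powi e2) (par_c * sqrt_q powi e3) (par_d * sqrt_q powi e4) (smom h)"
  using moment_rel_smom[of h] unfolding shiftK_params[OF assms] .

lemma moment_rels:
  "moment_rel par_a par_b par_c par_d (smom 0)"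
  "moment_rel (par_a * sqrt_q) (par_b * sqrt_q) (par_c * sqrt_q) (par_d * sqrt_q) (smom v1)"
  "moment_rel (par_a * si) (par_b * si) (par_c * si) (par_d * si) (smom (- v1))"
  "moment_rel (par_a * sqrt_q) (par_b * sqrt_q) (par_c * si) (par_d * si) (smom v2)"
  "moment_rel (par_a * si) (par_b * si) (par_c * sqrt_q) (par_d * sqrt_q) (smom (- v2))"
  "moment_rel (par_a * sqrt_q) (par_b * si) (par_c * sqrt_q) (par_d * si) (smom v3)"
  "moment_rel (par_a * si) (par_b * sqrt_q) (par_c * si) (par_d * sqrt_q) (smom (- v3))"
  using moment_rel_smom'[of 0 0 0 0 0 0 0] moment_rel_smom'[of v1 1 1 1 1 1 1] moment_rel_smom'[of "- v1" "-1" "-1" "-1" "-1" "-1" "-1"]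
    moment_rel_smom'[of v2 1 1 "-1" "-1" 1 "-1"] moment_rel_smom'[of "- v2" "-1" "-1" 1 1 "-1" 1]
    moment_rel_smom'[of v3 1 "-1" 1 "-1" 0 0] moment_rel_smom'[of "- v3" "-1" 1 "-1" 1 0 0]
  by (simp_all add: power_int_minus)

lemma nsG_plus_AW:
  "nsG_plus (nsAW 0 (- int n)) = cst (si * (sqrt_q powi int n - sqrt_q powi (- int n))) * nsAW v1 (1 - int n)"
  "nsG_plus (nsAW 0 (int n + 1)) = cst (sqrt_q powi int n - sqrt_q powi (- int n)) * nsAW v1 (int n)"
proof -
  let ?A = "nsG_plus (nsAW 0 (- int n)) = cst (si * (sqrt_q powi int n - sqrt_q powi (- int n))) * nsAW v1 (1 - int n)"
  let ?B = "nsG_plus (nsAW 0 (int n + 1)) = cst (sqrt_q powi int n - sqrt_q powi (- int n)) * nsAW v1 (int n)"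
  have "?A \<and> ?B"
  proof (cases n)
    case 0
    have z: "nsG_plus (nsAW 0 m) = 0" if "supp 0 e (nsAW 0 m)" "e = 0 \<or> e = 1" for m e
    proof -
      obtain g1 g2 where g: "sym g1" "sym g2" "nsAW 0 m = g1 + zZ * g2" by (rule S_decomposition)
      have "symdeg 0 g1" "symdeg (e - 1) g2"
        using S_decomposition_deg(1,2)[OF g, of 0 e] that by simp_all
      then have "symdeg 0 g1" "symdeg 0 g2" using symdeg_mono[of "e - 1" g2 0] that(2) by auto
      then show ?thesis unfolding g(3) nsG_plus_def by (rule conj_S_Gp_constants[where \<omega> = si]) simp_all
    qed
    have "supp 0 0 (nsAW 0 0)" "supp 0 1 (nsAW 0 1)"
      using is_AW_nsAW[of 0 "- int 0"] is_AW_nsAW[of 0 "int 0 + 1"] unfolding is_AW_supp by simp_all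
    then show ?thesis using 0 z by simp
  next
    case (Suc k)
    obtain e where L: "S_shift par_a par_b par_c par_d (par_a * sqrt_q) (par_b * sqrt_q) (par_c * sqrt_q) (par_d * sqrt_q) (smom 0) (smom v1)
      Gp Gp (Gm (par_a * sqrt_q * sqrt_q) par_b par_c par_d) (Gm par_a (par_b * sqrt_q * sqrt_q) par_c par_d) e si (-1)
      (\<lambda>n. sqrt_q powi n - sqrt_q powi (- n)) (\<lambda>n. par_a * par_b * par_c * par_d * sqrt_q * sqrt_q * sqrt_q powi n - sqrt_q powi (- n))"
      using S_shift_Gp[OF moment_rels(1) gen_par moment_rels(2)] .
    have k: "int k = int n + (-1)" "1 - int n = - int k" "int n = int k + 1" using Suc by simp_all
    note C = conj_S_AW[where h = v1 and S = Gq_plus, OF L _ _ Gq_plus_def Gq_plus_Gp[THEN fun_cong] Gq_plus_Gp[THEN fun_cong] k(1), simplified v_nth qpow_simps, OF refl refl]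
    show ?thesis unfolding nsG_plus_def using C unfolding k(2) k(3)[symmetric] by blast
  qed
  then show ?A ?B by blast+
qed

lemma nsG_minus_AW:
  "nsG_minus (nsAW 0 (- int n)) = cst (par_a * par_b * par_c * par_d * si * si * sqrt_q powi int n - sqrt_q powi (- int n)) * nsAW (- v1) (- int n - 1)"
  "nsG_minus (nsAW 0 (int n + 1)) = cst (si * (par_a * par_b * par_c * par_d * si * si * sqrt_q powi int n - sqrt_q powi (- int n))) * nsAW (- v1) (int n + 2)"
proof -
  obtain e where L: "S_shift par_a par_b par_c par_d (par_a * si) (par_b * si) (par_c * si) (par_d * si) (smom 0) (smom (- v1))
    (\<lambda>f. ci * Gm (par_a * sqrt_q) (par_b * si) (par_c * si) (par_d * si) f) (\<lambda>f. ci * Gm (par_a * si) (par_b * sqrt_q) (par_c * si) (par_d * si) f) Gp Gp e sqrt_q 1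
    (\<lambda>n. si * (par_a * par_b * par_c * par_d * si * si * sqrt_q powi n - sqrt_q powi (- n))) (\<lambda>n. sqrt_q powi n - sqrt_q powi (- n))"
    using S_shift_Gm[OF moment_rels(1) gen_par moment_rels(3)] .
  have h: "par_a * si = par_a * qpow ((- v1) $ 1)" "par_b * si = par_b * qpow ((- v1) $ 2)" by simp_all
  have n: "int (n + 1) = int n + 1" "- int n - 1 = - int (n + 1)" "int n + 2 = int (n + 1) + 1" by simp_all
  have S: "Gq_minus h = skew_op (cst (qpow (-1/2)) * zpow (-2) * (\<Prod>i\<in>UNIV. lin_factor h i))" for h
    by (rule Gq_minus_def)
  have S12: "Gq_minus (eps 1) f = ci * Gm (par_a * sqrt_q) (par_b * si) (par_c * si) (par_d * si) f"
    "Gq_minus (eps 2) f = ci * Gm (par_a * si) (par_b * sqrt_q) (par_c * si) (par_d * si) f" if "sym f" for f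
    unfolding Gq_minus_Gm[OF that] by (simp_all add: mult.assoc[symmetric])
  \<comment> \<open>Here \<omega> = q^(1/2) cancels the prefactor q^(-1/2) of G_-, which survives
    only for E_(n+1).\<close>
  have "sqrt_q * (si * x) = x" for x by simp
  then show "nsG_minus (nsAW 0 (- int n)) = cst (par_a * par_b * par_c * par_d * si * si * sqrt_q powi int n - sqrt_q powi (- int n)) * nsAW (- v1) (- int n - 1)"
    using conj_S_AW(1)[OF L h S S12 n(1)] unfolding nsG_minus_def n(2) by metis
  show "nsG_minus (nsAW 0 (int n + 1)) = cst (si * (par_a * par_b * par_c * par_d * si * si * sqrt_q powi int n - sqrt_q powi (- int n))) * nsAW (- v1) (int n + 2)"
    using conj_S_AW(2)[OF L h S S12 n(1)] unfolding nsG_minus_def n(3) by blast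
qed

lemma nsE1_AW:
  "nsE1_plus (nsAW 0 (- int n)) = cst (sqrt_q * - (par_a * par_b * sqrt_q powi int n - sqrt_q powi (- int n))) * nsAW (- v2) (- int n)"
  "nsE1_plus (nsAW 0 (int n + 1)) = cst (- (par_a * par_b * sqrt_q powi int n - sqrt_q powi (- int n))) * nsAW (- v2) (int n + 1)"
  "nsE1_minus (nsAW 0 (- int n)) = cst (si * - (par_c * si * (par_d * si) * sqrt_q powi int n - sqrt_q powi (- int n))) * nsAW v2 (- int n)"
  "nsE1_minus (nsAW 0 (int n + 1)) = cst (- (par_c * si * (par_d * si) * sqrt_q powi int n - sqrt_q powi (- int n))) * nsAW v2 (int n + 1)"
proof -
  have p: "par_a * si = par_a * qpow ((- v2) $ 1)" "par_b * si = par_b * qpow ((- v2) $ 2)"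
    "par_a * sqrt_q = par_a * qpow (v2 $ 1)" "par_b * sqrt_q = par_b * qpow (v2 $ 2)" by simp_all
  note L = S_shift_E12[OF moment_rels(1) gen_par moment_rels(5)] S_shift_E34[OF moment_rels(1) gen_par moment_rels(4)]
  note C = conj_S_AW[where S = "Eq_op 1 2" and n = n and n' = n, OF L(1) p(1,2) Eq_op_def]
    conj_S_AW[where S = "Eq_op 3 4" and n = n and n' = n, OF L(2) p(3,4) Eq_op_def]
  have E: "Eq_op 1 2 (eps 1) = Ep (par_a * sqrt_q) (par_b * si)" "Eq_op 1 2 (eps 2) = Ep (par_a * si) (par_b * sqrt_q)"
    "Eq_op 3 4 (eps 1) = Ep (par_c * si) (par_d * si)" "Eq_op 3 4 (eps 2) = Ep (par_c * si) (par_d * si)"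
    by (simp_all add: Eq_op_Ep mult.assoc[symmetric])
  show "nsE1_plus (nsAW 0 (- int n)) = cst (sqrt_q * - (par_a * par_b * sqrt_q powi int n - sqrt_q powi (- int n))) * nsAW (- v2) (- int n)"
    "nsE1_plus (nsAW 0 (int n + 1)) = cst (- (par_a * par_b * sqrt_q powi int n - sqrt_q powi (- int n))) * nsAW (- v2) (int n + 1)"
    unfolding nsE1_plus_def using C(1,2) by (simp_all only: E simp_thms add_0_right)
  show "nsE1_minus (nsAW 0 (- int n)) = cst (si * - (par_c * si * (par_d * si) * sqrt_q powi int n - sqrt_q powi (- int n))) * nsAW v2 (- int n)"
    "nsE1_minus (nsAW 0 (int n + 1)) = cst (- (par_c * si * (par_d * si) * sqrt_q powi int n - sqrt_q powi (- int n))) * nsAW v2 (int n + 1)"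
    unfolding nsE1_minus_def using C(3,4) by (simp_all only: E simp_thms add_0_right)
qed

lemma nsE2_AW:
  assumes "m = int n \<or> m = - int n"
  shows "nsE2_plus (nsAW 0 m) = cst (- (par_a * par_c * si * si * sqrt_q powi int n - sqrt_q powi (- int n))) * nsAW (- v3) m"
    "nsE2_minus (nsAW 0 m) = cst (- (par_b * par_d * si * si * sqrt_q powi int n - sqrt_q powi (- int n))) * nsAW v3 m"
proof -
  \<comment> \<open>The moment relations are invariant under exchanging a with b and c with d, so
    E_24 is an instance of the result for E_13.\<close>
  have sw: "moment_rel b a d c y" if "moment_rel a b c d y" for a b c d y
    using moment_rel_swap[OF that] by (simp add: moment_rel_def add.commute[of c] mult.commute[of c])
  have g: "gen_par par_b par_a par_d par_c"
  proof -
    have "par_b * sqrt_q powi e \<noteq> par_a" for e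
    proof
      assume e: "par_b * sqrt_q powi e = par_a"
      have "par_a * sqrt_q powi (- e) = par_b" unfolding e[symmetric] by (simp add: power_int_minus)
      then show False using gen_par unfolding gen_par_def by blast
    qed
    then show ?thesis using gen_par unfolding gen_par_def by (simp add: ac_simps)
  qed
  note L = K_shift_E13[OF moment_rels(1) gen_par moment_rels(7)] K_shift_E13[OF sw[OF moment_rels(1)] g sw[OF moment_rels(6)]]
  have E: "Eq_op 1 3 0 = Ep (par_a * si) (par_c * si)" "Eq_op 2 4 0 = Ep (par_b * si) (par_d * si)"
    "ci * Eq_op 1 3 (eps 1 + eps 2) f = ci * Ep (par_a * sqrt_q) (par_c * si) f"
    "ci * Eq_op 2 4 (eps 1 + eps 2) f = ci * Ep (par_b * sqrt_q) (par_d * si) f" for f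
    by (simp_all add: Eq_op_Ep mult.assoc[symmetric])
  have p: "par_a * si = par_a * qpow ((- v3) $ 1)" "par_b * sqrt_q = par_b * qpow ((- v3) $ 2)"
    "par_a * sqrt_q = par_a * qpow (v3 $ 1)" "par_b * si = par_b * qpow (v3 $ 2)" by simp_all
  show "nsE2_plus (nsAW 0 m) = cst (- (par_a * par_c * si * si * sqrt_q powi int n - sqrt_q powi (- int n))) * nsAW (- v3) m"
    using assms conj_K_AW[OF disjI1[OF L(1)] p(1,2) E(1,3), of n] unfolding nsE2_plus_def by blast
  show "nsE2_minus (nsAW 0 m) = cst (- (par_b * par_d * si * si * sqrt_q powi int n - sqrt_q powi (- int n))) * nsAW v3 m"
    using assms conj_K_AW[OF disjI2[OF L(2)] p(3,4) E(2,4), of n] unfolding nsE2_minus_def by blast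
qed

theorem proposition4p31:
  fixes n :: nat
  shows
   "nsG_plus (nsAW 0 (- int n)) =
      cst (qpow (-1/2) * (qpow (of_nat n / 2) - qpow (- of_nat n / 2)))
      * nsAW v1 (1 - int n) \<and>
    nsG_plus (nsAW 0 (int n + 1)) =
      cst (qpow (of_nat n / 2) - qpow (- of_nat n / 2))
      * nsAW v1 (int n) \<and>
    nsG_minus (nsAW 0 (- int n)) =
      cst (par_a * par_b * par_c * par_d / par_q * qpow (of_nat n / 2) - qpow (- of_nat n / 2))
      * nsAW (- v1) (- int n - 1) \<and>
    nsG_minus (nsAW 0 (int n + 1)) =
      cst (qpow (-1/2) * (par_a * par_b * par_c * par_d / par_q * qpow (of_nat n / 2) - qpow (- of_nat n / 2)))
      * nsAW (- v1) (int n + 2) \<and>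
    nsE1_plus (nsAW 0 (- int n)) =
      cst (- qpow (1/2) * (par_a * par_b * qpow (of_nat n / 2) - qpow (- of_nat n / 2)))
      * nsAW (- v2) (- int n) \<and>
    nsE1_plus (nsAW 0 (int n + 1)) =
      cst (- (par_a * par_b * qpow (of_nat n / 2) - qpow (- of_nat n / 2)))
      * nsAW (- v2) (int n + 1) \<and>
    nsE1_minus (nsAW 0 (- int n)) =
      cst (- qpow (-1/2) * (par_c * par_d / par_q * qpow (of_nat n / 2) - qpow (- of_nat n / 2)))
      * nsAW v2 (- int n) \<and>
    nsE1_minus (nsAW 0 (int n + 1)) =
      cst (- (par_c * par_d / par_q * qpow (of_nat n / 2) - qpow (- of_nat n / 2)))
      * nsAW v2 (int n + 1) \<and>
    nsE2_plus (nsAW 0 (- int n)) =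
      cst (- (par_a * par_c / par_q * qpow (of_nat n / 2) - qpow (- of_nat n / 2)))
      * nsAW (- v3) (- int n) \<and>
    nsE2_plus (nsAW 0 (int n)) =
      cst (- (par_a * par_c / par_q * qpow (of_nat n / 2) - qpow (- of_nat n / 2)))
      * nsAW (- v3) (int n) \<and>
    nsE2_minus (nsAW 0 (- int n)) =
      cst (- (par_b * par_d / par_q * qpow (of_nat n / 2) - qpow (- of_nat n / 2)))
      * nsAW v3 (- int n) \<and>
    nsE2_minus (nsAW 0 (int n)) =
      cst (- (par_b * par_d / par_q * qpow (of_nat n / 2) - qpow (- of_nat n / 2)))
      * nsAW v3 (int n)"
proof -
  have q: "x / par_q = x * si * si" for x
    by (simp add: par_q_def power2_eq_square field_simps)
  have m: "par_c * si * (par_d * si) = par_c * par_d * si * si" by simp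
  show ?thesis
    unfolding q qpow_simps minus_mult_commute
    by (intro conjI nsG_plus_AW nsG_minus_AW nsE1_AW[unfolded m] nsE2_AW disjI1[OF refl] disjI2[OF refl])
qed

end
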